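(* Let $S$ be an elephant random walk on $\mathbb Z_L$ with memory parameter $p\in[0,1)$, let $\widetilde S$ be its lift to $\mathbb Z$ and $\tau_{\rm cov}$ its cover time, and let $(B_t)_{t\ge0}$ be a standard Brownian motion. (i) If $p<3/4$, then as $L\to\infty$, $\dfrac{\tau_{\rm cov}}{L^2}\Longrightarrow\Phi(1,\widehat B)$, where the process $\widehat B$ (noise-reinforced Brownian motion) has the same law as $\left(\dfrac{t^{2p-1}}{\sqrt{3-4p}}B_{t^{3-4p}}\right)_{t\ge0}$, with value $0$ at $t=0$ by continuous extension. (ii) If $p=3/4$, then as $L\to\infty$, $\dfrac{\tau_{\rm cov}\log L}{L^2}\Longrightarrow\dfrac1{2B_1^2}$. (iii) If $p>3/4$, let $Y:=\lim_{n\to\infty}\widetilde S_n/n^{2p-1}$, which exists and is non-zero almost surely. If the walks for different $L$ are obtained by projecting the same lifted walk $\widetilde S$, then $$\lim_{L\to\infty}\frac{\tau_{\rm cov}}{L^{1/(2p-1)}}=\frac1{|Y|^{1/(2p-1)}}\qquad\text{almost surely}.$$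
   Context: Elephant random walk (ERW) on $\mathbb Z$ with memory parameter $p\in[0,1)$: the increments $X_1,X_2,\ldots\in\{+1,-1\}$ are defined as follows. $X_1$ is uniform on $\{+1,-1\}$. At each time $n\ge2$, a time $u_n$ is chosen uniformly from $\{1,\ldots,n-1\}$ (independently of the past); with probability $p$ one sets $X_n=X_{u_n}$, and with probability $1-p$ one sets $X_n=-X_{u_n}$. The lifted walk is $\widetilde S_0=0$, $\widetilde S_n=\sum_{j=1}^nX_j$. For an integer $L\ge2$, the ERW on $\mathbb Z_L=\mathbb Z/L\mathbb Z$ is $S_n=\widetilde S_n\pmod L$, and $\tau_{\rm cov}:=\inf\{n\ge0:\{S_0,\ldots,S_n\}=\mathbb Z_L\}$ (it depends on $L$). For $f$ in the Skorokhod space $D([0,\infty))$ and $t\ge0$, $\operatorname{Osc}_t(f):=\sup_{0\le s\le t}f(s)-\inf_{0\le s\le t}f(s)$, and for $\lambda>0$, $\Phi(\lambda,f):=\inf\{t\ge0:\operatorname{Osc}_t(f)\ge\lambda\}$. The symbol $\Longrightarrow$ denotes convergence in distribution. *)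

theory Defs
  imports "HOL-Probability.Probability"
begin

text \<open>
  Elephant random walk with memory parameter \<open>p\<close>. For \<open>n \<ge> 2\<close>, \<open>u n\<close> is the remembered time and
  \<open>r n\<close> tells whether the remembered step is repeated (probability \<open>p\<close>) or reversed; the two are
  independent of each other (their joint law is a product) and of the past. The past
  before time \<open>n\<close> is recorded as a pair of lists; \<open>X 0\<close>, \<open>u 0\<close>, \<open>u 1\<close>, \<open>r 0\<close> and \<open>r 1\<close> play no role.
\<close>

locale elephant_random_walk = prob_space M
  for M :: "'a measure" and p :: real
    and X :: "nat \<Rightarrow> 'a \<Rightarrow> int" and u :: "nat \<Rightarrow> 'a \<Rightarrow> nat" and r :: "nat \<Rightarrow> 'a \<Rightarrow> bool" +
  assumes memory_parameter: "0 \<le> p" "p < 1"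
    and first_measurable: "X 1 \<in> measurable M (count_space UNIV)"
    and first_step: "distr M (count_space UNIV) (X 1) = measure_pmf (pmf_of_set {1, - 1})"
    and choice_measurable: "\<And>n. 2 \<le> n \<Longrightarrow>
      (\<lambda>\<omega>. (u n \<omega>, r n \<omega>)) \<in> measurable M (count_space UNIV)"
    and choice_law: "\<And>n. 2 \<le> n \<Longrightarrow>
      distr M (count_space UNIV) (\<lambda>\<omega>. (u n \<omega>, r n \<omega>))
        = measure_pmf (pair_pmf (pmf_of_set {1..n - 1}) (bernoulli_pmf p))"
    and choice_indep_past: "\<And>n. 2 \<le> n \<Longrightarrow>
      indep_set
        (sets (vimage_algebra (space M)
          (\<lambda>\<omega>. (map (\<lambda>k. X k \<omega>) [1..<n], map (\<lambda>k. (u k \<omega>, r k \<omega>)) [2..<n])) (count_space UNIV)))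
        (sets (vimage_algebra (space M) (\<lambda>\<omega>. (u n \<omega>, r n \<omega>)) (count_space UNIV)))"
    and step: "\<And>n \<omega>. 2 \<le> n \<Longrightarrow> \<omega> \<in> space M \<Longrightarrow>
      X n \<omega> = (if r n \<omega> then X (u n \<omega>) \<omega> else - X (u n \<omega>) \<omega>)"

definition lifted_walk :: "(nat \<Rightarrow> 'a \<Rightarrow> int) \<Rightarrow> nat \<Rightarrow> 'a \<Rightarrow> int" where
  "lifted_walk X n \<omega> = (\<Sum>j = 1..n. X j \<omega>)"

text \<open>\<open>\<int>/L\<int>\<close> is represented by the residues \<open>{0..<L}\<close>.\<close>

definition cyclic_walk :: "nat \<Rightarrow> (nat \<Rightarrow> 'a \<Rightarrow> int) \<Rightarrow> nat \<Rightarrow> 'a \<Rightarrow> int" where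
  "cyclic_walk L X n \<omega> = lifted_walk X n \<omega> mod int L"

text \<open>The infimum of the empty set is \<open>\<infinity>\<close>.\<close>

definition cover_time :: "nat \<Rightarrow> (nat \<Rightarrow> 'a \<Rightarrow> int) \<Rightarrow> 'a \<Rightarrow> enat" where
  "cover_time L X \<omega> = Inf {enat n | n. (\<lambda>k. cyclic_walk L X k \<omega>) ` {0..n} = {0..<int L}}"

definition Osc :: "real \<Rightarrow> (real \<Rightarrow> real) \<Rightarrow> ereal" where
  "Osc t f = (SUP s\<in>{0..t}. ereal (f s)) - (INF s\<in>{0..t}. ereal (f s))"

definition Phi :: "real \<Rightarrow> (real \<Rightarrow> real) \<Rightarrow> ereal" where
  "Phi l f = Inf {ereal t | t. 0 \<le> t \<and> ereal l \<le> Osc t f}"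

definition skorokhod_paths :: "(real \<Rightarrow> real) set" where
  "skorokhod_paths = {f. (\<forall>t\<ge>0. (f \<longlongrightarrow> f t) (at_right t)) \<and> (\<forall>t>0. \<exists>l. (f \<longlongrightarrow> l) (at_left t))}"

locale standard_brownian_motion = prob_space N
  for N :: "'b measure" and B :: "real \<Rightarrow> 'b \<Rightarrow> real" +
  assumes measurable_at: "\<And>t. 0 \<le> t \<Longrightarrow> B t \<in> borel_measurable N"
    and start: "AE \<omega> in N. B 0 \<omega> = 0"
    and indep_increments: "\<And>(t :: nat \<Rightarrow> real) n. 0 \<le> t 0 \<Longrightarrow> strict_mono t \<Longrightarrow>
      indep_vars (\<lambda>_. borel) (\<lambda>i \<omega>. B (t (Suc i)) \<omega> - B (t i) \<omega>) {..<n}"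
    and normal_increments: "\<And>s t. 0 \<le> s \<Longrightarrow> s < t \<Longrightarrow>
      distributed N lborel (\<lambda>\<omega>. B t \<omega> - B s \<omega>) (normal_density 0 (sqrt (t - s)))"
    and continuous_paths: "AE \<omega> in N. continuous_on {0..} (\<lambda>t. B t \<omega>)"

text \<open>
  The law of a process indexed by \<open>[0,\<infinity>)\<close>, on the \<open>\<sigma>\<close>-algebra generated by the coordinate maps.
  For processes with paths in the Skorokhod space this \<open>\<sigma>\<close>-algebra is the Borel one.
\<close>

definition process_law :: "'b measure \<Rightarrow> (real \<Rightarrow> 'b \<Rightarrow> real) \<Rightarrow> (real \<Rightarrow> real) measure" where
  "process_law N Z = distr N (Pi\<^sub>M {0..} (\<lambda>_. borel)) (\<lambda>\<omega>. \<lambda>t\<in>{0..}. Z t \<omega>)"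

definition reinforced_transform :: "real \<Rightarrow> (real \<Rightarrow> 'b \<Rightarrow> real) \<Rightarrow> real \<Rightarrow> 'b \<Rightarrow> real" where
  "reinforced_transform p B t \<omega> =
    (if t = 0 then 0 else t powr (2 * p - 1) / sqrt (3 - 4 * p) * B (t powr (3 - 4 * p)) \<omega>)"

text \<open>
  \<open>W\<close> is a noise-reinforced Brownian motion: a random element of the Skorokhod space with the law of
  the transformed Brownian motion \<open>B\<close>, possibly defined on another probability space.
\<close>

locale noise_reinforced_brownian_motion = prob_space K
  for K :: "'c measure" and W :: "real \<Rightarrow> 'c \<Rightarrow> real"
    and p :: real and N :: "'b measure" and B :: "real \<Rightarrow> 'b \<Rightarrow> real" +
  assumes measurable_at: "\<And>t. 0 \<le> t \<Longrightarrow> W t \<in> borel_measurable K"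
    and paths: "\<And>\<omega>. \<omega> \<in> space K \<Longrightarrow> (\<lambda>t. W t \<omega>) \<in> skorokhod_paths"
    and law: "process_law K W = process_law N (reinforced_transform p B)"

text \<open>
  Convergence in distribution of almost surely finite random variables, written with values in the
  extended reals because they are infima of sets that may be empty on a null event. The random
  variables \<open>Z n\<close> may live on different probability spaces, and finitely many of them are ignored.
\<close>

definition converges_in_distribution ::
    "(nat \<Rightarrow> 'a measure) \<Rightarrow> (nat \<Rightarrow> 'a \<Rightarrow> ereal) \<Rightarrow> 'b measure \<Rightarrow> ('b \<Rightarrow> ereal) \<Rightarrow> bool" where
  "converges_in_distribution M Z N V \<longleftrightarrow>
    (\<forall>\<^sub>F n in sequentially. Z n \<in> borel_measurable (M n) \<and> (AE \<omega> in M n. \<bar>Z n \<omega>\<bar> \<noteq> \<infinity>)) \<and>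
    V \<in> borel_measurable N \<and> (AE \<omega> in N. \<bar>V \<omega>\<bar> \<noteq> \<infinity>) \<and>
    weak_conv_m (\<lambda>n. distr (M n) borel (\<lambda>\<omega>. real_of_ereal (Z n \<omega>)))
      (distr N borel (\<lambda>\<omega>. real_of_ereal (V \<omega>)))"

end

theory Submission
  imports Defs "HOL-Real_Asymp.Real_Asymp"
begin

text \<open>
  Write \<open>\<beta> = 2p - 1\<close>. The walk \<open>S\<close> on \<open>\<int>\<close> moves by single steps, so it visits all residues modulo \<open>L\<close> as soon as
  its spread, maximum minus minimum, reaches \<open>L - 1\<close>. Hence \<open>{\<tau> \<le> n} = {spread n \<ge> L - 1}\<close>
  (\<open>cover_time_le_iff\<close>), and all three statements are about the growth of the spread. The law of the
  first \<open>n\<close> steps depends on \<open>p\<close> only (\<open>elephant_history_law\<close>), so that the walks for different \<open>L\<close> in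
  the first two parts can be replaced by a single one.

  The only probabilistic input is the conditional mean \<open>E[X\<^bsub>n+1\<^esub> | past] = \<beta> S\<^sub>n / n\<close>
  (\<open>integral_next_step\<close>). It makes \<open>M\<^sub>n = S\<^sub>n / b\<^sub>n\<close> with \<open>b\<^sub>n = \<Prod>\<^bsub>k<n\<^esub> (1 + \<beta>/k)\<close> a martingale.
  Its increments have conditional variance about \<open>1 / b\<^sub>n\<^sup>2\<close>, so \<open>v\<^sub>n = \<Sum>\<^bsub>k\<le>n\<^esub> 1 / b\<^sub>k\<^sup>2\<close> is the
  natural clock. As \<open>b\<^sub>n\<close> is asymptotic to a multiple of \<open>n\<^sup>\<beta>\<close>, the clock grows like \<open>n\<^bsup>1 - 2\<beta>\<^esup>\<close> for
  \<open>p < 3/4\<close>, like \<open>ln n\<close> for \<open>p = 3/4\<close>, and stays bounded for \<open>p > 3/4\<close>. A supermartingale of degree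
  four gives the maximal inequality \<open>mart_increment_maximal\<close>, in which the squared clock increment
  appears; this one inequality serves all three regimes.

  If \<open>p > 3/4\<close>, the maximal inequality makes \<open>M\<^sub>n\<close> Cauchy almost surely. The limit is almost surely
  nonzero: whatever happens up to time \<open>n\<close>, a Paley-Zygmund estimate with constants independent of \<open>n\<close>
  keeps \<open>M\<close> away from zero with a fixed positive probability (\<open>spread_out_later\<close>), whereas the event
  that the limit vanishes is approximated by the events \<open>{\<bar>M\<^sub>n\<bar> < \<epsilon>}\<close>. The cover time then follows by
  inverting \<open>spread n / n\<^sup>\<beta> \<longlonglongrightarrow> \<bar>Y\<bar>\<close>.

  If \<open>p \<le> 3/4\<close>, the characteristic function of an increment of \<open>M\<close>, restricted to an event of the
  past, obeys a one-step recursion (\<open>char_step\<close>) with errors whose sum vanishes in the limit. By Levy's theorem in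
  dimension one, applied conditionally on the past, increments over successive blocks fall
  into boxes with asymptotically independent normal probabilities (\<open>increment_boxes\<close>). For \<open>p = 3/4\<close>,
  \<open>M\<close> hardly moves between \<open>n / ln n\<close> and \<open>n\<close> on its own scale, so the spread is essentially \<open>\<bar>S\<^sub>n\<bar>\<close>, which is
  normal on the scale \<open>\<surd>(n ln n)\<close>.

  For \<open>p < 3/4\<close>, the box probabilities give the limit law of the spread along a finite grid of times
  (\<open>grid_spread_limit\<close>), and by the assumption on its law the limit process has the same law along the
  grid. Dyadic grids suffice for the lower bound because paths are right-continuous; for the upper
  bound a geometric grid keeps the fluctuations between grid points small
  (\<open>fluctuations_between_grid_points\<close>). It remains to exclude that the oscillation of the limit stays
  at the level one for a while. This needs no scaling property of the limit: comparing the walk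
  for \<open>L\<close> with the walk for a slightly larger \<open>L\<close> at the same time yields
  \<open>liminf P(\<tau> \<le> x L\<^sup>2) \<ge> P(Osc\<^sub>y \<ge> 1)\<close> for every \<open>y < x\<close>.
\<close>

section \<open>Asymptotics of the norming sequence and of the clock\<close>

text \<open>
  The discrete l'Hospital rule. It serves both for the growth of the clock and for averages of a null
  sequence weighted by clock increments.
\<close>

lemma Stolz_Cesaro:
  fixes a c :: "nat \<Rightarrow> real"
  assumes mono: "\<And>n. n0 \<le> n \<Longrightarrow> c n < c (Suc n)"
    and c: "filterlim c at_top sequentially"
    and lim: "(\<lambda>n. (a (Suc n) - a n) / (c (Suc n) - c n)) \<longlonglongrightarrow> l"
  shows "(\<lambda>n. a n / c n) \<longlonglongrightarrow> l"
proof (rule LIMSEQ_I)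
  fix e :: real assume e: "0 < e"
  from LIMSEQ_D[OF lim, of "e / 2"] e obtain n1 where
    n1: "\<And>n. n1 \<le> n \<Longrightarrow> \<bar>(a (Suc n) - a n) / (c (Suc n) - c n) - l\<bar> < e / 2" by auto
  define m where "m = max n0 n1"
  have step: "\<bar>a (Suc n) - a n - l * (c (Suc n) - c n)\<bar> \<le> e / 2 * (c (Suc n) - c n)" if "m \<le> n" for n
  proof -
    have d: "0 < c (Suc n) - c n" using mono[of n] that by (simp add: m_def)
    have "a (Suc n) - a n - l * (c (Suc n) - c n)
        = ((a (Suc n) - a n) / (c (Suc n) - c n) - l) * (c (Suc n) - c n)"
      using d by (simp add: field_simps)
    then have "\<bar>a (Suc n) - a n - l * (c (Suc n) - c n)\<bar>
        = \<bar>(a (Suc n) - a n) / (c (Suc n) - c n) - l\<bar> * (c (Suc n) - c n)"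
      using d by (simp add: abs_mult)
    then show ?thesis using n1[of n] that d by (simp add: m_def mult_right_mono)
  qed
  have tele: "\<bar>a n - a m - l * (c n - c m)\<bar> \<le> e / 2 * (c n - c m)" if "m \<le> n" for n
    using that
  proof (induction n rule: dec_induct)
    case (step n)
    show ?case using step.IH \<open>\<And>n. m \<le> n \<Longrightarrow> \<bar>a (Suc n) - a n - l * (c (Suc n) - c n)\<bar> \<le> e / 2 * (c (Suc n) - c n)\<close>[OF step.hyps(1)]
      by (simp add: algebra_simps abs_if split: if_splits)
  qed simp
  define R where "R = \<bar>a m - l * c m\<bar> + e / 2 * \<bar>c m\<bar>"
  (* The accumulated error before m is absorbed by the divergence of c. *)
  have "eventually (\<lambda>n. max 1 (2 * R / e + 1) \<le> c n) sequentially"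
    by (rule c[unfolded filterlim_at_top, THEN spec])
  then have "eventually (\<lambda>n. m \<le> n \<and> max 1 (2 * R / e + 1) \<le> c n) sequentially"
    using eventually_ge_at_top[of m] by eventually_elim auto
  then obtain n2 where n2: "\<And>n. n2 \<le> n \<Longrightarrow> m \<le> n \<and> max 1 (2 * R / e + 1) \<le> c n"
    by (auto simp: eventually_sequentially)
  show "\<exists>no. \<forall>n\<ge>no. norm (a n / c n - l) < e"
  proof (intro exI allI impI)
    fix n assume "n2 \<le> n"
    with n2 have n: "m \<le> n" "1 \<le> c n" "2 * R / e + 1 \<le> c n" by auto
    have "\<bar>a n - l * c n\<bar> \<le> \<bar>a n - a m - l * (c n - c m)\<bar> + \<bar>a m - l * c m\<bar>"
      by (simp add: algebra_simps abs_if split: if_splits)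
    also have "\<dots> \<le> e / 2 * c n + R"
    proof -
      have "e / 2 * (c n - c m) \<le> e / 2 * c n + e / 2 * \<bar>c m\<bar>"
        using e by (simp add: algebra_simps abs_if)
      then show ?thesis using tele[OF n(1)] by (simp add: R_def)
    qed
    also have "\<dots> < e * c n"
    proof -
      have "2 * R / e < c n" using n by simp
      then show ?thesis using e by (simp add: field_simps)
    qed
    finally have "\<bar>a n - l * c n\<bar> < e * c n" .
    moreover have "a n / c n - l = (a n - l * c n) / c n" using n by (simp add: field_simps)
    ultimately show "norm (a n / c n - l) < e" using n by (simp add: abs_div pos_divide_less_eq)
  qed
qed

text \<open>
  The factor \<open>1 + \<beta>/k\<close> is the conditional growth of the mean of the walk from time \<open>k\<close> to \<open>k + 1\<close>. The
  product starts at \<open>k = 2\<close> since the factor for \<open>k = 1\<close> vanishes when \<open>p = 0\<close>; the martingale is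
  therefore started at time 2.
\<close>

definition norming :: "real \<Rightarrow> nat \<Rightarrow> real" where
  "norming \<beta> n = (\<Prod>k\<in>{2..<n}. 1 + \<beta> / real k)"

text \<open>
  An upper bound for the accumulated conditional variance of the martingale after time 2, sharp to
  first order if \<open>\<beta> \<le> 1/2\<close>.
\<close>

definition clock :: "real \<Rightarrow> nat \<Rightarrow> real" where
  "clock \<beta> n = (\<Sum>k\<in>{3..n}. 1 / (norming \<beta> k)\<^sup>2)"

lemma norming_pos:
  assumes "-1 \<le> \<beta>" shows "0 < norming \<beta> n"
  unfolding norming_def
proof (rule prod_pos)
  fix k assume "k \<in> {2..<n}"
  then have "0 < real k + \<beta>" "0 < real k" using assms by auto
  then show "0 < 1 + \<beta> / real k" by (simp add: field_simps)
qed

lemma norming_Suc: "2 \<le> n \<Longrightarrow> norming \<beta> (Suc n) = norming \<beta> n * (1 + \<beta> / real n)"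
  by (simp add: norming_def mult.commute)

lemma norming_2 [simp]: "norming \<beta> 2 = 1"
  by (simp add: norming_def)

text \<open>
  The product is a quotient of a Pochhammer symbol and a factorial, so Euler's limit formula for the
  Gamma function applies.
\<close>

lemma norming_asymp:
  assumes "-1 \<le> \<beta>"
  shows "(\<lambda>n. norming \<beta> n / real n powr \<beta>) \<longlonglongrightarrow> rGamma (2 + \<beta>)"
proof -
  (* The shift by 3 aligns the product with the index range of rGamma_series. *)
  have eq: "norming \<beta> (m + 3) = pochhammer (2 + \<beta>) (m + 1) / fact (m + 2)" for m
  proof (induction m)
    case 0
    show ?case by (simp add: norming_def pochhammer_Suc numeral_3_eq_3 numeral_2_eq_2 field_simps)
  next
    case (Suc m)
    have "norming \<beta> (Suc m + 3) = norming \<beta> (m + 3) * (1 + \<beta> / real (m + 3))"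
      using norming_Suc[of "m + 3" \<beta>] by simp
    also have "\<dots> = pochhammer (2 + \<beta>) (m + 1) / fact (m + 2) * ((2 + \<beta> + real (m + 1)) / real (m + 3))"
      by (simp add: Suc.IH field_simps)
    also have "\<dots> = pochhammer (2 + \<beta>) (Suc m + 1) / fact (Suc m + 2)"
      by (simp add: pochhammer_Suc field_simps)
    finally show ?case .
  qed
  have "(\<lambda>m. rGamma_series (2 + \<beta>) m * ((real m / real (m + 3)) powr \<beta> * (real m * real m / (real (m + 1) * real (m + 2)))))
      \<longlonglongrightarrow> rGamma (2 + \<beta>) * (1 powr \<beta> * 1)"
  proof (intro tendsto_intros rGamma_series_LIMSEQ)
    show "(\<lambda>m. real m / real (m + 3)) \<longlonglongrightarrow> 1" by real_asymp
    show "(\<lambda>m. real m * real m / (real (m + 1) * real (m + 2))) \<longlonglongrightarrow> 1" by real_asymp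
  qed (auto)
  moreover have "eventually (\<lambda>m. rGamma_series (2 + \<beta>) m * ((real m / real (m + 3)) powr \<beta> * (real m * real m / (real (m + 1) * real (m + 2))))
      = norming \<beta> (m + 3) / real (m + 3) powr \<beta>) sequentially"
    using eventually_gt_at_top[of 0]
  proof eventually_elim
    case (elim m)
    have e: "exp ((2 + \<beta>) * ln (real m)) = real m * real m * real m powr \<beta>"
    proof -
      have "(2 + \<beta>) * ln (real m) = ln (real m) + ln (real m) + \<beta> * ln (real m)"
        by (simp add: algebra_simps)
      then have "exp ((2 + \<beta>) * ln (real m)) = exp (ln (real m)) * exp (ln (real m)) * exp (\<beta> * ln (real m))"
        by (simp only: exp_add)
      then show ?thesis using elim by (simp add: powr_def)
    qed
    have f: "fact (m + 2) = real (m + 2) * real (m + 1) * fact m" by (simp add: algebra_simps)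
    define P A B F where "P = pochhammer (2 + \<beta>) (m + 1)" and "A = real m powr \<beta>"
      and "B = real (m + 3) powr \<beta>" and "F = (fact m :: real)"
    have nz: "A \<noteq> 0" "B \<noteq> 0" "F \<noteq> 0" "real m \<noteq> 0" "real (m + 1) \<noteq> 0" "real (m + 2) \<noteq> 0"
      using elim by (auto simp: A_def B_def F_def simp del: of_nat_Suc)
    have "rGamma_series (2 + \<beta>) m = P / (F * (real m * real m * A))"
      by (simp add: rGamma_series_def e P_def A_def F_def)
    moreover have "(real m / real (m + 3)) powr \<beta> = A / B"
      using elim by (simp add: powr_divide A_def B_def)
    moreover have "norming \<beta> (m + 3) = P / (real (m + 2) * real (m + 1) * F)"
      unfolding eq f P_def F_def ..
    moreover have "P / (F * (x * x * A)) * (A / B * (x * x / (y * z))) = P / (z * y * F) / B"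
      if "x \<noteq> 0" "y \<noteq> 0" "z \<noteq> 0" for x y z
      using that nz by (simp add: field_simps)
    ultimately show ?case using nz unfolding B_def[symmetric] by presburger
  qed
  ultimately have "(\<lambda>m. norming \<beta> (m + 3) / real (m + 3) powr \<beta>) \<longlonglongrightarrow> rGamma (2 + \<beta>)"
    by (simp add: tendsto_cong)
  then show ?thesis by (rule LIMSEQ_offset)
qed

lemma rGamma_norming_pos: "-1 \<le> \<beta> \<Longrightarrow> 0 < rGamma (2 + \<beta> :: real)"
  using Gamma_real_pos[of "2 + \<beta>"] by (simp add: rGamma_inverse_Gamma)

lemma clock_Suc: "2 \<le> n \<Longrightarrow> clock \<beta> (Suc n) = clock \<beta> n + 1 / (norming \<beta> (Suc n))\<^sup>2"
proof -
  assume "2 \<le> n"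
  then have "{3..Suc n} = insert (Suc n) {3..n}" by auto
  then show ?thesis by (simp add: clock_def)
qed

lemma clock_2 [simp]: "clock \<beta> 2 = 0"
  by (simp add: clock_def)

lemma clock_mono: "m \<le> n \<Longrightarrow> clock \<beta> m \<le> clock \<beta> n"
  unfolding clock_def by (rule sum_mono2) auto

lemma clock_nonneg: "0 \<le> clock \<beta> n"
  unfolding clock_def by (rule sum_nonneg) auto

lemma clock_increment_asymp:
  assumes "-1 \<le> \<beta>"
  shows "(\<lambda>n. (1 / (norming \<beta> (Suc n))\<^sup>2) * real (Suc n) powr (2 * \<beta>)) \<longlonglongrightarrow> 1 / (rGamma (2 + \<beta>))\<^sup>2"
proof -
  have "(\<lambda>n. 1 / (norming \<beta> (Suc n) / real (Suc n) powr \<beta>)\<^sup>2) \<longlonglongrightarrow> 1 / (rGamma (2 + \<beta>))\<^sup>2"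
    using LIMSEQ_Suc[OF norming_asymp[OF assms]] rGamma_norming_pos[OF assms]
    by (intro tendsto_intros) auto
  then show ?thesis by (simp add: power_divide powr_power mult.commute)
qed

text \<open>
  Increments \<open>1 / b\<^sub>n\<^sup>2\<close> of order \<open>n\<^bsup>-2\<beta>\<^esup>\<close> are compared with those of \<open>n\<^bsup>1 - 2\<beta>\<^esup>\<close>.
\<close>

lemma clock_asymp:
  assumes "-1 \<le> \<beta>" "\<beta> < 1 / 2"
  shows "(\<lambda>n. clock \<beta> n / real n powr (1 - 2 * \<beta>)) \<longlonglongrightarrow> 1 / ((1 - 2 * \<beta>) * (rGamma (2 + \<beta>))\<^sup>2)"
proof (rule Stolz_Cesaro[where ?n0.0 = 0])
  show "real n powr (1 - 2 * \<beta>) < real (Suc n) powr (1 - 2 * \<beta>)" for n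
    using assms by (intro powr_less_mono2) auto
  have "0 < 1 - 2 * \<beta>" using assms by simp
  then show "filterlim (\<lambda>n. real n powr (1 - 2 * \<beta>)) at_top sequentially" by real_asymp
  define a where "a = 1 - 2 * \<beta>"
  have a: "0 < a" using assms by (simp add: a_def)
  have "(\<lambda>n. real (Suc n) powr (a - 1) / (real (Suc n) powr a - real n powr a)) \<longlonglongrightarrow> 1 / a"
    using a by real_asymp (simp add: inverse_eq_divide)
  then have "(\<lambda>n. ((1 / (norming \<beta> (Suc n))\<^sup>2) * real (Suc n) powr (2 * \<beta>)) *
      (real (Suc n) powr (a - 1) / (real (Suc n) powr a - real n powr a))) \<longlonglongrightarrow> 1 / (rGamma (2 + \<beta>))\<^sup>2 * (1 / a)"
    by (intro tendsto_mult clock_increment_asymp[OF assms(1)])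
  moreover have "eventually (\<lambda>n. ((1 / (norming \<beta> (Suc n))\<^sup>2) * real (Suc n) powr (2 * \<beta>)) *
      (real (Suc n) powr (a - 1) / (real (Suc n) powr a - real n powr a)) =
      (clock \<beta> (Suc n) - clock \<beta> n) / (real (Suc n) powr a - real n powr a)) sequentially"
    using eventually_ge_at_top[of 2]
  proof eventually_elim
    case (elim n)
    have "real (Suc n) powr (2 * \<beta>) * real (Suc n) powr (a - 1) = 1"
      by (simp add: a_def flip: powr_add)
    then show ?case using elim by (simp add: clock_Suc)
  qed
  ultimately show "(\<lambda>n. (clock \<beta> (Suc n) - clock \<beta> n) / (real (Suc n) powr (1 - 2 * \<beta>) - real n powr (1 - 2 * \<beta>)))
      \<longlonglongrightarrow> 1 / ((1 - 2 * \<beta>) * (rGamma (2 + \<beta>))\<^sup>2)"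
    by (simp add: tendsto_cong a_def mult.commute)
qed

lemma clock_asymp_critical:
  "(\<lambda>n. clock (1 / 2) n / ln (real n)) \<longlonglongrightarrow> 1 / (rGamma (2 + 1 / 2))\<^sup>2"
proof (rule Stolz_Cesaro[where ?n0.0 = 1])
  show "ln (real n) < ln (real (Suc n))" if "1 \<le> n" for n using that by simp
  show "filterlim (\<lambda>n. ln (real n)) at_top sequentially" by real_asymp
  have "(\<lambda>n. (1 / real (Suc n)) / (ln (real (Suc n)) - ln (real n))) \<longlonglongrightarrow> 1"
    by real_asymp
  then have "(\<lambda>n. ((1 / (norming (1/2) (Suc n))\<^sup>2) * real (Suc n) powr (2 * (1/2))) *
      ((1 / real (Suc n)) / (ln (real (Suc n)) - ln (real n)))) \<longlonglongrightarrow> 1 / (rGamma (2 + 1/2))\<^sup>2 * 1"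
    by (intro tendsto_mult clock_increment_asymp) auto
  moreover have "eventually (\<lambda>n. ((1 / (norming (1/2) (Suc n))\<^sup>2) * real (Suc n) powr (2 * (1/2))) *
      ((1 / real (Suc n)) / (ln (real (Suc n)) - ln (real n))) =
      (clock (1/2) (Suc n) - clock (1/2) n) / (ln (real (Suc n)) - ln (real n))) sequentially"
    using eventually_ge_at_top[of 2] by eventually_elim (simp add: clock_Suc)
  ultimately show "(\<lambda>n. (clock (1/2) (Suc n) - clock (1/2) n) / (ln (real (Suc n)) - ln (real n)))
      \<longlonglongrightarrow> 1 / (rGamma (2 + 1 / 2))\<^sup>2"
    by (simp add: tendsto_cong)
qed

lemma clock_at_top:
  assumes "-1 \<le> \<beta>" "\<beta> \<le> 1 / 2"
  shows "filterlim (clock \<beta>) at_top sequentially"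
proof (cases "\<beta> < 1 / 2")
  case True
  have "0 < 1 - 2 * \<beta>" using True by simp
  then have "filterlim (\<lambda>n. real n powr (1 - 2 * \<beta>)) at_top sequentially" by real_asymp
  then have "filterlim (\<lambda>n. clock \<beta> n / real n powr (1 - 2 * \<beta>) * real n powr (1 - 2 * \<beta>)) at_top sequentially"
    by (intro filterlim_tendsto_pos_mult_at_top[OF clock_asymp[OF assms(1) True]])
      (use True rGamma_norming_pos[OF assms(1)] in auto)
  moreover have "eventually (\<lambda>n. clock \<beta> n / real n powr (1 - 2 * \<beta>) * real n powr (1 - 2 * \<beta>) = clock \<beta> n) sequentially"
    using eventually_gt_at_top[of 0] by eventually_elim simp
  ultimately show ?thesis by (simp cong: filterlim_cong)
next
  case False
  then have b: "\<beta> = 1 / 2" using assms by simp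
  have "filterlim (\<lambda>n. ln (real n)) at_top sequentially" by real_asymp
  then have "filterlim (\<lambda>n. clock \<beta> n / ln (real n) * ln (real n)) at_top sequentially"
    unfolding b by (intro filterlim_tendsto_pos_mult_at_top[OF clock_asymp_critical])
      (use rGamma_norming_pos[of "1/2"] in auto)
  moreover have "eventually (\<lambda>n. clock \<beta> n / ln (real n) * ln (real n) = clock \<beta> n) sequentially"
    using eventually_gt_at_top[of 1] by eventually_elim simp
  ultimately show ?thesis by (simp cong: filterlim_cong)
qed

lemma norming_clock_asymp:
  assumes "-1 \<le> \<beta>" "\<beta> < 1 / 2"
  shows "(\<lambda>n. (norming \<beta> n)\<^sup>2 * clock \<beta> n / real n) \<longlonglongrightarrow> 1 / (1 - 2 * \<beta>)"
proof -
  have "(\<lambda>n. (norming \<beta> n / real n powr \<beta>)\<^sup>2 * (clock \<beta> n / real n powr (1 - 2 * \<beta>)))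
      \<longlonglongrightarrow> (rGamma (2 + \<beta>))\<^sup>2 * (1 / ((1 - 2 * \<beta>) * (rGamma (2 + \<beta>))\<^sup>2))"
    by (intro tendsto_intros norming_asymp clock_asymp assms)
  moreover have "eventually (\<lambda>n. (norming \<beta> n / real n powr \<beta>)\<^sup>2 * (clock \<beta> n / real n powr (1 - 2 * \<beta>))
      = (norming \<beta> n)\<^sup>2 * clock \<beta> n / real n) sequentially"
    using eventually_gt_at_top[of 0]
  proof eventually_elim
    case (elim n)
    have "(real n powr \<beta>)\<^sup>2 * real n powr (1 - 2 * \<beta>) = real n"
      using elim by (simp add: powr_power flip: powr_add)
    then show ?case by (simp add: power_divide)
  qed
  ultimately show ?thesis using rGamma_norming_pos[OF assms(1)] by (simp add: tendsto_cong)
qed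

lemma norming_clock_asymp_critical:
  "(\<lambda>n. (norming (1/2) n)\<^sup>2 * clock (1/2) n / (real n * ln (real n))) \<longlonglongrightarrow> 1"
proof -
  have "(\<lambda>n. (norming (1/2) n / real n powr (1/2))\<^sup>2 * (clock (1/2) n / ln (real n)))
      \<longlonglongrightarrow> (rGamma (2 + 1/2))\<^sup>2 * (1 / (rGamma (2 + 1/2))\<^sup>2)"
    by (intro tendsto_intros norming_asymp clock_asymp_critical) auto
  moreover have "eventually (\<lambda>n. (norming (1/2) n / real n powr (1/2))\<^sup>2 * (clock (1/2) n / ln (real n))
      = (norming (1/2) n)\<^sup>2 * clock (1/2) n / (real n * ln (real n))) sequentially"
    using eventually_gt_at_top[of 0]
    by eventually_elim (simp add: power_divide powr_power)
  ultimately show ?thesis using rGamma_norming_pos[of "1/2"] by (simp add: tendsto_cong)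
qed

lemma clock_bounded:
  assumes "1 / 2 < \<beta>"
  shows "convergent (clock \<beta>)"
proof -
  have b: "-1 \<le> \<beta>" using assms by simp
  have "summable (\<lambda>n. 1 / (norming \<beta> (Suc n))\<^sup>2)"
  proof (rule summable_comparison_test_bigo[where g = "\<lambda>n. real (Suc n) powr (- (2 * \<beta>))"])
    have "summable (\<lambda>n. real n powr (- (2 * \<beta>)))" using assms by (simp add: summable_real_powr_iff)
    then show "summable (\<lambda>n. norm (real (Suc n) powr (- (2 * \<beta>))))" by (subst (asm) summable_Suc_iff[symmetric]) simp
    have "(\<lambda>n. 1 / (norming \<beta> (Suc n))\<^sup>2 / real (Suc n) powr (- (2 * \<beta>))) \<longlonglongrightarrow> 1 / (rGamma (2 + \<beta>))\<^sup>2"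
      using clock_increment_asymp[OF b] by (simp add: powr_minus field_simps)
    then show "(\<lambda>n. 1 / (norming \<beta> (Suc n))\<^sup>2) \<in> O(\<lambda>n. real (Suc n) powr (- (2 * \<beta>)))"
      by (rule bigoI_tendsto) auto
  qed
  then have s: "summable (\<lambda>n. 1 / (norming \<beta> n)\<^sup>2)" by (subst (asm) summable_Suc_iff)
  show ?thesis
  proof (rule Bseq_monoseq_convergent)
    show "monoseq (clock \<beta>)" by (simp add: monoseq_def clock_mono)
    have "clock \<beta> n \<le> (\<Sum>n. 1 / (norming \<beta> n)\<^sup>2)" for n
      unfolding clock_def by (rule sum_le_suminf[OF s]) auto
    then show "Bseq (clock \<beta>)" by (intro BseqI'[where K = "\<Sum>n. 1 / (norming \<beta> n)\<^sup>2"]) (simp add: clock_nonneg)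
  qed
qed

section \<open>The conditional mean of the next step\<close>

context elephant_random_walk
begin

abbreviation \<beta> :: real where "\<beta> \<equiv> 2 * p - 1"

definition walk :: "nat \<Rightarrow> 'a \<Rightarrow> real" where
  "walk n \<omega> = real_of_int (lifted_walk X n \<omega>)"

definition history :: "nat \<Rightarrow> 'a \<Rightarrow> int list" where
  "history n \<omega> = map (\<lambda>k. X k \<omega>) [1..<Suc n]"

text \<open>
  Dependence on the first \<open>n\<close> steps only, expressed without a \<open>\<sigma>\<close>-algebra: the steps take finitely many values
  almost surely, so such a function is a finite combination of indicators of histories, and
  measurability and integrability are automatic.
\<close>

definition adapted :: "nat \<Rightarrow> ('a \<Rightarrow> 'c) \<Rightarrow> bool" where
  "adapted n Z \<longleftrightarrow> (\<forall>\<omega> \<omega>'. (\<forall>k\<in>{1..n}. X k \<omega> = X k \<omega>') \<longrightarrow> Z \<omega> = Z \<omega>')"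

lemma adapted_mono: "adapted m Z \<Longrightarrow> m \<le> n \<Longrightarrow> adapted n Z"
  by (simp add: adapted_def)

lemma adapted_const [simp, intro]: "adapted n (\<lambda>\<omega>. c)"
  by (simp add: adapted_def)

lemma adapted_comp: "adapted n Z \<Longrightarrow> adapted n (\<lambda>\<omega>. f (Z \<omega>))"
  unfolding adapted_def by metis

lemma adapted_comp2: "adapted n Z \<Longrightarrow> adapted n Y \<Longrightarrow> adapted n (\<lambda>\<omega>. f (Z \<omega>) (Y \<omega>))"
  unfolding adapted_def by metis

lemma adapted_Ball: "(\<And>k. k \<in> A \<Longrightarrow> adapted n (Q k)) \<Longrightarrow> adapted n (\<lambda>\<omega>. \<forall>k\<in>A. Q k \<omega>)"
  unfolding adapted_def by metis

lemma adapted_Bex: "(\<And>k. k \<in> A \<Longrightarrow> adapted n (Q k)) \<Longrightarrow> adapted n (\<lambda>\<omega>. \<exists>k\<in>A. Q k \<omega>)"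
  unfolding adapted_def by metis

lemma adapted_X: "1 \<le> k \<Longrightarrow> k \<le> n \<Longrightarrow> adapted n (X k)"
  by (simp add: adapted_def)

lemma adapted_lifted_walk: "k \<le> n \<Longrightarrow> adapted n (lifted_walk X k)"
  unfolding adapted_def lifted_walk_def by (intro allI impI sum.cong) auto

lemma adapted_walk: "k \<le> n \<Longrightarrow> adapted n (walk k)"
  unfolding walk_def using adapted_comp[OF adapted_lifted_walk] .

lemma history_eq_iff: "history n \<omega> = history n \<omega>' \<longleftrightarrow> (\<forall>k\<in>{1..n}. X k \<omega> = X k \<omega>')"
proof -
  have "set [1..<Suc n] = {1..n}" by auto
  then show ?thesis unfolding history_def map_eq_conv by simp
qed

lemma adapted_history: "adapted n (history n)"
  by (simp add: adapted_def history_eq_iff)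

lemma adapted_factors:
  assumes "adapted n Z"
  shows "Z \<omega> = Z (SOME \<omega>'. history n \<omega>' = history n \<omega>)"
proof -
  have "history n (SOME \<omega>'. history n \<omega>' = history n \<omega>) = history n \<omega>"
    by (rule someI[of "\<lambda>\<omega>'. history n \<omega>' = history n \<omega>"]) simp
  then have "\<forall>k\<in>{1..n}. X k \<omega> = X k (SOME \<omega>'. history n \<omega>' = history n \<omega>)"
    unfolding history_eq_iff by simp
  with assms show ?thesis unfolding adapted_def by blast
qed

text \<open>
  Measurability of a single step does not follow from the step equation, because the remembered time
  may leave \<open>{1..n - 1}\<close> on a null set, where the step is arbitrary. It is instead part of the
  independence assumption for the next choice.
\<close>

lemma history_measurable: "history n \<in> measurable M (count_space UNIV)"
proof (cases "n = 0")
  case True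
  then have "history n = (\<lambda>\<omega>. [])" by (auto simp: history_def)
  then show ?thesis by simp
next
  case False
  define past where "past = (\<lambda>\<omega>. (map (\<lambda>k. X k \<omega>) [1..<Suc n], map (\<lambda>k. (u k \<omega>, r k \<omega>)) [2..<Suc n]))"
  have "2 \<le> Suc n" using False by simp
  from choice_indep_past[OF this]
  have "sets (vimage_algebra (space M) past (count_space UNIV)) \<subseteq> events"
    unfolding indep_set_def indep_sets_def past_def[symmetric] UNIV_bool by auto
  then have "past -` A \<inter> space M \<in> events" for A
    using in_vimage_algebra[of A "count_space UNIV" past "space M"] by auto
  then have "past \<in> measurable M (count_space UNIV)" by (auto simp: measurable_def)
  then have "(\<lambda>\<omega>. fst (past \<omega>)) \<in> measurable M (count_space UNIV)"
    by (rule measurable_compose) simp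
  then show ?thesis by (simp add: past_def history_def[abs_def])
qed

lemma adapted_measurable:
  assumes "adapted n Z" "range Z \<subseteq> space N"
  shows "Z \<in> measurable M N"
proof -
  have "Z = (\<lambda>\<omega>. (\<lambda>h. Z (SOME \<omega>'. history n \<omega>' = h)) (history n \<omega>))"
    using adapted_factors[OF assms(1)] by auto
  also have "\<dots> \<in> measurable M N"
    by (rule measurable_compose[OF history_measurable]) (use assms(2) in auto)
  finally show ?thesis .
qed

lemma adapted_borel: "adapted n (Z :: 'a \<Rightarrow> 'c :: topological_space) \<Longrightarrow> Z \<in> borel_measurable M"
  by (rule adapted_measurable) auto

lemma adapted_event: "adapted n Q \<Longrightarrow> {\<omega> \<in> space M. Q \<omega>} \<in> events"
  using adapted_measurable[of n Q "count_space UNIV"] by (simp add: pred_def)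

lemma AE_choice:
  assumes "2 \<le> n" shows "AE \<omega> in M. u n \<omega> \<in> {1..n - 1}"
proof -
  have "AE x in distr M (count_space UNIV) (\<lambda>\<omega>. (u n \<omega>, r n \<omega>)). fst x \<in> {1..n - 1}"
    unfolding choice_law[OF assms] AE_measure_pmf_iff using assms by (auto simp: set_pmf_of_set)
  then show ?thesis
    using choice_measurable[OF assms] by (subst (asm) AE_distr_iff) auto
qed

lemma AE_step:
  "1 \<le> n \<Longrightarrow> AE \<omega> in M. X n \<omega> \<in> {1, -1}"
proof (induction n rule: less_induct)
  case (less n)
  show ?case
  proof (cases "n = 1")
    case True
    have "AE x in distr M (count_space UNIV) (X 1). x \<in> {1, -1}"
      unfolding first_step AE_measure_pmf_iff by (auto simp: set_pmf_of_set)
    then show ?thesis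
      using first_measurable by (subst (asm) AE_distr_iff) (auto simp: True)
  next
    case False
    with less.prems have n: "2 \<le> n" by simp
    have "AE \<omega> in M. \<forall>k\<in>{1..n-1}. X k \<omega> \<in> {1, -1}"
      using less.IH n by (intro AE_ball_countable') auto
    with AE_choice[OF n] AE_space show ?thesis
      by eventually_elim (use step[OF n] in force)
  qed
qed

lemma AE_steps: "AE \<omega> in M. \<forall>k\<ge>1. X k \<omega> = 1 \<or> X k \<omega> = -1"
  using AE_step by (subst AE_all_countable) auto

lemma abs_walk_le:
  assumes "\<forall>k\<ge>1. X k \<omega> = 1 \<or> X k \<omega> = -1"
  shows "\<bar>walk n \<omega>\<bar> \<le> real n"
proof -
  have "\<bar>lifted_walk X n \<omega>\<bar> \<le> (\<Sum>j = 1..n. \<bar>X j \<omega>\<bar>)" unfolding lifted_walk_def by (rule sum_abs)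
  also have "\<dots> \<le> (\<Sum>j = 1..n. 1)" using assms by (intro sum_mono) force
  finally show ?thesis by (simp add: walk_def)
qed

lemma walk_Suc: "walk (Suc n) \<omega> = walk n \<omega> + real_of_int (X (Suc n) \<omega>)"
  by (simp add: walk_def lifted_walk_def)

definition sign_paths :: "nat \<Rightarrow> int list set" where
  "sign_paths n = {h. set h \<subseteq> {1, -1} \<and> length h = n}"

lemma finite_sign_paths: "finite (sign_paths n)"
  unfolding sign_paths_def by (rule finite_lists_length_eq) simp

lemma AE_history: "AE \<omega> in M. history n \<omega> \<in> sign_paths n"
  using AE_steps by eventually_elim (auto simp: history_def sign_paths_def)

lemma adapted_bounded:
  fixes Z :: "'a \<Rightarrow> 'c :: real_normed_vector"
  assumes "adapted n Z"
  obtains C where "AE \<omega> in M. norm (Z \<omega>) \<le> C"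
proof
  show "AE \<omega> in M. norm (Z \<omega>) \<le> Max ((\<lambda>h. norm (Z (SOME \<omega>'. history n \<omega>' = h))) ` sign_paths n)"
    using AE_history[of n]
  proof eventually_elim
    case (elim \<omega>)
    then show ?case using finite_sign_paths[of n]
      by (subst adapted_factors[OF assms]) (auto intro!: Max_ge)
  qed
qed

lemma adapted_integrable:
  fixes Z :: "'a \<Rightarrow> 'c :: {banach, second_countable_topology}"
  assumes "adapted n Z"
  shows "integrable M Z"
  using adapted_bounded[OF assms] integrable_const_bound[OF _ adapted_borel[OF assms]] by metis

lemma integral_of_bool_scaleR:
  fixes x :: "'c :: {banach, second_countable_topology}"
  assumes "{\<omega> \<in> space M. P \<omega>} \<in> events"
  shows "(\<integral>\<omega>. of_bool (P \<omega>) *\<^sub>R x \<partial>M) = \<P>(\<omega> in M. P \<omega>) *\<^sub>R x"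
    and "integrable M (\<lambda>\<omega>. of_bool (P \<omega>) *\<^sub>R x)"
proof -
  have "(\<integral>\<omega>. of_bool (P \<omega>) *\<^sub>R x \<partial>M) = (\<integral>\<omega>. indicator {\<omega> \<in> space M. P \<omega>} \<omega> *\<^sub>R x \<partial>M)"
    by (rule Bochner_Integration.integral_cong) (auto simp: indicator_def)
  also have "\<dots> = \<P>(\<omega> in M. P \<omega>) *\<^sub>R x"
    using assms by (subst integral_scaleR_left) (auto intro!: integrable_real_indicator simp: emeasure_eq_measure)
  finally show "(\<integral>\<omega>. of_bool (P \<omega>) *\<^sub>R x \<partial>M) = \<P>(\<omega> in M. P \<omega>) *\<^sub>R x" .
  have "integrable M (\<lambda>\<omega>. indicator {\<omega> \<in> space M. P \<omega>} \<omega> *\<^sub>R x)"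
    using assms by (intro integrable_scaleR_left) (auto intro!: integrable_real_indicator simp: emeasure_eq_measure)
  then show "integrable M (\<lambda>\<omega>. of_bool (P \<omega>) *\<^sub>R x)"
    by (rule Bochner_Integration.integrable_cong[THEN iffD1, rotated -1]) (auto simp: indicator_def)
qed

lemma integral_of_bool:
  assumes "{\<omega> \<in> space M. P \<omega>} \<in> events"
  shows "(\<integral>\<omega>. of_bool (P \<omega>) \<partial>M) = \<P>(\<omega> in M. P \<omega>)"
  using integral_of_bool_scaleR(1)[OF assms, of "1::real"] by simp

lemma prob_choice_history:
  assumes "1 \<le> n" "j \<in> {1..n}"
  shows "\<P>(\<omega> in M. (u (Suc n) \<omega> = j \<and> r (Suc n) \<omega> = c) \<and> history n \<omega> = h)
    = (if c then p else 1 - p) / real n * \<P>(\<omega> in M. history n \<omega> = h)"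
    and "{\<omega> \<in> space M. u (Suc n) \<omega> = j \<and> r (Suc n) \<omega> = c} \<in> events"
proof -
  have n: "2 \<le> Suc n" using assms by simp
  define past where "past = (\<lambda>\<omega>. (map (\<lambda>k. X k \<omega>) [1..<Suc n], map (\<lambda>k. (u k \<omega>, r k \<omega>)) [2..<Suc n]))"
  define ch where "ch = (\<lambda>\<omega>. (u (Suc n) \<omega>, r (Suc n) \<omega>))"
  have "prob (past -` {x. fst x = h} \<inter> space M \<inter> (ch -` {(j, c)} \<inter> space M))
      = prob (past -` {x. fst x = h} \<inter> space M) * prob (ch -` {(j, c)} \<inter> space M)"
    by (rule indep_setD[OF choice_indep_past[OF n, folded past_def ch_def]])
      (rule in_vimage_algebra, simp)+
  moreover have "past -` {x. fst x = h} \<inter> space M = {\<omega> \<in> space M. history n \<omega> = h}"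
    by (auto simp: past_def history_def)
  moreover have ch: "ch -` {(j, c)} \<inter> space M = {\<omega> \<in> space M. u (Suc n) \<omega> = j \<and> r (Suc n) \<omega> = c}"
    by (auto simp: ch_def)
  moreover have "prob (ch -` {(j, c)} \<inter> space M) = (if c then p else 1 - p) / real n"
  proof -
    have "prob (ch -` {(j, c)} \<inter> space M) = measure (distr M (count_space UNIV) ch) {(j, c)}"
      using choice_measurable[OF n] by (subst measure_distr) (auto simp: ch_def)
    also have "\<dots> = pmf (pair_pmf (pmf_of_set {1..n}) (bernoulli_pmf p)) (j, c)"
      unfolding ch_def choice_law[OF n] by (simp add: measure_pmf_single)
    also have "\<dots> = (if c then p else 1 - p) / real n"
      using assms memory_parameter by (simp add: pmf_pair)
    finally show ?thesis .
  qed
  moreover have "{\<omega> \<in> space M. history n \<omega> = h} \<inter> {\<omega> \<in> space M. u (Suc n) \<omega> = j \<and> r (Suc n) \<omega> = c}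
    = {\<omega> \<in> space M. (u (Suc n) \<omega> = j \<and> r (Suc n) \<omega> = c) \<and> history n \<omega> = h}" by auto
  ultimately show "\<P>(\<omega> in M. (u (Suc n) \<omega> = j \<and> r (Suc n) \<omega> = c) \<and> history n \<omega> = h)
    = (if c then p else 1 - p) / real n * \<P>(\<omega> in M. history n \<omega> = h)" by (simp add: mult.commute)
  show "{\<omega> \<in> space M. u (Suc n) \<omega> = j \<and> r (Suc n) \<omega> = c} \<in> events"
    using measurable_sets[OF choice_measurable[OF n], of "{(j, c)}"] ch by (simp add: ch_def)
qed

text \<open>
  Independence of the choice at time \<open>n + 1\<close> from the past, in the form needed for vector-valued
  functions of the past: both sides are linear in the indicators of the finitely many histories.
\<close>

lemma integral_choice:
  fixes Z :: "'a \<Rightarrow> 'c :: {banach, second_countable_topology}"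
  assumes "1 \<le> n" "j \<in> {1..n}" "adapted n Z"
  shows "(\<integral>\<omega>. of_bool (u (Suc n) \<omega> = j \<and> r (Suc n) \<omega> = c) *\<^sub>R Z \<omega> \<partial>M)
    = ((if c then p else 1 - p) / real n) *\<^sub>R (\<integral>\<omega>. Z \<omega> \<partial>M)"
proof -
  define g where "g = (\<lambda>h. Z (SOME \<omega>'. history n \<omega>' = h))"
  have Z: "Z \<omega> = (\<Sum>h\<in>sign_paths n. of_bool (history n \<omega> = h) *\<^sub>R g h)" if "history n \<omega> \<in> sign_paths n" for \<omega>
    using that finite_sign_paths[of n] adapted_factors[OF assms(3), of \<omega>]
    by (simp add: g_def of_bool_def if_distrib[of "\<lambda>x. x *\<^sub>R _"] cong: if_cong)
  have hist: "{\<omega> \<in> space M. history n \<omega> = h} \<in> events" for h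
    using adapted_event[OF adapted_comp[OF adapted_history, of n "\<lambda>x. x = h"]] .
  have both: "{\<omega> \<in> space M. (u (Suc n) \<omega> = j \<and> r (Suc n) \<omega> = c) \<and> history n \<omega> = h} \<in> events" for h
  proof -
    have "{\<omega> \<in> space M. (u (Suc n) \<omega> = j \<and> r (Suc n) \<omega> = c) \<and> history n \<omega> = h} =
      {\<omega> \<in> space M. u (Suc n) \<omega> = j \<and> r (Suc n) \<omega> = c} \<inter> {\<omega> \<in> space M. history n \<omega> = h}" by auto
    then show ?thesis using hist prob_choice_history(2)[OF assms(1,2)] by auto
  qed
  have mZ: "Z \<in> borel_measurable M" using adapted_borel[OF assms(3)] .
  have mB: "(\<lambda>\<omega>. of_bool (P \<omega>) *\<^sub>R x) \<in> borel_measurable M" if "{\<omega> \<in> space M. P \<omega>} \<in> events" for P and x :: 'c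
    by (rule borel_measurable_integrable[OF integral_of_bool_scaleR(2)[OF that]])
  have mC: "(\<lambda>\<omega>. of_bool (u (Suc n) \<omega> = j \<and> r (Suc n) \<omega> = c) :: real) \<in> borel_measurable M"
    using borel_measurable_integrable[OF integral_of_bool_scaleR(2)[OF prob_choice_history(2)[OF assms(1,2), of c], where x = "1::real"]]
    by simp
  have "(\<integral>\<omega>. of_bool (u (Suc n) \<omega> = j \<and> r (Suc n) \<omega> = c) *\<^sub>R Z \<omega> \<partial>M)
    = (\<integral>\<omega>. (\<Sum>h\<in>sign_paths n. of_bool ((u (Suc n) \<omega> = j \<and> r (Suc n) \<omega> = c) \<and> history n \<omega> = h) *\<^sub>R g h) \<partial>M)"
  proof (rule integral_cong_AE)
    show "AE \<omega> in M. of_bool (u (Suc n) \<omega> = j \<and> r (Suc n) \<omega> = c) *\<^sub>R Z \<omega>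
        = (\<Sum>h\<in>sign_paths n. of_bool ((u (Suc n) \<omega> = j \<and> r (Suc n) \<omega> = c) \<and> history n \<omega> = h) *\<^sub>R g h)"
      using AE_history[of n]
    proof eventually_elim
      case (elim \<omega>)
      show ?case unfolding Z[OF elim] by (simp add: scaleR_sum_right of_bool_conj)
    qed
  qed (intro borel_measurable_scaleR mC mZ borel_measurable_sum mB both)+
  also have "\<dots> = (\<Sum>h\<in>sign_paths n. ((if c then p else 1 - p) / real n * \<P>(\<omega> in M. history n \<omega> = h)) *\<^sub>R g h)"
    by (subst Bochner_Integration.integral_sum)
      (simp_all only: integral_of_bool_scaleR both prob_choice_history(1)[OF assms(1,2)])
  also have "\<dots> = ((if c then p else 1 - p) / real n) *\<^sub>R (\<Sum>h\<in>sign_paths n. \<P>(\<omega> in M. history n \<omega> = h) *\<^sub>R g h)"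
    by (simp add: scaleR_sum_right)
  also have "(\<Sum>h\<in>sign_paths n. \<P>(\<omega> in M. history n \<omega> = h) *\<^sub>R g h)
      = (\<integral>\<omega>. (\<Sum>h\<in>sign_paths n. of_bool (history n \<omega> = h) *\<^sub>R g h) \<partial>M)"
    by (subst Bochner_Integration.integral_sum) (simp_all only: integral_of_bool_scaleR hist)
  also have "\<dots> = (\<integral>\<omega>. Z \<omega> \<partial>M)"
  proof (rule integral_cong_AE)
    show "AE \<omega> in M. (\<Sum>h\<in>sign_paths n. of_bool (history n \<omega> = h) *\<^sub>R g h) = Z \<omega>"
      using AE_history[of n] by eventually_elim (simp only: Z)
  qed (intro borel_measurable_scaleR mC mZ borel_measurable_sum mB hist)+
  finally show ?thesis .
qed

text \<open>
  The elephant repeats a uniformly chosen past step with probability \<open>p\<close> and reverses it otherwise, so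
  the conditional mean of the next step is \<open>(2p - 1)\<close> times the average of the past steps. As the
  steps are \<open>\<plusminus>1\<close>, this determines their conditional law, and the choices of the elephant
  are not mentioned again. Complex values of \<open>Z\<close> are needed for characteristic functions.
\<close>

lemma integral_next_step:
  fixes Z :: "'a \<Rightarrow> 'c :: {banach, second_countable_topology}"
  assumes n: "1 \<le> n" and Z: "adapted n Z"
  shows "(\<integral>\<omega>. real_of_int (X (Suc n) \<omega>) *\<^sub>R Z \<omega> \<partial>M) = (\<beta> / real n) *\<^sub>R (\<integral>\<omega>. walk n \<omega> *\<^sub>R Z \<omega> \<partial>M)"
proof -
  have n2: "2 \<le> Suc n" using n by simp
  define \<sigma> :: "bool \<Rightarrow> real" where "\<sigma> c = (if c then 1 else - 1)" for c
  define w where "w j c \<omega> = (\<sigma> c * real_of_int (X j \<omega>)) *\<^sub>R Z \<omega>" for j c \<omega>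
  define I where "I j c \<omega> = (of_bool (u (Suc n) \<omega> = j \<and> r (Suc n) \<omega> = c) :: real)" for j c \<omega>
  have w: "adapted n (w j c)" if "j \<in> {1..n}" for j c
    unfolding w_def using that by (intro adapted_comp2[OF adapted_comp[OF adapted_X] Z]) auto
  have mI: "I j c \<in> borel_measurable M" if "j \<in> {1..n}" for j c
    using borel_measurable_integrable[OF integral_of_bool_scaleR(2)[OF prob_choice_history(2)[OF n that, of c], where x = "1::real"]]
    by (simp add: I_def[abs_def])
  have intI: "integrable M (\<lambda>\<omega>. I j c \<omega> *\<^sub>R w j c \<omega>)" if j: "j \<in> {1..n}" for j c
    by (rule Bochner_Integration.integrable_bound[OF adapted_integrable[OF w[OF j, of c]]
          borel_measurable_scaleR[OF mI[OF j] adapted_borel[OF w[OF j]]]]) (simp add: I_def)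
  have "(\<integral>\<omega>. real_of_int (X (Suc n) \<omega>) *\<^sub>R Z \<omega> \<partial>M)
    = (\<integral>\<omega>. (\<Sum>j\<in>{1..n}. \<Sum>c\<in>UNIV. I j c \<omega> *\<^sub>R w j c \<omega>) \<partial>M)"
  proof (rule integral_cong_AE)
    show "(\<lambda>\<omega>. real_of_int (X (Suc n) \<omega>) *\<^sub>R Z \<omega>) \<in> borel_measurable M"
      by (intro borel_measurable_scaleR adapted_borel[of "Suc n"] adapted_comp[OF adapted_X] adapted_mono[OF Z]) auto
    show "AE \<omega> in M. real_of_int (X (Suc n) \<omega>) *\<^sub>R Z \<omega> = (\<Sum>j\<in>{1..n}. \<Sum>c\<in>UNIV. I j c \<omega> *\<^sub>R w j c \<omega>)"
      using AE_choice[OF n2] AE_space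
    proof (eventually_elim)
      case (elim \<omega>)
      then have un: "u (Suc n) \<omega> \<in> {1..n}" using n by simp
      have "I j c \<omega> *\<^sub>R w j c \<omega> = (if j = u (Suc n) \<omega> then if c = r (Suc n) \<omega> then w j c \<omega> else 0 else 0)" for j c
        by (auto simp: I_def)
      then have "(\<Sum>j\<in>{1..n}. \<Sum>c\<in>UNIV. I j c \<omega> *\<^sub>R w j c \<omega>)
        = (\<Sum>j\<in>{1..n}. if j = u (Suc n) \<omega> then w j (r (Suc n) \<omega>) \<omega> else 0)"
        by (intro sum.cong) auto
      also have "\<dots> = w (u (Suc n) \<omega>) (r (Suc n) \<omega>) \<omega>" using un by simp
      also have "\<dots> = real_of_int (X (Suc n) \<omega>) *\<^sub>R Z \<omega>"
        using step[of "Suc n" \<omega>] n elim by (simp add: w_def \<sigma>_def)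
      finally show ?case by simp
    qed
    show "(\<lambda>\<omega>. \<Sum>j\<in>{1..n}. \<Sum>c\<in>UNIV. I j c \<omega> *\<^sub>R w j c \<omega>) \<in> borel_measurable M"
      by (intro borel_measurable_sum borel_measurable_scaleR mI adapted_borel[OF w])
  qed
  also have "\<dots> = (\<Sum>j\<in>{1..n}. \<Sum>c\<in>UNIV. (\<integral>\<omega>. I j c \<omega> *\<^sub>R w j c \<omega> \<partial>M))"
    using intI by (simp add: Bochner_Integration.integral_sum Bochner_Integration.integrable_sum del: UNIV_bool)
  also have "\<dots> = (\<Sum>j\<in>{1..n}. \<Sum>c\<in>UNIV. ((if c then p else 1 - p) / real n) *\<^sub>R (\<integral>\<omega>. w j c \<omega> \<partial>M))"
    unfolding I_def by (intro sum.cong refl integral_choice n w)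
  also have "\<dots> = (\<Sum>j\<in>{1..n}. (\<beta> / real n) *\<^sub>R (\<integral>\<omega>. real_of_int (X j \<omega>) *\<^sub>R Z \<omega> \<partial>M))"
  proof (rule sum.cong[OF refl])
    fix j
    define J where "J = (\<integral>\<omega>. real_of_int (X j \<omega>) *\<^sub>R Z \<omega> \<partial>M)"
    have J: "(\<integral>\<omega>. w j c \<omega> \<partial>M) = \<sigma> c *\<^sub>R J" for c
      unfolding w_def J_def by (simp only: scaleR_scaleR[symmetric] integral_scaleR_right)
    have "(\<Sum>c\<in>UNIV. ((if c then p else 1 - p) / real n) *\<^sub>R (\<sigma> c *\<^sub>R J))
      = (p / real n - (1 - p) / real n) *\<^sub>R J"
      unfolding UNIV_bool scaleR_diff_left
      by (simp add: \<sigma>_def) (simp only: scaleR_minus_left[symmetric] minus_divide_left minus_diff_eq)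
    also have "p / real n - (1 - p) / real n = \<beta> / real n"
      by (simp add: diff_divide_distrib add_divide_distrib)
    finally show "(\<Sum>c\<in>UNIV. ((if c then p else 1 - p) / real n) *\<^sub>R (\<integral>\<omega>. w j c \<omega> \<partial>M))
      = (\<beta> / real n) *\<^sub>R (\<integral>\<omega>. real_of_int (X j \<omega>) *\<^sub>R Z \<omega> \<partial>M)" unfolding J J_def[symmetric] .
  qed
  also have "\<dots> = (\<beta> / real n) *\<^sub>R (\<integral>\<omega>. (\<Sum>j\<in>{1..n}. real_of_int (X j \<omega>) *\<^sub>R Z \<omega>) \<partial>M)"
  proof -
    have "integrable M (\<lambda>\<omega>. real_of_int (X j \<omega>) *\<^sub>R Z \<omega>)" if "j \<in> {1..n}" for j
      using that by (intro adapted_integrable[of n] adapted_comp2[OF adapted_comp[OF adapted_X] Z]) auto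
    then show ?thesis by (simp add: Bochner_Integration.integral_sum scaleR_sum_right)
  qed
  also have "(\<lambda>\<omega>. (\<Sum>j\<in>{1..n}. real_of_int (X j \<omega>) *\<^sub>R Z \<omega>)) = (\<lambda>\<omega>. walk n \<omega> *\<^sub>R Z \<omega>)"
    by (simp add: walk_def lifted_walk_def scaleR_sum_left)
  finally show ?thesis .
qed

end

section \<open>Martingale moments and maximal inequalities\<close>

context elephant_random_walk
begin

text \<open>
  The innovation of the next step: the step minus its conditional mean.
\<close>

definition noise :: "nat \<Rightarrow> 'a \<Rightarrow> real" where
  "noise n \<omega> = real_of_int (X (Suc n) \<omega>) - \<beta> * walk n \<omega> / real n"

definition mart :: "nat \<Rightarrow> 'a \<Rightarrow> real" where
  "mart n \<omega> = walk n \<omega> / norming \<beta> n"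

lemma beta_bounds: "-1 \<le> \<beta>" "\<beta> < 1" "\<beta>\<^sup>2 \<le> 1"
  using memory_parameter by (auto simp: abs_square_le_1)

lemma norming_beta_pos [simp]: "0 < norming \<beta> n"
  using norming_pos beta_bounds(1) .

lemma norming_beta_nonzero [simp]: "norming \<beta> n \<noteq> 0"
  using norming_beta_pos[of n] by linarith

lemma adapted_mart: "k \<le> n \<Longrightarrow> adapted n (mart k)"
  unfolding mart_def[abs_def] by (rule adapted_comp[OF adapted_walk])

lemma adapted_noise: "adapted (Suc n) (noise n)"
  unfolding noise_def[abs_def]
  by (rule adapted_comp2[OF adapted_comp[OF adapted_X] adapted_comp[OF adapted_comp[OF adapted_walk]]]) auto

text \<open>
  The drift \<open>\<beta> S\<^sub>n / n\<close> is exactly absorbed by the change of the norming factor.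
\<close>

lemma mart_Suc:
  assumes "2 \<le> n"
  shows "mart (Suc n) \<omega> = mart n \<omega> + noise n \<omega> / norming \<beta> (Suc n)"
proof -
  have "norming \<beta> (Suc n) \<noteq> 0" by simp
  then have nz: "1 + \<beta> / real n \<noteq> 0" unfolding norming_Suc[OF assms] by auto
  have "mart n \<omega> = walk n \<omega> * (1 + \<beta> / real n) / norming \<beta> (Suc n)"
    unfolding mart_def norming_Suc[OF assms] using nz by simp
  then show ?thesis
    by (simp add: mart_def walk_Suc noise_def algebra_simps add_divide_distrib diff_divide_distrib)
qed

lemma noise_mean:
  fixes Z :: "'a \<Rightarrow> 'c :: {banach, second_countable_topology}"
  assumes n: "1 \<le> n" and Z: "adapted n Z"
  shows "(\<integral>\<omega>. noise n \<omega> *\<^sub>R Z \<omega> \<partial>M) = 0"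
proof -
  have int: "integrable M (\<lambda>\<omega>. real_of_int (X (Suc n) \<omega>) *\<^sub>R Z \<omega>)"
    by (intro adapted_integrable[of "Suc n"] adapted_comp2[OF adapted_comp[OF adapted_X] adapted_mono[OF Z]]) auto
  have int': "integrable M (\<lambda>\<omega>. walk n \<omega> *\<^sub>R Z \<omega>)"
    by (intro adapted_integrable[of "n"] adapted_comp2[OF adapted_walk Z]) auto
  have "(\<integral>\<omega>. noise n \<omega> *\<^sub>R Z \<omega> \<partial>M)
    = (\<integral>\<omega>. real_of_int (X (Suc n) \<omega>) *\<^sub>R Z \<omega> - (\<beta> / real n) *\<^sub>R (walk n \<omega> *\<^sub>R Z \<omega>) \<partial>M)"
    by (simp add: noise_def scaleR_diff_left)
  also have "\<dots> = 0"
    using int int' by (simp add: integral_next_step[OF n Z] del: scaleR_scaleR)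
  finally show ?thesis .
qed

text \<open>
  The step has square one, hence conditional variance \<open>1 - (\<beta> S\<^sub>n / n)\<^sup>2\<close>.
\<close>

lemma noise_square:
  fixes Z :: "'a \<Rightarrow> 'c :: {banach, second_countable_topology}"
  assumes n: "1 \<le> n" and Z: "adapted n Z"
  shows "(\<integral>\<omega>. (noise n \<omega>)\<^sup>2 *\<^sub>R Z \<omega> \<partial>M) = (\<integral>\<omega>. (1 - (\<beta> * walk n \<omega> / real n)\<^sup>2) *\<^sub>R Z \<omega> \<partial>M)"
proof -
  define m where "m \<omega> = \<beta> * walk n \<omega> / real n" for \<omega>
  have m: "adapted n m" unfolding m_def[abs_def] by (rule adapted_comp[OF adapted_comp[OF adapted_walk]]) simp
  define Z1 where "Z1 \<omega> = (1 - (m \<omega>)\<^sup>2) *\<^sub>R Z \<omega>" for \<omega>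
  define Z2 where "Z2 \<omega> = (- 2 * m \<omega>) *\<^sub>R Z \<omega>" for \<omega>
  have Z12: "adapted n Z1" "adapted n Z2"
    unfolding Z1_def[abs_def] Z2_def[abs_def] by (rule adapted_comp2[OF m Z])+
  have "(\<integral>\<omega>. (noise n \<omega>)\<^sup>2 *\<^sub>R Z \<omega> \<partial>M) = (\<integral>\<omega>. Z1 \<omega> + noise n \<omega> *\<^sub>R Z2 \<omega> \<partial>M)"
  proof (rule integral_cong_AE)
    show "AE \<omega> in M. (noise n \<omega>)\<^sup>2 *\<^sub>R Z \<omega> = Z1 \<omega> + noise n \<omega> *\<^sub>R Z2 \<omega>"
      using AE_steps
    proof eventually_elim
      case (elim \<omega>)
      have "(noise n \<omega> + m \<omega>)\<^sup>2 = (real_of_int (X (Suc n) \<omega>))\<^sup>2" by (simp add: noise_def m_def)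
      moreover have "X (Suc n) \<omega> = 1 \<or> X (Suc n) \<omega> = -1" using elim by simp
      ultimately have "(noise n \<omega>)\<^sup>2 = 1 - (m \<omega>)\<^sup>2 + noise n \<omega> * (- 2 * m \<omega>)"
        by (auto simp: power2_eq_square algebra_simps)
      then show ?case by (simp only: Z1_def Z2_def scaleR_add_left scaleR_scaleR)
    qed
    show "(\<lambda>\<omega>. (noise n \<omega>)\<^sup>2 *\<^sub>R Z \<omega>) \<in> borel_measurable M"
      by (rule adapted_borel[OF adapted_comp2[OF adapted_noise adapted_mono[OF Z]]]) simp
    show "(\<lambda>\<omega>. Z1 \<omega> + noise n \<omega> *\<^sub>R Z2 \<omega>) \<in> borel_measurable M"
      by (intro borel_measurable_add borel_measurable_scaleR adapted_borel[OF adapted_noise] adapted_borel[OF Z12(1)] adapted_borel[OF Z12(2)])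
  qed
  also have "\<dots> = (\<integral>\<omega>. Z1 \<omega> \<partial>M)"
  proof -
    have "integrable M (\<lambda>\<omega>. noise n \<omega> *\<^sub>R Z2 \<omega>)"
      by (rule adapted_integrable[OF adapted_comp2[OF adapted_noise adapted_mono[OF Z12(2)]]]) simp
    then show ?thesis using adapted_integrable[OF Z12(1)] noise_mean[OF n Z12(2)] by simp
  qed
  finally show ?thesis by (simp add: Z1_def m_def)
qed

lemma drift_le:
  assumes "\<forall>k\<ge>1. X k \<omega> = 1 \<or> X k \<omega> = -1"
  shows "(\<beta> * walk n \<omega> / real n)\<^sup>2 \<le> \<beta>\<^sup>2" "\<bar>\<beta> * walk n \<omega> / real n\<bar> \<le> 1"
proof -
  have "\<bar>walk n \<omega> / real n\<bar> \<le> 1"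
    using abs_walk_le[OF assms, of n] by (cases "n = 0") (auto simp: abs_div)
  then have w: "(walk n \<omega> / real n)\<^sup>2 \<le> 1" using abs_square_le_1 by blast
  have "(\<beta> * walk n \<omega> / real n)\<^sup>2 = \<beta>\<^sup>2 * (walk n \<omega> / real n)\<^sup>2" by (simp add: power_mult_distrib power_divide)
  also have "\<dots> \<le> \<beta>\<^sup>2 * 1" by (rule mult_left_mono[OF w]) simp
  finally show 1: "(\<beta> * walk n \<omega> / real n)\<^sup>2 \<le> \<beta>\<^sup>2" by simp
  with beta_bounds(3) have "(\<beta> * walk n \<omega> / real n)\<^sup>2 \<le> 1" by linarith
  then show "\<bar>\<beta> * walk n \<omega> / real n\<bar> \<le> 1" using abs_square_le_1 by blast
qed

lemma abs_noise_le:
  assumes "\<forall>k\<ge>1. X k \<omega> = 1 \<or> X k \<omega> = -1"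
  shows "\<bar>noise n \<omega>\<bar> \<le> 2"
  using drift_le(2)[OF assms, of n] assms[rule_format, of "Suc n"] unfolding noise_def by (auto simp: abs_if split: if_splits)

lemma abs_mart_2_le:
  assumes "\<forall>k\<ge>1. X k \<omega> = 1 \<or> X k \<omega> = -1"
  shows "\<bar>mart 2 \<omega>\<bar> \<le> 2"
  using abs_walk_le[OF assms, of 2] by (simp add: mart_def)

lemma integral_increment:
  fixes Z :: "'a \<Rightarrow> real"
  assumes n: "2 \<le> n" and Z: "adapted n Z"
  shows "(\<integral>\<omega>. Z \<omega> * (mart (Suc n) \<omega> - mart n \<omega>) \<partial>M) = 0"
proof -
  have "(\<integral>\<omega>. Z \<omega> * (mart (Suc n) \<omega> - mart n \<omega>) \<partial>M) = (\<integral>\<omega>. noise n \<omega> *\<^sub>R Z \<omega> / norming \<beta> (Suc n) \<partial>M)"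
    by (simp add: mart_Suc[OF n] mult.commute)
  then show ?thesis using noise_mean[OF _ Z] n by (simp del: real_scaleR_def)
qed

text \<open>
  The lower bound is uniform in the past because \<open>\<bar>S\<^sub>n\<bar> \<le> n\<close>; for \<open>\<bar>\<beta>\<bar> < 1\<close> it is positive and expresses that the noise
  never dies out.
\<close>

lemma integral_increment_square:
  fixes Z :: "'a \<Rightarrow> real"
  assumes n: "2 \<le> n" and Z: "adapted n Z" and pos: "\<And>\<omega>. 0 \<le> Z \<omega>"
  shows "(\<integral>\<omega>. Z \<omega> * (mart (Suc n) \<omega> - mart n \<omega>)\<^sup>2 \<partial>M) \<le> (\<integral>\<omega>. Z \<omega> \<partial>M) / (norming \<beta> (Suc n))\<^sup>2"
    and "(1 - \<beta>\<^sup>2) * (\<integral>\<omega>. Z \<omega> \<partial>M) / (norming \<beta> (Suc n))\<^sup>2 \<le> (\<integral>\<omega>. Z \<omega> * (mart (Suc n) \<omega> - mart n \<omega>)\<^sup>2 \<partial>M)"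
proof -
  have "(\<integral>\<omega>. Z \<omega> * (mart (Suc n) \<omega> - mart n \<omega>)\<^sup>2 \<partial>M) = (\<integral>\<omega>. (noise n \<omega>)\<^sup>2 *\<^sub>R Z \<omega> / (norming \<beta> (Suc n))\<^sup>2 \<partial>M)"
    by (simp add: mart_Suc[OF n] power_divide mult.commute)
  also have "\<dots> = (\<integral>\<omega>. (noise n \<omega>)\<^sup>2 *\<^sub>R Z \<omega> \<partial>M) / (norming \<beta> (Suc n))\<^sup>2" by simp
  also have "\<dots> = (\<integral>\<omega>. (1 - (\<beta> * walk n \<omega> / real n)\<^sup>2) * Z \<omega> \<partial>M) / (norming \<beta> (Suc n))\<^sup>2"
    using noise_square[OF _ Z] n by simp
  finally have eq: "(\<integral>\<omega>. Z \<omega> * (mart (Suc n) \<omega> - mart n \<omega>)\<^sup>2 \<partial>M)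
    = (\<integral>\<omega>. (1 - (\<beta> * walk n \<omega> / real n)\<^sup>2) * Z \<omega> \<partial>M) / (norming \<beta> (Suc n))\<^sup>2" .
  have int: "integrable M Z" "integrable M (\<lambda>\<omega>. (1 - (\<beta> * walk n \<omega> / real n)\<^sup>2) * Z \<omega>)"
    by (rule adapted_integrable[of n], rule Z)
      (rule adapted_integrable[of n], rule adapted_comp2[OF adapted_walk Z], simp)
  have "(\<integral>\<omega>. (1 - (\<beta> * walk n \<omega> / real n)\<^sup>2) * Z \<omega> \<partial>M) \<le> (\<integral>\<omega>. Z \<omega> \<partial>M)"
    using int by (intro integral_mono) (auto intro!: mult_left_le_one_le simp: pos mult_left_le_one_le algebra_simps)
  then show "(\<integral>\<omega>. Z \<omega> * (mart (Suc n) \<omega> - mart n \<omega>)\<^sup>2 \<partial>M) \<le> (\<integral>\<omega>. Z \<omega> \<partial>M) / (norming \<beta> (Suc n))\<^sup>2"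
    unfolding eq by (rule divide_right_mono) simp
  have "(\<integral>\<omega>. (1 - \<beta>\<^sup>2) * Z \<omega> \<partial>M) \<le> (\<integral>\<omega>. (1 - (\<beta> * walk n \<omega> / real n)\<^sup>2) * Z \<omega> \<partial>M)"
  proof (rule integral_mono_AE)
    show "AE \<omega> in M. (1 - \<beta>\<^sup>2) * Z \<omega> \<le> (1 - (\<beta> * walk n \<omega> / real n)\<^sup>2) * Z \<omega>"
      using AE_steps by eventually_elim (intro mult_right_mono diff_left_mono drift_le(1) pos)
  qed (use int in auto)
  then show "(1 - \<beta>\<^sup>2) * (\<integral>\<omega>. Z \<omega> \<partial>M) / (norming \<beta> (Suc n))\<^sup>2 \<le> (\<integral>\<omega>. Z \<omega> * (mart (Suc n) \<omega> - mart n \<omega>)\<^sup>2 \<partial>M)"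
    unfolding eq by (intro divide_right_mono) auto
qed

text \<open>
  Evaluated at the current displacement \<open>x\<close> of the martingale and the remaining clock \<open>w\<close>, this is a
  supermartingale (\<open>integral_quartic_Suc\<close>): it dominates \<open>x\<^sup>4\<close> and bounds the fourth moment at the end. The coefficients
  are chosen large enough to absorb the third and fourth moments of the bounded increments.
\<close>

definition quartic :: "real \<Rightarrow> real \<Rightarrow> real" where
  "quartic w x = x ^ 4 + 10 * x\<^sup>2 * w + 8 * w\<^sup>2"

text \<open>
  Taylor expansion in the increment \<open>D\<close>, where \<open>D\<^sup>2 \<le> 4d\<close> is used to trade the cubic and quartic terms for multiples
  of \<open>D\<^sup>2\<close>. The term linear in \<open>D\<close> has mean zero later on.
\<close>

lemma quartic_step_bound:
  fixes x D w d :: real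
  assumes "D\<^sup>2 \<le> 4 * d"
  shows "quartic (w - d) (x + D) \<le> x ^ 4 + 10 * x\<^sup>2 * (w - d) + 8 * (w - d)\<^sup>2
    + (4 * x ^ 3 + 20 * x * (w - d)) * D + (10 * x\<^sup>2 + 10 * w - 2 * d) * D\<^sup>2"
proof -
  (* By 4 x D <= 4 x^2 + D^2. *)
  have "4 * x * D \<le> 4 * x\<^sup>2 + 4 * d"
    using assms zero_le_power2[of "2 * x - D"] by (simp add: power2_eq_square algebra_simps)
  then have 1: "4 * x * D * D\<^sup>2 \<le> (4 * x\<^sup>2 + 4 * d) * D\<^sup>2" by (rule mult_right_mono) simp
  have 2: "D\<^sup>2 * D\<^sup>2 \<le> 4 * d * D\<^sup>2" using assms by (rule mult_right_mono) simp
  show ?thesis using 1 2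
    by (simp add: quartic_def power2_eq_square power3_eq_cube power4_eq_xxxx algebra_simps)
qed

lemma integral_quartic_Suc:
  fixes Z a :: "'a \<Rightarrow> real"
  assumes n: "2 \<le> n" and Z: "adapted n Z" and pos: "\<And>\<omega>. 0 \<le> Z \<omega>" and a: "adapted n a"
    and w: "1 / (norming \<beta> (Suc n))\<^sup>2 \<le> w"
  shows "(\<integral>\<omega>. Z \<omega> * quartic (w - 1 / (norming \<beta> (Suc n))\<^sup>2) (mart (Suc n) \<omega> - a \<omega>) \<partial>M)
    \<le> (\<integral>\<omega>. Z \<omega> * quartic w (mart n \<omega> - a \<omega>) \<partial>M)"
proof -
  define d where "d = 1 / (norming \<beta> (Suc n))\<^sup>2"
  define x where "x \<omega> = mart n \<omega> - a \<omega>" for \<omega>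
  define D where "D \<omega> = mart (Suc n) \<omega> - mart n \<omega>" for \<omega>
  have d: "0 < d" "d \<le> w" using w by (auto simp: d_def)
  have x: "adapted n x" unfolding x_def[abs_def] by (rule adapted_comp2[OF adapted_mart a]) simp
  have D: "adapted (Suc n) D" unfolding D_def[abs_def] by (rule adapted_comp2[OF adapted_mart adapted_mart]) auto
  define Z0 where "Z0 \<omega> = Z \<omega> * (x \<omega> ^ 4 + 10 * (x \<omega>)\<^sup>2 * (w - d) + 8 * (w - d)\<^sup>2)" for \<omega>
  define Z1 where "Z1 \<omega> = Z \<omega> * (4 * x \<omega> ^ 3 + 20 * x \<omega> * (w - d))" for \<omega>
  define Z2 where "Z2 \<omega> = Z \<omega> * (10 * (x \<omega>)\<^sup>2 + 10 * w - 2 * d)" for \<omega>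
  have Z012: "adapted n Z0" "adapted n Z1" "adapted n Z2"
    unfolding Z0_def[abs_def] Z1_def[abs_def] Z2_def[abs_def] by (rule adapted_comp2[OF Z x])+
  have Z2pos: "0 \<le> Z2 \<omega>" for \<omega>
    unfolding Z2_def
    by (rule mult_nonneg_nonneg[OF pos]) (use d zero_le_power2[of "x \<omega>"] in linarith)
  have int: "integrable M Z0" "integrable M Z2" "integrable M (\<lambda>\<omega>. Z1 \<omega> * D \<omega>)" "integrable M (\<lambda>\<omega>. Z2 \<omega> * (D \<omega>)\<^sup>2)"
    using Z012 by (auto intro: adapted_integrable adapted_integrable[OF adapted_comp2[OF adapted_mono[OF _ le_SucI] D]])
  have "(\<integral>\<omega>. Z \<omega> * quartic (w - d) (mart (Suc n) \<omega> - a \<omega>) \<partial>M) \<le> (\<integral>\<omega>. Z0 \<omega> + Z1 \<omega> * D \<omega> + Z2 \<omega> * (D \<omega>)\<^sup>2 \<partial>M)"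
  proof (rule integral_mono_AE)
    show "AE \<omega> in M. Z \<omega> * quartic (w - d) (mart (Suc n) \<omega> - a \<omega>) \<le> Z0 \<omega> + Z1 \<omega> * D \<omega> + Z2 \<omega> * (D \<omega>)\<^sup>2"
      using AE_steps
    proof eventually_elim
      case (elim \<omega>)
      have "(noise n \<omega>)\<^sup>2 \<le> 2\<^sup>2" using power_mono[OF abs_noise_le[OF elim, of n], of 2] by simp
      then have "(D \<omega>)\<^sup>2 \<le> 4 * d" unfolding D_def d_def mart_Suc[OF n]
        by (simp add: power_divide divide_right_mono)
      from mult_left_mono[OF quartic_step_bound[OF this, of w "x \<omega>"] pos[of \<omega>]]
      have "Z \<omega> * quartic (w - d) (x \<omega> + D \<omega>) \<le> Z0 \<omega> + Z1 \<omega> * D \<omega> + Z2 \<omega> * (D \<omega>)\<^sup>2"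
        by (simp only: Z0_def Z1_def Z2_def ring_distribs mult.assoc)
      moreover have "x \<omega> + D \<omega> = mart (Suc n) \<omega> - a \<omega>" by (simp add: x_def D_def)
      ultimately show ?case by simp
    qed
    have "adapted (Suc n) (\<lambda>\<omega>. mart (Suc n) \<omega> - a \<omega>)"
      by (rule adapted_comp2[OF adapted_mart adapted_mono[OF a]]) auto
    from adapted_comp2[OF adapted_mono[OF Z] this]
    show "integrable M (\<lambda>\<omega>. Z \<omega> * quartic (w - d) (mart (Suc n) \<omega> - a \<omega>))"
      by (intro adapted_integrable[of "Suc n"]) auto
  qed (use int in auto)
  also have "\<dots> = (\<integral>\<omega>. Z0 \<omega> \<partial>M) + (\<integral>\<omega>. Z2 \<omega> * (D \<omega>)\<^sup>2 \<partial>M)"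
    using int integral_increment[OF n Z012(2)] by (simp add: D_def)
  also have "\<dots> \<le> (\<integral>\<omega>. Z0 \<omega> \<partial>M) + d * (\<integral>\<omega>. Z2 \<omega> \<partial>M)"
    using integral_increment_square(1)[OF n Z012(3) Z2pos] by (simp add: D_def d_def)
  also have "\<dots> = (\<integral>\<omega>. Z0 \<omega> + d * Z2 \<omega> \<partial>M)" using int by simp
  also have "\<dots> \<le> (\<integral>\<omega>. Z \<omega> * quartic w (x \<omega>) \<partial>M)"
  proof (rule integral_mono)
    show "integrable M (\<lambda>\<omega>. Z \<omega> * quartic w (x \<omega>))"
      by (rule adapted_integrable[OF adapted_comp2[OF Z x]])
    fix \<omega>
    (* The condition d <= w says that the clock has not run out. *)
    have "x ^ 4 + 10 * x\<^sup>2 * (w - d) + 8 * (w - d)\<^sup>2 + d * (10 * x\<^sup>2 + 10 * w - 2 * d) = quartic w x - 6 * d * (w - d)" for x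
      by (simp add: quartic_def power2_eq_square algebra_simps)
    then have "x ^ 4 + 10 * x\<^sup>2 * (w - d) + 8 * (w - d)\<^sup>2 + d * (10 * x\<^sup>2 + 10 * w - 2 * d) \<le> quartic w x" for x
      using d by simp
    from mult_left_mono[OF this[of "x \<omega>"] pos[of \<omega>]]
    show "Z0 \<omega> + d * Z2 \<omega> \<le> Z \<omega> * quartic w (x \<omega>)"
      by (simp add: Z0_def Z2_def algebra_simps)
  qed (use int in auto)
  finally show ?thesis by (simp add: d_def x_def)
qed

text \<open>
  Ville's inequality for nonnegative supermartingales, by splitting off the event that the level has
  already been reached.
\<close>

lemma maximal_inequality:
  fixes Y :: "nat \<Rightarrow> 'a \<Rightarrow> real"
  assumes ad: "\<And>k. m \<le> k \<Longrightarrow> k \<le> n \<Longrightarrow> adapted k (Y k)"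
    and nonneg: "\<And>k \<omega>. m \<le> k \<Longrightarrow> k \<le> n \<Longrightarrow> 0 \<le> Y k \<omega>"
    and super: "\<And>k Z. m \<le> k \<Longrightarrow> k < n \<Longrightarrow> adapted k Z \<Longrightarrow> (\<And>\<omega>. 0 \<le> Z \<omega>) \<Longrightarrow>
      (\<integral>\<omega>. Z \<omega> * Y (Suc k) \<omega> \<partial>M) \<le> (\<integral>\<omega>. Z \<omega> * Y k \<omega> \<partial>M)"
    and "m \<le> n" "0 < c"
  shows "c * \<P>(\<omega> in M. \<exists>k\<in>{m..n}. c \<le> Y k \<omega>) \<le> (\<integral>\<omega>. Y m \<omega> \<partial>M)"
proof -
  define Q where "Q j \<omega> \<longleftrightarrow> (\<exists>k\<in>{m..j}. c \<le> Y k \<omega>)" for j \<omega>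
  have adQ: "adapted j (Q j)" if "j \<le> n" for j
    unfolding Q_def[abs_def]
    by (rule adapted_Bex, rule adapted_comp, rule adapted_mono[OF ad]) (use that in auto)
  have intQ: "integrable M (\<lambda>\<omega>. c * of_bool (Q j \<omega>))" if "j \<le> n" for j
    by (rule adapted_integrable[OF adapted_comp[OF adQ[OF that]]])
  have intY: "integrable M (\<lambda>\<omega>. of_bool (\<not> Q j \<omega>) * Y k \<omega>)" if "j \<le> n" "m \<le> k" "k \<le> n" for j k
    using that by (intro adapted_integrable[of n] adapted_comp2[OF adapted_mono[OF adQ] adapted_mono[OF ad]]) auto
  have PQ: "(\<integral>\<omega>. c * of_bool (Q j \<omega>) \<partial>M) = c * \<P>(\<omega> in M. Q j \<omega>)" if "j \<le> n" for j
    using integral_of_bool[OF adapted_event[OF adQ[OF that]]] by simp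
  have "c * \<P>(\<omega> in M. Q j \<omega>) + (\<integral>\<omega>. of_bool (\<not> Q j \<omega>) * Y j \<omega> \<partial>M) \<le> (\<integral>\<omega>. Y m \<omega> \<partial>M)"
    if "m \<le> j" "j \<le> n" for j
    using that
  proof (induction j rule: dec_induct)
    case base
    have "c * \<P>(\<omega> in M. Q m \<omega>) + (\<integral>\<omega>. of_bool (\<not> Q m \<omega>) * Y m \<omega> \<partial>M)
      = (\<integral>\<omega>. c * of_bool (Q m \<omega>) + of_bool (\<not> Q m \<omega>) * Y m \<omega> \<partial>M)"
      unfolding PQ[OF base, symmetric] using intQ[OF base] intY[of m m] base by simp
    also have "\<dots> \<le> (\<integral>\<omega>. Y m \<omega> \<partial>M)"
      using intQ[OF base] intY[of m m] base adapted_integrable[OF ad[of m]]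
      by (intro integral_mono) (auto simp: Q_def)
    finally show ?case .
  next
    case (step j)
    then have j: "j \<le> n" "Suc j \<le> n" "m \<le> j" by auto
    have "c * \<P>(\<omega> in M. Q (Suc j) \<omega>) + (\<integral>\<omega>. of_bool (\<not> Q (Suc j) \<omega>) * Y (Suc j) \<omega> \<partial>M)
      = (\<integral>\<omega>. c * of_bool (Q (Suc j) \<omega>) + of_bool (\<not> Q (Suc j) \<omega>) * Y (Suc j) \<omega> \<partial>M)"
      unfolding PQ[OF j(2), symmetric] using intQ[OF j(2)] intY[of "Suc j" "Suc j"] j by simp
    also have "\<dots> \<le> (\<integral>\<omega>. c * of_bool (Q j \<omega>) + of_bool (\<not> Q j \<omega>) * Y (Suc j) \<omega> \<partial>M)"
    proof (rule integral_mono)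
      fix \<omega>
      have "Q (Suc j) \<omega> \<longleftrightarrow> Q j \<omega> \<or> c \<le> Y (Suc j) \<omega>"
        using j unfolding Q_def by (auto simp: le_Suc_eq)
      then show "c * of_bool (Q (Suc j) \<omega>) + of_bool (\<not> Q (Suc j) \<omega>) * Y (Suc j) \<omega>
        \<le> c * of_bool (Q j \<omega>) + of_bool (\<not> Q j \<omega>) * Y (Suc j) \<omega>" by auto
    qed (use intQ[OF j(1)] intQ[OF j(2)] intY[of "Suc j" "Suc j"] intY[of j "Suc j"] j in auto)
    also have "\<dots> = c * \<P>(\<omega> in M. Q j \<omega>) + (\<integral>\<omega>. of_bool (\<not> Q j \<omega>) * Y (Suc j) \<omega> \<partial>M)"
      unfolding PQ[OF j(1), symmetric] using intQ[OF j(1)] intY[of j "Suc j"] j by simp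
    also have "\<dots> \<le> c * \<P>(\<omega> in M. Q j \<omega>) + (\<integral>\<omega>. of_bool (\<not> Q j \<omega>) * Y j \<omega> \<partial>M)"
      using j by (intro add_left_mono super adapted_comp[OF adQ]) auto
    also have "\<dots> \<le> (\<integral>\<omega>. Y m \<omega> \<partial>M)" using step.IH j by simp
    finally show ?case .
  qed
  from this[OF \<open>m \<le> n\<close> order_refl]
  have "c * \<P>(\<omega> in M. Q n \<omega>) + (\<integral>\<omega>. of_bool (\<not> Q n \<omega>) * Y n \<omega> \<partial>M) \<le> (\<integral>\<omega>. Y m \<omega> \<partial>M)" .
  moreover have "0 \<le> (\<integral>\<omega>. of_bool (\<not> Q n \<omega>) * Y n \<omega> \<partial>M)"
    using nonneg \<open>m \<le> n\<close> by (intro Bochner_Integration.integral_nonneg) auto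
  ultimately show ?thesis by (simp add: Q_def)
qed

lemma quartic_nonneg: "0 \<le> w \<Longrightarrow> 0 \<le> quartic w x"
  by (simp add: quartic_def)

lemma quartic_clock_super:
  fixes a :: "'a \<Rightarrow> real"
  assumes "2 \<le> m" "m \<le> k" "k < n" "adapted m a" "adapted k Z" "\<And>\<omega>. 0 \<le> Z \<omega>"
  shows "(\<integral>\<omega>. Z \<omega> * quartic (clock \<beta> n - clock \<beta> (Suc k)) (mart (Suc k) \<omega> - a \<omega>) \<partial>M)
    \<le> (\<integral>\<omega>. Z \<omega> * quartic (clock \<beta> n - clock \<beta> k) (mart k \<omega> - a \<omega>) \<partial>M)"
proof -
  have k: "2 \<le> k" using assms by simp
  have "1 / (norming \<beta> (Suc k))\<^sup>2 \<le> clock \<beta> n - clock \<beta> k"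
    using clock_mono[of "Suc k" n \<beta>] assms(3) by (simp add: clock_Suc[OF k])
  from integral_quartic_Suc[OF k assms(5,6) adapted_mono[OF assms(4,2)] this]
  show ?thesis by (simp add: clock_Suc[OF k] diff_diff_add)
qed

text \<open>
  The reference point \<open>a\<close> is either the value of the martingale at time \<open>m\<close> or zero.
\<close>

lemma quartic_maximal:
  fixes a :: "'a \<Rightarrow> real"
  assumes m: "2 \<le> m" "m \<le> n" and c: "0 < c" and a: "adapted m a"
  shows "\<P>(\<omega> in M. \<exists>k\<in>{m..n}. c \<le> \<bar>mart k \<omega> - a \<omega>\<bar>)
    \<le> (\<integral>\<omega>. quartic (clock \<beta> n - clock \<beta> m) (mart m \<omega> - a \<omega>) \<partial>M) / c ^ 4"
proof -
  define Y where "Y k \<omega> = quartic (clock \<beta> n - clock \<beta> k) (mart k \<omega> - a \<omega>)" for k \<omega>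
  have adY: "adapted k (Y k)" if "m \<le> k" for k
    unfolding Y_def[abs_def]
    by (rule adapted_comp, rule adapted_comp2[OF adapted_mart adapted_mono[OF a that]]) simp
  have "c ^ 4 * \<P>(\<omega> in M. \<exists>k\<in>{m..n}. c ^ 4 \<le> Y k \<omega>) \<le> (\<integral>\<omega>. Y m \<omega> \<partial>M)"
    using m c
  proof (intro maximal_inequality adY)
    fix k \<omega> assume "m \<le> k" "k \<le> n"
    then show "0 \<le> Y k \<omega>" unfolding Y_def by (intro quartic_nonneg) (simp add: clock_mono)
  qed (auto simp: Y_def intro: quartic_clock_super[OF m(1) _ _ a])
  moreover have "\<P>(\<omega> in M. \<exists>k\<in>{m..n}. c \<le> \<bar>mart k \<omega> - a \<omega>\<bar>) \<le> \<P>(\<omega> in M. \<exists>k\<in>{m..n}. c ^ 4 \<le> Y k \<omega>)"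
  proof (rule finite_measure_mono)
    show "{\<omega> \<in> space M. \<exists>k\<in>{m..n}. c ^ 4 \<le> Y k \<omega>} \<in> events"
      by (rule adapted_event[of n], rule adapted_Bex, rule adapted_comp) (auto intro: adapted_mono[OF adY])
    show "{\<omega> \<in> space M. \<exists>k\<in>{m..n}. c \<le> \<bar>mart k \<omega> - a \<omega>\<bar>} \<subseteq> {\<omega> \<in> space M. \<exists>k\<in>{m..n}. c ^ 4 \<le> Y k \<omega>}"
    proof safe
      fix \<omega> k assume k: "k \<in> {m..n}" "c \<le> \<bar>mart k \<omega> - a \<omega>\<bar>"
      have "c ^ 4 \<le> \<bar>mart k \<omega> - a \<omega>\<bar> ^ 4" using k c by (intro power_mono) auto
      also have "\<dots> = (mart k \<omega> - a \<omega>) ^ 4" by (simp add: power_even_abs)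
      also have "\<dots> \<le> Y k \<omega>" using k clock_mono[of k n \<beta>] by (simp add: Y_def quartic_def)
      finally show "\<exists>k\<in>{m..n}. c ^ 4 \<le> Y k \<omega>" using k by blast
    qed
  qed
  ultimately have "c ^ 4 * \<P>(\<omega> in M. \<exists>k\<in>{m..n}. c \<le> \<bar>mart k \<omega> - a \<omega>\<bar>) \<le> (\<integral>\<omega>. Y m \<omega> \<partial>M)"
    using c by (meson mult_left_mono order_trans zero_le_power less_imp_le)
  then show ?thesis using c by (simp add: Y_def pos_le_divide_eq mult.commute)
qed

lemma mart_increment_maximal:
  assumes "2 \<le> m" "m \<le> n" "0 < c"
  shows "\<P>(\<omega> in M. \<exists>k\<in>{m..n}. c \<le> \<bar>mart k \<omega> - mart m \<omega>\<bar>) \<le> 8 * (clock \<beta> n - clock \<beta> m)\<^sup>2 / c ^ 4"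
  using quartic_maximal[OF assms adapted_mart[OF order_refl]] by (simp add: quartic_def prob_space)

lemma mart_maximal:
  assumes "2 \<le> n" "0 < c"
  shows "\<P>(\<omega> in M. \<exists>k\<in>{2..n}. c \<le> \<bar>mart k \<omega>\<bar>) \<le> 8 * (clock \<beta> n + 3)\<^sup>2 / c ^ 4"
proof -
  have "\<P>(\<omega> in M. \<exists>k\<in>{2..n}. c \<le> \<bar>mart k \<omega>\<bar>) \<le> (\<integral>\<omega>. quartic (clock \<beta> n) (mart 2 \<omega>) \<partial>M) / c ^ 4"
    using quartic_maximal[OF order_refl assms adapted_const, of 0] by simp
  also have "(\<integral>\<omega>. quartic (clock \<beta> n) (mart 2 \<omega>) \<partial>M) \<le> (\<integral>\<omega>. 8 * (clock \<beta> n + 3)\<^sup>2 \<partial>M)"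
  proof (rule integral_mono_AE)
    show "integrable M (\<lambda>\<omega>. quartic (clock \<beta> n) (mart 2 \<omega>))"
      by (rule adapted_integrable[OF adapted_comp[OF adapted_mart[OF order_refl]]])
    show "AE \<omega> in M. quartic (clock \<beta> n) (mart 2 \<omega>) \<le> 8 * (clock \<beta> n + 3)\<^sup>2"
      using AE_steps
    proof eventually_elim
      case (elim \<omega>)
      have 1: "(mart 2 \<omega>)\<^sup>2 \<le> 4" using power_mono[OF abs_mart_2_le[OF elim], of 2] by simp
      have 2: "(mart 2 \<omega>) ^ 4 \<le> 16" using power_mono[OF abs_mart_2_le[OF elim], of 4] by (simp add: power_even_abs)
      have "(mart 2 \<omega>)\<^sup>2 * clock \<beta> n \<le> 4 * clock \<beta> n" by (rule mult_right_mono[OF 1 clock_nonneg])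
      then show ?case using 2 clock_nonneg[of \<beta> n] by (simp add: quartic_def power2_eq_square algebra_simps)
    qed
  qed auto
  finally show ?thesis using assms by (simp add: prob_space divide_right_mono)
qed

text \<open>
  The weight \<open>Z\<close> allows conditioning on the past: below it carries the normalisation by the conditional
  second moment.
\<close>

lemma integral_mart_power4_le:
  assumes m: "2 \<le> m" "m \<le> n" and Z: "adapted m Z" "\<And>\<omega>. 0 \<le> Z \<omega>"
  shows "(\<integral>\<omega>. Z \<omega> * mart n \<omega> ^ 4 \<partial>M) \<le> (\<integral>\<omega>. Z \<omega> * quartic (clock \<beta> n - clock \<beta> m) (mart m \<omega>) \<partial>M)"
proof -
  have "(\<integral>\<omega>. Z \<omega> * quartic (clock \<beta> n - clock \<beta> k) (mart k \<omega>) \<partial>M)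
    \<le> (\<integral>\<omega>. Z \<omega> * quartic (clock \<beta> n - clock \<beta> m) (mart m \<omega>) \<partial>M)" if "m \<le> k" "k \<le> n" for k
    using that
  proof (induction k rule: dec_induct)
    case (step k)
    then show ?case using quartic_clock_super[OF m(1), of k n "\<lambda>\<omega>. 0" Z] adapted_mono[OF Z(1), of k] Z(2)
      by fastforce
  qed simp
  from this[of n] m show ?thesis by (simp add: quartic_def)
qed

lemma integral_mart_square:
  fixes Z :: "'a \<Rightarrow> real"
  assumes m: "2 \<le> m" "m \<le> n" and Z: "adapted m Z" "\<And>\<omega>. 0 \<le> Z \<omega>"
  shows "(\<integral>\<omega>. Z \<omega> * (mart n \<omega>)\<^sup>2 \<partial>M) \<le> (\<integral>\<omega>. Z \<omega> * (mart m \<omega>)\<^sup>2 \<partial>M) + (clock \<beta> n - clock \<beta> m) * (\<integral>\<omega>. Z \<omega> \<partial>M)"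
    and "(\<integral>\<omega>. Z \<omega> * (mart m \<omega>)\<^sup>2 \<partial>M) + (1 - \<beta>\<^sup>2) * (clock \<beta> n - clock \<beta> m) * (\<integral>\<omega>. Z \<omega> \<partial>M) \<le> (\<integral>\<omega>. Z \<omega> * (mart n \<omega>)\<^sup>2 \<partial>M)"
proof -
  have "(\<integral>\<omega>. Z \<omega> * (mart n \<omega>)\<^sup>2 \<partial>M) \<le> (\<integral>\<omega>. Z \<omega> * (mart m \<omega>)\<^sup>2 \<partial>M) + (clock \<beta> n - clock \<beta> m) * (\<integral>\<omega>. Z \<omega> \<partial>M)
    \<and> (\<integral>\<omega>. Z \<omega> * (mart m \<omega>)\<^sup>2 \<partial>M) + (1 - \<beta>\<^sup>2) * (clock \<beta> n - clock \<beta> m) * (\<integral>\<omega>. Z \<omega> \<partial>M) \<le> (\<integral>\<omega>. Z \<omega> * (mart n \<omega>)\<^sup>2 \<partial>M)"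
    using m(2)
  proof (induction n rule: dec_induct)
    case (step n)
    then have n: "2 \<le> n" using m by simp
    have Zn: "adapted n Z" using adapted_mono[OF Z(1)] step by simp
    define D where "D \<omega> = mart (Suc n) \<omega> - mart n \<omega>" for \<omega>
    have Dad: "adapted (Suc n) D" unfolding D_def[abs_def] by (rule adapted_comp2[OF adapted_mart adapted_mart]) auto
    have ZM: "adapted n (\<lambda>\<omega>. Z \<omega> * mart n \<omega>)" by (rule adapted_comp2[OF Zn adapted_mart]) simp
    have int: "integrable M (\<lambda>\<omega>. Z \<omega> * (mart n \<omega>)\<^sup>2)" "integrable M (\<lambda>\<omega>. Z \<omega> * mart n \<omega> * D \<omega>)" "integrable M (\<lambda>\<omega>. Z \<omega> * (D \<omega>)\<^sup>2)"
      by (rule adapted_integrable[OF adapted_comp2[OF Zn adapted_mart[OF order_refl]]]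
          adapted_integrable[OF adapted_comp2[OF adapted_mono[OF ZM] Dad]]
          adapted_integrable[OF adapted_comp2[OF adapted_mono[OF Zn] Dad]] | simp)+
    have "(\<integral>\<omega>. Z \<omega> * (mart (Suc n) \<omega>)\<^sup>2 \<partial>M) = (\<integral>\<omega>. Z \<omega> * (mart n \<omega>)\<^sup>2 + 2 * (Z \<omega> * mart n \<omega> * D \<omega>) + Z \<omega> * (D \<omega>)\<^sup>2 \<partial>M)"
      by (rule Bochner_Integration.integral_cong) (auto simp: D_def power2_eq_square algebra_simps)
    also have "\<dots> = (\<integral>\<omega>. Z \<omega> * (mart n \<omega>)\<^sup>2 \<partial>M) + (\<integral>\<omega>. Z \<omega> * (D \<omega>)\<^sup>2 \<partial>M)"
      using int integral_increment[OF n ZM] by (simp add: D_def)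
    finally have eq: "(\<integral>\<omega>. Z \<omega> * (mart (Suc n) \<omega>)\<^sup>2 \<partial>M) = (\<integral>\<omega>. Z \<omega> * (mart n \<omega>)\<^sup>2 \<partial>M) + (\<integral>\<omega>. Z \<omega> * (D \<omega>)\<^sup>2 \<partial>M)" .
    show ?case
      unfolding eq using step.IH integral_increment_square[OF n Zn Z(2)]
      by (simp add: clock_Suc[OF n] D_def field_simps)
  qed auto
  then show "(\<integral>\<omega>. Z \<omega> * (mart n \<omega>)\<^sup>2 \<partial>M) \<le> (\<integral>\<omega>. Z \<omega> * (mart m \<omega>)\<^sup>2 \<partial>M) + (clock \<beta> n - clock \<beta> m) * (\<integral>\<omega>. Z \<omega> \<partial>M)"
    and "(\<integral>\<omega>. Z \<omega> * (mart m \<omega>)\<^sup>2 \<partial>M) + (1 - \<beta>\<^sup>2) * (clock \<beta> n - clock \<beta> m) * (\<integral>\<omega>. Z \<omega> \<partial>M) \<le> (\<integral>\<omega>. Z \<omega> * (mart n \<omega>)\<^sup>2 \<partial>M)"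
    by auto
qed

lemma integral_walk_square_le:
  assumes "2 \<le> n"
  shows "(\<integral>\<omega>. (walk n \<omega>)\<^sup>2 \<partial>M) \<le> (norming \<beta> n)\<^sup>2 * (clock \<beta> n + 4)"
proof -
  have "(\<integral>\<omega>. (walk n \<omega>)\<^sup>2 \<partial>M) = (\<integral>\<omega>. (norming \<beta> n)\<^sup>2 * (mart n \<omega>)\<^sup>2 \<partial>M)"
    by (simp add: mart_def power_divide)
  also have "\<dots> = (norming \<beta> n)\<^sup>2 * (\<integral>\<omega>. (mart n \<omega>)\<^sup>2 \<partial>M)" by simp
  also have "\<dots> \<le> (norming \<beta> n)\<^sup>2 * (clock \<beta> n + 4)"
  proof (rule mult_left_mono)
    have "(\<integral>\<omega>. (mart 2 \<omega>)\<^sup>2 \<partial>M) \<le> (\<integral>\<omega>. 4 \<partial>M)"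
    proof (rule integral_mono_AE)
      show "AE \<omega> in M. (mart 2 \<omega>)\<^sup>2 \<le> 4"
        using AE_steps by eventually_elim (use power_mono[OF abs_mart_2_le, of _ 2] in simp)
      show "integrable M (\<lambda>\<omega>. (mart 2 \<omega>)\<^sup>2)"
        by (rule adapted_integrable[OF adapted_comp[OF adapted_mart[OF order_refl]]])
    qed auto
    then show "(\<integral>\<omega>. (mart n \<omega>)\<^sup>2 \<partial>M) \<le> clock \<beta> n + 4"
      using integral_mart_square(1)[OF order_refl assms adapted_const, of 1] by (simp add: prob_space)
  qed simp
  finally show ?thesis .
qed

text \<open>
  For \<open>\<beta> \<le> 0\<close> the drift points to the origin and \<open>S\<^sub>k\<^sup>2 - k\<close> is a supermartingale. The martingale
  \<open>M\<close> is of no use for the early part of the path, as \<open>b\<^sub>n\<close> decreases.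
\<close>

lemma walk_maximal_repelled:
  assumes "\<beta> \<le> 0" "2 \<le> n" "0 < c"
  shows "\<P>(\<omega> in M. \<exists>k\<in>{2..n}. c \<le> \<bar>walk k \<omega>\<bar>) \<le> 2 * real n / c\<^sup>2"
proof -
  define Y where "Y k \<omega> = (walk k \<omega>)\<^sup>2 + (real n - real k)" for k \<omega>
  have adY: "adapted k (Y k)" for k
    unfolding Y_def[abs_def] by (rule adapted_comp[OF adapted_walk[OF order_refl]])
  have "c\<^sup>2 * \<P>(\<omega> in M. \<exists>k\<in>{2..n}. c\<^sup>2 \<le> Y k \<omega>) \<le> (\<integral>\<omega>. Y 2 \<omega> \<partial>M)"
  proof (rule maximal_inequality[OF adY])
    fix k and Z :: "'a \<Rightarrow> real"
    assume k: "2 \<le> k" and Z: "adapted k Z" "\<And>\<omega>. 0 \<le> Z \<omega>"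
    have k1: "1 \<le> k" using k by simp
    have ZS: "adapted k (\<lambda>\<omega>. Z \<omega> * walk k \<omega>)" by (rule adapted_comp2[OF Z(1) adapted_walk]) simp
    have int: "integrable M (\<lambda>\<omega>. Z \<omega> * Y k \<omega>)" "integrable M (\<lambda>\<omega>. real_of_int (X (Suc k) \<omega>) *\<^sub>R (Z \<omega> * walk k \<omega>))"
      by (rule adapted_integrable[OF adapted_comp2[OF Z(1) adY]])
        (rule adapted_integrable[of "Suc k"], rule adapted_comp2[OF adapted_comp[OF adapted_X] adapted_mono[OF ZS]], auto)
    have "(\<integral>\<omega>. Z \<omega> * Y (Suc k) \<omega> \<partial>M) = (\<integral>\<omega>. Z \<omega> * Y k \<omega> + 2 * (real_of_int (X (Suc k) \<omega>) *\<^sub>R (Z \<omega> * walk k \<omega>)) \<partial>M)"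
    proof (rule integral_cong_AE)
      show "AE \<omega> in M. Z \<omega> * Y (Suc k) \<omega> = Z \<omega> * Y k \<omega> + 2 * (real_of_int (X (Suc k) \<omega>) *\<^sub>R (Z \<omega> * walk k \<omega>))"
        using AE_steps
      proof eventually_elim
        case (elim \<omega>)
        then have "X (Suc k) \<omega> = 1 \<or> X (Suc k) \<omega> = -1" by simp
        then show ?case by (auto simp: Y_def walk_Suc power2_eq_square algebra_simps)
      qed
      show "(\<lambda>\<omega>. Z \<omega> * Y (Suc k) \<omega>) \<in> borel_measurable M"
        by (rule adapted_borel[OF adapted_comp2[OF adapted_mono[OF Z(1)] adY]]) simp
    qed (use int in auto)
    also have "\<dots> = (\<integral>\<omega>. Z \<omega> * Y k \<omega> \<partial>M) + 2 * ((\<beta> / real k) * (\<integral>\<omega>. walk k \<omega> * (Z \<omega> * walk k \<omega>) \<partial>M))"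
      using int integral_next_step[OF k1 ZS] by (simp only: Bochner_Integration.integral_add integrable_mult_right integral_mult_right_zero real_scaleR_def)
    also have "\<dots> \<le> (\<integral>\<omega>. Z \<omega> * Y k \<omega> \<partial>M)"
    proof -
      have "0 \<le> (\<integral>\<omega>. walk k \<omega> * (Z \<omega> * walk k \<omega>) \<partial>M)"
      proof (rule Bochner_Integration.integral_nonneg)
        fix \<omega>
        have "walk k \<omega> * (Z \<omega> * walk k \<omega>) = Z \<omega> * (walk k \<omega>)\<^sup>2" by (simp add: power2_eq_square)
        also have "0 \<le> \<dots>" by (rule mult_nonneg_nonneg[OF Z(2)]) simp
        finally show "0 \<le> walk k \<omega> * (Z \<omega> * walk k \<omega>)" .
      qed
      then have "(\<beta> / real k) * (\<integral>\<omega>. walk k \<omega> * (Z \<omega> * walk k \<omega>) \<partial>M) \<le> 0"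
        using assms by (intro mult_nonpos_nonneg divide_nonpos_nonneg) auto
      then show ?thesis by linarith
    qed
    finally show "(\<integral>\<omega>. Z \<omega> * Y (Suc k) \<omega> \<partial>M) \<le> (\<integral>\<omega>. Z \<omega> * Y k \<omega> \<partial>M)" .
  qed (use assms in \<open>auto simp: Y_def\<close>)
  also have "(\<integral>\<omega>. Y 2 \<omega> \<partial>M) \<le> (\<integral>\<omega>. real n + 2 \<partial>M)"
  proof (rule integral_mono_AE)
    show "AE \<omega> in M. Y 2 \<omega> \<le> real n + 2"
      using AE_steps by eventually_elim (use power_mono[OF abs_walk_le, of _ 2 2] in \<open>simp add: Y_def\<close>)
  qed (auto intro: adapted_integrable[OF adY])
  finally have "c\<^sup>2 * \<P>(\<omega> in M. \<exists>k\<in>{2..n}. c\<^sup>2 \<le> Y k \<omega>) \<le> 2 * real n" using assms by (simp add: prob_space)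
  moreover have "\<P>(\<omega> in M. \<exists>k\<in>{2..n}. c \<le> \<bar>walk k \<omega>\<bar>) \<le> \<P>(\<omega> in M. \<exists>k\<in>{2..n}. c\<^sup>2 \<le> Y k \<omega>)"
  proof (rule finite_measure_mono)
    show "{\<omega> \<in> space M. \<exists>k\<in>{2..n}. c\<^sup>2 \<le> Y k \<omega>} \<in> events"
      by (rule adapted_event[of n], rule adapted_Bex, rule adapted_comp) (auto intro: adapted_mono[OF adY])
    show "{\<omega> \<in> space M. \<exists>k\<in>{2..n}. c \<le> \<bar>walk k \<omega>\<bar>} \<subseteq> {\<omega> \<in> space M. \<exists>k\<in>{2..n}. c\<^sup>2 \<le> Y k \<omega>}"
    proof safe
      fix \<omega> k assume k: "k \<in> {2..n}" "c \<le> \<bar>walk k \<omega>\<bar>"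
      have "c\<^sup>2 \<le> \<bar>walk k \<omega>\<bar>\<^sup>2" using k assms by (intro power_mono) auto
      also have "\<dots> \<le> Y k \<omega>" using k by (simp add: Y_def)
      finally show "\<exists>k\<in>{2..n}. c\<^sup>2 \<le> Y k \<omega>" using k by blast
    qed
  qed
  ultimately have "c\<^sup>2 * \<P>(\<omega> in M. \<exists>k\<in>{2..n}. c \<le> \<bar>walk k \<omega>\<bar>) \<le> 2 * real n"
    by (meson mult_left_mono order_trans zero_le_power2)
  then show ?thesis using assms by (simp add: pos_le_divide_eq mult.commute)
qed

text \<open>
  For \<open>\<beta> > 0\<close> the factor \<open>b\<^sub>k\<close> increases, so a maximal inequality for \<open>M\<close> controls the walk down to the
  start.
\<close>

lemma walk_maximal_diffusive:
  assumes "\<beta> < 1 / 2"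
  obtains C where "0 < C" "\<And>n c. 2 \<le> n \<Longrightarrow> 0 < c \<Longrightarrow>
    \<P>(\<omega> in M. \<exists>k\<in>{2..n}. c \<le> \<bar>walk k \<omega>\<bar>) \<le> C * real n / c\<^sup>2"
proof (cases "\<beta> \<le> 0")
  case True
  then show ?thesis using that[of 2] walk_maximal_repelled by simp
next
  case False
  have "(\<lambda>n. (norming \<beta> n)\<^sup>2 * clock \<beta> n / real n + 3 * ((norming \<beta> n / real n powr \<beta>)\<^sup>2 * real n powr (2 * \<beta> - 1)))
    \<longlonglongrightarrow> 1 / (1 - 2 * \<beta>) + 3 * ((rGamma (2 + \<beta>))\<^sup>2 * 0)"
  proof (intro tendsto_add[OF norming_clock_asymp] tendsto_mult tendsto_const tendsto_power norming_asymp beta_bounds assms)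
    have "2 * \<beta> - 1 < 0" using assms by simp
    then show "(\<lambda>n. real n powr (2 * \<beta> - 1)) \<longlonglongrightarrow> 0" by real_asymp
  qed
  then have "Bseq (\<lambda>n. (norming \<beta> n)\<^sup>2 * clock \<beta> n / real n + 3 * ((norming \<beta> n / real n powr \<beta>)\<^sup>2 * real n powr (2 * \<beta> - 1)))"
    by (intro convergent_imp_Bseq convergentI)
  then obtain C where C: "0 < C" and Cb: "\<And>n. norm ((norming \<beta> n)\<^sup>2 * clock \<beta> n / real n + 3 * ((norming \<beta> n / real n powr \<beta>)\<^sup>2 * real n powr (2 * \<beta> - 1))) \<le> C"
    unfolding Bseq_def by auto
  show ?thesis
  proof (rule that[of "3 * C"])
    fix n :: nat and c :: real assume n: "2 \<le> n" and c: "0 < c"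
    have "(norming \<beta> n / real n powr \<beta>)\<^sup>2 * real n powr (2 * \<beta> - 1) = (norming \<beta> n)\<^sup>2 / real n"
    proof -
      have "(real n powr \<beta>)\<^sup>2 = real n powr (2 * \<beta>)" using n by (simp add: powr_power mult.commute)
      moreover have "real n powr (2 * \<beta> - 1) = real n powr (2 * \<beta>) / real n" using n by (subst powr_diff) simp
      moreover have "real n powr (2 * \<beta>) \<noteq> 0" using n by simp
      ultimately show ?thesis by (simp only: power_divide) simp
    qed
    with Cb[of n] have "(norming \<beta> n)\<^sup>2 * clock \<beta> n / real n + 3 * ((norming \<beta> n)\<^sup>2 / real n) \<le> C" by simp
    moreover have "(norming \<beta> n)\<^sup>2 * clock \<beta> n / real n + 3 * ((norming \<beta> n)\<^sup>2 / real n) = (norming \<beta> n)\<^sup>2 * (clock \<beta> n + 3) / real n"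
      by (simp add: algebra_simps add_divide_distrib)
    ultimately have bn: "(norming \<beta> n)\<^sup>2 * (clock \<beta> n + 3) \<le> C * real n"
      using n by (simp add: pos_divide_le_eq)
    have mono: "norming \<beta> k \<le> norming \<beta> n" if "k \<in> {2..n}" for k
    proof -
      have "norming \<beta> k \<le> norming \<beta> j" if "k \<le> j" "2 \<le> k" for j
        using that
      proof (induction j rule: dec_induct)
        case (step j)
        have "norming \<beta> j * 1 \<le> norming \<beta> (Suc j)"
          unfolding norming_Suc[OF order_trans[OF step.prems step.hyps(1)]]
          using False by (intro mult_left_mono less_imp_le[OF norming_beta_pos]) auto
        with step show ?case by simp
      qed simp
      with \<open>k \<in> {2..n}\<close> show ?thesis by auto
    qed
    define P where "P = \<P>(\<omega> in M. \<exists>k\<in>{2..n}. c \<le> \<bar>walk k \<omega>\<bar>)"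
    define b where "b = norming \<beta> n"
    have b: "0 < b" by (simp add: b_def)
    have "P \<le> \<P>(\<omega> in M. \<exists>k\<in>{2..n}. c / b \<le> \<bar>mart k \<omega>\<bar>)"
      unfolding P_def
    proof (rule finite_measure_mono)
      show "{\<omega> \<in> space M. \<exists>k\<in>{2..n}. c / b \<le> \<bar>mart k \<omega>\<bar>} \<in> events"
        by (rule adapted_event[of n], rule adapted_Bex, rule adapted_comp) (auto intro: adapted_mart)
      show "{\<omega> \<in> space M. \<exists>k\<in>{2..n}. c \<le> \<bar>walk k \<omega>\<bar>} \<subseteq> {\<omega> \<in> space M. \<exists>k\<in>{2..n}. c / b \<le> \<bar>mart k \<omega>\<bar>}"
      proof safe
        fix \<omega> k assume k: "k \<in> {2..n}" "c \<le> \<bar>walk k \<omega>\<bar>"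
        have "c / b \<le> c / norming \<beta> k" using mono[OF k(1)] c by (intro divide_left_mono) (auto simp: b_def)
        also have "\<dots> \<le> \<bar>walk k \<omega>\<bar> / norming \<beta> k" using k by (intro divide_right_mono) (auto simp: less_imp_le)
        also have "\<dots> = \<bar>mart k \<omega>\<bar>" by (simp add: mart_def abs_div abs_of_pos)
        finally show "\<exists>k\<in>{2..n}. c / b \<le> \<bar>mart k \<omega>\<bar>" using k by blast
      qed
    qed
    also have "\<dots> \<le> 8 * (clock \<beta> n + 3)\<^sup>2 / (c / b) ^ 4" using b c by (intro mart_maximal n) auto
    also have "\<dots> = 8 * (b\<^sup>2 * (clock \<beta> n + 3) / c\<^sup>2)\<^sup>2"
    proof -
      have "8 * v\<^sup>2 / (c / b) ^ 4 = 8 * (b\<^sup>2 * v / c\<^sup>2)\<^sup>2" for v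
        using b c by (simp add: power_divide power_mult_distrib flip: power_mult)
      then show ?thesis .
    qed
    finally have P1: "P \<le> 8 * (b\<^sup>2 * (clock \<beta> n + 3) / c\<^sup>2)\<^sup>2" .
    define t where "t = C * real n / c\<^sup>2"
    have t: "0 \<le> t" "b\<^sup>2 * (clock \<beta> n + 3) / c\<^sup>2 \<le> t" "0 \<le> b\<^sup>2 * (clock \<beta> n + 3) / c\<^sup>2"
      using bn C c clock_nonneg[of \<beta> n] by (auto simp: t_def b_def divide_right_mono)
    (* The bound of degree four is weakened to a linear one: min 1 (8 t^2) <= 3 t. *)
    have P2: "P \<le> 1" by (simp add: P_def)
    have "P \<le> 3 * t"
    proof (cases "1 / 3 \<le> t")
      case False
      have "P \<le> 8 * t\<^sup>2" using P1 power_mono[OF t(2,3), of 2] by simp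
      also have "\<dots> \<le> 8 * (1 / 3 * t)" using False t(1) unfolding power2_eq_square by (intro mult_left_mono mult_right_mono) auto
      finally show ?thesis using t by simp
    qed (use P2 in simp)
    then show "\<P>(\<omega> in M. \<exists>k\<in>{2..n}. c \<le> \<bar>walk k \<omega>\<bar>) \<le> 3 * C * real n / c\<^sup>2"
      by (simp add: P_def t_def)
  qed (use C in simp)
qed

end

section \<open>The law of the history and characteristic functions of increments\<close>

context elephant_random_walk
begin

lemma history_Suc: "history (Suc n) \<omega> = history n \<omega> @ [X (Suc n) \<omega>]"
  by (simp add: history_def)

lemma walk_eq_sum_list: "walk n \<omega> = real_of_int (sum_list (history n \<omega>))"
proof -
  have "sum_list (history n \<omega>) = (\<Sum>j\<in>{1..n}. X j \<omega>)"
    unfolding history_def by (subst sum_list_distinct_conv_sum_set) (auto intro!: sum.cong)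
  then show ?thesis by (simp add: walk_def lifted_walk_def)
qed

lemma history_prob_1:
  "\<P>(\<omega> in M. history 1 \<omega> = [x]) = (if x \<in> {1, -1} then 1 / 2 else 0)"
proof -
  have "\<P>(\<omega> in M. history 1 \<omega> = [x]) = measure (distr M (count_space UNIV) (X 1)) {x}"
    using first_measurable by (subst measure_distr) (auto simp: history_def vimage_def Int_def intro!: arg_cong[where f = prob])
  also have "\<dots> = pmf (pmf_of_set {1, -1}) x" unfolding first_step by (simp add: measure_pmf_single)
  also have "\<dots> = (if x \<in> {1, -1} then 1 / 2 else 0)" by simp
  finally show ?thesis .
qed

lemma history_prob_Suc:
  assumes n: "1 \<le> n"
  shows "\<P>(\<omega> in M. history (Suc n) \<omega> = h @ [x])
    = (if x \<in> {1, -1} then (1 + real_of_int x * (\<beta> / real n) * real_of_int (sum_list h)) / 2 else 0)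
      * \<P>(\<omega> in M. history n \<omega> = h)"
proof -
  define Z :: "'a \<Rightarrow> real" where "Z \<omega> = of_bool (history n \<omega> = h)" for \<omega>
  have Z: "adapted n Z" unfolding Z_def[abs_def] by (rule adapted_comp[OF adapted_history])
  have PZ: "(\<integral>\<omega>. Z \<omega> \<partial>M) = \<P>(\<omega> in M. history n \<omega> = h)"
    unfolding Z_def by (rule integral_of_bool[OF adapted_event[OF adapted_comp[OF adapted_history]]])
  have int: "integrable M Z" "integrable M (\<lambda>\<omega>. real_of_int (X (Suc n) \<omega>) *\<^sub>R Z \<omega>)"
    by (rule adapted_integrable[OF Z], rule adapted_integrable[of "Suc n"],
        rule adapted_comp2[OF adapted_comp[OF adapted_X] adapted_mono[OF Z]]) auto
  have "\<P>(\<omega> in M. history (Suc n) \<omega> = h @ [x]) = (\<integral>\<omega>. of_bool (history (Suc n) \<omega> = h @ [x]) \<partial>M)"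
    by (rule integral_of_bool[symmetric, OF adapted_event[OF adapted_comp[OF adapted_history]]])
  also have "\<dots> = (\<integral>\<omega>. of_bool (x \<in> {1, -1}) / 2 * (Z \<omega> + real_of_int x * (real_of_int (X (Suc n) \<omega>) *\<^sub>R Z \<omega>)) \<partial>M)"
  proof (rule integral_cong_AE)
    show "(\<lambda>\<omega>. of_bool (history (Suc n) \<omega> = h @ [x]) :: real) \<in> borel_measurable M"
      by (rule adapted_borel[OF adapted_comp[OF adapted_history]])
    show "AE \<omega> in M. of_bool (history (Suc n) \<omega> = h @ [x])
      = of_bool (x \<in> {1, -1}) / 2 * (Z \<omega> + real_of_int x * (real_of_int (X (Suc n) \<omega>) *\<^sub>R Z \<omega>))"
      using AE_steps
    proof eventually_elim
      case (elim \<omega>)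
      then have "X (Suc n) \<omega> = 1 \<or> X (Suc n) \<omega> = -1" by simp
      then show ?case by (auto simp: history_Suc Z_def)
    qed
  qed (use int in auto)
  also have "\<dots> = of_bool (x \<in> {1, -1}) / 2 * ((\<integral>\<omega>. Z \<omega> \<partial>M) + real_of_int x * ((\<beta> / real n) * (\<integral>\<omega>. walk n \<omega> * Z \<omega> \<partial>M)))"
    using int integral_next_step[OF n Z]
    by (simp only: integral_mult_right_zero Bochner_Integration.integral_add integrable_mult_right real_scaleR_def)
  also have "(\<integral>\<omega>. walk n \<omega> * Z \<omega> \<partial>M) = (\<integral>\<omega>. real_of_int (sum_list h) * Z \<omega> \<partial>M)"
    by (rule Bochner_Integration.integral_cong) (auto simp: walk_eq_sum_list Z_def)
  finally show ?thesis by (simp add: PZ algebra_simps split: if_splits)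
qed

lemma prob_history_sum:
  "\<P>(\<omega> in M. Q (history n \<omega>)) = (\<Sum>h\<in>{h \<in> sign_paths n. Q h}. \<P>(\<omega> in M. history n \<omega> = h))"
proof -
  have fin: "finite {h \<in> sign_paths n. Q h}" using finite_sign_paths by simp
  have "\<P>(\<omega> in M. Q (history n \<omega>)) = prob (\<Union>h\<in>{h \<in> sign_paths n. Q h}. {\<omega> \<in> space M. history n \<omega> = h})"
  proof (rule measure_eq_AE)
    show "AE \<omega> in M. \<omega> \<in> {\<omega> \<in> space M. Q (history n \<omega>)} \<longleftrightarrow> \<omega> \<in> (\<Union>h\<in>{h \<in> sign_paths n. Q h}. {\<omega> \<in> space M. history n \<omega> = h})"
      using AE_history[of n] by eventually_elim auto
    show "{\<omega> \<in> space M. Q (history n \<omega>)} \<in> events"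
      by (rule adapted_event[OF adapted_comp[OF adapted_history]])
    show "(\<Union>h\<in>{h \<in> sign_paths n. Q h}. {\<omega> \<in> space M. history n \<omega> = h}) \<in> events"
      using fin by (intro sets.finite_UN) (auto intro!: adapted_event[OF adapted_comp[OF adapted_history]])
  qed
  also have "\<dots> = (\<Sum>h\<in>{h \<in> sign_paths n. Q h}. \<P>(\<omega> in M. history n \<omega> = h))"
    using fin by (intro finite_measure_finite_Union)
      (auto simp: disjoint_family_on_def intro!: adapted_event[OF adapted_comp[OF adapted_history]])
  finally show ?thesis .
qed

end

text \<open>
  The conditional mean determines the conditional law of a \<open>\<plusminus>1\<close> step, so the law of the
  history is determined by \<open>p\<close>.
\<close>

lemma elephant_history_law:
  assumes "elephant_random_walk M1 p X1 u1 r1" "elephant_random_walk M2 p X2 u2 r2"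
  shows "\<P>(\<omega> in M1. Q (map (\<lambda>k. X1 k \<omega>) [1..<Suc n]))
    = \<P>(\<omega> in M2. Q (map (\<lambda>k. X2 k \<omega>) [1..<Suc n]))"
proof -
  interpret E1: elephant_random_walk M1 p X1 u1 r1 by fact
  interpret E2: elephant_random_walk M2 p X2 u2 r2 by fact
  have "\<P>(\<omega> in M1. E1.history n \<omega> = h) = \<P>(\<omega> in M2. E2.history n \<omega> = h)"
    if "length h = n" for n h
    using that
  proof (induction n arbitrary: h)
    case 0
    then show ?case by (simp add: E1.history_def E2.history_def E1.prob_space E2.prob_space)
  next
    case (Suc n)
    then obtain h' x where h: "h = h' @ [x]" by (metis append_butlast_last_id length_0_conv nat.distinct(1))
    show ?case
    proof (cases "n = 0")
      case True
      then have "h = [x]" using h Suc.prems by simp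
      then show ?thesis using E1.history_prob_1[of x] E2.history_prob_1[of x] True by simp
    next
      case False
      then show ?thesis using Suc.IH[of h'] Suc.prems by (simp add: h E1.history_prob_Suc E2.history_prob_Suc)
    qed
  qed
  then have "(\<Sum>h\<in>{h \<in> E1.sign_paths n. Q h}. \<P>(\<omega> in M1. E1.history n \<omega> = h))
    = (\<Sum>h\<in>{h \<in> E2.sign_paths n. Q h}. \<P>(\<omega> in M2. E2.history n \<omega> = h))"
    unfolding E1.sign_paths_def E2.sign_paths_def by (intro sum.cong) auto
  then show ?thesis
    unfolding E1.prob_history_sum[symmetric] E2.prob_history_sum[symmetric] by (simp add: E1.history_def E2.history_def)
qed

lemma exp_minus_bound:
  fixes y :: real assumes "0 \<le> y" shows "\<bar>exp (- y) - (1 - y)\<bar> \<le> y\<^sup>2"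
proof -
  have 1: "1 - y \<le> exp (- y)" using exp_ge_add_one_self[of "- y"] by simp
  have "exp (- y) = 1 / exp y" by (simp add: exp_minus inverse_eq_divide)
  also have "\<dots> \<le> 1 / (1 + y)" using assms exp_ge_add_one_self[of y] by (intro divide_left_mono) auto
  also have "\<dots> \<le> 1 - y + y\<^sup>2"
  proof -
    have "(1 - y + y\<^sup>2) * (1 + y) = 1 + y ^ 3" by (simp add: algebra_simps power2_eq_square power3_eq_cube)
    then show ?thesis using assms by (simp add: pos_divide_le_eq)
  qed
  finally show ?thesis using 1 by simp
qed

context elephant_random_walk
begin

text \<open>
  The three terms bound the effect of the drift on the conditional variance, the third-order Taylor
  remainder, and the difference between \<open>1 - t\<^sup>2/2\<close> and \<open>exp (- t\<^sup>2/2)\<close>.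
\<close>

definition char_error :: "nat \<Rightarrow> real \<Rightarrow> real" where
  "char_error n t = t\<^sup>2 * (\<integral>\<omega>. (walk n \<omega> / real n)\<^sup>2 \<partial>M) + 2 * \<bar>t\<bar> ^ 3 + t ^ 4"

text \<open>
  One step multiplies the characteristic function by \<open>exp (- t\<^sup>2/2)\<close> up to a small error, even in the
  presence of a bounded function \<open>W\<close> of the past.
\<close>

lemma char_step:
  fixes W :: "'a \<Rightarrow> complex"
  assumes n: "1 \<le> n" and W: "adapted n W" and W1: "\<And>\<omega>. norm (W \<omega>) \<le> 1"
  shows "norm ((\<integral>\<omega>. W \<omega> * iexp (t * noise n \<omega>) \<partial>M) - exp (- t\<^sup>2 / 2) *\<^sub>R (\<integral>\<omega>. W \<omega> \<partial>M)) \<le> char_error n t"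
proof -
  define T :: "real \<Rightarrow> complex" where "T x = 1 + \<i> * of_real x - of_real (x\<^sup>2 / 2)" for x
  (* The linear term of the expansion integrates to zero, the quadratic one is given by noise_square. *)
  have T: "cmod (iexp x - T x) \<le> \<bar>x\<bar> ^ 3 / 6" for x
    using iexp_approx1[of x 2] by (simp add: T_def numeral_2_eq_2 numeral_3_eq_3 power2_eq_square algebra_simps)
  define q where "q \<omega> = (\<beta> * walk n \<omega> / real n)\<^sup>2" for \<omega>
  have adq: "adapted n q" unfolding q_def[abs_def] by (rule adapted_comp[OF adapted_walk]) simp
  have int_n: "integrable M (\<lambda>\<omega>. noise n \<omega> *\<^sub>R W \<omega>)" "integrable M (\<lambda>\<omega>. (noise n \<omega>)\<^sup>2 *\<^sub>R W \<omega>)"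
    "integrable M (\<lambda>\<omega>. W \<omega> * iexp (t * noise n \<omega>))" "integrable M (\<lambda>\<omega>. W \<omega> * T (t * noise n \<omega>))"
    by (rule adapted_integrable[of "Suc n"], rule adapted_comp2[OF adapted_mono[OF W] adapted_noise], simp)+
  have int_W: "integrable M W" by (rule adapted_integrable[OF W])
  have int_q: "integrable M (\<lambda>\<omega>. q \<omega> *\<^sub>R W \<omega>)" "integrable M (\<lambda>\<omega>. (walk n \<omega> / real n)\<^sup>2)"
    by (rule adapted_integrable[OF adapted_comp2[OF adq W]],
        rule adapted_integrable[OF adapted_comp[OF adapted_walk[OF order_refl]]])
  have TW: "W \<omega> * T (t * noise n \<omega>) = W \<omega> + (\<i> * of_real t) * (noise n \<omega> *\<^sub>R W \<omega>) - (t\<^sup>2 / 2) *\<^sub>R ((noise n \<omega>)\<^sup>2 *\<^sub>R W \<omega>)" for \<omega>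
    by (simp add: T_def scaleR_conv_of_real power_mult_distrib algebra_simps)
  have "(\<integral>\<omega>. W \<omega> * T (t * noise n \<omega>) \<partial>M) = (\<integral>\<omega>. W \<omega> \<partial>M) + (\<i> * of_real t) * (\<integral>\<omega>. noise n \<omega> *\<^sub>R W \<omega> \<partial>M)
      - (t\<^sup>2 / 2) *\<^sub>R (\<integral>\<omega>. (noise n \<omega>)\<^sup>2 *\<^sub>R W \<omega> \<partial>M)"
    unfolding TW using int_n int_W
    by (simp only: Bochner_Integration.integral_diff Bochner_Integration.integral_add Bochner_Integration.integrable_add
        integrable_mult_right integrable_scaleR_right integral_scaleR_right integral_mult_right_zero)
  also have "(\<integral>\<omega>. noise n \<omega> *\<^sub>R W \<omega> \<partial>M) = 0" by (rule noise_mean[OF n W])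
  also have "(\<integral>\<omega>. (noise n \<omega>)\<^sup>2 *\<^sub>R W \<omega> \<partial>M) = (\<integral>\<omega>. W \<omega> - q \<omega> *\<^sub>R W \<omega> \<partial>M)"
    unfolding noise_square[OF n W] q_def by (simp add: scaleR_diff_left)
  also have "\<dots> = (\<integral>\<omega>. W \<omega> \<partial>M) - (\<integral>\<omega>. q \<omega> *\<^sub>R W \<omega> \<partial>M)" using int_W int_q by simp
  finally have IT: "(\<integral>\<omega>. W \<omega> * T (t * noise n \<omega>) \<partial>M)
    = (1 - t\<^sup>2 / 2) *\<^sub>R (\<integral>\<omega>. W \<omega> \<partial>M) + (t\<^sup>2 / 2) *\<^sub>R (\<integral>\<omega>. q \<omega> *\<^sub>R W \<omega> \<partial>M)"
    by (simp add: scaleR_diff_left scaleR_diff_right)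
  have 1: "norm ((\<integral>\<omega>. W \<omega> * iexp (t * noise n \<omega>) \<partial>M) - (\<integral>\<omega>. W \<omega> * T (t * noise n \<omega>) \<partial>M)) \<le> 2 * \<bar>t\<bar> ^ 3"
  proof -
    have "(\<integral>\<omega>. W \<omega> * iexp (t * noise n \<omega>) \<partial>M) - (\<integral>\<omega>. W \<omega> * T (t * noise n \<omega>) \<partial>M)
      = (\<integral>\<omega>. W \<omega> * iexp (t * noise n \<omega>) - W \<omega> * T (t * noise n \<omega>) \<partial>M)" using int_n by simp
    also have "norm \<dots> \<le> (\<integral>\<omega>. norm (W \<omega> * iexp (t * noise n \<omega>) - W \<omega> * T (t * noise n \<omega>)) \<partial>M)"
      by (rule integral_norm_bound)
    also have "\<dots> \<le> (\<integral>\<omega>. 2 * \<bar>t\<bar> ^ 3 \<partial>M)"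
    proof (rule integral_mono_AE)
      show "AE \<omega> in M. norm (W \<omega> * iexp (t * noise n \<omega>) - W \<omega> * T (t * noise n \<omega>)) \<le> 2 * \<bar>t\<bar> ^ 3"
        using AE_steps
      proof eventually_elim
        case (elim \<omega>)
        have "norm (W \<omega> * iexp (t * noise n \<omega>) - W \<omega> * T (t * noise n \<omega>))
          = norm (W \<omega>) * norm (iexp (t * noise n \<omega>) - T (t * noise n \<omega>))"
          by (simp add: right_diff_distrib[symmetric] norm_mult)
        also have "\<dots> \<le> 1 * (\<bar>t * noise n \<omega>\<bar> ^ 3 / 6)" by (intro mult_mono W1 T) auto
        also have "\<bar>t * noise n \<omega>\<bar> ^ 3 = \<bar>t\<bar> ^ 3 * \<bar>noise n \<omega>\<bar> ^ 3" by (simp add: abs_mult power_mult_distrib)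
        also have "\<dots> \<le> \<bar>t\<bar> ^ 3 * 2 ^ 3" by (intro mult_left_mono power_mono abs_noise_le[OF elim]) auto
        finally have "norm (W \<omega> * iexp (t * noise n \<omega>) - W \<omega> * T (t * noise n \<omega>)) \<le> 1 * (\<bar>t\<bar> ^ 3 * 2 ^ 3 / 6)"
          by simp
        moreover have "1 * (x * 2 ^ 3 / 6) \<le> 2 * x" if "0 \<le> x" for x :: real using that by simp
        ultimately show ?case by (meson order_trans zero_le_power abs_ge_zero)
      qed
    qed (use int_n in auto)
    finally show ?thesis by (simp add: prob_space)
  qed
  have 2: "norm ((\<integral>\<omega>. q \<omega> *\<^sub>R W \<omega> \<partial>M)) \<le> (\<integral>\<omega>. (walk n \<omega> / real n)\<^sup>2 \<partial>M)"
  proof -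
    have "norm ((\<integral>\<omega>. q \<omega> *\<^sub>R W \<omega> \<partial>M)) \<le> (\<integral>\<omega>. norm (q \<omega> *\<^sub>R W \<omega>) \<partial>M)" by (rule integral_norm_bound)
    also have "\<dots> \<le> (\<integral>\<omega>. (walk n \<omega> / real n)\<^sup>2 \<partial>M)"
    proof (rule integral_mono)
      fix \<omega>
      have "norm (q \<omega> *\<^sub>R W \<omega>) = \<beta>\<^sup>2 * (walk n \<omega> / real n)\<^sup>2 * norm (W \<omega>)"
        by (simp add: q_def power_mult_distrib power_divide)
      also have "\<dots> \<le> 1 * (walk n \<omega> / real n)\<^sup>2 * 1"
        using beta_bounds(3) W1[of \<omega>] by (intro mult_mono) auto
      finally show "norm (q \<omega> *\<^sub>R W \<omega>) \<le> (walk n \<omega> / real n)\<^sup>2" by simp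
    qed (rule integrable_norm[OF int_q(1)], rule int_q(2))
    finally show ?thesis .
  qed
  have 3: "norm (\<integral>\<omega>. W \<omega> \<partial>M) \<le> 1"
  proof -
    have "norm (\<integral>\<omega>. W \<omega> \<partial>M) \<le> (\<integral>\<omega>. norm (W \<omega>) \<partial>M)" by (rule integral_norm_bound)
    also have "\<dots> \<le> (\<integral>\<omega>. 1 \<partial>M)" using int_W W1 by (intro integral_mono) auto
    finally show ?thesis by (simp add: prob_space)
  qed
  have 4: "\<bar>exp (- t\<^sup>2 / 2) - (1 - t\<^sup>2 / 2)\<bar> \<le> t ^ 4"
  proof -
    have "\<bar>exp (- (t\<^sup>2 / 2)) - (1 - t\<^sup>2 / 2)\<bar> \<le> (t\<^sup>2 / 2)\<^sup>2" by (rule exp_minus_bound) simp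
    also have "\<dots> = t ^ 4 / 4" by (simp add: power_divide flip: power_mult)
    also have "\<dots> \<le> t ^ 4" by simp
    finally show ?thesis by simp
  qed
  define A B C J where "A = (\<integral>\<omega>. W \<omega> * iexp (t * noise n \<omega>) \<partial>M)" and "B = (\<integral>\<omega>. W \<omega> * T (t * noise n \<omega>) \<partial>M)"
    and "C = (\<integral>\<omega>. q \<omega> *\<^sub>R W \<omega> \<partial>M)" and "J = (\<integral>\<omega>. W \<omega> \<partial>M)"
  have "A - exp (- t\<^sup>2 / 2) *\<^sub>R J = (A - B) + (t\<^sup>2 / 2) *\<^sub>R C - (exp (- t\<^sup>2 / 2) - (1 - t\<^sup>2 / 2)) *\<^sub>R J"
    using IT unfolding A_def[symmetric] B_def[symmetric] C_def[symmetric] J_def[symmetric] by (simp add: scaleR_diff_left)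
  also have "norm \<dots> \<le> norm (A - B) + norm ((t\<^sup>2 / 2) *\<^sub>R C) + norm ((exp (- t\<^sup>2 / 2) - (1 - t\<^sup>2 / 2)) *\<^sub>R J)"
    by (rule order_trans[OF norm_triangle_ineq4 add_right_mono[OF norm_triangle_ineq]])
  also have "norm ((t\<^sup>2 / 2) *\<^sub>R C) \<le> t\<^sup>2 * (\<integral>\<omega>. (walk n \<omega> / real n)\<^sup>2 \<partial>M)"
  proof -
    have "(t\<^sup>2 / 2) * norm C \<le> t\<^sup>2 * (\<integral>\<omega>. (walk n \<omega> / real n)\<^sup>2 \<partial>M)"
      using 2 by (intro mult_mono) (auto simp: C_def)
    then show ?thesis by simp
  qed
  also have "norm ((exp (- t\<^sup>2 / 2) - (1 - t\<^sup>2 / 2)) *\<^sub>R J) \<le> t ^ 4"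
    using mult_mono[OF 4 3] by (simp add: J_def)
  finally show ?thesis
    using 1 unfolding char_error_def A_def[symmetric] B_def[symmetric] J_def[symmetric] by linarith
qed

text \<open>
  The errors of the single steps add up because the factors \<open>exp (- t\<^sup>2/2)\<close> are at most one.
\<close>

lemma char_increment:
  assumes s: "2 \<le> s" "s \<le> n" and Q: "adapted s Q"
  shows "norm ((\<integral>\<omega>. of_bool (Q \<omega>) * iexp (t * (mart n \<omega> - mart s \<omega>)) \<partial>M)
      - exp (- t\<^sup>2 * (clock \<beta> n - clock \<beta> s) / 2) *\<^sub>R (\<integral>\<omega>. of_bool (Q \<omega>) \<partial>M))
    \<le> (\<Sum>k\<in>{s..<n}. char_error k (t / norming \<beta> (Suc k)))"
  using s(2)
proof (induction n rule: dec_induct)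
  case base
  show ?case by simp
next
  case (step n)
  then have n: "2 \<le> n" "1 \<le> n" using s by auto
  define W :: "'a \<Rightarrow> complex" where "W \<omega> = of_bool (Q \<omega>) * iexp (t * (mart n \<omega> - mart s \<omega>))" for \<omega>
  have "adapted n (\<lambda>\<omega>. mart n \<omega> - mart s \<omega>)"
    by (rule adapted_comp2[OF adapted_mart adapted_mart]) (use step in auto)
  from adapted_comp2[OF adapted_mono[OF Q step.hyps(1)] this] have W: "adapted n W" unfolding W_def[abs_def] .
  define \<tau> where "\<tau> = t / norming \<beta> (Suc n)"
  have split: "of_bool (Q \<omega>) * iexp (t * (mart (Suc n) \<omega> - mart s \<omega>)) = W \<omega> * iexp (\<tau> * noise n \<omega>)" for \<omega>
  proof -
    have e: "t * (mart (Suc n) \<omega> - mart s \<omega>) = t * (mart n \<omega> - mart s \<omega>) + \<tau> * noise n \<omega>"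
      by (simp add: mart_Suc[OF n(1)] \<tau>_def algebra_simps)
    show ?thesis unfolding e W_def by (simp add: exp_add ring_distribs)
  qed
  define r where "r = exp (- \<tau>\<^sup>2 / 2)"
  have r: "0 \<le> r" "r \<le> 1" by (auto simp: r_def)
  have er: "exp (- t\<^sup>2 * (clock \<beta> (Suc n) - clock \<beta> s) / 2) = r * exp (- t\<^sup>2 * (clock \<beta> n - clock \<beta> s) / 2)"
  proof -
    have "- t\<^sup>2 * (clock \<beta> (Suc n) - clock \<beta> s) / 2 = - \<tau>\<^sup>2 / 2 + - t\<^sup>2 * (clock \<beta> n - clock \<beta> s) / 2"
      by (simp add: clock_Suc[OF n(1)] \<tau>_def power_divide field_simps)
    then show ?thesis unfolding r_def by (simp only: exp_add)
  qed
  define J where "J = (\<integral>\<omega>. of_bool (Q \<omega>) \<partial>M :: complex)"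
  define E where "E = exp (- t\<^sup>2 * (clock \<beta> n - clock \<beta> s) / 2)"
  define I where "I = (\<integral>\<omega>. W \<omega> \<partial>M)"
  have "norm (W \<omega>) \<le> 1" for \<omega> by (simp add: W_def norm_mult)
  from char_step[OF n(2) W this, of \<tau>]
  have 1: "norm ((\<integral>\<omega>. W \<omega> * iexp (\<tau> * noise n \<omega>) \<partial>M) - r *\<^sub>R I) \<le> char_error n \<tau>" unfolding r_def I_def .
  have 2: "norm (r *\<^sub>R I - r *\<^sub>R (E *\<^sub>R J)) \<le> (\<Sum>k\<in>{s..<n}. char_error k (t / norming \<beta> (Suc k)))"
  proof -
    have "norm (r *\<^sub>R I - r *\<^sub>R (E *\<^sub>R J)) = norm (r *\<^sub>R (I - E *\<^sub>R J))"
      by (simp only: scaleR_diff_right)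
    also have "\<dots> = r * norm (I - E *\<^sub>R J)" using r by simp
    also have "\<dots> \<le> 1 * norm (I - E *\<^sub>R J)" by (rule mult_right_mono[OF r(2)]) simp
    finally show ?thesis using step.IH by (simp add: I_def E_def J_def W_def)
  qed
  have "norm ((\<integral>\<omega>. W \<omega> * iexp (\<tau> * noise n \<omega>) \<partial>M) - (r * E) *\<^sub>R J)
    \<le> char_error n \<tau> + (\<Sum>k\<in>{s..<n}. char_error k (t / norming \<beta> (Suc k)))"
    using norm_triangle_mono[OF 1 2] by simp
  then show ?case
    unfolding split er E_def[symmetric] J_def[symmetric]
    using step.hyps by (simp add: \<tau>_def add.commute)
qed

end

section \<open>Normal limits of increments over successive blocks\<close>

text \<open>
  Equivalently \<open>1 / b\<^sub>n\<^sup>2 = o(v\<^sub>n)\<close>: no single increment contributes to the variance in the limit.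
\<close>

lemma norming_clock_at_top:
  assumes "-1 \<le> \<beta>" "\<beta> \<le> 1 / 2"
  shows "filterlim (\<lambda>n. (norming \<beta> n)\<^sup>2 * clock \<beta> n) at_top sequentially"
proof (cases "\<beta> < 1 / 2")
  case True
  have "filterlim (\<lambda>n. (norming \<beta> n)\<^sup>2 * clock \<beta> n / real n * real n) at_top sequentially"
    by (intro filterlim_tendsto_pos_mult_at_top[OF norming_clock_asymp[OF assms(1) True]] filterlim_real_sequentially)
      (use True in auto)
  moreover have "eventually (\<lambda>n. (norming \<beta> n)\<^sup>2 * clock \<beta> n / real n * real n = (norming \<beta> n)\<^sup>2 * clock \<beta> n) sequentially"
    using eventually_gt_at_top[of 0] by eventually_elim simp
  ultimately show ?thesis by (simp cong: filterlim_cong)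
next
  case False
  then have b: "\<beta> = 1 / 2" using assms by simp
  have "filterlim (\<lambda>n. real n * ln (real n)) at_top sequentially" by real_asymp
  then have "filterlim (\<lambda>n. (norming (1/2) n)\<^sup>2 * clock (1/2) n / (real n * ln (real n)) * (real n * ln (real n))) at_top sequentially"
    by (intro filterlim_tendsto_pos_mult_at_top[OF norming_clock_asymp_critical]) auto
  moreover have "eventually (\<lambda>n. (norming (1/2) n)\<^sup>2 * clock (1/2) n / (real n * ln (real n)) * (real n * ln (real n))
      = (norming (1/2) n)\<^sup>2 * clock (1/2) n) sequentially"
    using eventually_gt_at_top[of 1] by eventually_elim simp
  ultimately show ?thesis unfolding b by (simp cong: filterlim_cong)
qed

lemma norming_clock_sublinear:
  assumes "-1 \<le> \<beta>" "\<beta> \<le> 1 / 2"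
  shows "(\<lambda>n. (norming \<beta> n)\<^sup>2 * (clock \<beta> n + 4) / (real n)\<^sup>2) \<longlonglongrightarrow> 0"
proof -
  have "(\<lambda>n. (norming \<beta> n)\<^sup>2 * clock \<beta> n / (real n)\<^sup>2) \<longlonglongrightarrow> 0"
  proof (cases "\<beta> < 1 / 2")
    case True
    have "(\<lambda>n. (norming \<beta> n)\<^sup>2 * clock \<beta> n / real n * (1 / real n)) \<longlonglongrightarrow> 1 / (1 - 2 * \<beta>) * 0"
      by (intro tendsto_mult norming_clock_asymp assms True) real_asymp
    then show ?thesis by (simp add: power2_eq_square)
  next
    case False
    then have b: "\<beta> = 1 / 2" using assms by simp
    have "(\<lambda>n. (norming (1/2) n)\<^sup>2 * clock (1/2) n / (real n * ln (real n)) * (ln (real n) / real n)) \<longlonglongrightarrow> 1 * 0"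
      by (intro tendsto_mult norming_clock_asymp_critical) real_asymp
    moreover have "eventually (\<lambda>n. (norming (1/2) n)\<^sup>2 * clock (1/2) n / (real n * ln (real n)) * (ln (real n) / real n)
      = (norming (1/2) n)\<^sup>2 * clock (1/2) n / (real n)\<^sup>2) sequentially"
      using eventually_gt_at_top[of 1] by eventually_elim (simp add: power2_eq_square)
    ultimately show ?thesis unfolding b by (simp add: tendsto_cong)
  qed
  moreover have "(\<lambda>n. 4 * ((norming \<beta> n / real n powr \<beta>)\<^sup>2 * (real n powr (2 * \<beta> - 2)))) \<longlonglongrightarrow> 4 * ((rGamma (2 + \<beta>))\<^sup>2 * 0)"
  proof (intro tendsto_mult tendsto_const tendsto_power norming_asymp assms)
    have "2 * \<beta> - 2 < 0" using assms by simp
    then show "(\<lambda>n. real n powr (2 * \<beta> - 2)) \<longlonglongrightarrow> 0" by real_asymp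
  qed
  ultimately have "(\<lambda>n. (norming \<beta> n)\<^sup>2 * clock \<beta> n / (real n)\<^sup>2 + 4 * ((norming \<beta> n / real n powr \<beta>)\<^sup>2 * (real n powr (2 * \<beta> - 2)))) \<longlonglongrightarrow> 0 + 4 * ((rGamma (2 + \<beta>))\<^sup>2 * 0)"
    by (rule tendsto_add)
  moreover have "eventually (\<lambda>n. (norming \<beta> n)\<^sup>2 * clock \<beta> n / (real n)\<^sup>2 + 4 * ((norming \<beta> n / real n powr \<beta>)\<^sup>2 * (real n powr (2 * \<beta> - 2)))
    = (norming \<beta> n)\<^sup>2 * (clock \<beta> n + 4) / (real n)\<^sup>2) sequentially"
    using eventually_gt_at_top[of 0]
  proof eventually_elim
    case (elim n)
    have "(real n powr \<beta>)\<^sup>2 = real n powr (2 * \<beta>)" using elim by (simp add: powr_power mult.commute)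
    moreover have "real n powr (2 * \<beta> - 2) = real n powr (2 * \<beta>) / (real n)\<^sup>2"
      using elim by (subst powr_diff) simp
    moreover have "real n powr (2 * \<beta>) \<noteq> 0" using elim by simp
    ultimately have "(norming \<beta> n / real n powr \<beta>)\<^sup>2 * (real n powr (2 * \<beta> - 2)) = (norming \<beta> n)\<^sup>2 / (real n)\<^sup>2"
      by (simp only: power_divide) simp
    then show ?case by (simp add: algebra_simps add_divide_distrib)
  qed
  ultimately show ?thesis by (simp add: tendsto_cong)
qed

lemma clock_pos: "3 \<le> n \<Longrightarrow> -1 \<le> \<beta> \<Longrightarrow> 0 < clock \<beta> n"
  unfolding clock_def using norming_pos by (intro sum_pos) (auto simp: less_le)

lemma isCont_cdf_std_normal: "isCont (cdf std_normal_distribution) x"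
proof -
  interpret real_distribution std_normal_distribution by (rule real_dist_normal_dist)
  have "emeasure std_normal_distribution {x} = 0"
    by (subst emeasure_density) (auto intro!: nn_integral_null_set simp: null_sets_def)
  then show ?thesis by (simp add: isCont_cdf measure_def)
qed

context elephant_random_walk
begin

text \<open>
  The law of large numbers in mean square: the influence of the drift on the conditional variance is
  negligible.
\<close>

lemma walk_second_moment_sublinear:
  assumes "\<beta> \<le> 1 / 2"
  shows "(\<lambda>n. \<integral>\<omega>. (walk n \<omega> / real n)\<^sup>2 \<partial>M) \<longlonglongrightarrow> 0"
proof (rule tendsto_sandwich[OF _ _ tendsto_const norming_clock_sublinear[OF beta_bounds(1) assms]])
  show "\<forall>\<^sub>F n in sequentially. 0 \<le> (\<integral>\<omega>. (walk n \<omega> / real n)\<^sup>2 \<partial>M)"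
    by (intro always_eventually allI Bochner_Integration.integral_nonneg) simp
  show "\<forall>\<^sub>F n in sequentially. (\<integral>\<omega>. (walk n \<omega> / real n)\<^sup>2 \<partial>M) \<le> (norming \<beta> n)\<^sup>2 * (clock \<beta> n + 4) / (real n)\<^sup>2"
    using eventually_ge_at_top[of 2]
    by eventually_elim (simp add: power_divide divide_right_mono integral_walk_square_le)
qed

lemma char_error_nonneg: "0 \<le> char_error n t"
  unfolding char_error_def
  by (intro add_nonneg_nonneg mult_nonneg_nonneg Bochner_Integration.integral_nonneg) auto

text \<open>
  Each error is a clock increment times a null sequence, divided by the total clock, so the sum is a
  weighted average of a null sequence.
\<close>

lemma char_error_sum_vanishes:
  fixes n :: "nat \<Rightarrow> nat" and t :: "nat \<Rightarrow> real"
  assumes b: "\<beta> \<le> 1 / 2" and n: "filterlim n at_top sequentially" and t: "\<And>L. (t L)\<^sup>2 * clock \<beta> (n L) \<le> \<gamma>"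
  shows "(\<lambda>L. \<Sum>k\<in>{2..<n L}. char_error k (t L / norming \<beta> (Suc k))) \<longlonglongrightarrow> 0"
proof -
  define d where "d k = 1 / (norming \<beta> k)\<^sup>2" for k
  define E where "E k = (\<integral>\<omega>. (walk k \<omega> / real k)\<^sup>2 \<partial>M)" for k
  define \<eta> where "\<eta> k = E k + 2 * sqrt (\<gamma> * (d (Suc k) / clock \<beta> (Suc k))) + \<gamma> * (d (Suc k) / clock \<beta> (Suc k))" for k
  (* The weighted sum of the null sequence; divided by the clock it tends to zero by Stolz_Cesaro. *)
  define a where "a m = (\<Sum>k\<in>{2..<m}. d (Suc k) * \<eta> k)" for m
  have dpos: "0 < d k" for k by (simp add: d_def)
  have "(\<lambda>n. inverse ((norming \<beta> n)\<^sup>2 * clock \<beta> n)) \<longlonglongrightarrow> 0"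
    by (rule tendsto_inverse_0_at_top[OF norming_clock_at_top[OF beta_bounds(1) b]])
  then have "(\<lambda>n. d n / clock \<beta> n) \<longlonglongrightarrow> 0" by (simp add: d_def inverse_eq_divide)
  from LIMSEQ_Suc[OF this] have dv: "(\<lambda>k. d (Suc k) / clock \<beta> (Suc k)) \<longlonglongrightarrow> 0" .
  have "\<eta> \<longlonglongrightarrow> 0 + 2 * sqrt (\<gamma> * 0) + \<gamma> * 0"
    unfolding \<eta>_def E_def by (intro tendsto_intros walk_second_moment_sublinear b dv)
  then have eta: "\<eta> \<longlonglongrightarrow> 0" by simp
  have a: "(\<lambda>m. a m / clock \<beta> m) \<longlonglongrightarrow> 0"
  proof (rule Stolz_Cesaro[where ?n0.0 = 2])
    show "filterlim (clock \<beta>) at_top sequentially" by (rule clock_at_top[OF beta_bounds(1) b])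
    show "clock \<beta> m < clock \<beta> (Suc m)" if "2 \<le> m" for m using dpos[of "Suc m"] by (simp add: clock_Suc[OF that] d_def)
    have "eventually (\<lambda>m. \<eta> m = (a (Suc m) - a m) / (clock \<beta> (Suc m) - clock \<beta> m)) sequentially"
      using eventually_ge_at_top[of 2]
    proof eventually_elim
      case (elim m)
      then show ?case using dpos[of "Suc m"] by (simp add: a_def clock_Suc d_def)
    qed
    then show "(\<lambda>m. (a (Suc m) - a m) / (clock \<beta> (Suc m) - clock \<beta> m)) \<longlonglongrightarrow> 0"
      using eta by (rule Lim_transform_eventually[rotated])
  qed
  have "(\<lambda>L. \<gamma> * (a (n L) / clock \<beta> (n L))) \<longlonglongrightarrow> \<gamma> * 0"
    by (intro tendsto_mult tendsto_const filterlim_compose[OF a n])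
  then have lim: "(\<lambda>L. \<gamma> * (a (n L) / clock \<beta> (n L))) \<longlonglongrightarrow> 0" by simp
  show ?thesis
  proof (rule tendsto_sandwich[OF _ _ tendsto_const lim])
    show "\<forall>\<^sub>F L in sequentially. 0 \<le> (\<Sum>k\<in>{2..<n L}. char_error k (t L / norming \<beta> (Suc k)))"
      by (intro always_eventually allI sum_nonneg char_error_nonneg)
    have "eventually (\<lambda>L. 3 \<le> n L) sequentially" using n by (simp add: filterlim_at_top)
    then show "\<forall>\<^sub>F L in sequentially. (\<Sum>k\<in>{2..<n L}. char_error k (t L / norming \<beta> (Suc k))) \<le> \<gamma> * (a (n L) / clock \<beta> (n L))"
    proof eventually_elim
      case (elim L)
      have v: "0 < clock \<beta> (n L)" using clock_pos[OF elim beta_bounds(1)] .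
      have term_le: "char_error k (t L / norming \<beta> (Suc k)) \<le> (t L)\<^sup>2 * (d (Suc k) * \<eta> k)" if k: "k \<in> {2..<n L}" for k
      proof -
        define \<tau> where "\<tau> = t L / norming \<beta> (Suc k)"
        have vk: "0 < clock \<beta> (Suc k)" "clock \<beta> (Suc k) \<le> clock \<beta> (n L)"
          using k by (auto intro: clock_pos beta_bounds clock_mono)
        have \<tau>2: "\<tau>\<^sup>2 = (t L)\<^sup>2 * d (Suc k)" by (simp add: \<tau>_def d_def power_divide)
        have "(t L)\<^sup>2 * clock \<beta> (Suc k) \<le> \<gamma>"
          using t[of L] mult_left_mono[OF vk(2), of "(t L)\<^sup>2"] by simp
        then have "(t L)\<^sup>2 \<le> \<gamma> / clock \<beta> (Suc k)" using vk by (simp add: pos_le_divide_eq)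
        from mult_right_mono[OF this, of "d (Suc k)"] dpos[of "Suc k"]
        have bd: "\<tau>\<^sup>2 \<le> \<gamma> * (d (Suc k) / clock \<beta> (Suc k))" by (simp add: \<tau>2)
        then have bd': "\<bar>\<tau>\<bar> \<le> sqrt (\<gamma> * (d (Suc k) / clock \<beta> (Suc k)))" by (metis real_sqrt_abs real_sqrt_le_mono)
        have "char_error k \<tau> = \<tau>\<^sup>2 * (E k + 2 * \<bar>\<tau>\<bar> + \<tau>\<^sup>2)"
          by (simp add: char_error_def E_def power2_eq_square power3_eq_cube power4_eq_xxxx algebra_simps)
        also have "\<dots> \<le> \<tau>\<^sup>2 * \<eta> k" using bd bd' by (intro mult_left_mono) (auto simp: \<eta>_def)
        finally show ?thesis unfolding \<tau>2 by (simp add: \<tau>_def)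
      qed
      have \<gamma>: "0 \<le> \<gamma>" using t[of L] v by (meson mult_nonneg_nonneg order_trans zero_le_power2 less_imp_le)
      have Epos: "0 \<le> E k" for k unfolding E_def by (intro Bochner_Integration.integral_nonneg) simp
      have apos: "0 \<le> a (n L)"
        unfolding a_def \<eta>_def using \<gamma> dpos Epos
        by (intro sum_nonneg mult_nonneg_nonneg add_nonneg_nonneg divide_nonneg_nonneg) (auto simp: less_imp_le clock_nonneg)
      have "(\<Sum>k\<in>{2..<n L}. char_error k (t L / norming \<beta> (Suc k))) \<le> (t L)\<^sup>2 * a (n L)"
        unfolding a_def sum_distrib_left by (intro sum_mono term_le)
      also have "\<dots> = ((t L)\<^sup>2 * clock \<beta> (n L)) * (a (n L) / clock \<beta> (n L))" using v by simp
      also have "\<dots> \<le> \<gamma> * (a (n L) / clock \<beta> (n L))"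
        using t[of L] apos v by (intro mult_right_mono) auto
      finally show ?case .
    qed
  qed
qed

text \<open>
  Levy's continuity theorem for the law of the increment conditioned on the event \<open>Q\<close> of the past.
  The event may vary with \<open>L\<close>; only its probability has to converge. This replaces a
  multidimensional continuity theorem.
\<close>

lemma conditional_clt:
  fixes s n :: "nat \<Rightarrow> nat" and c :: "nat \<Rightarrow> real" and Q :: "nat \<Rightarrow> 'a \<Rightarrow> bool" and lo hi :: real
  assumes b: "\<beta> \<le> 1 / 2"
    and s: "\<And>L. 2 \<le> s L" "\<And>L. s L \<le> n L" and n: "filterlim n at_top sequentially"
    and Q: "\<And>L. adapted (s L) (Q L)" and q: "(\<lambda>L. \<P>(\<omega> in M. Q L \<omega>)) \<longlonglongrightarrow> q"
    and c: "(\<lambda>L. (c L)\<^sup>2 * (clock \<beta> (n L) - clock \<beta> (s L))) \<longlonglongrightarrow> 1"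
    and \<gamma>: "\<And>L. (c L)\<^sup>2 * clock \<beta> (n L) \<le> \<gamma>"
    and lu: "lo < hi"
  shows "(\<lambda>L. \<P>(\<omega> in M. Q L \<omega> \<and> c L * (mart (n L) \<omega> - mart (s L) \<omega>) \<in> {lo<..hi}))
    \<longlonglongrightarrow> q * measure std_normal_distribution {lo<..hi}"
proof -
  define V where "V L \<omega> = c L * (mart (n L) \<omega> - mart (s L) \<omega>)" for L \<omega>
  define A where "A L = {\<omega> \<in> space M. Q L \<omega>}" for L
  have V: "adapted (n L) (V L)" for L
    unfolding V_def[abs_def] by (rule adapted_comp2[OF adapted_mart adapted_mart]) (use s in auto)
  have mV[measurable]: "V L \<in> borel_measurable M" for L using adapted_borel[OF V] .
  have A[measurable]: "A L \<in> events" for L unfolding A_def by (rule adapted_event[OF Q])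
  interpret N: real_distribution std_normal_distribution by (rule real_dist_normal_dist)
  have q0: "0 \<le> q" by (rule LIMSEQ_le_const[OF q]) auto
  have ev: "{\<omega> \<in> space M. Q L \<omega> \<and> V L \<omega> \<in> B} = A L \<inter> (V L -` B \<inter> space M)" for L B
    by (auto simp: A_def)
  show ?thesis
  proof (cases "q = 0")
    case True
    have "(\<lambda>L. \<P>(\<omega> in M. Q L \<omega> \<and> V L \<omega> \<in> {lo<..hi})) \<longlonglongrightarrow> 0"
    proof (rule tendsto_sandwich[OF _ _ tendsto_const q[unfolded True]])
      show "\<forall>\<^sub>F L in sequentially. \<P>(\<omega> in M. Q L \<omega> \<and> V L \<omega> \<in> {lo<..hi}) \<le> \<P>(\<omega> in M. Q L \<omega>)"
        using A by (intro always_eventually allI finite_measure_mono) (auto simp: A_def)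
    qed auto
    then show ?thesis using True by (simp add: V_def)
  next
    case False
    with q0 have qpos: "0 < q" by simp
    have char: "(\<lambda>L. (\<integral>\<omega>. of_bool (Q L \<omega>) * iexp (\<theta> * V L \<omega>) \<partial>M)) \<longlonglongrightarrow> of_real q * of_real (exp (- \<theta>\<^sup>2 / 2))" for \<theta>
    proof -
      define I where "I L = (\<integral>\<omega>. of_bool (Q L \<omega>) * iexp (\<theta> * V L \<omega>) \<partial>M)" for L
      define J :: "nat \<Rightarrow> complex" where "J L = (\<integral>\<omega>. of_bool (Q L \<omega>) \<partial>M)" for L
      have J: "J L = of_real (\<P>(\<omega> in M. Q L \<omega>))" for L
      proof -
        have "J L = (\<integral>\<omega>. complex_of_real (of_bool (Q L \<omega>)) \<partial>M)"
          unfolding J_def by (rule Bochner_Integration.integral_cong) simp_all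
        also have "\<dots> = of_real (\<integral>\<omega>. of_bool (Q L \<omega>) \<partial>M)" by (rule integral_complex_of_real)
        also have "\<dots> = of_real (\<P>(\<omega> in M. Q L \<omega>))"
          by (simp only: integral_of_bool[OF adapted_event[OF Q]])
        finally show ?thesis .
      qed
      define R where "R L = exp (- (\<theta> * c L)\<^sup>2 * (clock \<beta> (n L) - clock \<beta> (s L)) / 2) *\<^sub>R J L" for L
      have "norm (I L - R L) \<le> (\<Sum>k\<in>{s L..<n L}. char_error k (\<theta> * c L / norming \<beta> (Suc k)))" for L
        using char_increment[OF s Q, of L "\<theta> * c L"] by (simp add: I_def R_def J_def V_def mult.assoc)
      also have "(\<Sum>k\<in>{s L..<n L}. char_error k (\<theta> * c L / norming \<beta> (Suc k))) \<le> (\<Sum>k\<in>{2..<n L}. char_error k (\<theta> * c L / norming \<beta> (Suc k)))" for L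
        by (rule sum_mono2) (auto intro: char_error_nonneg order_trans[OF s(1)])
      finally have bd: "norm (I L - R L) \<le> (\<Sum>k\<in>{2..<n L}. char_error k (\<theta> * c L / norming \<beta> (Suc k)))" for L .
      have "(\<lambda>L. \<Sum>k\<in>{2..<n L}. char_error k (\<theta> * c L / norming \<beta> (Suc k))) \<longlonglongrightarrow> 0"
      proof (rule char_error_sum_vanishes[OF b n])
        fix L
        show "(\<theta> * c L)\<^sup>2 * clock \<beta> (n L) \<le> \<theta>\<^sup>2 * \<gamma>"
          using mult_left_mono[OF \<gamma>[of L], of "\<theta>\<^sup>2"] by (simp add: power_mult_distrib mult.assoc)
      qed
      then have IR: "(\<lambda>L. I L - R L) \<longlonglongrightarrow> 0"
        by (rule Lim_null_comparison[rotated]) (use bd in auto)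
      have "(\<lambda>L. exp (- \<theta>\<^sup>2 * ((c L)\<^sup>2 * (clock \<beta> (n L) - clock \<beta> (s L))) / 2) *\<^sub>R J L) \<longlonglongrightarrow> exp (- \<theta>\<^sup>2 * 1 / 2) *\<^sub>R of_real q"
        unfolding J by (intro tendsto_intros c q) auto
      then have "R \<longlonglongrightarrow> exp (- \<theta>\<^sup>2 / 2) *\<^sub>R of_real q"
        by (simp add: R_def[abs_def] power_mult_distrib mult.assoc)
      from tendsto_add[OF IR this] show ?thesis by (simp add: I_def scaleR_conv_of_real mult.commute)
    qed
    (* The continuity theorem needs a probability law for every L, also where conditioning is impossible. *)
    define \<mu> where "\<mu> L = (if 0 < prob (A L) then distr (uniform_measure M (A L)) borel (V L) else std_normal_distribution)" for L
    have Apos: "emeasure M (A L) \<noteq> 0" "emeasure M (A L) \<noteq> \<infinity>" if "0 < prob (A L)" for L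
      using that by (auto simp: emeasure_eq_measure)
    have rd: "real_distribution (\<mu> L)" for L
    proof (cases "0 < prob (A L)")
      case True
      interpret U: prob_space "uniform_measure M (A L)"
        by (rule prob_space_uniform_measure[OF Apos[OF True]])
      show ?thesis using True by (auto simp: \<mu>_def intro!: U.real_distribution_distr)
    qed (simp add: \<mu>_def real_dist_normal_dist)
    have "eventually (\<lambda>L. 0 < prob (A L)) sequentially"
      using order_tendstoD(1)[OF q qpos] by (simp add: A_def)
    note ev_pos = this
    have "weak_conv_m \<mu> std_normal_distribution"
    proof (rule levy_continuity[OF rd real_dist_normal_dist])
      fix \<theta>
      have "(\<lambda>L. (\<integral>\<omega>. of_bool (Q L \<omega>) * iexp (\<theta> * V L \<omega>) \<partial>M) / of_real (prob (A L))) \<longlonglongrightarrow>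
        (of_real q * of_real (exp (- \<theta>\<^sup>2 / 2))) / of_real q"
        using False by (intro tendsto_divide char tendsto_of_real) (auto simp: A_def intro: q)
      then have "(\<lambda>L. (\<integral>\<omega>. of_bool (Q L \<omega>) * iexp (\<theta> * V L \<omega>) \<partial>M) / of_real (prob (A L))) \<longlonglongrightarrow> char std_normal_distribution \<theta>"
        using False by (simp add: char_std_normal_distribution)
      moreover have "eventually (\<lambda>L. (\<integral>\<omega>. of_bool (Q L \<omega>) * iexp (\<theta> * V L \<omega>) \<partial>M) / of_real (prob (A L)) = char (\<mu> L) \<theta>) sequentially"
        using ev_pos
      proof eventually_elim
        case (elim L)
        have "char (\<mu> L) \<theta> = (\<integral>\<omega>. iexp (\<theta> * V L \<omega>) \<partial>uniform_measure M (A L))"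
          unfolding char_def using elim by (simp add: \<mu>_def integral_distr)
        also have "uniform_measure M (A L) = density M (\<lambda>\<omega>. ennreal (indicator (A L) \<omega> / prob (A L)))"
          unfolding uniform_measure_def
        proof (rule density_cong)
          show "AE x in M. indicator (A L) x / emeasure M (A L) = ennreal (indicator (A L) x / prob (A L))"
            using elim by (intro AE_I2) (auto simp: indicator_def emeasure_eq_measure divide_ennreal[symmetric] ennreal_1[symmetric] simp del: ennreal_1)
        qed auto
        also have "(\<integral>\<omega>. iexp (\<theta> * V L \<omega>) \<partial>\<dots>) = (\<integral>\<omega>. (indicator (A L) \<omega> / prob (A L)) *\<^sub>R iexp (\<theta> * V L \<omega>) \<partial>M)"
          by (rule integral_density) auto
        also have "\<dots> = (\<integral>\<omega>. (of_bool (Q L \<omega>) * iexp (\<theta> * V L \<omega>)) / of_real (prob (A L)) \<partial>M)"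
          by (rule Bochner_Integration.integral_cong) (auto simp: A_def indicator_def scaleR_conv_of_real)
        finally show ?case by simp
      qed
      ultimately show "(\<lambda>L. char (\<mu> L) \<theta>) \<longlonglongrightarrow> char std_normal_distribution \<theta>"
        by (rule Lim_transform_eventually)
    qed
    then have cdf: "(\<lambda>L. cdf (\<mu> L) x) \<longlonglongrightarrow> cdf std_normal_distribution x" for x
      using isCont_cdf_std_normal unfolding weak_conv_m_def weak_conv_def by blast
    have "(\<lambda>L. prob (A L) * (cdf (\<mu> L) hi - cdf (\<mu> L) lo)) \<longlonglongrightarrow> q * (cdf std_normal_distribution hi - cdf std_normal_distribution lo)"
      unfolding A_def by (intro tendsto_intros cdf q)
    moreover have "eventually (\<lambda>L. prob (A L) * (cdf (\<mu> L) hi - cdf (\<mu> L) lo) = \<P>(\<omega> in M. Q L \<omega> \<and> V L \<omega> \<in> {lo<..hi})) sequentially"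
      using ev_pos
    proof eventually_elim
      case (elim L)
      interpret U: real_distribution "\<mu> L" by (rule rd)
      have "cdf (\<mu> L) hi - cdf (\<mu> L) lo = measure (\<mu> L) {lo<..hi}"
        using U.cdf_diff_eq[OF lu] by simp
      also have "\<dots> = measure (uniform_measure M (A L)) (V L -` {lo<..hi} \<inter> space M)"
        using elim by (simp add: \<mu>_def measure_distr)
      also have "\<dots> = prob (A L \<inter> (V L -` {lo<..hi} \<inter> space M)) / prob (A L)"
        by (rule measure_uniform_measure) (use Apos[OF elim] in auto)
      finally show ?case unfolding ev using elim by simp
    qed
    ultimately have "(\<lambda>L. \<P>(\<omega> in M. Q L \<omega> \<and> V L \<omega> \<in> {lo<..hi})) \<longlonglongrightarrow> q * (cdf std_normal_distribution hi - cdf std_normal_distribution lo)"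
      by (rule Lim_transform_eventually)
    then show ?thesis using N.cdf_diff_eq[OF lu] by (simp add: V_def)
  qed
qed

text \<open>
  Induction over the blocks: the event that the earlier increments lie in their intervals is the event of the past
  in \<open>conditional_clt\<close>.
\<close>

lemma increment_boxes:
  fixes T :: "nat \<Rightarrow> nat \<Rightarrow> nat" and c :: "nat \<Rightarrow> real" and \<sigma> lo hi :: "nat \<Rightarrow> real"
  assumes b: "\<beta> \<le> 1 / 2"
    and T: "\<And>j L. 2 \<le> T j L" "\<And>j L. T j L \<le> T (Suc j) L" "\<And>j. filterlim (T (Suc j)) at_top sequentially"
    and c: "\<And>j. (\<lambda>L. (c L)\<^sup>2 * (clock \<beta> (T (Suc j) L) - clock \<beta> (T j L))) \<longlonglongrightarrow> (\<sigma> j)\<^sup>2"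
    and \<gamma>: "\<And>j. \<exists>\<gamma>. \<forall>L. (c L)\<^sup>2 * clock \<beta> (T (Suc j) L) \<le> \<gamma>"
    and \<sigma>: "\<And>j. 0 < \<sigma> j"
    and lu: "\<And>j. j < m \<Longrightarrow> lo j < hi j"
  shows "(\<lambda>L. \<P>(\<omega> in M. \<forall>j<m. lo j < c L * (mart (T (Suc j) L) \<omega> - mart (T j L) \<omega>)
      \<and> c L * (mart (T (Suc j) L) \<omega> - mart (T j L) \<omega>) \<le> hi j))
    \<longlonglongrightarrow> (\<Prod>j<m. measure std_normal_distribution {lo j / \<sigma> j<..hi j / \<sigma> j})"
  using lu
proof (induction m)
  case 0
  then show ?case by (simp add: prob_space)
next
  case (Suc m)
  define I where "I j L \<omega> \<longleftrightarrow> lo j < c L * (mart (T (Suc j) L) \<omega> - mart (T j L) \<omega>)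
      \<and> c L * (mart (T (Suc j) L) \<omega> - mart (T j L) \<omega>) \<le> hi j" for j L \<omega>
  have Tmono: "T i L \<le> T j L" if "i \<le> j" for i j L
    using that by (rule lift_Suc_mono_le[of "\<lambda>j. T j L", OF T(2)])
  obtain \<gamma>0 where \<gamma>0: "\<And>L. (c L)\<^sup>2 * clock \<beta> (T (Suc m) L) \<le> \<gamma>0" using \<gamma> by blast
  have "(\<lambda>L. \<P>(\<omega> in M. (\<forall>j\<in>{..<m}. I j L \<omega>) \<and> c L / \<sigma> m * (mart (T (Suc m) L) \<omega> - mart (T m L) \<omega>) \<in> {lo m / \<sigma> m<..hi m / \<sigma> m}))
    \<longlonglongrightarrow> (\<Prod>j<m. measure std_normal_distribution {lo j / \<sigma> j<..hi j / \<sigma> j}) * measure std_normal_distribution {lo m / \<sigma> m<..hi m / \<sigma> m}"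
  proof (rule conditional_clt[OF b T(1) T(2) T(3)])
    fix L
    show "adapted (T m L) (\<lambda>\<omega>. \<forall>j\<in>{..<m}. I j L \<omega>)"
      unfolding I_def
      by (rule adapted_Ball, rule adapted_comp2[OF adapted_mart adapted_mart]) (auto intro: Tmono)
    show "(c L / \<sigma> m)\<^sup>2 * clock \<beta> (T (Suc m) L) \<le> \<gamma>0 / (\<sigma> m)\<^sup>2"
      using \<gamma>0[of L] by (simp add: power_divide divide_right_mono)
  next
    show "(\<lambda>L. \<P>(\<omega> in M. \<forall>j\<in>{..<m}. I j L \<omega>)) \<longlonglongrightarrow> (\<Prod>j<m. measure std_normal_distribution {lo j / \<sigma> j<..hi j / \<sigma> j})"
      using Suc.IH Suc.prems by (simp add: I_def Ball_def)
    have "(\<lambda>L. (c L)\<^sup>2 * (clock \<beta> (T (Suc m) L) - clock \<beta> (T m L)) / (\<sigma> m)\<^sup>2) \<longlonglongrightarrow> (\<sigma> m)\<^sup>2 / (\<sigma> m)\<^sup>2"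
      by (intro tendsto_divide c tendsto_const) (use \<sigma>[of m] in auto)
    then show "(\<lambda>L. (c L / \<sigma> m)\<^sup>2 * (clock \<beta> (T (Suc m) L) - clock \<beta> (T m L))) \<longlonglongrightarrow> 1"
      using \<sigma>[of m] by (simp add: power_divide)
    show "lo m / \<sigma> m < hi m / \<sigma> m" using Suc.prems[of m] \<sigma>[of m] by (simp add: divide_strict_right_mono)
  qed
  moreover have "{\<omega> \<in> space M. (\<forall>j\<in>{..<m}. I j L \<omega>) \<and> c L / \<sigma> m * (mart (T (Suc m) L) \<omega> - mart (T m L) \<omega>) \<in> {lo m / \<sigma> m<..hi m / \<sigma> m}}
    = {\<omega> \<in> space M. \<forall>j<Suc m. I j L \<omega>}" for L
  proof -
    have "c L / \<sigma> m * x \<in> {lo m / \<sigma> m<..hi m / \<sigma> m} \<longleftrightarrow> lo m < c L * x \<and> c L * x \<le> hi m" for x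
      using \<sigma>[of m] by (simp add: divide_less_cancel divide_le_cancel)
    then show ?thesis by (auto simp: I_def less_Suc_eq)
  qed
  ultimately show ?case by (simp add: I_def)
qed

end

lemma sets_Collect_slab:
  assumes [measurable]: "f \<in> borel_measurable M"
  shows "{\<omega> \<in> space M. a < f \<omega> \<and> f \<omega> \<le> (b :: real)} \<in> sets M"
  by measurable

lemma sets_Collect_box:
  fixes f :: "nat \<Rightarrow> 'a \<Rightarrow> real"
  assumes "\<And>j. j < m \<Longrightarrow> f j \<in> borel_measurable M"
  shows "{\<omega> \<in> space M. \<forall>j<m. a j < f j \<omega> \<and> f j \<omega> \<le> b j} \<in> sets M"
  using assms
proof (induction m)
  case (Suc m)
  have "{\<omega> \<in> space M. \<forall>j<Suc m. a j < f j \<omega> \<and> f j \<omega> \<le> b j}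
    = {\<omega> \<in> space M. \<forall>j<m. a j < f j \<omega> \<and> f j \<omega> \<le> b j} \<inter> {\<omega> \<in> space M. a m < f m \<omega> \<and> f m \<omega> \<le> b m}"
    by (auto simp: less_Suc_eq)
  also have "\<dots> \<in> sets M" using Suc by (intro sets.Int sets_Collect_slab) auto
  finally show ?case .
qed simp

text \<open>
  Convergence of box probabilities implies the open-set half of weak convergence for the image under
  a Lipschitz map: the set \<open>{F > c}\<close> is covered by finitely many small boxes up to mass \<open>\<epsilon>\<close>, and on these boxes
  \<open>F > c'\<close>.
\<close>

lemma box_portmanteau:
  fixes V :: "nat \<Rightarrow> nat \<Rightarrow> 'a \<Rightarrow> real" and G :: "nat \<Rightarrow> 'b \<Rightarrow> real" and F :: "(nat \<Rightarrow> real) \<Rightarrow> real"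
  assumes "prob_space M" "prob_space N"
    and V: "\<And>L j. j < m \<Longrightarrow> V L j \<in> borel_measurable M" and G: "\<And>j. j < m \<Longrightarrow> G j \<in> borel_measurable N"
    and box: "\<And>l u :: nat \<Rightarrow> real. (\<And>j. j < m \<Longrightarrow> l j < u j) \<Longrightarrow>
      (\<lambda>L. \<P>(\<omega> in M. \<forall>j<m. l j < V L j \<omega> \<and> V L j \<omega> \<le> u j))
        \<longlonglongrightarrow> \<P>(\<omega> in N. \<forall>j<m. l j < G j \<omega> \<and> G j \<omega> \<le> u j)"
    and K: "0 \<le> K" and F: "\<And>x y h. (\<And>j. j < m \<Longrightarrow> \<bar>x j - y j\<bar> \<le> h) \<Longrightarrow> \<bar>F x - F y\<bar> \<le> K * h"
    and FV: "\<And>L. {\<omega> \<in> space M. c' < F (\<lambda>j. V L j \<omega>)} \<in> sets M"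
    and FG: "{\<omega> \<in> space N. c < F (\<lambda>j. G j \<omega>)} \<in> sets N"
    and c: "c' < c" and \<epsilon>: "0 < \<epsilon>"
  shows "\<forall>\<^sub>F L in sequentially. \<P>(\<omega> in N. c < F (\<lambda>j. G j \<omega>)) - \<epsilon> \<le> \<P>(\<omega> in M. c' < F (\<lambda>j. V L j \<omega>))"
proof -
  interpret M: prob_space M by fact
  interpret N: prob_space N by fact
  (* The mesh is so small that F varies by less than c - c' on a box. *)
  define h where "h = (c - c') / (K + 1)"
  have h: "0 < h" using c K by (simp add: h_def)
  have Kh: "K * h \<le> c - c'" using c K by (simp add: h_def field_simps)
  define inbox :: "(nat \<Rightarrow> int) \<Rightarrow> (nat \<Rightarrow> real) \<Rightarrow> bool"
    where "inbox k x \<longleftrightarrow> (\<forall>j<m. of_int (k j) * h < x j \<and> x j \<le> (of_int (k j) + 1) * h)" for k x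
  have mbV: "{\<omega> \<in> space M. inbox k (\<lambda>j. V L j \<omega>)} \<in> sets M" for k L
    unfolding inbox_def by (rule sets_Collect_box[OF V])
  have mbG: "{\<omega> \<in> space N. inbox k (\<lambda>j. G j \<omega>)} \<in> sets N" for k
    unfolding inbox_def by (rule sets_Collect_box[OF G])
  define big where "big n = {\<omega> \<in> space N. \<forall>j<m. - (real n * h) < G j \<omega> \<and> G j \<omega> \<le> real n * h}" for n
  have mbig: "big n \<in> sets N" for n
    unfolding big_def by (rule sets_Collect_box[OF G])
  have "incseq big"
  proof (rule incseq_SucI)
    fix n
    have "real n * h \<le> real (Suc n) * h" using h by (intro mult_right_mono) auto
    then show "big n \<le> big (Suc n)" by (force simp: big_def)
  qed
  moreover have "(\<Union>n. big n) = space N"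
  proof (intro equalityI subsetI)
    fix \<omega> assume \<omega>: "\<omega> \<in> space N"
    obtain n where n: "(\<Sum>j<m. \<bar>G j \<omega>\<bar>) + h < real n * h"
      using reals_Archimedean3[OF h] by blast
    have "\<bar>G j \<omega>\<bar> \<le> (\<Sum>j<m. \<bar>G j \<omega>\<bar>)" if "j < m" for j
      using that by (intro member_le_sum) auto
    then have "\<omega> \<in> big n" using \<omega> n h by (force simp: big_def)
    then show "\<omega> \<in> (\<Union>n. big n)" by blast
  qed (auto simp: big_def)
  ultimately have "(\<lambda>n. measure N (big n)) \<longlonglongrightarrow> 1"
    using N.finite_Lim_measure_incseq[of big] mbig by (auto simp: N.prob_space image_subset_iff)
  then have "eventually (\<lambda>n. 1 - \<epsilon> / 2 < measure N (big n)) sequentially"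
    using \<epsilon> by (intro order_tendstoD(1)) auto
  then obtain n where n: "1 - \<epsilon> / 2 < measure N (big n)" by (auto simp: eventually_sequentially)
  define I where "I = (\<Pi>\<^sub>E j\<in>{..<m}. {- int n..<int n})"
  define Good where "Good = {k \<in> I. \<exists>x. inbox k x \<and> c < F x}"
  have fin: "finite Good" unfolding Good_def I_def by (auto intro!: finite_PiE)
  have good: "c' < F y" if kG: "k \<in> Good" and y: "inbox k y" for k y
  proof -
    obtain x where x: "inbox k x" "c < F x" using kG by (auto simp: Good_def)
    have "\<bar>x j - y j\<bar> \<le> h" if "j < m" for j
    proof -
      have "of_int (k j) * h < x j" "x j \<le> of_int (k j) * h + h" "of_int (k j) * h < y j" "y j \<le> of_int (k j) * h + h"
        using x(1) y that by (auto simp: inbox_def algebra_simps)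
      then show ?thesis by linarith
    qed
    from F[OF this] have "\<bar>F x - F y\<bar> \<le> K * h" .
    then show ?thesis using x Kh by linarith
  qed
  have cover: "{\<omega> \<in> space N. c < F (\<lambda>j. G j \<omega>)} \<inter> big n \<subseteq> (\<Union>k\<in>Good. {\<omega> \<in> space N. inbox k (\<lambda>j. G j \<omega>)})"
  proof
    fix \<omega> assume \<omega>: "\<omega> \<in> {\<omega> \<in> space N. c < F (\<lambda>j. G j \<omega>)} \<inter> big n"
    define k where "k = (\<lambda>j\<in>{..<m}. \<lceil>G j \<omega> / h\<rceil> - 1)"
    have ib: "inbox k (\<lambda>j. G j \<omega>)"
      unfolding inbox_def
    proof (intro allI impI)
      fix j assume j: "j < m"
      have "of_int (k j) < G j \<omega> / h" "G j \<omega> / h \<le> of_int (k j) + 1"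
        using j by (simp_all add: k_def) linarith+
      then show "of_int (k j) * h < G j \<omega> \<and> G j \<omega> \<le> (of_int (k j) + 1) * h"
        using h by (simp add: field_simps)
    qed
    have "k \<in> I" unfolding I_def
    proof (rule PiE_I)
      fix j assume j: "j \<in> {..<m}"
      have "- real n < G j \<omega> / h" "G j \<omega> / h \<le> real n"
        using \<omega> j h by (auto simp: big_def field_simps)
      then show "k j \<in> {- int n..<int n}" using j by (simp add: k_def) linarith
    qed (auto simp: k_def)
    with ib \<omega> have "k \<in> Good" by (auto simp: Good_def)
    with ib \<omega> show "\<omega> \<in> (\<Union>k\<in>Good. {\<omega> \<in> space N. inbox k (\<lambda>j. G j \<omega>)})" by auto
  qed
  have lower: "\<P>(\<omega> in N. c < F (\<lambda>j. G j \<omega>)) - \<epsilon> / 2 \<le> (\<Sum>k\<in>Good. \<P>(\<omega> in N. inbox k (\<lambda>j. G j \<omega>)))"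
  proof -
    define D where "D = {\<omega> \<in> space N. c < F (\<lambda>j. G j \<omega>)}"
    have D: "D \<in> sets N" using FG by (simp add: D_def)
    have "measure N D \<le> measure N ((D \<inter> big n) \<union> (space N - big n))"
      using D mbig sets.sets_into_space[OF D] by (intro N.finite_measure_mono) auto
    also have "\<dots> \<le> measure N (D \<inter> big n) + measure N (space N - big n)"
      using D mbig by (intro measure_Un_le) auto
    also have "measure N (space N - big n) \<le> \<epsilon> / 2" using n N.prob_compl[OF mbig] by simp
    also have "measure N (D \<inter> big n) \<le> measure N (\<Union>k\<in>Good. {\<omega> \<in> space N. inbox k (\<lambda>j. G j \<omega>)})"
      using cover mbG fin by (intro N.finite_measure_mono) (auto simp: D_def)
    also have "\<dots> \<le> (\<Sum>k\<in>Good. \<P>(\<omega> in N. inbox k (\<lambda>j. G j \<omega>)))"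
      using mbG fin by (intro measure_UNION_le) auto
    finally show ?thesis by (simp add: D_def)
  qed
  have upper: "(\<Sum>k\<in>Good. \<P>(\<omega> in M. inbox k (\<lambda>j. V L j \<omega>))) \<le> \<P>(\<omega> in M. c' < F (\<lambda>j. V L j \<omega>))" for L
  proof -
    have "disjoint_family_on (\<lambda>k. {\<omega> \<in> space M. inbox k (\<lambda>j. V L j \<omega>)}) Good"
    proof (unfold disjoint_family_on_def, intro ballI impI)
      fix k k' assume k: "k \<in> Good" "k' \<in> Good" "k \<noteq> k'"
      have "k = k'" if "inbox k x" "inbox k' x" for x
      proof (rule PiE_ext[of _ "{..<m}" "\<lambda>_. {- int n..<int n}"])
        show "k \<in> {..<m} \<rightarrow>\<^sub>E {- int n..<int n}" "k' \<in> {..<m} \<rightarrow>\<^sub>E {- int n..<int n}"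
          using k by (auto simp: Good_def I_def)
        fix j assume "j \<in> {..<m}"
        then have "of_int (k j) * h < (of_int (k' j) + 1) * h" "of_int (k' j) * h < (of_int (k j) + 1) * h"
          using that unfolding inbox_def by (meson lessThan_iff less_le_trans)+
        then have "of_int (k j) < (of_int (k' j) + 1 :: real)" "of_int (k' j) < (of_int (k j) + 1 :: real)"
          using h by (simp_all only: mult_less_cancel_right_pos)
        then show "k j = k' j" by linarith
      qed
      with k show "{\<omega> \<in> space M. inbox k (\<lambda>j. V L j \<omega>)} \<inter> {\<omega> \<in> space M. inbox k' (\<lambda>j. V L j \<omega>)} = {}" by auto
    qed
    then have "(\<Sum>k\<in>Good. \<P>(\<omega> in M. inbox k (\<lambda>j. V L j \<omega>))) = measure M (\<Union>k\<in>Good. {\<omega> \<in> space M. inbox k (\<lambda>j. V L j \<omega>)})"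
      using mbV fin by (intro M.finite_measure_finite_Union[symmetric]) auto
    also have "\<dots> \<le> \<P>(\<omega> in M. c' < F (\<lambda>j. V L j \<omega>))"
      using good FV by (intro M.finite_measure_mono) auto
    finally show ?thesis .
  qed
  have "(\<lambda>L. \<Sum>k\<in>Good. \<P>(\<omega> in M. inbox k (\<lambda>j. V L j \<omega>))) \<longlonglongrightarrow> (\<Sum>k\<in>Good. \<P>(\<omega> in N. inbox k (\<lambda>j. G j \<omega>)))"
    unfolding inbox_def using h by (intro tendsto_sum box) (auto simp: algebra_simps)
  then have "eventually (\<lambda>L. (\<Sum>k\<in>Good. \<P>(\<omega> in N. inbox k (\<lambda>j. G j \<omega>))) - \<epsilon> / 2 < (\<Sum>k\<in>Good. \<P>(\<omega> in M. inbox k (\<lambda>j. V L j \<omega>)))) sequentially"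
    using \<epsilon> by (intro order_tendstoD(1)) auto
  then show ?thesis
  proof eventually_elim
    case (elim L)
    then show ?case using lower upper[of L] by linarith
  qed
qed

section \<open>Cover time and spread\<close>

definition path_spread :: "nat \<Rightarrow> (nat \<Rightarrow> real) \<Rightarrow> real" where
  "path_spread n s = Max (s ` {0..n}) - Min (s ` {0..n})"

lemma path_spread_ge: "i \<le> n \<Longrightarrow> j \<le> n \<Longrightarrow> s i - s j \<le> path_spread n s"
  unfolding path_spread_def by (intro diff_mono Max_ge Min_le) auto

lemma path_spread_attained:
  obtains i j where "i \<le> n" "j \<le> n" "path_spread n s = s i - s j"
proof -
  have "Max (s ` {0..n}) \<in> s ` {0..n}" "Min (s ` {0..n}) \<in> s ` {0..n}"
    by (intro Max_in Min_in, auto)+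
  then obtain i j where "i \<le> n" "j \<le> n" "Max (s ` {0..n}) = s i" "Min (s ` {0..n}) = s j" by fastforce
  then show ?thesis using that by (simp add: path_spread_def)
qed

lemma less_path_spread_iff: "c < path_spread n s \<longleftrightarrow> (\<exists>i\<le>n. \<exists>j\<le>n. c < s i - s j)"
  by (metis path_spread_attained path_spread_ge less_le_trans)

lemma path_spread_mono: "m \<le> n \<Longrightarrow> path_spread m s \<le> path_spread n s"
  by (metis path_spread_attained path_spread_ge order_trans)

lemma path_spread_cong: "(\<And>k. k \<le> n \<Longrightarrow> s k = t k) \<Longrightarrow> path_spread n s = path_spread n t"
  unfolding path_spread_def using image_cong[of "{0..n}" "{0..n}" s t] by simp

lemma path_spread_diff:
  assumes "\<And>i. i \<le> n \<Longrightarrow> \<bar>s i - t i\<bar> \<le> h"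
  shows "\<bar>path_spread n s - path_spread n t\<bar> \<le> 2 * h"
proof -
  have *: "path_spread n s \<le> path_spread n t + 2 * h" if "\<And>i. i \<le> n \<Longrightarrow> \<bar>s i - t i\<bar> \<le> h" for s t
  proof -
    obtain i j where ij: "i \<le> n" "j \<le> n" "path_spread n s = s i - s j" by (rule path_spread_attained)
    show ?thesis using that[OF ij(1)] that[OF ij(2)] path_spread_ge[OF ij(1,2), of t] ij(3) by linarith
  qed
  show ?thesis using *[of s t] *[of t s] assms by (simp add: abs_minus_commute abs_le_iff)
qed

lemma path_spread_scale: "0 \<le> c \<Longrightarrow> path_spread n (\<lambda>k. c * s k) = c * path_spread n s"
proof -
  assume c: "0 \<le> c"
  obtain i j where ij: "i \<le> n" "j \<le> n" "path_spread n (\<lambda>k. c * s k) = c * s i - c * s j" by (rule path_spread_attained)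
  obtain i' j' where ij': "i' \<le> n" "j' \<le> n" "path_spread n s = s i' - s j'" by (rule path_spread_attained)
  have "path_spread n (\<lambda>k. c * s k) = c * (s i - s j)" using ij by (simp add: algebra_simps)
  also have "\<dots> \<le> c * path_spread n s" by (rule mult_left_mono[OF path_spread_ge[OF ij(1,2)] c])
  finally have 1: "path_spread n (\<lambda>k. c * s k) \<le> c * path_spread n s" .
  have 2: "c * path_spread n s \<le> path_spread n (\<lambda>k. c * s k)"
    using path_spread_ge[OF ij'(1,2), of "\<lambda>k. c * s k"] by (simp add: ij'(3) algebra_simps)
  from 1 2 show ?thesis by simp
qed

text \<open>
  Steps of size at most one make the set of visited integers an interval. It meets all residue
  classes if and only if it contains at least \<open>L\<close> integers.
\<close>

lemma residues_covered_iff: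
  fixes s :: "nat \<Rightarrow> int"
  assumes L: "1 \<le> L" and step: "\<And>k. \<bar>s (Suc k) - s k\<bar> \<le> 1"
  shows "(\<lambda>k. s k mod int L) ` {0..n} = {0..<int L} \<longleftrightarrow> real L - 1 \<le> path_spread n (\<lambda>k. real_of_int (s k))"
proof -
  obtain i j where ij: "i \<le> n" "j \<le> n" and sp: "path_spread n (\<lambda>k. real_of_int (s k)) = real_of_int (s i) - real_of_int (s j)"
    by (rule path_spread_attained)
  have max: "s k \<le> s i" if "k \<le> n" for k
    using path_spread_ge[OF that ij(2), of "\<lambda>k. real_of_int (s k)"] sp by simp
  have min: "s j \<le> s k" if "k \<le> n" for k
    using path_spread_ge[OF ij(1) that, of "\<lambda>k. real_of_int (s k)"] sp by simp
  have img: "s ` {0..n} = {s j..s i}"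
  proof (intro equalityI subsetI)
    fix x assume x: "x \<in> {s j..s i}"
    show "x \<in> s ` {0..n}"
    proof (cases "j \<le> i")
      case True
      have "\<exists>k\<ge>j. k \<le> i \<and> s k = x"
        by (rule nat_intermed_int_val) (use x True step in auto)
      then show ?thesis using ij by fastforce
    next
      case False
      have st: "\<bar>- s (Suc k) - - s k\<bar> \<le> 1" for k using step[of k] by linarith
      have "\<exists>k\<ge>i. k \<le> j \<and> - s k = - x"
        by (rule nat_intermed_int_val) (use x False st in auto)
      then show ?thesis using ij by fastforce
    qed
  qed (use max min in auto)
  have eq: "(\<lambda>k. s k mod int L) ` {0..n} = (\<lambda>x. x mod int L) ` {s j..s i}"
    unfolding img[symmetric] by (simp add: image_image)
  have "(\<lambda>x. x mod int L) ` {s j..s i} = {0..<int L} \<longleftrightarrow> int L - 1 \<le> s i - s j"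
  proof
    assume "(\<lambda>x. x mod int L) ` {s j..s i} = {0..<int L}"
    then have "card {0..<int L} \<le> card {s j..s i}" by (metis card_image_le finite_atLeastAtMost_int)
    then show "int L - 1 \<le> s i - s j" using L by simp
  next
    assume le: "int L - 1 \<le> s i - s j"
    show "(\<lambda>x. x mod int L) ` {s j..s i} = {0..<int L}"
    proof (intro equalityI subsetI)
      fix c assume c: "c \<in> {0..<int L}"
      define x where "x = s j + (c - s j) mod int L"
      have "0 \<le> (c - s j) mod int L" "(c - s j) mod int L < int L" using L by auto
      then have "x \<in> {s j..s i}" using le by (auto simp: x_def)
      moreover have "x mod int L = c" using c by (simp add: x_def mod_add_right_eq)
      ultimately show "c \<in> (\<lambda>x. x mod int L) ` {s j..s i}" by force
    qed (use L in auto)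
  qed
  also have "\<dots> \<longleftrightarrow> real L - 1 \<le> path_spread n (\<lambda>k. real_of_int (s k))" unfolding sp by linarith
  finally show ?thesis unfolding eq .
qed

lemma std_normal_interval_le:
  assumes "a \<le> b" shows "measure std_normal_distribution {a<..b} \<le> b - a"
proof -
  have d1: "std_normal_density x \<le> 1" for x
  proof -
    have "1 \<le> sqrt (2 * pi)" using pi_gt3 by simp
    then have "1 / sqrt (2 * pi) * exp (- x\<^sup>2 / 2) \<le> 1 * 1"
      by (intro mult_mono) auto
    then show ?thesis by (simp add: std_normal_density_def)
  qed
  have "emeasure std_normal_distribution {a<..b} = (\<integral>\<^sup>+ x. ennreal (std_normal_density x) * indicator {a<..b} x \<partial>lborel)"
    by (rule emeasure_density) auto
  also have "\<dots> \<le> (\<integral>\<^sup>+ x. indicator {a<..b} x \<partial>lborel)"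
    by (intro nn_integral_mono) (auto simp: indicator_def intro: d1)
  also have "\<dots> = ennreal (b - a)" using assms by simp
  finally have "emeasure std_normal_distribution {a<..b} \<le> ennreal (b - a)" .
  then show ?thesis using assms unfolding measure_def by (metis diff_ge_0_iff_ge enn2real_ennreal enn2real_mono ennreal_less_top)
qed

context elephant_random_walk
begin

definition spread :: "nat \<Rightarrow> 'a \<Rightarrow> real" where
  "spread n \<omega> = path_spread n (\<lambda>k. walk k \<omega>)"

lemma adapted_spread: "m \<le> n \<Longrightarrow> adapted n (spread m)"
proof (unfold adapted_def, intro allI impI)
  fix \<omega> \<omega>' assume m: "m \<le> n" and eq: "\<forall>k\<in>{1..n}. X k \<omega> = X k \<omega>'"
  have "walk k \<omega> = walk k \<omega>'" if "k \<le> n" for k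
    using adapted_walk[OF that] eq unfolding adapted_def by blast
  then show "spread m \<omega> = spread m \<omega>'" unfolding spread_def using m by (intro path_spread_cong) auto
qed

lemma spread_history: "spread n \<omega> = path_spread n (\<lambda>k. real_of_int (sum_list (take k (history n \<omega>))))"
  unfolding spread_def
proof (rule path_spread_cong)
  fix k assume "k \<le> n"
  then have "take k (history n \<omega>) = history k \<omega>" by (simp add: history_def take_map take_upt del: upt_Suc)
  then show "walk k \<omega> = real_of_int (sum_list (take k (history n \<omega>)))" by (simp add: walk_eq_sum_list)
qed

lemma walk_0 [simp]: "walk 0 \<omega> = 0"
  by (simp add: walk_def lifted_walk_def)

lemma abs_walk_le_spread: "k \<le> n \<Longrightarrow> \<bar>walk k \<omega>\<bar> \<le> spread n \<omega>"
  using path_spread_ge[of k n 0 "\<lambda>k. walk k \<omega>"] path_spread_ge[of 0 n k "\<lambda>k. walk k \<omega>"]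
  by (simp add: spread_def)

lemma cover_time_le_iff_covered:
  assumes "1 \<le> L"
  shows "cover_time L X \<omega> \<le> enat n \<longleftrightarrow> (\<exists>m\<le>n. (\<lambda>k. cyclic_walk L X k \<omega>) ` {0..m} = {0..<int L})"
proof
  define A where "A = {enat n | n. (\<lambda>k. cyclic_walk L X k \<omega>) ` {0..n} = {0..<int L}}"
  assume "cover_time L X \<omega> \<le> enat n"
  then have le: "Inf A \<le> enat n" by (simp add: cover_time_def A_def)
  then have ne: "A \<noteq> {}" by (auto simp: Inf_enat_def)
  then have "Inf A \<in> A" unfolding Inf_enat_def using LeastI_ex[of "\<lambda>x. x \<in> A"] by auto
  then obtain m where "Inf A = enat m" "(\<lambda>k. cyclic_walk L X k \<omega>) ` {0..m} = {0..<int L}" by (auto simp: A_def)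
  with le show "\<exists>m\<le>n. (\<lambda>k. cyclic_walk L X k \<omega>) ` {0..m} = {0..<int L}" by auto
next
  assume "\<exists>m\<le>n. (\<lambda>k. cyclic_walk L X k \<omega>) ` {0..m} = {0..<int L}"
  then obtain m where m: "m \<le> n" "(\<lambda>k. cyclic_walk L X k \<omega>) ` {0..m} = {0..<int L}" by auto
  then have "cover_time L X \<omega> \<le> enat m" unfolding cover_time_def by (intro Inf_lower) auto
  with m show "cover_time L X \<omega> \<le> enat n" by (meson enat_ord_simps(1) order_trans)
qed

lemma cover_time_le_iff:
  assumes L: "1 \<le> L" and X: "\<forall>k\<ge>1. X k \<omega> = 1 \<or> X k \<omega> = -1"
  shows "cover_time L X \<omega> \<le> enat n \<longleftrightarrow> real L - 1 \<le> spread n \<omega>"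
proof -
  have step: "\<bar>lifted_walk X (Suc k) \<omega> - lifted_walk X k \<omega>\<bar> \<le> 1" for k
    using X[rule_format, of "Suc k"] by (auto simp: lifted_walk_def)
  have cov: "(\<lambda>k. cyclic_walk L X k \<omega>) ` {0..m} = {0..<int L} \<longleftrightarrow> real L - 1 \<le> spread m \<omega>" for m
    using residues_covered_iff[of L "\<lambda>k. lifted_walk X k \<omega>" m, OF L step]
    by (simp add: cyclic_walk_def spread_def walk_def)
  show ?thesis
    unfolding cover_time_le_iff_covered[OF L] cov
    using path_spread_mono[of _ n "\<lambda>k. walk k \<omega>"] by (force simp: spread_def)
qed

lemma cover_time_le_event:
  assumes L: "1 \<le> L" shows "{\<omega> \<in> space M. cover_time L X \<omega> \<le> enat n} \<in> events"
proof (rule adapted_event[of n], unfold cover_time_le_iff_covered[OF L])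
  have "adapted n (\<lambda>\<omega>. (\<lambda>k. cyclic_walk L X k \<omega>) ` {0..m} = {0..<int L})" if "m \<le> n" for m
  proof (unfold adapted_def, intro allI impI)
    fix \<omega> \<omega>' assume eq: "\<forall>k\<in>{1..n}. X k \<omega> = X k \<omega>'"
    have "cyclic_walk L X k \<omega> = cyclic_walk L X k \<omega>'" if "k \<le> n" for k
      using adapted_lifted_walk[OF that] eq unfolding adapted_def cyclic_walk_def by metis
    then have "(\<lambda>k. cyclic_walk L X k \<omega>) ` {0..m} = (\<lambda>k. cyclic_walk L X k \<omega>') ` {0..m}"
      using that by (intro image_cong) auto
    then show "((\<lambda>k. cyclic_walk L X k \<omega>) ` {0..m} = {0..<int L}) = ((\<lambda>k. cyclic_walk L X k \<omega>') ` {0..m} = {0..<int L})"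
      by simp
  qed
  then have "adapted n (\<lambda>\<omega>. \<exists>m\<in>{..n}. (\<lambda>k. cyclic_walk L X k \<omega>) ` {0..m} = {0..<int L})"
    by (intro adapted_Bex) auto
  then show "adapted n (\<lambda>\<omega>. \<exists>m\<le>n. (\<lambda>k. cyclic_walk L X k \<omega>) ` {0..m} = {0..<int L})"
    by (simp add: Bex_def)
qed

lemma cover_time_measurable:
  assumes L: "1 \<le> L"
  shows "(\<lambda>\<omega>. ereal_of_enat (cover_time L X \<omega>)) \<in> borel_measurable M"
proof -
  have "cover_time L X \<in> measurable M (count_space UNIV)"
  proof (subst measurable_count_space_eq2_countable, intro conjI ballI)
    fix x :: enat
    have fin: "cover_time L X -` {enat n} \<inter> space M \<in> events" for n
    proof -
      have "cover_time L X -` {enat n} \<inter> space M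
        = {\<omega> \<in> space M. cover_time L X \<omega> \<le> enat n} - (\<Union>k\<in>{..<n}. {\<omega> \<in> space M. cover_time L X \<omega> \<le> enat k})"
      proof -
        have "t = enat n \<longleftrightarrow> t \<le> enat n \<and> \<not> (\<exists>k<n. t \<le> enat k)" for t
        proof (cases t)
          case (enat m)
          have "(\<exists>k<n. m \<le> k) \<longleftrightarrow> m < n" by auto
          then show ?thesis using enat by auto
        qed auto
        then show ?thesis by auto
      qed
      also have "\<dots> \<in> events" using cover_time_le_event[OF L] by auto
      finally show ?thesis .
    qed
    show "cover_time L X -` {x} \<inter> space M \<in> events"
    proof (cases x)
      case infinity
      have "cover_time L X -` {\<infinity>} \<inter> space M = space M - (\<Union>n. {\<omega> \<in> space M. cover_time L X \<omega> \<le> enat n})"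
      proof -
        have "t = \<infinity> \<longleftrightarrow> \<not> (\<exists>n. t \<le> enat n)" for t by (cases t) auto
        then show ?thesis by auto
      qed
      also have "\<dots> \<in> events" using cover_time_le_event[OF L] by auto
      finally show ?thesis by (simp add: infinity)
    qed (simp add: fin)
  qed auto
  then show ?thesis by (rule measurable_compose) simp
qed

text \<open>
  The spread dominates \<open>\<bar>S\<^sub>n\<bar>\<close>, and a normal limit on a diverging scale leaves no mass near zero.
\<close>

lemma spread_unbounded:
  assumes b: "\<beta> \<le> 1 / 2"
  shows "(\<lambda>n. \<P>(\<omega> in M. spread n \<omega> < C)) \<longlonglongrightarrow> 0"
proof (rule LIMSEQ_I)
  fix e :: real assume e: "0 < e"
  define h where "h = e / 4"
  have h: "0 < h" using e by (simp add: h_def)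
  define c where "c n = 1 / sqrt (clock \<beta> n)" for n
  have cv: "(c n)\<^sup>2 * clock \<beta> n \<le> 1" "3 \<le> n \<Longrightarrow> (c n)\<^sup>2 * clock \<beta> n = 1" for n
    using clock_nonneg[of \<beta> n] clock_pos[of n \<beta>] beta_bounds(1) by (cases "clock \<beta> n = 0"; simp add: c_def power_divide)+
  have "(\<lambda>L. \<P>(\<omega> in M. True \<and> c (L + 3) * (mart (L + 3) \<omega> - mart 2 \<omega>) \<in> {- h<..h}))
    \<longlonglongrightarrow> 1 * measure std_normal_distribution {- h<..h}"
  proof (rule conditional_clt[OF b])
    show "filterlim (\<lambda>L. L + 3) at_top sequentially" by (rule filterlim_add_const_nat_at_top)
    show "(\<lambda>L. \<P>(\<omega> in M. True)) \<longlonglongrightarrow> 1" by (simp add: prob_space)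
    show "(\<lambda>L. (c (L + 3))\<^sup>2 * (clock \<beta> (L + 3) - clock \<beta> 2)) \<longlonglongrightarrow> 1" by (simp add: cv(2))
  qed (use h cv in auto)
  then have "(\<lambda>L. \<P>(\<omega> in M. c (L + 3) * (mart (L + 3) \<omega> - mart 2 \<omega>) \<in> {- h<..h}))
    \<longlonglongrightarrow> measure std_normal_distribution {- h<..h}" by simp
  then have "(\<lambda>n. \<P>(\<omega> in M. c n * (mart n \<omega> - mart 2 \<omega>) \<in> {- h<..h}))
    \<longlonglongrightarrow> measure std_normal_distribution {- h<..h}" by (rule LIMSEQ_offset)
  moreover have "measure std_normal_distribution {- h<..h} < e"
    using std_normal_interval_le[of "- h" h] h by (simp add: h_def)
  ultimately have 1: "\<forall>\<^sub>F n in sequentially. \<P>(\<omega> in M. c n * (mart n \<omega> - mart 2 \<omega>) \<in> {- h<..h}) < e"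
    by (rule order_tendstoD)
  have sq: "filterlim (\<lambda>n. sqrt ((norming \<beta> n)\<^sup>2 * clock \<beta> n)) at_top sequentially"
    by (rule filterlim_compose[OF sqrt_at_top norming_clock_at_top[OF beta_bounds(1) b]])
  have sq': "filterlim (\<lambda>n. sqrt (clock \<beta> n)) at_top sequentially"
    by (rule filterlim_compose[OF sqrt_at_top clock_at_top[OF beta_bounds(1) b]])
  have "(\<lambda>n. C * inverse (sqrt ((norming \<beta> n)\<^sup>2 * clock \<beta> n)) + 2 * inverse (sqrt (clock \<beta> n))) \<longlonglongrightarrow> C * 0 + 2 * 0"
    by (intro tendsto_intros tendsto_inverse_0_at_top sq sq')
  moreover have "C * inverse (sqrt ((norming \<beta> n)\<^sup>2 * clock \<beta> n)) + 2 * inverse (sqrt (clock \<beta> n))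
    = c n * (C / norming \<beta> n + 2)" for n
    unfolding c_def real_sqrt_mult real_sqrt_abs abs_of_pos[OF norming_beta_pos] inverse_mult_distrib
    by (simp only: divide_inverse ring_distribs mult.commute mult.left_commute mult_1)
  ultimately have "(\<lambda>n. c n * (C / norming \<beta> n + 2)) \<longlonglongrightarrow> 0" by simp
  then have 2: "\<forall>\<^sub>F n in sequentially. c n * (C / norming \<beta> n + 2) < h"
    using h by (rule order_tendstoD)
  from 1 2 have "\<forall>\<^sub>F n in sequentially. \<P>(\<omega> in M. spread n \<omega> < C) < e"
  proof eventually_elim
    case (elim n)
    have "\<P>(\<omega> in M. spread n \<omega> < C) \<le> \<P>(\<omega> in M. c n * (mart n \<omega> - mart 2 \<omega>) \<in> {- h<..h})"
    proof (rule finite_measure_mono_AE)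
      show "{\<omega> \<in> space M. c n * (mart n \<omega> - mart 2 \<omega>) \<in> {- h<..h}} \<in> events"
        by (rule adapted_event[of "max 2 n"], rule adapted_comp2[OF adapted_mart[of n] adapted_mart[of 2]]) auto
      show "AE \<omega> in M. \<omega> \<in> {\<omega> \<in> space M. spread n \<omega> < C} \<longrightarrow> \<omega> \<in> {\<omega> \<in> space M. c n * (mart n \<omega> - mart 2 \<omega>) \<in> {- h<..h}}"
        using AE_steps
      proof eventually_elim
        case (elim \<omega>)
        show ?case
        proof
          assume "\<omega> \<in> {\<omega> \<in> space M. spread n \<omega> < C}"
          then have \<omega>: "\<omega> \<in> space M" "\<bar>walk n \<omega>\<bar> < C" using abs_walk_le_spread[of n n \<omega>] by auto
          have "\<bar>mart n \<omega>\<bar> = \<bar>walk n \<omega>\<bar> / norming \<beta> n" by (simp add: mart_def abs_div abs_of_pos)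
          also have "\<dots> \<le> C / norming \<beta> n" using \<omega> by (intro divide_right_mono) (auto simp: less_imp_le)
          finally have "\<bar>mart n \<omega> - mart 2 \<omega>\<bar> \<le> C / norming \<beta> n + 2" using abs_mart_2_le[OF elim] by linarith
          then have "c n * \<bar>mart n \<omega> - mart 2 \<omega>\<bar> \<le> c n * (C / norming \<beta> n + 2)"
            using clock_nonneg[of \<beta> n] by (intro mult_left_mono) (auto simp: c_def)
          then have "\<bar>c n * (mart n \<omega> - mart 2 \<omega>)\<bar> < h"
            using \<open>c n * (C / norming \<beta> n + 2) < h\<close> clock_nonneg[of \<beta> n] by (simp add: abs_mult c_def)
          then show "\<omega> \<in> {\<omega> \<in> space M. c n * (mart n \<omega> - mart 2 \<omega>) \<in> {- h<..h}}" using \<omega> by auto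
        qed
      qed
    qed
    with elim show ?case by simp
  qed
  then show "\<exists>no. \<forall>n\<ge>no. norm (\<P>(\<omega> in M. spread n \<omega> < C) - 0) < e"
    by (simp add: eventually_sequentially)
qed

lemma cover_time_finite:
  assumes b: "\<beta> \<le> 1 / 2" and L: "1 \<le> L"
  shows "AE \<omega> in M. cover_time L X \<omega> \<noteq> \<infinity>"
proof -
  define A where "A = {\<omega> \<in> space M. cover_time L X \<omega> = \<infinity>}"
  have A: "A \<in> events"
  proof -
    have "A = space M - (\<Union>n. {\<omega> \<in> space M. cover_time L X \<omega> \<le> enat n})"
    proof -
      have "t = \<infinity> \<longleftrightarrow> \<not> (\<exists>n. t \<le> enat n)" for t by (cases t) auto
      then show ?thesis by (auto simp: A_def)
    qed
    then show ?thesis using cover_time_le_event[OF L] by auto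
  qed
  have "prob A \<le> \<P>(\<omega> in M. spread n \<omega> < real L - 1)" for n
  proof (rule finite_measure_mono_AE)
    show "{\<omega> \<in> space M. spread n \<omega> < real L - 1} \<in> events"
      by (rule adapted_event[of n], rule adapted_comp[OF adapted_spread]) simp
    show "AE \<omega> in M. \<omega> \<in> A \<longrightarrow> \<omega> \<in> {\<omega> \<in> space M. spread n \<omega> < real L - 1}"
      using AE_steps
    proof eventually_elim
      case (elim \<omega>)
      show ?case using cover_time_le_iff[OF L elim, of n] by (auto simp: A_def not_le[symmetric])
    qed
  qed
  then have "prob A \<le> 0" by (intro LIMSEQ_le_const[OF spread_unbounded[OF b]]) auto
  then have "prob A = 0" using measure_nonneg[of M A] by linarith
  then show ?thesis using A by (intro AE_I[of _ _ A]) (auto simp: A_def emeasure_eq_measure)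
qed

end

text \<open>
  Only the distribution function of the cover time matters, and it is a probability about the spread,
  hence may be computed for a single walk. At points \<open>x \<le> 0\<close> both sides vanish; at \<open>x = 0\<close> this uses that only
  continuity points of the limit are relevant.
\<close>

lemma cover_time_converges_in_distribution:
  fixes M :: "nat \<Rightarrow> 'a measure" and a :: "nat \<Rightarrow> real" and V :: "'b \<Rightarrow> ereal"
  assumes erw: "\<And>L. 2 \<le> L \<Longrightarrow> elephant_random_walk (M L) p (X L) (u L) (r L)"
    and common: "elephant_random_walk M' p X' u' r'"
    and p: "p \<le> 3 / 4" and K: "prob_space K"
    and a: "\<And>L. 2 \<le> L \<Longrightarrow> 0 < a L"
    and V: "V \<in> borel_measurable K" "AE \<omega> in K. \<bar>V \<omega>\<bar> \<noteq> \<infinity>" "\<And>\<omega>. \<omega> \<in> space K \<Longrightarrow> 0 \<le> V \<omega>"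
    and lim: "\<And>x. 0 < x \<Longrightarrow> isCont (cdf (distr K borel (\<lambda>\<omega>. real_of_ereal (V \<omega>)))) x \<Longrightarrow>
      (\<lambda>L. \<P>(\<omega> in M'. real L - 1 \<le> elephant_random_walk.spread X' (nat \<lfloor>x / a L\<rfloor>) \<omega>))
        \<longlonglongrightarrow> cdf (distr K borel (\<lambda>\<omega>. real_of_ereal (V \<omega>))) x"
  shows "converges_in_distribution M (\<lambda>L \<omega>. ereal_of_enat (cover_time L (X L) \<omega>) * ereal (a L)) K V"
  unfolding converges_in_distribution_def
proof (intro conjI V(1,2))
  interpret E: elephant_random_walk M' p X' u' r' by fact
  interpret K: prob_space K by fact
  define Z where "Z L \<omega> = ereal_of_enat (cover_time L (X L) \<omega>) * ereal (a L)" for L \<omega>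
  have b: "2 * p - 1 \<le> 1 / 2" using p by simp
  have Zm: "Z L \<in> borel_measurable (M L)" if "2 \<le> L" for L
  proof -
    interpret EL: elephant_random_walk "M L" p "X L" "u L" "r L" using erw[OF that] .
    show ?thesis unfolding Z_def[abs_def] using that by (intro borel_measurable_ereal_times EL.cover_time_measurable) auto
  qed
  have Zfin: "AE \<omega> in M L. cover_time L (X L) \<omega> \<noteq> \<infinity>" if "2 \<le> L" for L
  proof -
    interpret EL: elephant_random_walk "M L" p "X L" "u L" "r L" using erw[OF that] .
    show ?thesis using that by (intro EL.cover_time_finite b) auto
  qed
  have fin_abs: "\<bar>ereal_of_enat t * ereal y\<bar> \<noteq> \<infinity>" if "t \<noteq> \<infinity>" for t y
    using that by (cases t) auto
  show "\<forall>\<^sub>F L in sequentially. (\<lambda>\<omega>. ereal_of_enat (cover_time L (X L) \<omega>) * ereal (a L)) \<in> borel_measurable (M L)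
      \<and> (AE \<omega> in M L. \<bar>ereal_of_enat (cover_time L (X L) \<omega>) * ereal (a L)\<bar> \<noteq> \<infinity>)"
    using eventually_ge_at_top[of 2]
  proof eventually_elim
    case (elim L)
    then show ?case using Zm[OF elim] Zfin[OF elim] fin_abs by (auto simp: Z_def[abs_def] elim!: eventually_mono)
  qed
  define \<nu> where "\<nu> = distr K borel (\<lambda>\<omega>. real_of_ereal (V \<omega>))"
  have Vr: "(\<lambda>\<omega>. real_of_ereal (V \<omega>)) \<in> borel_measurable K" using V(1) by simp
  interpret \<nu>: real_distribution \<nu> unfolding \<nu>_def by (rule K.real_distribution_distr[OF Vr])
  have cdf_neg: "cdf \<nu> x = 0" if "x < 0" for x
  proof -
    have "cdf \<nu> x = measure K ((\<lambda>\<omega>. real_of_ereal (V \<omega>)) -` {..x} \<inter> space K)"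
      unfolding cdf_def \<nu>_def using Vr by (subst measure_distr) auto
    also have "(\<lambda>\<omega>. real_of_ereal (V \<omega>)) -` {..x} \<inter> space K = {}"
    proof -
      have "\<not> real_of_ereal (V \<omega>) \<le> x" if "\<omega> \<in> space K" for \<omega>
        using real_of_ereal_pos[OF V(3)[OF that]] \<open>x < 0\<close> by (meson not_le less_le_trans)
      then show ?thesis by blast
    qed
    finally show ?thesis by simp
  qed
  have cdfZ: "cdf (distr (M L) borel (\<lambda>\<omega>. real_of_ereal (Z L \<omega>))) x
    = (if x < 0 then 0 else \<P>(\<omega> in M'. real L - 1 \<le> E.spread (nat \<lfloor>x / a L\<rfloor>) \<omega>))" if L: "2 \<le> L" for L x
  proof -
    interpret EL: elephant_random_walk "M L" p "X L" "u L" "r L" using erw[OF L] .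
    have rZ: "(\<lambda>\<omega>. real_of_ereal (Z L \<omega>)) \<in> borel_measurable (M L)" using Zm[OF L] by simp
    have 1: "cdf (distr (M L) borel (\<lambda>\<omega>. real_of_ereal (Z L \<omega>))) x = \<P>(\<omega> in M L. real_of_ereal (Z L \<omega>) \<le> x)"
      unfolding cdf_def using rZ by (subst measure_distr) (auto simp: vimage_def Int_def conj_commute)
    show ?thesis
    proof (cases "x < 0")
      case True
      have "0 \<le> real_of_ereal (Z L \<omega>)" for \<omega> unfolding Z_def using a[OF L] by (intro real_of_ereal_pos) simp
      then have "\<not> real_of_ereal (Z L \<omega>) \<le> x" for \<omega> using True by (meson not_le less_le_trans)
      then have E: "{\<omega> \<in> space (M L). real_of_ereal (Z L \<omega>) \<le> x} = {}" by simp
      show ?thesis unfolding 1 E using True by simp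
    next
      case False
      define n where "n = nat \<lfloor>x / a L\<rfloor>"
      have "\<P>(\<omega> in M L. real_of_ereal (Z L \<omega>) \<le> x)
        = \<P>(\<omega> in M L. real L - 1 \<le> EL.spread n \<omega>)"
      proof (rule measure_eq_AE)
        show "{\<omega> \<in> space (M L). real_of_ereal (Z L \<omega>) \<le> x} \<in> sets (M L)" using rZ by measurable
        show "{\<omega> \<in> space (M L). real L - 1 \<le> EL.spread n \<omega>} \<in> sets (M L)"
          by (rule EL.adapted_event[of n], rule EL.adapted_comp[OF EL.adapted_spread]) simp
        show "AE \<omega> in M L. (\<omega> \<in> {\<omega> \<in> space (M L). real_of_ereal (Z L \<omega>) \<le> x}) = (\<omega> \<in> {\<omega> \<in> space (M L). real L - 1 \<le> EL.spread n \<omega>})"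
          using EL.AE_steps Zfin[OF L]
        proof eventually_elim
          case (elim \<omega>)
          then obtain t where t: "cover_time L (X L) \<omega> = enat t" by (cases "cover_time L (X L) \<omega>") auto
          have "real_of_ereal (Z L \<omega>) \<le> x \<longleftrightarrow> real t \<le> x / a L"
            using a[OF L] by (simp add: Z_def t pos_le_divide_eq)
          also have "\<dots> \<longleftrightarrow> t \<le> n" using False a[OF L] unfolding n_def by (simp add: le_nat_floor le_floor_iff nat_le_iff le_nat_iff)
          also have "\<dots> \<longleftrightarrow> cover_time L (X L) \<omega> \<le> enat n" by (simp add: t)
          also have "\<dots> \<longleftrightarrow> real L - 1 \<le> EL.spread n \<omega>" using L elim by (intro EL.cover_time_le_iff) auto
          finally show ?case by simp
        qed
      qed
      also have "\<dots> = \<P>(\<omega> in M'. real L - 1 \<le> E.spread n \<omega>)"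
        unfolding EL.spread_history E.spread_history EL.history_def E.history_def
        by (rule elephant_history_law[OF erw[OF L] common])
      finally show ?thesis using 1 False by (simp add: n_def)
    qed
  qed
  show "weak_conv_m (\<lambda>L. distr (M L) borel (\<lambda>\<omega>. real_of_ereal (ereal_of_enat (cover_time L (X L) \<omega>) * ereal (a L)))) (distr K borel (\<lambda>\<omega>. real_of_ereal (V \<omega>)))"
    unfolding weak_conv_m_def weak_conv_def \<nu>_def[symmetric] Z_def[symmetric]
  proof (intro allI impI)
    fix x assume cont: "isCont (cdf \<nu>) x"
    consider "x < 0" | "x = 0" | "0 < x" by linarith
    then show "(\<lambda>L. cdf (distr (M L) borel (\<lambda>\<omega>. real_of_ereal (Z L \<omega>))) x) \<longlonglongrightarrow> cdf \<nu> x"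
    proof cases
      case 1
      have "\<forall>\<^sub>F L in sequentially. 0 = cdf (distr (M L) borel (\<lambda>\<omega>. real_of_ereal (Z L \<omega>))) x"
        using eventually_ge_at_top[of 2] by eventually_elim (simp add: cdfZ 1)
      then show ?thesis unfolding cdf_neg[OF 1] by (rule Lim_transform_eventually[rotated]) simp
    next
      case 2
      have "((\<lambda>y. cdf \<nu> y) \<longlongrightarrow> cdf \<nu> 0) (at_left 0)"
        using cont unfolding 2 isCont_def by (rule filterlim_mono) (auto simp: at_within_le_at)
      moreover have "((\<lambda>y. cdf \<nu> y) \<longlongrightarrow> 0) (at_left 0)"
        by (rule tendsto_eventually) (auto simp: eventually_at_left_field cdf_neg intro: exI[of _ "-1"])
      ultimately have nu0: "cdf \<nu> 0 = 0" by (rule tendsto_unique[rotated]) simp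
      have "\<forall>\<^sub>F L in sequentially. 0 = cdf (distr (M L) borel (\<lambda>\<omega>. real_of_ereal (Z L \<omega>))) 0"
        using eventually_ge_at_top[of 2] by eventually_elim (simp add: cdfZ E.spread_def path_spread_def)
      then show ?thesis unfolding 2 nu0 by (rule Lim_transform_eventually[rotated]) simp
    next
      case 3
      have "\<forall>\<^sub>F L in sequentially. \<P>(\<omega> in M'. real L - 1 \<le> E.spread (nat \<lfloor>x / a L\<rfloor>) \<omega>)
        = cdf (distr (M L) borel (\<lambda>\<omega>. real_of_ereal (Z L \<omega>))) x"
        using eventually_ge_at_top[of 2] by eventually_elim (use 3 in \<open>simp add: cdfZ\<close>)
      with lim[OF 3 cont[unfolded \<nu>_def]] show ?thesis unfolding \<nu>_def by (rule Lim_transform_eventually)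
    qed
  qed
qed

section \<open>The superdiffusive regime\<close>

text \<open>
  The first time at which a sequence of growth \<open>y n\<^sup>a\<close> reaches \<open>L - 1\<close>: its value there and one step earlier
  enclose \<open>L - 1\<close>.
\<close>

lemma inverse_growth:
  fixes s :: "nat \<Rightarrow> real" and t :: "nat \<Rightarrow> nat"
  assumes a: "0 < a" and y: "0 < y"
    and g: "(\<lambda>n. s n / real n powr a) \<longlonglongrightarrow> y"
    and t: "filterlim t at_top sequentially"
    and lower: "\<forall>\<^sub>F L in sequentially. real L - 1 \<le> s (t L)"
    and upper: "\<forall>\<^sub>F L in sequentially. s (t L - 1) < real L - 1"
  shows "(\<lambda>L. real (t L) / real L powr (1 / a)) \<longlonglongrightarrow> 1 / y powr (1 / a)"
proof -
  have t1: "filterlim (\<lambda>L. t L - 1) at_top sequentially"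
    using t by (intro filterlim_compose[OF filterlim_minus_const_nat_at_top t])
  have tr: "filterlim (\<lambda>L. real (t L)) at_top sequentially"
    by (rule filterlim_compose[OF filterlim_real_sequentially t])
  have ratio: "(\<lambda>L. (real (t L - 1) / real (t L)) powr a) \<longlonglongrightarrow> 1 powr a"
  proof (intro tendsto_powr)
    have "((\<lambda>n::nat. real (n - 1) / real n) \<longlongrightarrow> 1) sequentially" by real_asymp
    then show "(\<lambda>L. real (t L - 1) / real (t L)) \<longlonglongrightarrow> 1" by (rule filterlim_compose[OF _ t])
  qed auto
  have up: "(\<lambda>L. s (t L) / real (t L) powr a) \<longlonglongrightarrow> y" by (rule filterlim_compose[OF g t])
  have lo: "(\<lambda>L. s (t L - 1) / real (t L - 1) powr a * (real (t L - 1) / real (t L)) powr a) \<longlonglongrightarrow> y * 1 powr a"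
    by (intro tendsto_mult ratio filterlim_compose[OF g t1])
  have ev: "\<forall>\<^sub>F L in sequentially. 2 \<le> t L" using t by (simp add: filterlim_at_top)
  have mid: "(\<lambda>L. (real L - 1) / real (t L) powr a) \<longlonglongrightarrow> y"
  proof (rule tendsto_sandwich[OF _ _ lo[unfolded powr_one_eq_one mult_1_right] up])
    show "\<forall>\<^sub>F L in sequentially. (real L - 1) / real (t L) powr a \<le> s (t L) / real (t L) powr a"
      using lower by eventually_elim (simp add: divide_right_mono)
    show "\<forall>\<^sub>F L in sequentially. s (t L - 1) / real (t L - 1) powr a * (real (t L - 1) / real (t L)) powr a \<le> (real L - 1) / real (t L) powr a"
      using upper ev
    proof eventually_elim
      case (elim L)
      have "s (t L - 1) / real (t L - 1) powr a * (real (t L - 1) / real (t L)) powr a = s (t L - 1) / real (t L) powr a"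
        using elim by (subst powr_divide) auto
      then show ?case using elim by (simp add: divide_right_mono)
    qed
  qed
  have "(\<lambda>L. real L / (real L - 1)) \<longlonglongrightarrow> 1" by real_asymp
  from tendsto_mult[OF mid this]
  have "(\<lambda>L. (real L - 1) / real (t L) powr a * (real L / (real L - 1))) \<longlonglongrightarrow> y" by simp
  moreover have "\<forall>\<^sub>F L in sequentially. (real L - 1) / real (t L) powr a * (real L / (real L - 1)) = real L / real (t L) powr a"
    using eventually_gt_at_top[of 1] by eventually_elim simp
  ultimately have "(\<lambda>L. real L / real (t L) powr a) \<longlonglongrightarrow> y" by (simp add: tendsto_cong)
  then have "(\<lambda>L. 1 / (real L / real (t L) powr a) powr (1 / a)) \<longlonglongrightarrow> 1 / y powr (1 / a)"
    using y by (intro tendsto_intros) auto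
  moreover have "\<forall>\<^sub>F L in sequentially. 1 / (real L / real (t L) powr a) powr (1 / a) = real (t L) / real L powr (1 / a)"
    using ev eventually_gt_at_top[of 0]
  proof eventually_elim
    case (elim L)
    have "(real L / real (t L) powr a) powr (1 / a) = real L powr (1 / a) / real (t L)"
      using elim a by (simp add: powr_divide powr_powr)
    then show ?case using elim by simp
  qed
  ultimately show ?thesis by (simp add: tendsto_cong)
qed

text \<open>
  For a path close to \<open>y n\<^sup>a\<close> with \<open>a > 0\<close>, the extreme values over \<open>{0..n}\<close> are attained near the
  two ends.
\<close>

lemma spread_growth:
  fixes s :: "nat \<Rightarrow> real"
  assumes a: "0 < a" and s0: "s 0 = 0" and lim: "(\<lambda>n. s n / real n powr a) \<longlonglongrightarrow> y"
  shows "(\<lambda>n. path_spread n s / real n powr a) \<longlonglongrightarrow> \<bar>y\<bar>"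
proof (rule LIMSEQ_I)
  fix e :: real assume e: "0 < e"
  define h where "h = e / 6"
  have h: "0 < h" using e by (simp add: h_def)
  from LIMSEQ_D[OF lim h] obtain k0 where k0: "\<And>k. k0 \<le> k \<Longrightarrow> \<bar>s k / real k powr a - y\<bar> < h" by auto
  define C where "C = (\<Sum>k\<le>k0. \<bar>s k\<bar>)"
  have near: "\<bar>s k - y * real k powr a\<bar> \<le> h * real k powr a" if "k0 \<le> k" "0 < k" for k
  proof -
    have p: "0 < real k powr a" using that by simp
    have "s k - y * real k powr a = (s k / real k powr a - y) * real k powr a" using p by (simp add: field_simps)
    then have "\<bar>s k - y * real k powr a\<bar> = \<bar>s k / real k powr a - y\<bar> * real k powr a" using p by (simp add: abs_mult)
    then show ?thesis using k0[OF that(1)] p by (simp add: mult_right_mono less_imp_le)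
  qed
  have bounds: "s k \<le> max 0 y * real n powr a + h * real n powr a + C \<and> min 0 y * real n powr a - h * real n powr a - C \<le> s k"
    if "k \<le> n" for k n
  proof -
    have C0: "0 \<le> C" by (simp add: C_def sum_nonneg)
    have pm: "real k powr a \<le> real n powr a" using that a by (intro powr_mono2) auto
    have m: "max 0 y * real k powr a \<le> max 0 y * real n powr a" "h * real k powr a \<le> h * real n powr a"
      "min 0 y * real n powr a \<le> min 0 y * real k powr a"
      by (rule mult_left_mono[OF pm], simp, rule mult_left_mono[OF pm], use h in simp, rule mult_left_mono_neg[OF pm], simp)
    have n0: "0 \<le> max 0 y * real n powr a" "0 \<le> h * real n powr a" "min 0 y * real n powr a \<le> 0"
      using h by (auto intro: mult_nonpos_nonneg)
    show ?thesis
    proof (cases "k0 \<le> k \<and> 0 < k")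
      case True
      have "min 0 y * real k powr a \<le> y * real k powr a" "y * real k powr a \<le> max 0 y * real k powr a"
        by (auto intro!: mult_right_mono)
      then show ?thesis using near[of k] True m C0 by linarith
    next
      case False
      then have "k \<le> k0" by auto
      then have "\<bar>s k\<bar> \<le> C" unfolding C_def by (intro member_le_sum) auto
      then show ?thesis using n0 by linarith
    qed
  qed
  have upper: "path_spread n s \<le> \<bar>y\<bar> * real n powr a + 2 * h * real n powr a + 2 * C" for n
  proof -
    obtain i j where ij: "i \<le> n" "j \<le> n" "path_spread n s = s i - s j" by (rule path_spread_attained)
    have "max 0 y * real n powr a - min 0 y * real n powr a = \<bar>y\<bar> * real n powr a"
      by (simp add: max_def min_def)
    then show ?thesis using bounds[OF ij(1)] bounds[OF ij(2)] ij(3) by linarith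
  qed
  have lower: "\<bar>s n\<bar> \<le> path_spread n s" for n
    using path_spread_ge[of n n 0 s] path_spread_ge[of 0 n n s] s0 by simp
  have "(\<lambda>n. 2 * C / real n powr a) \<longlonglongrightarrow> 0" using a by real_asymp
  then have "\<forall>\<^sub>F n in sequentially. 2 * C / real n powr a < h" using h by (rule order_tendstoD)
  then have "\<forall>\<^sub>F n in sequentially. norm (path_spread n s / real n powr a - \<bar>y\<bar>) < e"
    using eventually_ge_at_top[of "max 1 k0"]
  proof eventually_elim
    case (elim n)
    have p: "0 < real n powr a" using elim by simp
    have "path_spread n s / real n powr a \<le> (\<bar>y\<bar> * real n powr a + 2 * h * real n powr a + 2 * C) / real n powr a"
      using upper p by (intro divide_right_mono) auto
    also have "\<dots> = \<bar>y\<bar> + 2 * h + 2 * C / real n powr a" using p by (simp add: add_divide_distrib)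
    finally have 1: "path_spread n s / real n powr a \<le> \<bar>y\<bar> + 3 * h" using elim by linarith
    have "\<bar>s n / real n powr a\<bar> = \<bar>s n\<bar> / real n powr a" using p by (simp add: abs_div)
    also have "\<dots> \<le> path_spread n s / real n powr a" using lower p by (intro divide_right_mono) auto
    finally have "\<bar>y\<bar> - h \<le> path_spread n s / real n powr a" using k0[of n] elim by linarith
    then show ?case using 1 e by (simp add: h_def)
  qed
  then show "\<exists>no. \<forall>n\<ge>no. norm (path_spread n s / real n powr a - \<bar>y\<bar>) < e" by (simp add: eventually_sequentially)
qed

context elephant_random_walk
begin

text \<open>
  The event that the martingale leaves the \<open>\<epsilon>\<close>-neighbourhood of its value at time \<open>n\<close>; outside it, the limit is
  within \<open>\<epsilon>\<close> of that value.
\<close>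

definition tail_event :: "nat \<Rightarrow> real \<Rightarrow> 'a set" where
  "tail_event n \<epsilon> = {\<omega> \<in> space M. \<exists>k\<ge>n. \<epsilon> \<le> \<bar>mart k \<omega> - mart n \<omega>\<bar>}"

lemma tail_event_prob:
  assumes "2 \<le> n" "0 < \<epsilon>" and V: "\<And>k. clock \<beta> k \<le> V"
  shows "tail_event n \<epsilon> \<in> events" "prob (tail_event n \<epsilon>) \<le> 8 * (V - clock \<beta> n)\<^sup>2 / \<epsilon> ^ 4"
proof -
  define T where "T N = {\<omega> \<in> space M. \<exists>k\<in>{n..N}. \<epsilon> \<le> \<bar>mart k \<omega> - mart n \<omega>\<bar>}" for N
  have T: "T N \<in> events" for N
    unfolding T_def
    by (rule adapted_event[of "max n N"], rule adapted_Bex, rule adapted_comp2[OF adapted_mart adapted_mart]) auto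
  have un: "tail_event n \<epsilon> = (\<Union>N. T N)"
    by (auto simp: tail_event_def T_def) (meson atLeastAtMost_iff order_refl)
  then show "tail_event n \<epsilon> \<in> events" using T by auto
  have "incseq T" by (rule incseq_SucI) (force simp: T_def)
  then have "(\<lambda>N. prob (T N)) \<longlonglongrightarrow> prob (tail_event n \<epsilon>)"
    unfolding un using T by (intro finite_Lim_measure_incseq) auto
  moreover have "prob (T N) \<le> 8 * (V - clock \<beta> n)\<^sup>2 / \<epsilon> ^ 4" if "n \<le> N" for N
  proof -
    have "prob (T N) \<le> 8 * (clock \<beta> N - clock \<beta> n)\<^sup>2 / \<epsilon> ^ 4"
      unfolding T_def by (rule mart_increment_maximal[OF assms(1) that assms(2)])
    also have "\<dots> \<le> 8 * (V - clock \<beta> n)\<^sup>2 / \<epsilon> ^ 4"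
      using V[of N] clock_mono[OF that, of \<beta>] assms by (intro divide_right_mono mult_left_mono power_mono) auto
    finally show ?thesis .
  qed
  ultimately show "prob (tail_event n \<epsilon>) \<le> 8 * (V - clock \<beta> n)\<^sup>2 / \<epsilon> ^ 4"
    by (intro LIMSEQ_le_const2) auto
qed

lemma tail_event_vanishes:
  assumes b: "1 / 2 < \<beta>" and \<epsilon>: "0 < \<epsilon>"
  shows "(\<lambda>n. prob (tail_event n \<epsilon>)) \<longlonglongrightarrow> 0"
proof -
  obtain V where V: "clock \<beta> \<longlonglongrightarrow> V" using clock_bounded[OF b] by (auto simp: convergent_def)
  have Vle: "clock \<beta> k \<le> V" for k
    by (rule incseq_le[OF _ V]) (simp add: incseq_def clock_mono)
  have "(\<lambda>n. 8 * (V - clock \<beta> n)\<^sup>2 / \<epsilon> ^ 4) \<longlonglongrightarrow> 8 * (V - V)\<^sup>2 / \<epsilon> ^ 4"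
    using \<epsilon> by (intro tendsto_intros V) auto
  then have lim: "(\<lambda>n. 8 * (V - clock \<beta> n)\<^sup>2 / \<epsilon> ^ 4) \<longlonglongrightarrow> 0" by simp
  show ?thesis
  proof (rule tendsto_sandwich[OF _ _ tendsto_const lim])
    show "\<forall>\<^sub>F n in sequentially. prob (tail_event n \<epsilon>) \<le> 8 * (V - clock \<beta> n)\<^sup>2 / \<epsilon> ^ 4"
      using eventually_ge_at_top[of 2] by eventually_elim (rule tail_event_prob(2)[OF _ \<epsilon> Vle])
  qed auto
qed

lemma mart_convergent:
  assumes b: "1 / 2 < \<beta>"
  shows "AE \<omega> in M. convergent (\<lambda>n. mart n \<omega>)"
proof -
  have "AE \<omega> in M. \<exists>n. \<forall>k\<ge>n. \<bar>mart k \<omega> - mart n \<omega>\<bar> < inverse (real (Suc j))" for j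
  proof -
    define \<epsilon> where "\<epsilon> = inverse (real (Suc j))"
    have \<epsilon>: "0 < \<epsilon>" by (simp add: \<epsilon>_def)
    obtain V where V: "clock \<beta> \<longlonglongrightarrow> V" using clock_bounded[OF b] by (auto simp: convergent_def)
    have Vle: "clock \<beta> k \<le> V" for k
      by (rule incseq_le[OF _ V]) (simp add: incseq_def clock_mono)
    define B where "B = (\<Inter>n\<in>{2..}. tail_event n \<epsilon>)"
    have te: "tail_event n \<epsilon> \<in> events" if "2 \<le> n" for n by (rule tail_event_prob(1)[OF that \<epsilon> Vle])
    have B: "B \<in> events" unfolding B_def using te by (intro sets.countable_INT') auto
    have "prob B \<le> prob (tail_event n \<epsilon>)" if "2 \<le> n" for n
      using te[OF that] that by (intro finite_measure_mono) (auto simp: B_def)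
    then have "prob B \<le> 0" by (intro LIMSEQ_le_const[OF tail_event_vanishes[OF b \<epsilon>]]) auto
    then have "prob B = 0" using measure_nonneg[of M B] by linarith
    then have "AE \<omega> in M. \<omega> \<notin> B" using B by (subst (asm) prob_eq_0) auto
    then show ?thesis using AE_space
    proof eventually_elim
      case (elim \<omega>)
      then obtain n where "2 \<le> n" "\<omega> \<notin> tail_event n \<epsilon>" by (auto simp: B_def)
      then have "\<forall>k\<ge>n. \<not> \<epsilon> \<le> \<bar>mart k \<omega> - mart n \<omega>\<bar>" using elim by (simp add: tail_event_def)
      then show ?case unfolding \<epsilon>_def[symmetric] by (meson not_le)
    qed
  qed
  then have "AE \<omega> in M. \<forall>j. \<exists>n. \<forall>k\<ge>n. \<bar>mart k \<omega> - mart n \<omega>\<bar> < inverse (real (Suc j))"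
    by (subst AE_all_countable) auto
  then show ?thesis
  proof eventually_elim
    case (elim \<omega>)
    have "Cauchy (\<lambda>n. mart n \<omega>)"
    proof (rule CauchyI')
      fix e :: real assume "0 < e"
      then obtain j where j: "inverse (real (Suc j)) < e / 2" using reals_Archimedean[of "e / 2"] by auto
      obtain n where n: "\<And>k. n \<le> k \<Longrightarrow> \<bar>mart k \<omega> - mart n \<omega>\<bar> < inverse (real (Suc j))" using elim by blast
      show "\<exists>n. \<forall>m\<ge>n. \<forall>k>m. dist (mart m \<omega>) (mart k \<omega>) < e"
      proof (intro exI allI impI)
        fix m k assume "n \<le> m" "m < k"
        then show "dist (mart m \<omega>) (mart k \<omega>) < e" using n[of m] n[of k] j by (simp add: dist_real_def)
      qed
    qed
    then show ?case by (simp add: Cauchy_convergent_iff)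
  qed
qed

text \<open>
  A Paley-Zygmund inequality, uniform over all events \<open>Q\<close> of the past. With \<open>q = M\<^sub>n\<^sup>2 + w\<close> and \<open>w\<close> the
  clock increment up to \<open>N\<close>, the ratio \<open>U = M\<^sub>N\<^sup>2 / q\<close> has conditional mean at least \<open>1 - \<beta>\<^sup>2\<close> and conditional second moment at most
  18, whatever the value of \<open>M\<^sub>n\<close>. So \<open>U\<close> exceeds half of its minimal mean with a fixed conditional
  probability.
\<close>

lemma spread_out_later:
  assumes n: "2 \<le> n" "n < N" and Q: "adapted n Q"
  shows "(1 - \<beta>\<^sup>2)\<^sup>2 / 72 * \<P>(\<omega> in M. Q \<omega>)
    \<le> \<P>(\<omega> in M. Q \<omega> \<and> (1 - \<beta>\<^sup>2) / 2 * (clock \<beta> (Suc n) - clock \<beta> n) < (mart N \<omega>)\<^sup>2)"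
proof (cases "\<beta>\<^sup>2 = 1")
  case True
  then show ?thesis by simp
next
  case False
  define \<delta> where "\<delta> = 1 - \<beta>\<^sup>2"
  have \<delta>: "0 < \<delta>" "\<delta> \<le> 1" using False beta_bounds(3) by (auto simp: \<delta>_def)
  define w where "w = clock \<beta> N - clock \<beta> n"
  have w1: "clock \<beta> (Suc n) - clock \<beta> n \<le> w" using clock_mono[of "Suc n" N \<beta>] n by (simp add: w_def)
  have w: "0 < w" using w1 n by (simp add: clock_Suc order_less_le_trans[rotated])
  (* Up to the factor 1 - beta^2, this is the conditional second moment of the martingale at time N. *)
  define q where "q \<omega> = (mart n \<omega>)\<^sup>2 + w" for \<omega>
  have q: "w \<le> q \<omega>" "0 < q \<omega>" for \<omega> using w by (auto simp: q_def add_nonneg_pos)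
  define I where "I \<omega> = (of_bool (Q \<omega>) :: real)" for \<omega>
  have adI: "adapted n I" unfolding I_def[abs_def] by (rule adapted_comp[OF Q])
  have adq: "adapted n q" unfolding q_def[abs_def] by (rule adapted_comp[OF adapted_mart[OF order_refl]])
  define U where "U \<omega> = (mart N \<omega>)\<^sup>2 / q \<omega>" for \<omega>
  have adU: "adapted N U" unfolding U_def[abs_def]
    by (rule adapted_comp2[OF adapted_mart adapted_mono[OF adq]]) (use n in auto)
  have nN: "n \<le> N" using n by simp
  define P where "P = \<P>(\<omega> in M. Q \<omega>)"
  have PI: "(\<integral>\<omega>. I \<omega> \<partial>M) = P" unfolding I_def P_def by (rule integral_of_bool[OF adapted_event[OF Q]])
  have adW: "adapted n (\<lambda>\<omega>. I \<omega> / q \<omega>)" "adapted n (\<lambda>\<omega>. I \<omega> / (q \<omega>)\<^sup>2)"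
    by (rule adapted_comp2[OF adI adq])+
  have int: "integrable M (\<lambda>\<omega>. I \<omega> / q \<omega> * (mart n \<omega>)\<^sup>2)" "integrable M (\<lambda>\<omega>. I \<omega> / q \<omega>)" "integrable M I"
    by (rule adapted_integrable[OF adapted_comp2[OF adW(1) adapted_mart[OF order_refl]]], rule adapted_integrable[OF adW(1)],
        rule adapted_integrable[OF adI])
  have m2: "\<delta> * P \<le> (\<integral>\<omega>. I \<omega> * U \<omega> \<partial>M)"
  proof -
    have "\<delta> * P = (\<integral>\<omega>. \<delta> * I \<omega> \<partial>M)" by (simp add: PI)
    also have "\<dots> \<le> (\<integral>\<omega>. I \<omega> / q \<omega> * (mart n \<omega>)\<^sup>2 + \<delta> * w * (I \<omega> / q \<omega>) \<partial>M)"
    proof (rule integral_mono)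
      fix \<omega>
      have "\<delta> * q \<omega> \<le> (mart n \<omega>)\<^sup>2 + \<delta> * w" using \<delta> mult_right_mono[OF \<delta>(2), of "(mart n \<omega>)\<^sup>2"] by (simp add: q_def algebra_simps)
      then have "I \<omega> / q \<omega> * (\<delta> * q \<omega>) \<le> I \<omega> / q \<omega> * ((mart n \<omega>)\<^sup>2 + \<delta> * w)"
        by (rule mult_left_mono) (use q(2)[of \<omega>] in \<open>auto simp: I_def\<close>)
      then show "\<delta> * I \<omega> \<le> I \<omega> / q \<omega> * (mart n \<omega>)\<^sup>2 + \<delta> * w * (I \<omega> / q \<omega>)"
        using q(2)[of \<omega>] by (simp add: algebra_simps)
    qed (intro Bochner_Integration.integrable_add integrable_mult_right int)+
    also have "\<dots> = (\<integral>\<omega>. I \<omega> / q \<omega> * (mart n \<omega>)\<^sup>2 \<partial>M) + \<delta> * w * (\<integral>\<omega>. I \<omega> / q \<omega> \<partial>M)"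
      by (simp only: Bochner_Integration.integral_add integrable_mult_right integral_mult_right_zero int)
    also have "\<dots> \<le> (\<integral>\<omega>. I \<omega> / q \<omega> * (mart N \<omega>)\<^sup>2 \<partial>M)"
      unfolding \<delta>_def w_def by (rule integral_mart_square(2)[OF n(1) nN adW(1)]) (use q(2) in \<open>auto simp: I_def less_imp_le\<close>)
    finally show ?thesis by (simp add: U_def)
  qed
  have m4: "(\<integral>\<omega>. I \<omega> * (U \<omega>)\<^sup>2 \<partial>M) \<le> 18 * P"
  proof -
    have "(\<integral>\<omega>. I \<omega> * (U \<omega>)\<^sup>2 \<partial>M) = (\<integral>\<omega>. I \<omega> / (q \<omega>)\<^sup>2 * mart N \<omega> ^ 4 \<partial>M)"
      by (simp add: U_def power_divide flip: power_mult)
    also have "\<dots> \<le> (\<integral>\<omega>. I \<omega> / (q \<omega>)\<^sup>2 * quartic w (mart n \<omega>) \<partial>M)"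
      unfolding w_def by (rule integral_mart_power4_le[OF n(1) nN adW(2)]) (auto simp: I_def)
    also have "\<dots> \<le> (\<integral>\<omega>. 18 * I \<omega> \<partial>M)"
    proof (rule integral_mono)
      show "integrable M (\<lambda>\<omega>. I \<omega> / (q \<omega>)\<^sup>2 * quartic w (mart n \<omega>))"
        by (rule adapted_integrable[OF adapted_comp2[OF adW(2) adapted_mart[OF order_refl]]])
      fix \<omega>
      have "0 \<le> (mart n \<omega>)\<^sup>2 * w" using w by simp
      then have "quartic w (mart n \<omega>) \<le> 18 * (q \<omega>)\<^sup>2"
        using zero_le_power2[of "mart n \<omega> * mart n \<omega>"] zero_le_power2[of w]
        by (simp add: quartic_def q_def power2_eq_square power4_eq_xxxx algebra_simps)
      then have "I \<omega> / (q \<omega>)\<^sup>2 * quartic w (mart n \<omega>) \<le> I \<omega> / (q \<omega>)\<^sup>2 * (18 * (q \<omega>)\<^sup>2)"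
        by (rule mult_left_mono) (simp add: I_def)
      then show "I \<omega> / (q \<omega>)\<^sup>2 * quartic w (mart n \<omega>) \<le> 18 * I \<omega>" using q(2)[of \<omega>] by simp
    qed (use int in auto)
    finally show ?thesis by (simp add: PI)
  qed
  define R where "R = \<P>(\<omega> in M. Q \<omega> \<and> \<delta> / 2 < U \<omega>)"
  have adR: "adapted N (\<lambda>\<omega>. Q \<omega> \<and> \<delta> / 2 < U \<omega>)" by (rule adapted_comp2[OF adapted_mono[OF Q nN] adU])
  have "\<delta> * P \<le> (\<integral>\<omega>. I \<omega> * U \<omega> \<partial>M)" by (rule m2)
  also have "\<dots> \<le> (\<integral>\<omega>. \<delta> / 2 * I \<omega> + \<delta> / 72 * (I \<omega> * (U \<omega>)\<^sup>2) + 18 / \<delta> * of_bool (Q \<omega> \<and> \<delta> / 2 < U \<omega>) \<partial>M)"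
  proof (rule integral_mono)
    show "integrable M (\<lambda>\<omega>. I \<omega> * U \<omega>)"
      by (rule adapted_integrable[OF adapted_comp2[OF adapted_mono[OF adI nN] adU]])
    show "integrable M (\<lambda>\<omega>. \<delta> / 2 * I \<omega> + \<delta> / 72 * (I \<omega> * (U \<omega>)\<^sup>2) + 18 / \<delta> * of_bool (Q \<omega> \<and> \<delta> / 2 < U \<omega>))"
      by (intro Bochner_Integration.integrable_add integrable_mult_right adapted_integrable[OF adI]
          adapted_integrable[OF adapted_comp2[OF adapted_mono[OF adI nN] adU]] adapted_integrable[OF adapted_comp[OF adR]])
    fix \<omega>
    (* The weight delta/72 leaves delta/4 of the first moment: delta - delta/2 - 18 delta/72. *)
    have "x \<le> \<delta> / 72 * x\<^sup>2 + 18 / \<delta>" for x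
    proof -
      have "0 \<le> (\<delta> / 36 * x - 1)\<^sup>2" by simp
      then have "0 \<le> 18 / \<delta> * (\<delta> / 36 * x - 1)\<^sup>2" using \<delta> by simp
      also have "\<dots> = \<delta> / 72 * x\<^sup>2 + 18 / \<delta> - x" using \<delta> by (simp add: power2_eq_square field_simps)
      finally show ?thesis by simp
    qed
    from this[of "U \<omega>"] have "U \<omega> \<le> \<delta> / 2 + \<delta> / 72 * (U \<omega>)\<^sup>2 + 18 / \<delta> * of_bool (\<delta> / 2 < U \<omega>)"
      using \<delta> by (cases "\<delta> / 2 < U \<omega>") (simp_all add: add_increasing2)
    then show "I \<omega> * U \<omega> \<le> \<delta> / 2 * I \<omega> + \<delta> / 72 * (I \<omega> * (U \<omega>)\<^sup>2) + 18 / \<delta> * of_bool (Q \<omega> \<and> \<delta> / 2 < U \<omega>)"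
      by (cases "Q \<omega>") (simp_all add: I_def)
  qed
  also have "\<dots> = \<delta> / 2 * P + \<delta> / 72 * (\<integral>\<omega>. I \<omega> * (U \<omega>)\<^sup>2 \<partial>M) + 18 / \<delta> * R"
  proof -
    have i: "integrable M (\<lambda>\<omega>. I \<omega> * (U \<omega>)\<^sup>2)" "integrable M (\<lambda>\<omega>. of_bool (Q \<omega> \<and> \<delta> / 2 < U \<omega>) :: real)"
      by (rule adapted_integrable[OF adapted_comp2[OF adapted_mono[OF adI nN] adU]],
          rule adapted_integrable[OF adapted_comp[OF adR]])
    have r: "(\<integral>\<omega>. of_bool (Q \<omega> \<and> \<delta> / 2 < U \<omega>) \<partial>M) = R" unfolding R_def by (rule integral_of_bool[OF adapted_event[OF adR]])
    show ?thesis
      by (simp only: Bochner_Integration.integral_add Bochner_Integration.integrable_add integrable_mult_right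
          integral_mult_right_zero i int(3) PI r)
  qed
  also have "\<dots> \<le> \<delta> / 2 * P + \<delta> / 72 * (18 * P) + 18 / \<delta> * R"
    using m4 \<delta> by (intro add_right_mono add_left_mono mult_left_mono) auto
  finally have "\<delta> * P \<le> \<delta> / 2 * P + \<delta> / 72 * (18 * P) + 18 / \<delta> * R" .
  moreover have "\<delta> / 4 * P = \<delta> * P - \<delta> / 2 * P - \<delta> / 72 * (18 * P)" by (simp add: field_simps)
  ultimately have "\<delta> / 4 * P \<le> 18 / \<delta> * R" by linarith
  then have "\<delta> / 18 * (\<delta> / 4 * P) \<le> \<delta> / 18 * (18 / \<delta> * R)" using \<delta> by (intro mult_left_mono) auto
  then have "\<delta>\<^sup>2 / 72 * P \<le> R" using \<delta> by (simp add: power2_eq_square)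
  also have "R \<le> \<P>(\<omega> in M. Q \<omega> \<and> \<delta> / 2 * (clock \<beta> (Suc n) - clock \<beta> n) < (mart N \<omega>)\<^sup>2)"
    unfolding R_def
  proof (rule finite_measure_mono)
    show "{\<omega> \<in> space M. Q \<omega> \<and> \<delta> / 2 * (clock \<beta> (Suc n) - clock \<beta> n) < (mart N \<omega>)\<^sup>2} \<in> events"
      by (rule adapted_event[of N], rule adapted_comp2[OF adapted_mono[OF Q nN] adapted_mart[OF order_refl]])
    show "{\<omega> \<in> space M. Q \<omega> \<and> \<delta> / 2 < U \<omega>} \<subseteq> {\<omega> \<in> space M. Q \<omega> \<and> \<delta> / 2 * (clock \<beta> (Suc n) - clock \<beta> n) < (mart N \<omega>)\<^sup>2}"
    proof safe
      fix \<omega> assume "\<delta> / 2 < U \<omega>"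
      then have "\<delta> / 2 * q \<omega> < (mart N \<omega>)\<^sup>2" using q(2)[of \<omega>] by (simp add: U_def pos_less_divide_eq)
      moreover have "\<delta> / 2 * (clock \<beta> (Suc n) - clock \<beta> n) \<le> \<delta> / 2 * q \<omega>"
        using \<delta> w1 q(1)[of \<omega>] by (intro mult_left_mono) auto
      ultimately show "\<delta> / 2 * (clock \<beta> (Suc n) - clock \<beta> n) < (mart N \<omega>)\<^sup>2" by linarith
    qed
  qed
  finally show ?thesis by (simp add: \<delta>_def P_def)
qed

text \<open>
  By \<open>spread_out_later\<close>, every event of the past keeps a fixed fraction of its mass on
  \<open>{Y \<noteq> 0}\<close>. Applied to the events \<open>{\<bar>M\<^sub>n\<bar> < \<epsilon>}\<close>, which approximate \<open>{Y = 0}\<close>, this bounds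
  a multiple of the probability of \<open>{Y = 0}\<close> by that of \<open>{0 < \<bar>Y\<bar> < 2\<epsilon>}\<close>, which tends to 0.
\<close>

lemma mart_limit_nonzero:
  assumes b: "1 / 2 < \<beta>"
  shows "AE \<omega> in M. lim (\<lambda>n. mart n \<omega>) \<noteq> 0"
proof -
  define Y where "Y \<omega> = lim (\<lambda>n. mart n \<omega>)" for \<omega>
  have [measurable]: "mart n \<in> borel_measurable M" for n by (rule adapted_borel[OF adapted_mart[OF order_refl]])
  have Y[measurable]: "Y \<in> borel_measurable M" unfolding Y_def[abs_def] by measurable
  define \<kappa> where "\<kappa> = (1 - \<beta>\<^sup>2)\<^sup>2 / 72"
  have "\<bar>\<beta>\<bar> < 1" using b beta_bounds(2) by simp
  then have "\<beta>\<^sup>2 < 1" by (simp add: abs_square_less_1)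
  then have \<kappa>: "0 < \<kappa>" and \<delta>: "0 < 1 - \<beta>\<^sup>2" by (auto simp: \<kappa>_def)
  obtain V where V: "clock \<beta> \<longlonglongrightarrow> V" using clock_bounded[OF b] by (auto simp: convergent_def)
  have Vle: "clock \<beta> k \<le> V" for k
    by (rule incseq_le[OF _ V]) (simp add: incseq_def clock_mono)
  have te[measurable]: "tail_event n \<epsilon> \<in> events" if "2 \<le> n" "0 < \<epsilon>" for n \<epsilon> by (rule tail_event_prob(1)[OF that Vle])
  have near: "AE \<omega> in M. \<omega> \<notin> tail_event n \<epsilon> \<longrightarrow> \<bar>Y \<omega> - mart n \<omega>\<bar> \<le> \<epsilon>" for n \<epsilon>
    using mart_convergent[OF b] AE_space
  proof eventually_elim
    case (elim \<omega>)
    show ?case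
    proof
      assume "\<omega> \<notin> tail_event n \<epsilon>"
      then have "\<forall>k\<ge>n. \<not> \<epsilon> \<le> \<bar>mart k \<omega> - mart n \<omega>\<bar>" using elim by (simp add: tail_event_def)
      then have "\<And>k. n \<le> k \<Longrightarrow> \<bar>mart k \<omega> - mart n \<omega>\<bar> \<le> \<epsilon>" by (meson linear)
      moreover have "(\<lambda>k. \<bar>mart k \<omega> - mart n \<omega>\<bar>) \<longlonglongrightarrow> \<bar>Y \<omega> - mart n \<omega>\<bar>"
        using elim by (intro tendsto_intros) (simp add: Y_def convergent_LIMSEQ_iff)
      ultimately show "\<bar>Y \<omega> - mart n \<omega>\<bar> \<le> \<epsilon>" by (intro LIMSEQ_le_const2) auto
    qed
  qed
  have nondeg: "\<kappa> * \<P>(\<omega> in M. Q \<omega>) \<le> \<P>(\<omega> in M. Q \<omega> \<and> Y \<omega> \<noteq> 0)"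
    if n: "2 \<le> n" and Q: "adapted n Q" for n Q
  proof -
    have [measurable]: "{\<omega> \<in> space M. Q \<omega>} \<in> events" by (rule adapted_event[OF Q])
    have QY: "{\<omega> \<in> space M. Q \<omega> \<and> Y \<omega> \<noteq> 0} \<in> events"
    proof -
      have "{\<omega> \<in> space M. Q \<omega> \<and> Y \<omega> \<noteq> 0} = {\<omega> \<in> space M. Q \<omega>} \<inter> {\<omega> \<in> space M. Y \<omega> \<noteq> 0}" by auto
      then show ?thesis by simp
    qed
    define h where "h = (1 - \<beta>\<^sup>2) / 2 * (clock \<beta> (Suc n) - clock \<beta> n)"
    have h: "0 < h" using \<delta> by (simp add: h_def clock_Suc[OF n])
    define \<eta> where "\<eta> = sqrt h / 2"
    have \<eta>: "0 < \<eta>" "\<eta>\<^sup>2 < h" using h by (auto simp: \<eta>_def power_divide)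
    have "\<kappa> * \<P>(\<omega> in M. Q \<omega>) \<le> \<P>(\<omega> in M. Q \<omega> \<and> Y \<omega> \<noteq> 0) + prob (tail_event N \<eta>)" if N: "n < N" for N
    proof -
      have "\<kappa> * \<P>(\<omega> in M. Q \<omega>) \<le> \<P>(\<omega> in M. Q \<omega> \<and> h < (mart N \<omega>)\<^sup>2)"
        unfolding \<kappa>_def h_def by (rule spread_out_later[OF n N Q])
      also have "\<dots> \<le> prob ({\<omega> \<in> space M. Q \<omega> \<and> Y \<omega> \<noteq> 0} \<union> tail_event N \<eta>)"
      proof (rule finite_measure_mono_AE)
        show "{\<omega> \<in> space M. Q \<omega> \<and> Y \<omega> \<noteq> 0} \<union> tail_event N \<eta> \<in> events" using QY te[of N \<eta>] n N \<eta> by auto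
        show "AE \<omega> in M. \<omega> \<in> {\<omega> \<in> space M. Q \<omega> \<and> h < (mart N \<omega>)\<^sup>2} \<longrightarrow> \<omega> \<in> {\<omega> \<in> space M. Q \<omega> \<and> Y \<omega> \<noteq> 0} \<union> tail_event N \<eta>"
          using near[of N \<eta>]
        proof eventually_elim
          case (elim \<omega>)
          have "(mart N \<omega>)\<^sup>2 \<le> \<eta>\<^sup>2" if "\<omega> \<notin> tail_event N \<eta>" "Y \<omega> = 0"
            using elim that \<eta> by (simp add: abs_le_square_iff[symmetric])
          then show ?case using \<eta> by force
        qed
      qed
      also have "\<dots> \<le> \<P>(\<omega> in M. Q \<omega> \<and> Y \<omega> \<noteq> 0) + prob (tail_event N \<eta>)"
        using QY te[of N \<eta>] n N \<eta> by (intro measure_Un_le) auto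
      finally show ?thesis .
    qed
    then have "\<kappa> * \<P>(\<omega> in M. Q \<omega>) \<le> \<P>(\<omega> in M. Q \<omega> \<and> Y \<omega> \<noteq> 0) + 0"
      by (intro LIMSEQ_le_const[OF tendsto_add[OF tendsto_const tail_event_vanishes[OF b \<eta>(1)]]]) (auto intro!: exI[of _ "Suc n"])
    then show ?thesis by simp
  qed
  define z where "z = \<P>(\<omega> in M. Y \<omega> = 0)"
  have small: "\<kappa> * z \<le> \<P>(\<omega> in M. 0 < \<bar>Y \<omega>\<bar> \<and> \<bar>Y \<omega>\<bar> < \<epsilon>)" if \<epsilon>: "0 < \<epsilon>" for \<epsilon>
  proof -
    define e where "e = \<epsilon> / 2"
    have e: "0 < e" "0 < e / 2" using \<epsilon> by (auto simp: e_def)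
    define S where "S = {\<omega> \<in> space M. 0 < \<bar>Y \<omega>\<bar> \<and> \<bar>Y \<omega>\<bar> < \<epsilon>}"
    have S[measurable]: "S \<in> events" unfolding S_def by measurable
    have "\<kappa> * (z - prob (tail_event n (e / 2))) \<le> prob S + prob (tail_event n (e / 2))" if n: "2 \<le> n" for n
    proof -
      define A where "A = {\<omega> \<in> space M. \<bar>mart n \<omega>\<bar> < e}"
      have adA: "adapted n (\<lambda>\<omega>. \<bar>mart n \<omega>\<bar> < e)" by (rule adapted_comp[OF adapted_mart[OF order_refl]])
      have A: "A \<in> events" unfolding A_def by (rule adapted_event[OF adA])
      have "z \<le> prob (A \<union> tail_event n (e / 2))"
        unfolding z_def
      proof (rule finite_measure_mono_AE)
        show "AE \<omega> in M. \<omega> \<in> {\<omega> \<in> space M. Y \<omega> = 0} \<longrightarrow> \<omega> \<in> A \<union> tail_event n (e / 2)"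
          using near[of n "e / 2"] by eventually_elim (use e in \<open>auto simp: A_def\<close>)
        show "A \<union> tail_event n (e / 2) \<in> events" using A te[OF n e(2)] by auto
      qed
      also have "\<dots> \<le> prob A + prob (tail_event n (e / 2))" using A te[OF n e(2)] by (intro measure_Un_le) auto
      finally have "\<kappa> * (z - prob (tail_event n (e / 2))) \<le> \<kappa> * prob A" using \<kappa> by (intro mult_left_mono) auto
      also have "\<dots> \<le> \<P>(\<omega> in M. \<bar>mart n \<omega>\<bar> < e \<and> Y \<omega> \<noteq> 0)" unfolding A_def by (rule nondeg[OF n adA])
      also have "\<dots> \<le> prob (S \<union> tail_event n (e / 2))"
      proof (rule finite_measure_mono_AE)
        show "AE \<omega> in M. \<omega> \<in> {\<omega> \<in> space M. \<bar>mart n \<omega>\<bar> < e \<and> Y \<omega> \<noteq> 0} \<longrightarrow> \<omega> \<in> S \<union> tail_event n (e / 2)"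
          using near[of n "e / 2"]
        proof eventually_elim
          case (elim \<omega>)
          have "\<bar>Y \<omega>\<bar> < \<epsilon>" if "\<bar>mart n \<omega>\<bar> < e" "\<omega> \<notin> tail_event n (e / 2)"
          proof -
            have "\<bar>Y \<omega> - mart n \<omega>\<bar> \<le> e / 2" using elim that by blast
            then show ?thesis using that(1) e unfolding e_def by linarith
          qed
          then show ?case by (auto simp: S_def)
        qed
        show "S \<union> tail_event n (e / 2) \<in> events" using S te[OF n e(2)] by auto
      qed
      also have "\<dots> \<le> prob S + prob (tail_event n (e / 2))" using S te[OF n e(2)] by (intro measure_Un_le) auto
      finally show ?thesis .
    qed
    then have "\<kappa> * (z - 0) \<le> prob S + 0"
      by (intro LIMSEQ_le[OF tendsto_mult[OF tendsto_const tendsto_diff[OF tendsto_const tail_event_vanishes[OF b e(2)]]]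
            tendsto_add[OF tendsto_const tail_event_vanishes[OF b e(2)]]]) (auto intro!: exI[of _ 2])
    then show ?thesis by (simp add: S_def)
  qed
  define D where "D i = {\<omega> \<in> space M. 0 < \<bar>Y \<omega>\<bar> \<and> \<bar>Y \<omega>\<bar> < inverse (real (Suc i))}" for i
  have D: "D i \<in> events" for i unfolding D_def by measurable
  have "decseq D"
  proof (rule decseq_SucI)
    fix i
    have "inverse (real (Suc (Suc i))) \<le> inverse (real (Suc i))" by (rule le_imp_inverse_le) auto
    then show "D (Suc i) \<le> D i" by (auto simp: D_def simp del: of_nat_Suc intro: less_le_trans)
  qed
  moreover have "(\<Inter>i. D i) = {}"
  proof -
    have "\<exists>i. \<not> (0 < \<bar>Y \<omega>\<bar> \<and> \<bar>Y \<omega>\<bar> < inverse (real (Suc i)))" for \<omega>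
    proof (cases "0 < \<bar>Y \<omega>\<bar>")
      case True
      from reals_Archimedean[OF this] obtain i where "inverse (real (Suc i)) < \<bar>Y \<omega>\<bar>" by auto
      then show ?thesis by (intro exI[of _ i]) auto
    qed auto
    then show ?thesis unfolding D_def by blast
  qed
  ultimately have "(\<lambda>i. prob (D i)) \<longlonglongrightarrow> 0"
    using finite_Lim_measure_decseq[of D] D by auto
  moreover have "\<kappa> * z \<le> prob (D i)" for i unfolding D_def by (rule small) simp
  ultimately have "\<kappa> * z \<le> 0" by (intro LIMSEQ_le_const) auto
  then have "z \<le> 0" using \<kappa> by (simp add: mult_le_0_iff)
  then have "\<P>(\<omega> in M. Y \<omega> = 0) = 0" unfolding z_def using measure_nonneg by (metis antisym)
  then have "AE \<omega> in M. \<not> Y \<omega> = 0" by (subst (asm) prob_Collect_eq_0) auto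
  then show ?thesis by (simp add: Y_def)
qed

theorem superdiffusive_limit:
  assumes b: "1 / 2 < \<beta>"
  shows "AE \<omega> in M. convergent (\<lambda>n. walk n \<omega> / real n powr \<beta>) \<and> lim (\<lambda>n. walk n \<omega> / real n powr \<beta>) \<noteq> 0"
  using mart_convergent[OF b] mart_limit_nonzero[OF b]
proof eventually_elim
  case (elim \<omega>)
  then have "(\<lambda>n. mart n \<omega>) \<longlonglongrightarrow> lim (\<lambda>n. mart n \<omega>)" by (simp add: convergent_LIMSEQ_iff)
  from tendsto_mult[OF this norming_asymp[OF beta_bounds(1)]]
  have "(\<lambda>n. walk n \<omega> / real n powr \<beta>) \<longlonglongrightarrow> lim (\<lambda>n. mart n \<omega>) * rGamma (2 + \<beta>)"
    by (simp add: mart_def)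
  then show ?case using elim rGamma_norming_pos[OF beta_bounds(1)] by (auto simp: convergent_def limI)
qed

theorem superdiffusive_cover_time:
  assumes b: "1 / 2 < \<beta>"
  shows "AE \<omega> in M. (\<lambda>L. ereal_of_enat (cover_time L X \<omega>) / ereal (real L powr (1 / \<beta>)))
    \<longlonglongrightarrow> ereal (1 / \<bar>lim (\<lambda>n. walk n \<omega> / real n powr \<beta>)\<bar> powr (1 / \<beta>))"
  using superdiffusive_limit[OF b] AE_steps
proof eventually_elim
  case (elim \<omega>)
  define y where "y = lim (\<lambda>n. walk n \<omega> / real n powr \<beta>)"
  have y: "y \<noteq> 0" "(\<lambda>n. walk n \<omega> / real n powr \<beta>) \<longlonglongrightarrow> y"
    using elim by (auto simp: y_def convergent_LIMSEQ_iff)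
  have b0: "0 < \<beta>" using b by simp
  have sp: "(\<lambda>n. spread n \<omega> / real n powr \<beta>) \<longlonglongrightarrow> \<bar>y\<bar>"
    unfolding spread_def by (rule spread_growth[OF b0 _ y(2)]) simp
  have "filterlim (\<lambda>n. real n powr \<beta>) at_top sequentially" using b0 by real_asymp
  then have "filterlim (\<lambda>n. spread n \<omega> / real n powr \<beta> * real n powr \<beta>) at_top sequentially"
    using y by (intro filterlim_tendsto_pos_mult_at_top[OF sp]) auto
  moreover have "\<forall>\<^sub>F n in sequentially. spread n \<omega> / real n powr \<beta> * real n powr \<beta> = spread n \<omega>"
    using eventually_gt_at_top[of 0] by eventually_elim simp
  ultimately have inf: "filterlim (\<lambda>n. spread n \<omega>) at_top sequentially" by (simp cong: filterlim_cong)
  define t where "t L = the_enat (cover_time L X \<omega>)" for L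
  have t: "cover_time L X \<omega> = enat (t L)" if L: "1 \<le> L" for L
  proof -
    have "\<forall>\<^sub>F n in sequentially. real L - 1 \<le> spread n \<omega>" using inf by (simp add: filterlim_at_top)
    then obtain n where "real L - 1 \<le> spread n \<omega>" by (auto simp: eventually_sequentially)
    then have "cover_time L X \<omega> \<le> enat n" using cover_time_le_iff[OF L elim(2)] by simp
    then show ?thesis unfolding t_def by (cases "cover_time L X \<omega>") auto
  qed
  have tle: "t L \<le> n \<longleftrightarrow> real L - 1 \<le> spread n \<omega>" if "1 \<le> L" for L n
    using cover_time_le_iff[OF that elim(2), of n] t[OF that] by simp
  have "(\<lambda>L. real (t L) / real L powr (1 / \<beta>)) \<longlonglongrightarrow> 1 / \<bar>y\<bar> powr (1 / \<beta>)"
  proof (rule inverse_growth[OF b0 _ sp])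
    show "0 < \<bar>y\<bar>" using y by simp
    show "\<forall>\<^sub>F L in sequentially. real L - 1 \<le> spread (t L) \<omega>"
      using eventually_ge_at_top[of 1] by eventually_elim (simp flip: tle)
    show "\<forall>\<^sub>F L in sequentially. spread (t L - 1) \<omega> < real L - 1"
      using eventually_ge_at_top[of 2]
    proof eventually_elim
      case (elim L)
      have "spread 0 \<omega> = 0" by (simp add: spread_def path_spread_def)
      then have "\<not> t L \<le> 0" using tle[of L 0] elim by simp
      then have "\<not> t L \<le> t L - 1" by simp
      then show ?case using tle[of L "t L - 1"] elim by simp
    qed
    show "filterlim t at_top sequentially"
    proof (unfold filterlim_at_top, intro allI)
      fix n
      show "\<forall>\<^sub>F L in sequentially. n \<le> t L"
        using eventually_ge_at_top[of "nat \<lceil>spread n \<omega>\<rceil> + 2"]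
      proof eventually_elim
        case (elim L)
        have "spread n \<omega> < real L - 1" using elim by linarith
        then have "\<not> t L \<le> n" using tle[of L n] elim by simp
        then show ?case by simp
      qed
    qed
  qed
  then have "(\<lambda>L. ereal (real (t L) / real L powr (1 / \<beta>))) \<longlonglongrightarrow> ereal (1 / \<bar>y\<bar> powr (1 / \<beta>))" by simp
  moreover have "\<forall>\<^sub>F L in sequentially. ereal (real (t L) / real L powr (1 / \<beta>))
    = ereal_of_enat (cover_time L X \<omega>) / ereal (real L powr (1 / \<beta>))"
    using eventually_ge_at_top[of 1] by eventually_elim (simp add: t)
  ultimately show ?case unfolding y_def[symmetric] by (rule Lim_transform_eventually)
qed

end

section \<open>The critical regime\<close>

lemma norming_mono:
  assumes "0 \<le> \<beta>" "k \<le> n" shows "norming \<beta> k \<le> norming \<beta> n"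
proof -
  have "(\<Prod>j\<in>{2..<k}. 1 + \<beta> / real j) * 1 \<le> (\<Prod>j\<in>{2..<k}. 1 + \<beta> / real j) * (\<Prod>j\<in>{2..<n} - {2..<k}. 1 + \<beta> / real j)"
    using assms by (intro mult_left_mono prod_ge_1 prod_nonneg) auto
  also have "\<dots> = (\<Prod>j\<in>{2..<n}. 1 + \<beta> / real j)"
    using assms by (subst mult.commute, subst prod.subset_diff[of "{2..<k}" "{2..<n}"]) auto
  finally show ?thesis by (simp add: norming_def)
qed

text \<open>
  The probability that a standard normal variable exceeds \<open>c\<close> in absolute value. The half-open
  interval fits the distribution functions; its end points have no mass.
\<close>

definition two_sided_tail :: "real \<Rightarrow> real" where
  "two_sided_tail c = 1 - measure std_normal_distribution {- c<..c}"

lemma two_sided_tail_Lipschitz: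
  assumes "0 \<le> c" "c \<le> c'"
  shows "two_sided_tail c \<le> two_sided_tail c' + 2 * (c' - c)"
proof -
  interpret real_distribution std_normal_distribution by (rule real_dist_normal_dist)
  have "prob {- c'<..c'} \<le> prob ({- c'<..- c} \<union> {- c<..c} \<union> {c<..c'})"
    by (intro finite_measure_mono) auto
  also have "\<dots> \<le> prob {- c'<..- c} + prob {- c<..c} + prob {c<..c'}"
    by (intro order_trans[OF measure_Un_le] add_right_mono measure_Un_le) auto
  also have "\<dots> \<le> (- c - - c') + prob {- c<..c} + (c' - c)"
    using assms by (intro add_mono std_normal_interval_le) auto
  finally show ?thesis by (simp add: two_sided_tail_def)
qed

context elephant_random_walk
begin

text \<open>
  Between the times \<open>m\<close> and \<open>n\<close> the path is nearly a multiple of \<open>b\<^sub>k\<close>, which increases, so it runs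
  monotonically from near 0 to \<open>S\<^sub>n\<close>; before \<open>m\<close> it stays near 0.
\<close>

lemma spread_le_endpoint:
  assumes b: "0 \<le> \<beta>" and mn: "2 \<le> m" "m \<le> n" and h: "1 \<le> h"
    and X: "\<forall>k\<ge>1. X k \<omega> = 1 \<or> X k \<omega> = -1"
    and early: "\<And>k. k \<in> {2..m} \<Longrightarrow> \<bar>walk k \<omega>\<bar> \<le> h"
    and late: "\<And>k. k \<in> {m..n} \<Longrightarrow> \<bar>mart k \<omega> - mart m \<omega>\<bar> \<le> h / (2 * norming \<beta> n)"
  shows "spread n \<omega> \<le> \<bar>walk n \<omega>\<bar> + 2 * h"
proof -
  have *: "min 0 (walk n \<omega>) - h \<le> walk k \<omega> \<and> walk k \<omega> \<le> max 0 (walk n \<omega>) + h" if k: "k \<le> n" for k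
  proof -
    consider "k < 2" | "k \<in> {2..m}" | "k \<in> {m..n}" using k mn by force
    then show ?thesis
    proof cases
      case 1
      have "real k \<le> 1" using 1 by linarith
      then have "\<bar>walk k \<omega>\<bar> \<le> h" using abs_walk_le[OF X, of k] h by linarith
      then show ?thesis by linarith
    next
      case 2
      then show ?thesis using early[OF 2] by linarith
    next
      case 3
      define r where "r = norming \<beta> k / norming \<beta> n"
      have r: "0 \<le> r" "r \<le> 1" using norming_mono[OF b k] by (auto simp: r_def less_imp_le divide_le_eq_1)
      have split: "walk k \<omega> = r * walk n \<omega> + norming \<beta> k * (mart k \<omega> - mart n \<omega>)"
      proof -
        have "w = a / c * v + a * (w / a - v / c)" if "a \<noteq> 0" "c \<noteq> 0" for w v a c :: real
          using that by (simp add: field_simps)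
        then show ?thesis unfolding r_def mart_def by (metis norming_beta_nonzero)
      qed
      have "\<bar>mart k \<omega> - mart n \<omega>\<bar> \<le> \<bar>mart k \<omega> - mart m \<omega>\<bar> + \<bar>mart n \<omega> - mart m \<omega>\<bar>" by linarith
      also have "\<dots> \<le> h / norming \<beta> n" using late[OF 3] late[of n] mn by (simp add: field_simps)
      finally have "norming \<beta> k * \<bar>mart k \<omega> - mart n \<omega>\<bar> \<le> norming \<beta> n * (h / norming \<beta> n)"
        using norming_mono[OF b k] h by (intro mult_mono) (auto simp: less_imp_le)
      then have e: "\<bar>norming \<beta> k * (mart k \<omega> - mart n \<omega>)\<bar> \<le> h" by (simp add: abs_mult abs_of_pos)
      have "min 0 (walk n \<omega>) \<le> r * walk n \<omega> \<and> r * walk n \<omega> \<le> max 0 (walk n \<omega>)"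
      proof (cases "0 \<le> walk n \<omega>")
        case True
        then show ?thesis using r mult_right_mono[OF r(2) True] by simp
      next
        case False
        then have "walk n \<omega> \<le> r * walk n \<omega>" using mult_right_mono_neg[OF r(2), of "walk n \<omega>"] by simp
        moreover have "r * walk n \<omega> \<le> 0" using r False by (simp add: mult_nonneg_nonpos)
        ultimately show ?thesis using False by simp
      qed
      then show ?thesis using split e by linarith
    qed
  qed
  obtain i j where ij: "i \<le> n" "j \<le> n" "spread n \<omega> = walk i \<omega> - walk j \<omega>"
    unfolding spread_def by (rule path_spread_attained)
  show ?thesis using *[OF ij(1)] *[OF ij(2)] ij(3) by linarith
qed

text \<open>
  The two parts of the path are separated at \<open>m = n / ln n\<close>. This time is short compared with \<open>n\<close>, so
  that the walk is still negligible on the scale \<open>\<surd>(n ln n)\<close>, and at the same time \<open>ln m\<close> is asymptotic to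
  \<open>ln n\<close>, so that the martingale accumulates only a vanishing fraction of its variance after \<open>m\<close>.
\<close>

lemma critical_spread_endpoint:
  assumes b: "\<beta> = 1 / 2" and \<epsilon>: "0 < \<epsilon>"
  shows "(\<lambda>n. \<P>(\<omega> in M. \<bar>walk n \<omega>\<bar> + 2 * (\<epsilon> * sqrt (real n * ln (real n))) < spread n \<omega>)) \<longlonglongrightarrow> 0"
proof -
  define m where "m n = nat \<lfloor>real n / ln (real n)\<rfloor>" for n
  define \<sigma> where "\<sigma> n = sqrt (real n * ln (real n))" for n
  have m: "filterlim m at_top sequentially" unfolding m_def by real_asymp
  have mn: "\<forall>\<^sub>F n in sequentially. m n \<le> n"
  proof -
    have "\<forall>\<^sub>F n in sequentially. 1 \<le> ln (real n)" by real_asymp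
    then show ?thesis using eventually_gt_at_top[of 0]
    proof eventually_elim
      case (elim n)
      then have "real n / ln (real n) \<le> real n" by (simp add: divide_le_eq)
      then show ?case unfolding m_def by linarith
    qed
  qed
  have ln_ratio: "(\<lambda>n. ln (real (m n)) / ln (real n)) \<longlonglongrightarrow> 1" unfolding m_def by real_asymp
  have m_ratio: "(\<lambda>n. real (m n) * ln (real (m n)) / (real n * ln (real n))) \<longlonglongrightarrow> 0" unfolding m_def by real_asymp
  define \<kappa> where "\<kappa> = rGamma (2 + 1 / 2 :: real)"
  have clock_m: "(\<lambda>n. clock \<beta> (m n) / ln (real n)) \<longlonglongrightarrow> 1 / \<kappa>\<^sup>2"
  proof -
    have "(\<lambda>n. clock \<beta> (m n) / ln (real (m n)) * (ln (real (m n)) / ln (real n))) \<longlonglongrightarrow> 1 / \<kappa>\<^sup>2 * 1"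
      unfolding b \<kappa>_def by (intro tendsto_mult ln_ratio filterlim_compose[OF clock_asymp_critical m])
    moreover have "\<forall>\<^sub>F n in sequentially. clock \<beta> (m n) / ln (real (m n)) * (ln (real (m n)) / ln (real n)) = clock \<beta> (m n) / ln (real n)"
    proof -
      have "\<forall>\<^sub>F n in sequentially. 2 \<le> m n" using m by (simp add: filterlim_at_top)
      then show ?thesis by eventually_elim simp
    qed
    ultimately show ?thesis unfolding mult_1_right by (rule Lim_transform_eventually)
  qed
  have clock_diff: "(\<lambda>n. (clock \<beta> n - clock \<beta> (m n)) / ln (real n)) \<longlonglongrightarrow> 0"
    using tendsto_diff[OF clock_asymp_critical[folded \<kappa>_def b] clock_m] by (simp add: diff_divide_distrib)
  have nc: "(\<lambda>n. (norming \<beta> n)\<^sup>2 * (clock \<beta> n + 3) / (real n * ln (real n))) \<longlonglongrightarrow> 1"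
  proof -
    have "(\<lambda>n. (norming \<beta> n)\<^sup>2 * clock \<beta> n / (real n * ln (real n)) + 3 * ((norming \<beta> n / real n powr \<beta>)\<^sup>2 * (1 / ln (real n)))) \<longlonglongrightarrow> 1 + 3 * (\<kappa>\<^sup>2 * 0)"
      unfolding b \<kappa>_def
    proof (intro tendsto_add tendsto_mult tendsto_const tendsto_power norming_asymp norming_clock_asymp_critical)
      show "(\<lambda>n. 1 / ln (real n)) \<longlonglongrightarrow> 0" by real_asymp
    qed auto
    moreover have "\<forall>\<^sub>F n in sequentially. (norming \<beta> n)\<^sup>2 * clock \<beta> n / (real n * ln (real n)) + 3 * ((norming \<beta> n / real n powr \<beta>)\<^sup>2 * (1 / ln (real n)))
      = (norming \<beta> n)\<^sup>2 * (clock \<beta> n + 3) / (real n * ln (real n))"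
      using eventually_gt_at_top[of 1]
    proof eventually_elim
      case (elim n)
      then have "(real n powr \<beta>)\<^sup>2 = real n" by (simp add: b powr_power)
      then show ?case by (simp add: power_divide ring_distribs add_divide_distrib)
    qed
    ultimately show ?thesis by (simp add: tendsto_cong)
  qed
  have nb: "(\<lambda>n. (norming \<beta> n)\<^sup>2 / real n) \<longlonglongrightarrow> \<kappa>\<^sup>2"
  proof -
    have "(\<lambda>n. (norming (1/2) n / real n powr (1/2))\<^sup>2) \<longlonglongrightarrow> \<kappa>\<^sup>2"
      unfolding \<kappa>_def by (intro tendsto_power norming_asymp) auto
    moreover have "\<forall>\<^sub>F n in sequentially. (norming (1/2) n / real n powr (1/2))\<^sup>2 = (norming \<beta> n)\<^sup>2 / real n"
      using eventually_gt_at_top[of 0] by eventually_elim (simp add: b power_divide powr_power)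
    ultimately show ?thesis by (simp add: tendsto_cong)
  qed
  define A where "A n = (norming \<beta> (m n))\<^sup>2 * (clock \<beta> (m n) + 3) / (real n * ln (real n))" for n
  define B where "B n = (norming \<beta> n)\<^sup>2 * (clock \<beta> n - clock \<beta> (m n)) / (real n * ln (real n))" for n
  have A: "A \<longlonglongrightarrow> 0"
  proof -
    have "(\<lambda>n. (norming \<beta> (m n))\<^sup>2 * (clock \<beta> (m n) + 3) / (real (m n) * ln (real (m n))) * (real (m n) * ln (real (m n)) / (real n * ln (real n)))) \<longlonglongrightarrow> 1 * 0"
      by (intro tendsto_mult m_ratio filterlim_compose[OF nc m])
    moreover have "\<forall>\<^sub>F n in sequentially. (norming \<beta> (m n))\<^sup>2 * (clock \<beta> (m n) + 3) / (real (m n) * ln (real (m n))) * (real (m n) * ln (real (m n)) / (real n * ln (real n))) = A n"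
    proof -
      have "\<forall>\<^sub>F n in sequentially. 2 \<le> m n" using m by (simp add: filterlim_at_top)
      then show ?thesis by eventually_elim (simp add: A_def)
    qed
    ultimately show ?thesis by (simp add: tendsto_cong)
  qed
  have B: "B \<longlonglongrightarrow> 0"
  proof -
    have "(\<lambda>n. (norming \<beta> n)\<^sup>2 / real n * ((clock \<beta> n - clock \<beta> (m n)) / ln (real n))) \<longlonglongrightarrow> \<kappa>\<^sup>2 * 0"
      by (intro tendsto_mult nb clock_diff)
    then show ?thesis by (simp add: B_def[abs_def])
  qed
  have lim: "(\<lambda>n. 8 * (A n)\<^sup>2 / \<epsilon> ^ 4 + 128 * (B n)\<^sup>2 / \<epsilon> ^ 4) \<longlonglongrightarrow> 0"
  proof -
    have "(\<lambda>n. 8 * (A n)\<^sup>2 / \<epsilon> ^ 4 + 128 * (B n)\<^sup>2 / \<epsilon> ^ 4) \<longlonglongrightarrow> 8 * 0\<^sup>2 / \<epsilon> ^ 4 + 128 * 0\<^sup>2 / \<epsilon> ^ 4"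
      using \<epsilon> by (intro tendsto_intros A B) auto
    then show ?thesis by simp
  qed
  have "\<forall>\<^sub>F n in sequentially. 1 \<le> \<epsilon> * \<sigma> n" unfolding \<sigma>_def using \<epsilon> by real_asymp
  moreover have "\<forall>\<^sub>F n in sequentially. 2 \<le> m n" using m by (simp add: filterlim_at_top)
  ultimately have "\<forall>\<^sub>F n in sequentially. \<P>(\<omega> in M. \<bar>walk n \<omega>\<bar> + 2 * (\<epsilon> * \<sigma> n) < spread n \<omega>) \<le> 8 * (A n)\<^sup>2 / \<epsilon> ^ 4 + 128 * (B n)\<^sup>2 / \<epsilon> ^ 4"
    using mn eventually_gt_at_top[of 1]
  proof eventually_elim
    case (elim n)
    define h where "h = \<epsilon> * \<sigma> n"
    have h: "0 < h" "1 \<le> h" using elim by (auto simp: h_def)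
    have \<sigma>2: "(\<sigma> n)\<^sup>2 = real n * ln (real n)" using elim by (simp add: \<sigma>_def)
    define E1 where "E1 = {\<omega> \<in> space M. \<exists>k\<in>{2..m n}. h / norming \<beta> (m n) \<le> \<bar>mart k \<omega>\<bar>}"
    define E2 where "E2 = {\<omega> \<in> space M. \<exists>k\<in>{m n..n}. h / (2 * norming \<beta> n) \<le> \<bar>mart k \<omega> - mart (m n) \<omega>\<bar>}"
    have E: "E1 \<in> events" "E2 \<in> events"
    proof -
      show "E1 \<in> events" unfolding E1_def
        by (rule adapted_event[of n], rule adapted_Bex, rule adapted_comp, rule adapted_mart) (use elim in auto)
      show "E2 \<in> events" unfolding E2_def
        by (rule adapted_event[of n], rule adapted_Bex, rule adapted_comp2[OF adapted_mart adapted_mart]) (use elim in auto)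
    qed
    have P1: "prob E1 \<le> 8 * (A n)\<^sup>2 / \<epsilon> ^ 4"
    proof -
      have "prob E1 \<le> 8 * (clock \<beta> (m n) + 3)\<^sup>2 / (h / norming \<beta> (m n)) ^ 4"
        unfolding E1_def using elim h by (intro mart_maximal) auto
      also have "\<dots> = 8 * (A n)\<^sup>2 / \<epsilon> ^ 4"
      proof -
        have "8 * v\<^sup>2 / (\<epsilon> * s / c) ^ 4 = 8 * (c\<^sup>2 * v / s\<^sup>2)\<^sup>2 / \<epsilon> ^ 4" for v s c :: real
          by (simp add: power_divide power_mult_distrib mult_ac flip: power_mult)
        then show ?thesis unfolding A_def h_def \<sigma>2[symmetric] .
      qed
      finally show ?thesis .
    qed
    have P2: "prob E2 \<le> 128 * (B n)\<^sup>2 / \<epsilon> ^ 4"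
    proof -
      have "prob E2 \<le> 8 * (clock \<beta> n - clock \<beta> (m n))\<^sup>2 / (h / (2 * norming \<beta> n)) ^ 4"
        unfolding E2_def using elim h by (intro mart_increment_maximal) auto
      also have "\<dots> = 128 * (B n)\<^sup>2 / \<epsilon> ^ 4"
      proof -
        have "8 * v\<^sup>2 / (\<epsilon> * s / (2 * c)) ^ 4 = 128 * (c\<^sup>2 * v / s\<^sup>2)\<^sup>2 / \<epsilon> ^ 4" for v s c :: real
          by (simp add: power_divide power_mult_distrib mult_ac flip: power_mult)
        then show ?thesis unfolding B_def h_def \<sigma>2[symmetric] .
      qed
      finally show ?thesis .
    qed
    have "\<P>(\<omega> in M. \<bar>walk n \<omega>\<bar> + 2 * h < spread n \<omega>) \<le> prob (E1 \<union> E2)"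
    proof (rule finite_measure_mono_AE)
      show "AE \<omega> in M. \<omega> \<in> {\<omega> \<in> space M. \<bar>walk n \<omega>\<bar> + 2 * h < spread n \<omega>} \<longrightarrow> \<omega> \<in> E1 \<union> E2"
        using AE_steps AE_space
      proof eventually_elim
        case (elim \<omega>)
        have "spread n \<omega> \<le> \<bar>walk n \<omega>\<bar> + 2 * h" if no: "\<omega> \<notin> E1" "\<omega> \<notin> E2"
        proof (rule spread_le_endpoint[OF _ _ _ h(2) elim(1)])
          show "0 \<le> \<beta>" using b by simp
          show "2 \<le> m n" "m n \<le> n" by fact+
          fix k
          show "\<bar>mart k \<omega> - mart (m n) \<omega>\<bar> \<le> h / (2 * norming \<beta> n)" if "k \<in> {m n..n}"
            using no(2) that elim(2) unfolding E2_def by (auto simp: not_le less_imp_le)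
          show "\<bar>walk k \<omega>\<bar> \<le> h" if k: "k \<in> {2..m n}"
          proof -
            have "\<bar>mart k \<omega>\<bar> \<le> h / norming \<beta> (m n)" using no(1) k elim(2) unfolding E1_def by (auto simp: not_le less_imp_le)
            also have "\<dots> \<le> h / norming \<beta> k"
            proof -
              have "0 \<le> \<beta>" using b by simp
              then have "norming \<beta> k \<le> norming \<beta> (m n)" by (rule norming_mono) (use k in auto)
              then show ?thesis by (rule divide_left_mono) (use h in auto)
            qed
            finally show ?thesis by (simp add: mart_def abs_div abs_of_pos divide_le_cancel)
          qed
        qed
        then show ?case by force
      qed
    qed (use E in auto)
    also have "\<dots> \<le> prob E1 + prob E2" using E by (intro measure_Un_le) auto
    finally show ?case using P1 P2 by (simp add: h_def)
  qed
  then show ?thesis unfolding \<sigma>_def[symmetric] by (intro tendsto_sandwich[OF _ _ tendsto_const lim]) auto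
qed

lemma critical_spread_limit:
  assumes b: "\<beta> = 1 / 2" and c: "0 < c"
  shows "(\<lambda>n. \<P>(\<omega> in M. c * sqrt (real n * ln (real n)) \<le> spread n \<omega>)) \<longlonglongrightarrow> two_sided_tail c"
proof (rule LIMSEQ_I)
  fix e :: real assume e: "0 < e"
  define \<epsilon> where "\<epsilon> = min (e / 32) (c / 8)"
  have \<epsilon>: "0 < \<epsilon>" "32 * \<epsilon> \<le> e" "8 * \<epsilon> \<le> c" using e c by (auto simp: \<epsilon>_def)
  define \<sigma> where "\<sigma> n = sqrt (real n * ln (real n))" for n
  define a where "a n = 1 / sqrt (clock \<beta> n)" for n
  define R where "R n \<omega> = a n * (mart n \<omega> - mart 2 \<omega>)" for n \<omega>
  have b': "\<beta> \<le> 1 / 2" using b by simp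
  have av: "(a n)\<^sup>2 * clock \<beta> n \<le> 1" "3 \<le> n \<Longrightarrow> (a n)\<^sup>2 * clock \<beta> n = 1" for n
    using clock_nonneg[of \<beta> n] clock_pos[of n \<beta>] beta_bounds(1) by (cases "clock \<beta> n = 0"; simp add: a_def power_divide)+
  have adR: "adapted (max 2 n) (R n)" for n
    unfolding R_def[abs_def] by (rule adapted_comp2[OF adapted_mart adapted_mart]) auto
  have Rlim: "(\<lambda>n. \<P>(\<omega> in M. R n \<omega> \<notin> {- h<..h})) \<longlonglongrightarrow> two_sided_tail h" if h: "0 < h" for h
  proof -
    have "(\<lambda>L. \<P>(\<omega> in M. True \<and> a (L + 3) * (mart (L + 3) \<omega> - mart 2 \<omega>) \<in> {- h<..h}))
      \<longlonglongrightarrow> 1 * measure std_normal_distribution {- h<..h}"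
    proof (rule conditional_clt[OF b'])
      show "filterlim (\<lambda>L. L + 3) at_top sequentially" by (rule filterlim_add_const_nat_at_top)
      show "(\<lambda>L. \<P>(\<omega> in M. True)) \<longlonglongrightarrow> 1" by (simp add: prob_space)
      show "(\<lambda>L. (a (L + 3))\<^sup>2 * (clock \<beta> (L + 3) - clock \<beta> 2)) \<longlonglongrightarrow> 1" by (simp add: av(2))
    qed (use h av in auto)
    then have "(\<lambda>L. \<P>(\<omega> in M. R (L + 3) \<omega> \<in> {- h<..h})) \<longlonglongrightarrow> measure std_normal_distribution {- h<..h}"
      by (simp add: R_def)
    then have "(\<lambda>n. \<P>(\<omega> in M. R n \<omega> \<in> {- h<..h})) \<longlonglongrightarrow> measure std_normal_distribution {- h<..h}" by (rule LIMSEQ_offset)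
    then have "(\<lambda>n. 1 - \<P>(\<omega> in M. R n \<omega> \<in> {- h<..h})) \<longlonglongrightarrow> two_sided_tail h"
      unfolding two_sided_tail_def by (intro tendsto_diff tendsto_const)
    moreover have "1 - \<P>(\<omega> in M. R n \<omega> \<in> {- h<..h}) = \<P>(\<omega> in M. R n \<omega> \<notin> {- h<..h})" for n
      by (rule prob_neg[symmetric], rule adapted_event[OF adapted_comp[OF adR]])
    ultimately show ?thesis by simp
  qed
  define \<rho> where "\<rho> n = norming \<beta> n * sqrt (clock \<beta> n) / \<sigma> n" for n
  have \<rho>: "\<rho> \<longlonglongrightarrow> 1"
  proof -
    have "(\<lambda>n. sqrt ((norming (1/2) n)\<^sup>2 * clock (1/2) n / (real n * ln (real n)))) \<longlonglongrightarrow> sqrt 1"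
      by (intro tendsto_real_sqrt norming_clock_asymp_critical)
    moreover have "sqrt ((norming (1/2) n)\<^sup>2 * clock (1/2) n / (real n * ln (real n))) = \<rho> n" for n
      using norming_beta_pos[of n] unfolding \<rho>_def \<sigma>_def b by (simp add: real_sqrt_divide real_sqrt_mult abs_of_pos)
    ultimately show ?thesis by simp
  qed
  have a0: "a \<longlonglongrightarrow> 0"
  proof -
    have "filterlim (\<lambda>n. sqrt (clock \<beta> n)) at_top sequentially"
      by (rule filterlim_compose[OF sqrt_at_top clock_at_top[OF beta_bounds(1) b']])
    from tendsto_inverse_0_at_top[OF this] show ?thesis by (simp add: a_def[abs_def] inverse_eq_divide)
  qed
  have up_lim: "(\<lambda>n. \<rho> n * (c - 3 * \<epsilon>) + \<rho> n * (2 * a n)) \<longlonglongrightarrow> 1 * (c - 3 * \<epsilon>) + 1 * (2 * 0)"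
    by (intro tendsto_intros \<rho> a0)
  have lo_lim: "(\<lambda>n. \<rho> n * (c + \<epsilon>) - \<rho> n * (2 * a n)) \<longlonglongrightarrow> 1 * (c + \<epsilon>) - 1 * (2 * 0)"
    by (intro tendsto_intros \<rho> a0)
  have ev1: "\<forall>\<^sub>F n in sequentially. \<rho> n * (c - 3 * \<epsilon>) + \<rho> n * (2 * a n) < c - 2 * \<epsilon>"
    by (rule order_tendstoD(2)[OF up_lim]) (use \<epsilon> in simp)
  have ev2: "\<forall>\<^sub>F n in sequentially. c < \<rho> n * (c + \<epsilon>) - \<rho> n * (2 * a n)"
    by (rule order_tendstoD(1)[OF lo_lim]) (use \<epsilon> in simp)
  have ev3: "\<forall>\<^sub>F n in sequentially. \<P>(\<omega> in M. R n \<omega> \<notin> {- (c - 4 * \<epsilon>)<..c - 4 * \<epsilon>}) < two_sided_tail (c - 4 * \<epsilon>) + \<epsilon>"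
    by (rule order_tendstoD(2)[OF Rlim]) (use \<epsilon> c in auto)
  have ev4: "\<forall>\<^sub>F n in sequentially. two_sided_tail (c + \<epsilon>) - \<epsilon> < \<P>(\<omega> in M. R n \<omega> \<notin> {- (c + \<epsilon>)<..c + \<epsilon>})"
    by (rule order_tendstoD(1)[OF Rlim]) (use \<epsilon> c in auto)
  have ev5: "\<forall>\<^sub>F n in sequentially. \<P>(\<omega> in M. \<bar>walk n \<omega>\<bar> + 2 * (\<epsilon> * \<sigma> n) < spread n \<omega>) < \<epsilon>"
    unfolding \<sigma>_def by (rule order_tendstoD(2)[OF critical_spread_endpoint[OF b \<epsilon>(1)] \<epsilon>(1)])
  have "\<forall>\<^sub>F n in sequentially. norm (\<P>(\<omega> in M. c * \<sigma> n \<le> spread n \<omega>) - two_sided_tail c) < e"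
    using ev1 ev2 ev3 ev4 ev5 eventually_ge_at_top[of 3]
  proof eventually_elim
    case (elim n)
    have s: "0 < \<sigma> n" using elim by (simp add: \<sigma>_def)
    have vn: "0 < clock \<beta> n" using clock_pos[of n \<beta>] elim beta_bounds(1) by simp
    have \<rho>0: "0 < \<rho> n" using s vn by (simp add: \<rho>_def)
    have evS: "{\<omega> \<in> space M. c * \<sigma> n \<le> spread n \<omega>} \<in> events"
      by (rule adapted_event[OF adapted_comp[OF adapted_spread[OF order_refl]]])
    have close: "\<bar>\<bar>walk n \<omega>\<bar> / \<sigma> n - \<rho> n * \<bar>R n \<omega>\<bar>\<bar> \<le> \<rho> n * (2 * a n)"
      if X: "\<forall>k\<ge>1. X k \<omega> = 1 \<or> X k \<omega> = -1" for \<omega>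
    proof -
      have "\<rho> n * R n \<omega> = norming \<beta> n * (mart n \<omega> - mart 2 \<omega>) / \<sigma> n"
        using vn by (simp add: \<rho>_def R_def a_def)
      also have "\<dots> = walk n \<omega> / \<sigma> n - \<rho> n * (a n * mart 2 \<omega>)"
        using vn by (simp add: \<rho>_def a_def mart_def[of n] right_diff_distrib diff_divide_distrib)
      finally have "walk n \<omega> / \<sigma> n - \<rho> n * R n \<omega> = \<rho> n * (a n * mart 2 \<omega>)" by simp
      moreover have "\<bar>\<rho> n * (a n * mart 2 \<omega>)\<bar> \<le> \<rho> n * (a n * 2)"
        using \<rho>0 vn abs_mart_2_le[OF X] by (simp add: abs_mult a_def divide_right_mono)
      ultimately have "\<bar>walk n \<omega> / \<sigma> n - \<rho> n * R n \<omega>\<bar> \<le> \<rho> n * (2 * a n)" by (simp add: mult.commute)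
      moreover have "\<bar>walk n \<omega>\<bar> / \<sigma> n = \<bar>walk n \<omega> / \<sigma> n\<bar>" "\<rho> n * \<bar>R n \<omega>\<bar> = \<bar>\<rho> n * R n \<omega>\<bar>"
        using s \<rho>0 by (simp_all add: abs_div abs_mult)
      ultimately show ?thesis by linarith
    qed
    have lower: "\<P>(\<omega> in M. R n \<omega> \<notin> {- (c + \<epsilon>)<..c + \<epsilon>}) \<le> \<P>(\<omega> in M. c * \<sigma> n \<le> spread n \<omega>)"
    proof (rule finite_measure_mono_AE[OF _ evS])
      show "AE \<omega> in M. \<omega> \<in> {\<omega> \<in> space M. R n \<omega> \<notin> {- (c + \<epsilon>)<..c + \<epsilon>}} \<longrightarrow> \<omega> \<in> {\<omega> \<in> space M. c * \<sigma> n \<le> spread n \<omega>}"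
        using AE_steps
      proof eventually_elim
        case X: (elim \<omega>)
        show ?case
        proof
          assume "\<omega> \<in> {\<omega> \<in> space M. R n \<omega> \<notin> {- (c + \<epsilon>)<..c + \<epsilon>}}"
          then have \<omega>: "\<omega> \<in> space M" "c + \<epsilon> \<le> \<bar>R n \<omega>\<bar>" by auto
          have "\<rho> n * (c + \<epsilon>) \<le> \<rho> n * \<bar>R n \<omega>\<bar>" using \<omega> \<rho>0 by (intro mult_left_mono) auto
          then have "c \<le> \<bar>walk n \<omega>\<bar> / \<sigma> n" using close[OF X] elim by linarith
          then have "c * \<sigma> n \<le> \<bar>walk n \<omega>\<bar>" using s by (simp add: pos_le_divide_eq)
          then show "\<omega> \<in> {\<omega> \<in> space M. c * \<sigma> n \<le> spread n \<omega>}" using \<omega> abs_walk_le_spread[of n n \<omega>] by simp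
        qed
      qed
    qed
    define E where "E = {\<omega> \<in> space M. \<bar>walk n \<omega>\<bar> + 2 * (\<epsilon> * \<sigma> n) < spread n \<omega>}"
    define F where "F = {\<omega> \<in> space M. R n \<omega> \<notin> {- (c - 4 * \<epsilon>)<..c - 4 * \<epsilon>}}"
    have E: "E \<in> events"
      unfolding E_def by (rule adapted_event[of n], rule adapted_comp2[OF adapted_walk adapted_spread]) auto
    have F: "F \<in> events" unfolding F_def by (rule adapted_event[OF adapted_comp[OF adR]])
    have "\<P>(\<omega> in M. c * \<sigma> n \<le> spread n \<omega>) \<le> prob (F \<union> E)"
    proof (rule finite_measure_mono_AE)
      show "AE \<omega> in M. \<omega> \<in> {\<omega> \<in> space M. c * \<sigma> n \<le> spread n \<omega>} \<longrightarrow> \<omega> \<in> F \<union> E"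
        using AE_steps
      proof eventually_elim
        case X: (elim \<omega>)
        have "\<omega> \<in> F" if \<omega>: "\<omega> \<in> space M" "c * \<sigma> n \<le> spread n \<omega>" "\<omega> \<notin> E"
        proof -
          have "c * \<sigma> n \<le> \<bar>walk n \<omega>\<bar> + 2 * (\<epsilon> * \<sigma> n)" using \<omega> by (auto simp: E_def)
          then have "(c - 2 * \<epsilon>) * \<sigma> n \<le> \<bar>walk n \<omega>\<bar>" by (simp add: algebra_simps)
          then have "c - 2 * \<epsilon> \<le> \<bar>walk n \<omega>\<bar> / \<sigma> n" using s by (simp add: pos_le_divide_eq)
          then have "\<rho> n * (c - 3 * \<epsilon>) < \<rho> n * \<bar>R n \<omega>\<bar>" using close[OF X] elim by linarith
          then have "c - 3 * \<epsilon> < \<bar>R n \<omega>\<bar>" using \<rho>0 by simp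
          then show ?thesis using \<omega> \<epsilon> by (auto simp: F_def)
        qed
        then show ?case by auto
      qed
    qed (use E F in auto)
    also have "\<dots> \<le> prob F + prob E" using E F by (intro measure_Un_le) auto
    finally have upper: "\<P>(\<omega> in M. c * \<sigma> n \<le> spread n \<omega>) < two_sided_tail (c - 4 * \<epsilon>) + 2 * \<epsilon>"
      using elim by (simp add: E_def F_def)
    have "two_sided_tail (c - 4 * \<epsilon>) \<le> two_sided_tail c + 2 * (4 * \<epsilon>)" "two_sided_tail c \<le> two_sided_tail (c + \<epsilon>) + 2 * \<epsilon>"
      using two_sided_tail_Lipschitz[of "c - 4 * \<epsilon>" c] two_sided_tail_Lipschitz[of c "c + \<epsilon>"] \<epsilon> c by auto
    then have "\<bar>\<P>(\<omega> in M. c * \<sigma> n \<le> spread n \<omega>) - two_sided_tail c\<bar> < e"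
      using upper lower elim \<epsilon> unfolding abs_less_iff by linarith
    then show ?case by simp
  qed
  then show "\<exists>no. \<forall>n\<ge>no. norm (\<P>(\<omega> in M. c * sqrt (real n * ln (real n)) \<le> spread n \<omega>) - two_sided_tail c) < e"
    by (simp add: eventually_sequentially \<sigma>_def)
qed

text \<open>
  With \<open>n = x L\<^sup>2 / ln L\<close> one has \<open>n ln n\<close> asymptotic to \<open>2 x L\<^sup>2\<close>, as \<open>ln n\<close> is asymptotic to \<open>2 ln L\<close>.
\<close>

lemma critical_cover_probability:
  assumes b: "\<beta> = 1 / 2" and x: "0 < x"
  shows "(\<lambda>L. \<P>(\<omega> in M. real L - 1 \<le> spread (nat \<lfloor>x / (ln (real L) / real L ^ 2)\<rfloor>) \<omega>))
    \<longlonglongrightarrow> two_sided_tail (1 / sqrt (2 * x))"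
proof (rule LIMSEQ_I)
  fix e :: real assume e: "0 < e"
  define n where "n L = nat \<lfloor>x / (ln (real L) / real L ^ 2)\<rfloor>" for L
  define \<sigma> where "\<sigma> m = sqrt (real m * ln (real m))" for m
  define z where "z = 1 / sqrt (2 * x)"
  have z: "0 < z" using x by (simp add: z_def)
  have n: "filterlim n at_top sequentially" unfolding n_def using x by real_asymp
  have "(\<lambda>L. (real L - 1)\<^sup>2 / (real (n L) * ln (real (n L)))) \<longlonglongrightarrow> 1 / (2 * x)"
    unfolding n_def using x by (real_asymp simp: field_simps)
  then have "(\<lambda>L. sqrt ((real L - 1)\<^sup>2 / (real (n L) * ln (real (n L))))) \<longlonglongrightarrow> sqrt (1 / (2 * x))"
    by (rule tendsto_real_sqrt)
  moreover have "\<forall>\<^sub>F L in sequentially. sqrt ((real L - 1)\<^sup>2 / (real (n L) * ln (real (n L)))) = (real L - 1) / \<sigma> (n L)"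
    using eventually_ge_at_top[of 1] by eventually_elim (simp add: real_sqrt_divide \<sigma>_def)
  ultimately have ratio: "(\<lambda>L. (real L - 1) / \<sigma> (n L)) \<longlonglongrightarrow> z"
    by (simp add: tendsto_cong real_sqrt_divide z_def)
  define \<epsilon> where "\<epsilon> = min (e / 4) (z / 2)"
  have \<epsilon>: "0 < \<epsilon>" "4 * \<epsilon> \<le> e" "2 * \<epsilon> \<le> z" using e z by (auto simp: \<epsilon>_def)
  have lim: "(\<lambda>L. \<P>(\<omega> in M. c * \<sigma> (n L) \<le> spread (n L) \<omega>)) \<longlonglongrightarrow> two_sided_tail c" if "0 < c" for c
    unfolding \<sigma>_def by (rule filterlim_compose[OF critical_spread_limit[OF b that] n])
  have "\<forall>\<^sub>F L in sequentially. \<P>(\<omega> in M. (z - \<epsilon>) * \<sigma> (n L) \<le> spread (n L) \<omega>) < two_sided_tail (z - \<epsilon>) + \<epsilon>"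
    by (rule order_tendstoD(2)[OF lim]) (use \<epsilon> in auto)
  moreover have "\<forall>\<^sub>F L in sequentially. two_sided_tail (z + \<epsilon>) - \<epsilon> < \<P>(\<omega> in M. (z + \<epsilon>) * \<sigma> (n L) \<le> spread (n L) \<omega>)"
    by (rule order_tendstoD(1)[OF lim]) (use \<epsilon> z in auto)
  moreover have "\<forall>\<^sub>F L in sequentially. z - \<epsilon> < (real L - 1) / \<sigma> (n L)" by (rule order_tendstoD(1)[OF ratio]) (use \<epsilon> in auto)
  moreover have "\<forall>\<^sub>F L in sequentially. (real L - 1) / \<sigma> (n L) < z + \<epsilon>" by (rule order_tendstoD(2)[OF ratio]) (use \<epsilon> in auto)
  moreover have "\<forall>\<^sub>F L in sequentially. 2 \<le> n L" using n by (simp add: filterlim_at_top)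
  ultimately have "\<forall>\<^sub>F L in sequentially. norm (\<P>(\<omega> in M. real L - 1 \<le> spread (n L) \<omega>) - two_sided_tail z) < e"
  proof eventually_elim
    case (elim L)
    have s: "0 < \<sigma> (n L)" using elim by (simp add: \<sigma>_def)
    have ev: "{\<omega> \<in> space M. c \<le> spread (n L) \<omega>} \<in> events" for c
      by (rule adapted_event[OF adapted_comp[OF adapted_spread[OF order_refl]]])
    have "(z - \<epsilon>) * \<sigma> (n L) \<le> real L - 1" "real L - 1 \<le> (z + \<epsilon>) * \<sigma> (n L)"
      using elim s by (simp_all add: pos_less_divide_eq pos_divide_less_eq less_imp_le)
    then have "\<P>(\<omega> in M. real L - 1 \<le> spread (n L) \<omega>) \<le> \<P>(\<omega> in M. (z - \<epsilon>) * \<sigma> (n L) \<le> spread (n L) \<omega>)"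
      "\<P>(\<omega> in M. (z + \<epsilon>) * \<sigma> (n L) \<le> spread (n L) \<omega>) \<le> \<P>(\<omega> in M. real L - 1 \<le> spread (n L) \<omega>)"
      by (auto intro!: finite_measure_mono ev)
    moreover have "two_sided_tail (z - \<epsilon>) \<le> two_sided_tail z + 2 * \<epsilon>" "two_sided_tail z \<le> two_sided_tail (z + \<epsilon>) + 2 * \<epsilon>"
      using two_sided_tail_Lipschitz[of "z - \<epsilon>" z] two_sided_tail_Lipschitz[of z "z + \<epsilon>"] \<epsilon> z by auto
    ultimately have "\<bar>\<P>(\<omega> in M. real L - 1 \<le> spread (n L) \<omega>) - two_sided_tail z\<bar> < e"
      using elim \<epsilon> unfolding abs_less_iff by linarith
    then show ?case by simp
  qed
  then show "\<exists>no. \<forall>L\<ge>no. norm (\<P>(\<omega> in M. real L - 1 \<le> spread (nat \<lfloor>x / (ln (real L) / real L ^ 2)\<rfloor>) \<omega>) - two_sided_tail (1 / sqrt (2 * x))) < e"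
    by (simp add: eventually_sequentially n_def z_def)
qed

end

lemma (in standard_brownian_motion) increment_prob:
  assumes "0 \<le> s" "s < t" "A \<in> sets borel"
  shows "\<P>(\<omega> in N. B t \<omega> - B s \<omega> \<in> A) = measure (density lborel (normal_density 0 (sqrt (t - s)))) A"
proof -
  have d: "distributed N lborel (\<lambda>\<omega>. B t \<omega> - B s \<omega>) (normal_density 0 (sqrt (t - s)))"
    by (rule normal_increments) (use assms in auto)
  have "\<P>(\<omega> in N. B t \<omega> - B s \<omega> \<in> A) = measure (distr N lborel (\<lambda>\<omega>. B t \<omega> - B s \<omega>)) A"
    using distributed_measurable[OF d] assms(3) by (subst measure_distr) (auto simp: vimage_def Int_def conj_commute)
  then show ?thesis unfolding distributed_distr_eq_density[OF d] .
qed

lemma (in standard_brownian_motion) critical_limit_cdf: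
  assumes x: "0 < x"
  shows "\<P>(\<omega> in N. 1 / (2 * (B 1 \<omega>)\<^sup>2) \<le> x) = two_sided_tail (1 / sqrt (2 * x))"
proof -
  define z where "z = 1 / sqrt (2 * x)"
  have z: "0 < z" using x by (simp add: z_def)
  have [measurable]: "B 1 \<in> borel_measurable N" "B 0 \<in> borel_measurable N" using measurable_at by auto
  have equiv: "1 / (2 * y\<^sup>2) \<le> x \<longleftrightarrow> z \<le> \<bar>y\<bar>" if "y \<noteq> 0" for y
  proof -
    have "1 / (2 * y\<^sup>2) \<le> x \<longleftrightarrow> 1 / (2 * x) \<le> y\<^sup>2" using that x by (simp add: field_simps)
    also have "\<dots> \<longleftrightarrow> z\<^sup>2 \<le> y\<^sup>2" using x by (simp add: z_def power_divide)
    also have "\<dots> \<longleftrightarrow> z \<le> \<bar>y\<bar>" using z abs_le_square_iff[of z y] by simp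
    finally show ?thesis .
  qed
  have pt: "measure std_normal_distribution {y} = 0" for y
  proof -
    have "measure std_normal_distribution {y} \<le> 0 + e" if "0 < e" for e
    proof -
      interpret S: real_distribution std_normal_distribution by (rule real_dist_normal_dist)
      have "measure std_normal_distribution {y} \<le> measure std_normal_distribution {y - e<..y}"
        using that by (intro S.finite_measure_mono) auto
      then show ?thesis using std_normal_interval_le[of "y - e" y] that by simp
    qed
    then have "measure std_normal_distribution {y} \<le> 0" by (rule field_le_epsilon)
    then show ?thesis using measure_nonneg by (rule antisym)
  qed
  have sd: "\<P>(\<omega> in N. B 1 \<omega> - B 0 \<omega> \<in> A) = measure std_normal_distribution A" if "A \<in> sets borel" for A
    using increment_prob[of 0 1 A] that by simp
  have ae: "AE \<omega> in N. B 1 \<omega> - B 0 \<omega> \<noteq> y" for y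
  proof -
    have "\<P>(\<omega> in N. B 1 \<omega> - B 0 \<omega> = y) = 0" using sd[of "{y}"] pt by simp
    then show ?thesis by (subst (asm) prob_Collect_eq_0) auto
  qed
  have "\<P>(\<omega> in N. 1 / (2 * (B 1 \<omega>)\<^sup>2) \<le> x) = \<P>(\<omega> in N. B 1 \<omega> - B 0 \<omega> \<in> - {- z<..z})"
  proof (rule measure_eq_AE)
    show "AE \<omega> in N. (\<omega> \<in> {\<omega> \<in> space N. 1 / (2 * (B 1 \<omega>)\<^sup>2) \<le> x}) = (\<omega> \<in> {\<omega> \<in> space N. B 1 \<omega> - B 0 \<omega> \<in> - {- z<..z}})"
      using start ae[of 0] ae[of z]
    proof eventually_elim
      case (elim \<omega>)
      then have "B 1 \<omega> \<noteq> 0" "B 1 \<omega> \<noteq> z" by auto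
      then show ?case using equiv[of "B 1 \<omega>"] elim(1) z by auto
    qed
  qed measurable
  also have "\<dots> = two_sided_tail z"
  proof -
    interpret S: real_distribution std_normal_distribution by (rule real_dist_normal_dist)
    have "measure std_normal_distribution (- {- z<..z}) = 1 - measure std_normal_distribution {- z<..z}"
      using S.prob_compl[of "{- z<..z}"] by (simp add: Compl_eq_Diff_UNIV)
    then show ?thesis unfolding two_sided_tail_def by (subst sd) simp_all
  qed
  finally show ?thesis by (simp add: z_def)
qed

section \<open>Limits along a grid in the diffusive regime\<close>

text \<open>
  The time of the walk that corresponds to the macroscopic time \<open>x\<close>. The macroscopic time 0 is mapped
  to the start of the martingale at time 2.
\<close>

definition diffusive_time :: "real \<Rightarrow> nat \<Rightarrow> nat" where
  "diffusive_time x L = max 2 (nat \<lfloor>x * real L ^ 2\<rfloor>)"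

text \<open>
  The factor that gives the martingale a limit at times of order \<open>L\<^sup>2\<close>. As \<open>S / L = (b / L) M\<close>, it is the
  asymptotic value of \<open>b / L\<close> at time \<open>L\<^sup>2\<close>.
\<close>

definition diffusive_scale :: "real \<Rightarrow> nat \<Rightarrow> real" where
  "diffusive_scale \<beta> L = rGamma (2 + \<beta>) * real L powr (2 * \<beta> - 1)"

text \<open>
  It converges to \<open>x\<^sup>\<beta>\<close> and becomes the deterministic factor in the transform of the limiting
  Brownian motion.
\<close>

definition norming_ratio :: "real \<Rightarrow> real \<Rightarrow> nat \<Rightarrow> real" where
  "norming_ratio \<beta> x L = norming \<beta> (diffusive_time x L) / (rGamma (2 + \<beta>) * real L powr (2 * \<beta>))"

lemma diffusive_time_ge_2: "2 \<le> diffusive_time x L"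
  by (simp add: diffusive_time_def)

lemma diffusive_time_mono: "x \<le> y \<Longrightarrow> diffusive_time x L \<le> diffusive_time y L"
  unfolding diffusive_time_def by (intro max.mono order_refl nat_mono floor_mono mult_right_mono) auto

lemma diffusive_time_0 [simp]: "diffusive_time 0 L = 2"
  by (simp add: diffusive_time_def)

lemma diffusive_time_at_top:
  assumes "0 < x" shows "filterlim (diffusive_time x) at_top sequentially"
proof -
  have "filterlim (\<lambda>L. nat \<lfloor>x * real L ^ 2\<rfloor>) at_top sequentially" using assms by real_asymp
  then show ?thesis
    by (rule filterlim_at_top_mono) (simp add: diffusive_time_def)
qed

lemma diffusive_time_eventually:
  assumes "0 < x" shows "\<forall>\<^sub>F L in sequentially. diffusive_time x L = nat \<lfloor>x * real L ^ 2\<rfloor>"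
proof -
  have "filterlim (\<lambda>L. nat \<lfloor>x * real L ^ 2\<rfloor>) at_top sequentially" using assms by real_asymp
  then have "\<forall>\<^sub>F L in sequentially. 2 \<le> nat \<lfloor>x * real L ^ 2\<rfloor>" by (simp add: filterlim_at_top)
  then show ?thesis by eventually_elim (simp add: diffusive_time_def)
qed

lemma diffusive_time_asymp:
  assumes "0 < x" shows "(\<lambda>L. real (diffusive_time x L) / real L ^ 2) \<longlonglongrightarrow> x"
proof -
  have "(\<lambda>L. real (nat \<lfloor>x * real L ^ 2\<rfloor>) / real L ^ 2) \<longlonglongrightarrow> x" using assms by real_asymp
  moreover have "\<forall>\<^sub>F L in sequentially. real (nat \<lfloor>x * real L ^ 2\<rfloor>) / real L ^ 2 = real (diffusive_time x L) / real L ^ 2"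
    using diffusive_time_eventually[OF assms] by eventually_elim simp
  ultimately show ?thesis by (rule Lim_transform_eventually)
qed

lemma norming_ratio_asymp:
  assumes x: "0 < x" and b: "-1 \<le> \<beta>"
  shows "norming_ratio \<beta> x \<longlonglongrightarrow> x powr \<beta>"
proof -
  define \<kappa> where "\<kappa> = rGamma (2 + \<beta>)"
  have \<kappa>: "0 < \<kappa>" unfolding \<kappa>_def by (rule rGamma_norming_pos[OF b])
  define T where "T = diffusive_time x"
  have "(\<lambda>L. norming \<beta> (T L) / real (T L) powr \<beta> * (real (T L) / real L ^ 2) powr \<beta> / \<kappa>) \<longlonglongrightarrow> \<kappa> * x powr \<beta> / \<kappa>"
    unfolding T_def \<kappa>_def using x \<kappa>
    by (intro tendsto_intros filterlim_compose[OF norming_asymp[OF b] diffusive_time_at_top] diffusive_time_asymp)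
      (auto simp: \<kappa>_def)
  moreover have "\<forall>\<^sub>F L in sequentially. norming \<beta> (T L) / real (T L) powr \<beta> * (real (T L) / real L ^ 2) powr \<beta> / \<kappa> = norming_ratio \<beta> x L"
    using eventually_gt_at_top[of 0]
  proof eventually_elim
    case (elim L)
    have "0 < real (T L)" using diffusive_time_ge_2[of x L] by (simp add: T_def)
    moreover have "(real L ^ 2) powr \<beta> = real L powr (2 * \<beta>)"
      using elim by (simp add: powr_powr flip: powr_numeral)
    ultimately show ?case using elim by (simp add: powr_divide norming_ratio_def T_def \<kappa>_def)
  qed
  ultimately have "norming_ratio \<beta> x \<longlonglongrightarrow> \<kappa> * x powr \<beta> / \<kappa>" by (rule Lim_transform_eventually)
  then show ?thesis using \<kappa> by simp
qed

lemma clock_scale_asymp: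
  assumes x: "0 \<le> x" and b: "-1 \<le> \<beta>" "\<beta> < 1 / 2"
  shows "(\<lambda>L. (diffusive_scale \<beta> L)\<^sup>2 * clock \<beta> (diffusive_time x L)) \<longlonglongrightarrow> x powr (1 - 2 * \<beta>) / (1 - 2 * \<beta>)"
proof (cases "x = 0")
  case False
  with x have x: "0 < x" by simp
  define \<kappa> where "\<kappa> = rGamma (2 + \<beta>)"
  have \<kappa>: "0 < \<kappa>" unfolding \<kappa>_def by (rule rGamma_norming_pos[OF b(1)])
  define T where "T = diffusive_time x"
  define a where "a = 1 - 2 * \<beta>"
  have "(\<lambda>L. \<kappa>\<^sup>2 * (clock \<beta> (T L) / real (T L) powr a * (real (T L) / real L ^ 2) powr a)) \<longlonglongrightarrow> \<kappa>\<^sup>2 * (1 / (a * \<kappa>\<^sup>2) * x powr a)"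
    unfolding T_def \<kappa>_def a_def using x
    by (intro tendsto_intros filterlim_compose[OF clock_asymp[OF b] diffusive_time_at_top] diffusive_time_asymp) auto
  moreover have "\<forall>\<^sub>F L in sequentially. \<kappa>\<^sup>2 * (clock \<beta> (T L) / real (T L) powr a * (real (T L) / real L ^ 2) powr a)
    = (diffusive_scale \<beta> L)\<^sup>2 * clock \<beta> (T L)"
    using eventually_gt_at_top[of 0]
  proof eventually_elim
    case (elim L)
    have T: "0 < real (T L) powr a" using diffusive_time_ge_2[of x L] by (simp add: T_def)
    have "(real L ^ 2) powr a = real L powr (2 * a)"
      using elim by (simp add: powr_powr flip: powr_numeral)
    then have 1: "(real (T L) / real L ^ 2) powr a = real (T L) powr a / real L powr (2 * a)" by (simp add: powr_divide)
    have "(real L powr (2 * \<beta> - 1))\<^sup>2 = real L powr (- (2 * a))"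
      using elim by (simp add: powr_power a_def algebra_simps)
    then have 2: "(diffusive_scale \<beta> L)\<^sup>2 = \<kappa>\<^sup>2 * (1 / real L powr (2 * a))"
      by (simp add: diffusive_scale_def \<kappa>_def power_mult_distrib powr_minus_divide)
    show ?case unfolding 1 2 using T by simp
  qed
  ultimately have "(\<lambda>L. (diffusive_scale \<beta> L)\<^sup>2 * clock \<beta> (T L)) \<longlonglongrightarrow> \<kappa>\<^sup>2 * (1 / (a * \<kappa>\<^sup>2) * x powr a)" by (rule Lim_transform_eventually)
  then show ?thesis using \<kappa> by (simp add: T_def a_def)
qed simp

lemma norming_antimono:
  assumes "-1 \<le> \<beta>" "\<beta> \<le> 0" "k \<le> n" shows "norming \<beta> n \<le> norming \<beta> k"
proof -
  have *: "0 \<le> 1 + \<beta> / real j" if "2 \<le> j" for j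
  proof -
    have "0 \<le> real j + \<beta>" using that assms by linarith
    then show ?thesis using that by (simp add: field_simps)
  qed
  have "(\<Prod>j\<in>{2..<n} - {2..<k}. 1 + \<beta> / real j) * (\<Prod>j\<in>{2..<k}. 1 + \<beta> / real j) \<le> 1 * (\<Prod>j\<in>{2..<k}. 1 + \<beta> / real j)"
  proof (rule mult_right_mono)
    show "(\<Prod>j\<in>{2..<n} - {2..<k}. 1 + \<beta> / real j) \<le> 1"
      by (rule prod_le_1) (use * assms in \<open>auto simp: divide_nonpos_nonneg\<close>)
    show "0 \<le> (\<Prod>j\<in>{2..<k}. 1 + \<beta> / real j)" by (rule prod_nonneg) (use * in auto)
  qed
  moreover have "(\<Prod>j\<in>{2..<n} - {2..<k}. 1 + \<beta> / real j) * (\<Prod>j\<in>{2..<k}. 1 + \<beta> / real j) = (\<Prod>j\<in>{2..<n}. 1 + \<beta> / real j)"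
    using assms by (subst prod.subset_diff[of "{2..<k}" "{2..<n}"]) auto
  ultimately show ?thesis by (simp add: norming_def)
qed

lemma norming_between:
  assumes b: "-1 \<le> \<beta>" and k: "m \<le> k" "k \<le> n"
  shows "norming \<beta> k \<le> max (norming \<beta> m) (norming \<beta> n)"
    and "\<bar>norming \<beta> k / norming \<beta> m - 1\<bar> \<le> \<bar>norming \<beta> n / norming \<beta> m - 1\<bar>"
proof -
  have m0: "0 < norming \<beta> m" by (rule norming_pos[OF b])
  have "norming \<beta> m \<le> norming \<beta> k \<and> norming \<beta> k \<le> norming \<beta> n \<or> norming \<beta> n \<le> norming \<beta> k \<and> norming \<beta> k \<le> norming \<beta> m"
    using norming_mono[of \<beta>] norming_antimono[OF b] k by (cases "0 \<le> \<beta>") auto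
  moreover have "1 \<le> y / norming \<beta> m" if "norming \<beta> m \<le> y" for y using that m0 by simp
  moreover have "y / norming \<beta> m \<le> 1" if "y \<le> norming \<beta> m" for y using that m0 by simp
  moreover have "y / norming \<beta> m \<le> y' / norming \<beta> m" if "y \<le> y'" for y y' using that m0 by (simp add: divide_right_mono)
  ultimately show "norming \<beta> k \<le> max (norming \<beta> m) (norming \<beta> n)"
    and "\<bar>norming \<beta> k / norming \<beta> m - 1\<bar> \<le> \<bar>norming \<beta> n / norming \<beta> m - 1\<bar>"
    by (auto simp: le_max_iff_disj)
qed

context standard_brownian_motion
begin

lemma increment_interval_prob:
  assumes "0 \<le> s" "s < t"
  shows "\<P>(\<omega> in N. B t \<omega> - B s \<omega> \<in> {x<..y}) = measure std_normal_distribution {x / sqrt (t - s)<..y / sqrt (t - s)}"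
proof -
  define v where "v = sqrt (t - s)"
  have v: "0 < v" using assms by (simp add: v_def)
  have "distributed N lborel (\<lambda>\<omega>. (B t \<omega> - B s \<omega> - 0) / v) std_normal_density"
    using normal_increments[OF assms] normal_standard_normal_convert[OF v, of "\<lambda>\<omega>. B t \<omega> - B s \<omega>" 0] by (simp add: v_def)
  then have d: "distributed N lborel (\<lambda>\<omega>. (B t \<omega> - B s \<omega>) / v) std_normal_density" by simp
  have "{\<omega> \<in> space N. B t \<omega> - B s \<omega> \<in> {x<..y}} = (\<lambda>\<omega>. (B t \<omega> - B s \<omega>) / v) -` {x / v<..y / v} \<inter> space N"
    using v by (auto simp: divide_less_cancel divide_le_cancel)
  then have "\<P>(\<omega> in N. B t \<omega> - B s \<omega> \<in> {x<..y}) = measure (distr N lborel (\<lambda>\<omega>. (B t \<omega> - B s \<omega>) / v)) {x / v<..y / v}"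
    using distributed_measurable[OF d] by (subst measure_distr) auto
  then show ?thesis unfolding distributed_distr_eq_density[OF d] unfolding v_def .
qed

text \<open>
  With \<open>t\<^sub>j = \<rho>\<^sub>j\<^sup>a\<close> these are the limits in \<open>increment_boxes\<close>.
\<close>

lemma brownian_boxes:
  fixes t l u :: "nat \<Rightarrow> real"
  assumes t: "0 \<le> t 0" "strict_mono t" and a: "0 < a"
  shows "\<P>(\<omega> in N. \<forall>j<m. l j < (B (t (Suc j)) \<omega> - B (t j) \<omega>) / sqrt a \<and> (B (t (Suc j)) \<omega> - B (t j) \<omega>) / sqrt a \<le> u j)
    = (\<Prod>j<m. measure std_normal_distribution {l j / sqrt ((t (Suc j) - t j) / a)<..u j / sqrt ((t (Suc j) - t j) / a)})"
proof (cases "m = 0")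
  case False
  define D where "D j \<omega> = B (t (Suc j)) \<omega> - B (t j) \<omega>" for j \<omega>
  define A where "A j = {l j * sqrt a<..u j * sqrt a}" for j
  have ind: "indep_vars (\<lambda>_. borel) D {..<m}"
    unfolding D_def[abs_def] by (rule indep_increments[OF t])
  have "{\<omega> \<in> space N. \<forall>j<m. l j < D j \<omega> / sqrt a \<and> D j \<omega> / sqrt a \<le> u j} = (\<Inter>j\<in>{..<m}. D j -` A j \<inter> space N)"
    using False a by (auto simp: A_def pos_less_divide_eq pos_divide_le_eq)
  then have "\<P>(\<omega> in N. \<forall>j<m. l j < D j \<omega> / sqrt a \<and> D j \<omega> / sqrt a \<le> u j) = (\<Prod>j<m. measure N (D j -` A j \<inter> space N))"
    using indep_varsD[OF ind, of "{..<m}" A] False by (simp add: A_def lessThan_empty_iff)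
  also have "\<dots> = (\<Prod>j<m. measure std_normal_distribution {l j / sqrt ((t (Suc j) - t j) / a)<..u j / sqrt ((t (Suc j) - t j) / a)})"
  proof (rule prod.cong[OF refl])
    fix j
    have tj: "0 \<le> t j" "t j < t (Suc j)"
      using t strict_mono_mono[OF t(2)] monoD[of t 0 j] by (auto simp: strict_mono_def)
    have "D j -` A j \<inter> space N = {\<omega> \<in> space N. B (t (Suc j)) \<omega> - B (t j) \<omega> \<in> {l j * sqrt a<..u j * sqrt a}}"
      by (auto simp: D_def A_def)
    then show "measure N (D j -` A j \<inter> space N)
      = measure std_normal_distribution {l j / sqrt ((t (Suc j) - t j) / a)<..u j / sqrt ((t (Suc j) - t j) / a)}"
      using increment_interval_prob[OF tj, of "l j * sqrt a" "u j * sqrt a"] a by (simp add: real_sqrt_divide)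
  qed
  finally show ?thesis by (simp add: D_def)
qed (simp add: prob_space)

end

text \<open>
  The spread along the grid as a function of the increments of the driving process: partial sums are
  the values of the martingale, respectively of the time-changed Brownian motion, and the power is
  the norming factor.
\<close>

definition grid_functional :: "real \<Rightarrow> (nat \<Rightarrow> real) \<Rightarrow> nat \<Rightarrow> (nat \<Rightarrow> real) \<Rightarrow> real" where
  "grid_functional \<beta> r m x = path_spread m (\<lambda>j. r j powr \<beta> * (\<Sum>i<j. x i))"

lemma grid_functional_Lipschitz:
  assumes "\<And>j. j < m \<Longrightarrow> \<bar>x j - y j\<bar> \<le> h"
  shows "\<bar>grid_functional \<beta> r m x - grid_functional \<beta> r m y\<bar> \<le> (2 * (\<Sum>j\<le>m. r j powr \<beta>) * real m) * h"
proof -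
  have "\<bar>r j powr \<beta> * (\<Sum>i<j. x i) - r j powr \<beta> * (\<Sum>i<j. y i)\<bar> \<le> (\<Sum>j\<le>m. r j powr \<beta>) * (real m * h)" if j: "j \<le> m" for j
  proof -
    have "\<bar>(\<Sum>i<j. x i) - (\<Sum>i<j. y i)\<bar> \<le> (\<Sum>i<j. \<bar>x i - y i\<bar>)"
      unfolding sum_subtractf[symmetric] by (rule sum_abs)
    also have "\<dots> \<le> (\<Sum>i<m. \<bar>x i - y i\<bar>)" using j by (intro sum_mono2) auto
    also have "\<dots> \<le> (\<Sum>i<m. h)" using assms by (intro sum_mono) auto
    finally have 1: "\<bar>(\<Sum>i<j. x i) - (\<Sum>i<j. y i)\<bar> \<le> real m * h" by simp
    have 2: "r j powr \<beta> \<le> (\<Sum>j\<le>m. r j powr \<beta>)" using j by (intro member_le_sum) auto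
    have "\<bar>r j powr \<beta> * (\<Sum>i<j. x i) - r j powr \<beta> * (\<Sum>i<j. y i)\<bar> = r j powr \<beta> * \<bar>(\<Sum>i<j. x i) - (\<Sum>i<j. y i)\<bar>"
      by (simp add: right_diff_distrib[symmetric] abs_mult)
    also have "\<dots> \<le> (\<Sum>j\<le>m. r j powr \<beta>) * (real m * h)" using 1 2 by (intro mult_mono) (auto intro: sum_nonneg)
    finally show ?thesis .
  qed
  then have "\<bar>grid_functional \<beta> r m x - grid_functional \<beta> r m y\<bar> \<le> 2 * ((\<Sum>j\<le>m. r j powr \<beta>) * (real m * h))"
    unfolding grid_functional_def by (rule path_spread_diff)
  then show ?thesis by (simp add: mult.assoc)
qed

lemma path_spread_measurable:
  fixes s :: "nat \<Rightarrow> 'a \<Rightarrow> real"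
  assumes s: "\<And>j. j \<le> m \<Longrightarrow> s j \<in> borel_measurable M"
  shows "(\<lambda>\<omega>. path_spread m (\<lambda>j. s j \<omega>)) \<in> borel_measurable M"
proof (rule borel_measurableI_greater)
  fix c
  have "{\<omega> \<in> space M. c < path_spread m (\<lambda>j. s j \<omega>)} = (\<Union>i\<in>{..m}. \<Union>j\<in>{..m}. {\<omega> \<in> space M. c < s i \<omega> - s j \<omega>})"
    by (auto simp: less_path_spread_iff)
  also have "\<dots> \<in> sets M"
  proof (intro sets.finite_UN finite_atMost)
    fix i j assume "i \<in> {..m}" "j \<in> {..m}"
    then have [measurable]: "s i \<in> borel_measurable M" "s j \<in> borel_measurable M" using s by auto
    show "{\<omega> \<in> space M. c < s i \<omega> - s j \<omega>} \<in> sets M" by measurable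
  qed
  finally show "{\<omega> \<in> space M. c < path_spread m (\<lambda>j. s j \<omega>)} \<in> sets M" .
qed

lemma grid_functional_measurable:
  assumes V: "\<And>j. j < m \<Longrightarrow> V j \<in> borel_measurable M"
  shows "(\<lambda>\<omega>. grid_functional \<beta> r m (\<lambda>j. V j \<omega>)) \<in> borel_measurable M"
  unfolding grid_functional_def
  by (intro path_spread_measurable borel_measurable_times borel_measurable_sum borel_measurable_const V) auto

context elephant_random_walk
begin

definition grid_spread :: "(nat \<Rightarrow> real) \<Rightarrow> nat \<Rightarrow> nat \<Rightarrow> 'a \<Rightarrow> real" where
  "grid_spread \<rho> m L \<omega> = path_spread m (\<lambda>j. walk (diffusive_time (\<rho> j) L) \<omega> / real L)"

lemma walk_borel [measurable]: "walk n \<in> borel_measurable M"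
  by (rule adapted_borel[OF adapted_walk[OF order_refl]])

lemma mart_borel [measurable]: "mart n \<in> borel_measurable M"
  by (rule adapted_borel[OF adapted_mart[OF order_refl]])

lemma grid_spread_borel [measurable]: "grid_spread \<rho> m L \<in> borel_measurable M"
  unfolding grid_spread_def[abs_def] by (rule path_spread_measurable) measurable

definition grid_increment :: "(nat \<Rightarrow> real) \<Rightarrow> nat \<Rightarrow> nat \<Rightarrow> 'a \<Rightarrow> real" where
  "grid_increment \<rho> L j \<omega> = diffusive_scale \<beta> L * (mart (diffusive_time (\<rho> (Suc j)) L) \<omega> - mart (diffusive_time (\<rho> j) L) \<omega>)"

lemma grid_increment_borel [measurable]: "grid_increment \<rho> L j \<in> borel_measurable M"
  unfolding grid_increment_def[abs_def] by measurable

lemma grid_increment_sum: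
  assumes "\<rho> 0 = 0"
  shows "(\<Sum>i<j. grid_increment \<rho> L i \<omega>) = diffusive_scale \<beta> L * (mart (diffusive_time (\<rho> j) L) \<omega> - mart 2 \<omega>)"
proof -
  have "(\<Sum>i<j. grid_increment \<rho> L i \<omega>) = diffusive_scale \<beta> L * (\<Sum>i<j. mart (diffusive_time (\<rho> (Suc i)) L) \<omega> - mart (diffusive_time (\<rho> i) L) \<omega>)"
    by (simp add: grid_increment_def sum_distrib_left)
  then show ?thesis using assms by (simp add: sum_lessThan_telescope[of "\<lambda>i. mart (diffusive_time (\<rho> i) L) \<omega>"])
qed

lemma walk_diffusive:
  assumes "0 < L"
  shows "walk (diffusive_time x L) \<omega> / real L = norming_ratio \<beta> x L * (diffusive_scale \<beta> L * mart (diffusive_time x L) \<omega>)"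
proof -
  have \<kappa>: "rGamma (2 + \<beta>) \<noteq> 0" using rGamma_norming_pos[OF beta_bounds(1)] by linarith
  have L: "real L powr (2 * \<beta>) \<noteq> 0" using assms by simp
  have pw: "real L powr (2 * \<beta> - 1) = real L powr (2 * \<beta>) / real L" using assms by (subst powr_diff) simp
  have "w / l = n / (k * q) * (k * (q / l) * (w / n))" if "k \<noteq> 0" "q \<noteq> 0" "n \<noteq> 0" for w l n k q :: real
    using that by simp
  from this[OF \<kappa> L norming_beta_nonzero] show ?thesis
    unfolding norming_ratio_def diffusive_scale_def mart_def pw .
qed

lemma grid_error_vanishes:
  assumes b: "\<beta> < 1 / 2" and \<rho>: "\<rho> 0 = 0" "strict_mono \<rho>" and \<epsilon>: "0 < \<epsilon>"
  shows "(\<lambda>L. \<P>(\<omega> in M. 2 * \<epsilon> < \<bar>grid_spread \<rho> m L \<omega> - grid_functional \<beta> \<rho> m (\<lambda>j. grid_increment \<rho> L j \<omega>)\<bar>)) \<longlonglongrightarrow> 0"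
proof (rule LIMSEQ_I)
  fix \<eta> :: real assume \<eta>: "0 < \<eta>"
  define sc where "sc = diffusive_scale \<beta>"
  define T where "T j L = diffusive_time (\<rho> j) L" for j L
  have \<rho>0: "0 \<le> \<rho> j" for j using strict_mono_mono[OF \<rho>(2)] monoD[of \<rho> 0 j] \<rho>(1) by simp
  have \<rho>pos: "0 < \<rho> j" if "j \<noteq> 0" for j using strict_monoD[OF \<rho>(2), of 0 j] that \<rho>(1) by simp
  have conv: "(\<lambda>L. (sc L)\<^sup>2 * clock \<beta> (T m L)) \<longlonglongrightarrow> \<rho> m powr (1 - 2 * \<beta>) / (1 - 2 * \<beta>)"
    unfolding sc_def T_def by (rule clock_scale_asymp[OF \<rho>0 beta_bounds(1) b])
  obtain \<gamma> where \<gamma>: "0 < \<gamma>" "\<And>L. norm ((sc L)\<^sup>2 * clock \<beta> (T m L)) \<le> \<gamma>"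
    using convergent_imp_Bseq[OF convergentI[OF conv]] unfolding Bseq_def by blast
  (* The level R is exceeded by the scaled martingale with probability less than eta. *)
  define R where "R = root 4 (16 * \<gamma>\<^sup>2 / \<eta>) + 1"
  have R: "0 < R" "8 * \<gamma>\<^sup>2 / R ^ 4 < \<eta>"
  proof -
    have g: "0 < 16 * \<gamma>\<^sup>2 / \<eta>" using \<gamma> \<eta> by simp
    then have r4: "0 < root 4 (16 * \<gamma>\<^sup>2 / \<eta>)" by simp
    then show R0: "0 < R" unfolding R_def by linarith
    have "16 * \<gamma>\<^sup>2 / \<eta> = root 4 (16 * \<gamma>\<^sup>2 / \<eta>) ^ 4" using g by (simp add: less_imp_le)
    also have "\<dots> \<le> R ^ 4" using r4 by (intro power_mono) (auto simp: R_def)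
    finally have "16 * \<gamma>\<^sup>2 / \<eta> \<le> R ^ 4" .
    then have "16 * \<gamma>\<^sup>2 \<le> R ^ 4 * \<eta>" using \<eta> by (simp only: pos_divide_le_eq)
    moreover have "8 * \<gamma>\<^sup>2 < 16 * \<gamma>\<^sup>2" using \<gamma> by simp
    ultimately have "8 * \<gamma>\<^sup>2 < R ^ 4 * \<eta>" by (rule less_le_trans[rotated])
    then have "8 * \<gamma>\<^sup>2 < \<eta> * R ^ 4" by (simp only: mult.commute)
    then show "8 * \<gamma>\<^sup>2 / R ^ 4 < \<eta>" using R0 by (simp add: pos_divide_less_eq)
  qed
  have sc0: "sc \<longlonglongrightarrow> 0"
  proof -
    have "2 * \<beta> - 1 < 0" using b by simp
    then have "(\<lambda>L. real L powr (2 * \<beta> - 1)) \<longlonglongrightarrow> 0" by real_asymp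
    from tendsto_mult[OF tendsto_const[of "rGamma (2 + \<beta>)"] this] show ?thesis
      by (simp add: sc_def diffusive_scale_def[abs_def])
  qed
  have scpos: "0 < sc L" if "0 < L" for L
    using that rGamma_norming_pos[OF beta_bounds(1)] by (simp add: sc_def diffusive_scale_def)
  have err: "(\<lambda>L. \<bar>norming_ratio \<beta> (\<rho> j) L - \<rho> j powr \<beta>\<bar> * R + norming_ratio \<beta> (\<rho> j) L * (2 * sc L)) \<longlonglongrightarrow> 0" if "j \<noteq> 0" for j
  proof -
    have "(\<lambda>L. \<bar>norming_ratio \<beta> (\<rho> j) L - \<rho> j powr \<beta>\<bar> * R + norming_ratio \<beta> (\<rho> j) L * (2 * sc L)) \<longlonglongrightarrow> \<bar>\<rho> j powr \<beta> - \<rho> j powr \<beta>\<bar> * R + \<rho> j powr \<beta> * (2 * 0)"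
      by (intro tendsto_intros sc0 norming_ratio_asymp \<rho>pos that beta_bounds)
    then show ?thesis by simp
  qed
  have "\<forall>\<^sub>F L in sequentially. \<forall>j\<in>{1..m}. \<bar>norming_ratio \<beta> (\<rho> j) L - \<rho> j powr \<beta>\<bar> * R + norming_ratio \<beta> (\<rho> j) L * (2 * sc L) < \<epsilon>"
    by (intro eventually_ball_finite ballI order_tendstoD(2)[OF err] \<epsilon>) auto
  moreover have "\<forall>\<^sub>F L in sequentially. 2 / \<epsilon> \<le> real L" by real_asymp
  ultimately have "\<forall>\<^sub>F L in sequentially. \<P>(\<omega> in M. 2 * \<epsilon> < \<bar>grid_spread \<rho> m L \<omega> - grid_functional \<beta> \<rho> m (\<lambda>j. grid_increment \<rho> L j \<omega>)\<bar>) < \<eta>"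
    using eventually_gt_at_top[of 0]
  proof eventually_elim
    case (elim L)
    have s: "0 < sc L" using scpos elim by blast
    define E where "E = {\<omega> \<in> space M. \<exists>k\<in>{2..T m L}. R / sc L \<le> \<bar>mart k \<omega> - mart 2 \<omega>\<bar>}"
    have T2: "2 \<le> T j L" for j by (simp add: T_def diffusive_time_ge_2)
    have E: "E \<in> events" unfolding E_def
      by (rule adapted_event[of "T m L"], rule adapted_Bex, rule adapted_comp2[OF adapted_mart adapted_mart]) (use T2 in auto)
    have "\<P>(\<omega> in M. 2 * \<epsilon> < \<bar>grid_spread \<rho> m L \<omega> - grid_functional \<beta> \<rho> m (\<lambda>j. grid_increment \<rho> L j \<omega>)\<bar>) \<le> prob E"
    proof (rule finite_measure_mono_AE[OF _ E])
      show "AE \<omega> in M. \<omega> \<in> {\<omega> \<in> space M. 2 * \<epsilon> < \<bar>grid_spread \<rho> m L \<omega> - grid_functional \<beta> \<rho> m (\<lambda>j. grid_increment \<rho> L j \<omega>)\<bar>} \<longrightarrow> \<omega> \<in> E"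
        using AE_steps AE_space
      proof eventually_elim
        case X: (elim \<omega>)
        have "\<bar>grid_spread \<rho> m L \<omega> - grid_functional \<beta> \<rho> m (\<lambda>j. grid_increment \<rho> L j \<omega>)\<bar> \<le> 2 * \<epsilon>" if no: "\<omega> \<notin> E"
          unfolding grid_spread_def grid_functional_def
        proof (rule path_spread_diff)
          fix j assume j: "j \<le> m"
          show "\<bar>walk (diffusive_time (\<rho> j) L) \<omega> / real L - \<rho> j powr \<beta> * (\<Sum>i<j. grid_increment \<rho> L i \<omega>)\<bar> \<le> \<epsilon>"
          proof (cases "j = 0")
            case True
            have "\<bar>walk 2 \<omega>\<bar> \<le> 2" using abs_walk_le[OF X(1), of 2] by simp
            then have "\<bar>walk 2 \<omega> / real L\<bar> \<le> 2 / real L" by (simp add: abs_div divide_right_mono)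
            also have "\<dots> \<le> \<epsilon>" using elim(2,3) \<epsilon> by (simp add: field_simps)
            finally show ?thesis using True \<rho>(1) by simp
          next
            case False
            define q where "q = norming_ratio \<beta> (\<rho> j) L"
            define S where "S = (\<Sum>i<j. grid_increment \<rho> L i \<omega>)"
            have q0: "0 < q" using elim(3) rGamma_norming_pos[OF beta_bounds(1)] by (simp add: q_def norming_ratio_def)
            have S: "S = sc L * (mart (T j L) \<omega> - mart 2 \<omega>)"
              unfolding S_def sc_def T_def by (rule grid_increment_sum[of \<rho>, OF \<rho>(1)])
            have "T j L \<le> T m L" unfolding T_def by (rule diffusive_time_mono) (rule monoD[OF strict_mono_mono[OF \<rho>(2)] j])
            then have "T j L \<in> {2..T m L}" using T2 by simp
            then have "\<bar>mart (T j L) \<omega> - mart 2 \<omega>\<bar> \<le> R / sc L" using no X(2) by (auto simp: E_def not_le less_imp_le)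
            then have SR: "\<bar>S\<bar> \<le> R" using s by (simp add: S abs_mult pos_le_divide_eq mult.commute)
            have "walk (diffusive_time (\<rho> j) L) \<omega> / real L = q * (sc L * mart (T j L) \<omega>)"
              unfolding q_def sc_def T_def by (rule walk_diffusive[OF elim(3)])
            also have "\<dots> = q * S + q * (sc L * mart 2 \<omega>)" by (simp add: S ring_distribs)
            finally have "walk (diffusive_time (\<rho> j) L) \<omega> / real L - \<rho> j powr \<beta> * S = (q - \<rho> j powr \<beta>) * S + q * (sc L * mart 2 \<omega>)"
              by (simp add: ring_distribs)
            also have "\<bar>\<dots>\<bar> \<le> \<bar>q - \<rho> j powr \<beta>\<bar> * R + q * (2 * sc L)"
            proof -
              have "\<bar>(q - \<rho> j powr \<beta>) * S\<bar> \<le> \<bar>q - \<rho> j powr \<beta>\<bar> * R" unfolding abs_mult by (rule mult_left_mono[OF SR]) simp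
              moreover have "\<bar>q * (sc L * mart 2 \<omega>)\<bar> \<le> q * (2 * sc L)"
                using q0 s abs_mart_2_le[OF X(1)] by (simp add: abs_mult mult.commute)
              ultimately show ?thesis by linarith
            qed
            also have "\<dots> < \<epsilon>" using elim(1) j False by (auto simp: q_def)
            finally show ?thesis by (simp add: S_def)
          qed
        qed
        then show ?case by force
      qed
    qed
    also have "\<dots> \<le> 8 * (clock \<beta> (T m L) - clock \<beta> 2)\<^sup>2 / (R / sc L) ^ 4"
      unfolding E_def using R s T2 by (intro mart_increment_maximal) auto
    also have "\<dots> = 8 * ((sc L)\<^sup>2 * clock \<beta> (T m L))\<^sup>2 / R ^ 4"
    proof -
      have "8 * v\<^sup>2 / (R / s) ^ 4 = 8 * (s\<^sup>2 * v)\<^sup>2 / R ^ 4" for v s :: real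
        by (simp add: power_divide power_mult_distrib mult_ac flip: power_mult)
      then show ?thesis by simp
    qed
    also have "\<dots> \<le> 8 * \<gamma>\<^sup>2 / R ^ 4"
      using \<gamma>(2)[of L] R by (intro divide_right_mono mult_left_mono power_mono) (auto simp: clock_nonneg)
    finally show ?case using R by linarith
  qed
  then show "\<exists>no. \<forall>L\<ge>no. norm (\<P>(\<omega> in M. 2 * \<epsilon> < \<bar>grid_spread \<rho> m L \<omega> - grid_functional \<beta> \<rho> m (\<lambda>j. grid_increment \<rho> L j \<omega>)\<bar>) - 0) < \<eta>"
    by (simp add: eventually_sequentially)
qed

text \<open>
  The sign \<open>\<sigma>\<close> allows to treat lower and upper bounds for the grid spread at once.
\<close>

lemma grid_spread_limit:
  assumes bm: "standard_brownian_motion N B" and b: "\<beta> < 1 / 2" and \<rho>: "\<rho> 0 = 0" "strict_mono \<rho>"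
    and G: "\<And>j \<omega>. G j \<omega> = (B (\<rho> (Suc j) powr (1 - 2 * \<beta>)) \<omega> - B (\<rho> j powr (1 - 2 * \<beta>)) \<omega>) / sqrt (1 - 2 * \<beta>)"
    and sgn: "\<bar>\<sigma>\<bar> = 1" and c: "c' < c" and \<eta>: "0 < \<eta>"
  shows "\<forall>\<^sub>F L in sequentially. \<P>(\<omega> in N. c < \<sigma> * grid_functional \<beta> \<rho> m (\<lambda>j. G j \<omega>)) - \<eta>
    \<le> \<P>(\<omega> in M. c' < \<sigma> * grid_spread \<rho> m L \<omega>)"
proof -
  interpret bm: standard_brownian_motion N B by fact
  define a where "a = 1 - 2 * \<beta>"
  have a: "0 < a" using b by (simp add: a_def)
  define t where "t j = \<rho> j powr a" for j
  have \<rho>0: "0 \<le> \<rho> j" for j using strict_mono_mono[OF \<rho>(2)] monoD[of \<rho> 0 j] \<rho>(1) by simp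
  have \<rho>pos: "0 < \<rho> (Suc j)" for j using strict_monoD[OF \<rho>(2), of 0 "Suc j"] \<rho>(1) by simp
  have t: "0 \<le> t 0" "strict_mono t"
    using a \<rho>0 strict_monoD[OF \<rho>(2)] by (auto simp: t_def strict_mono_def intro!: powr_less_mono2)
  have Gt: "G j \<omega> = (B (t (Suc j)) \<omega> - B (t j) \<omega>) / sqrt a" for j \<omega>
    unfolding G t_def a_def ..
  have Gm: "G j \<in> borel_measurable N" for j
  proof -
    have [measurable]: "B (t i) \<in> borel_measurable N" for i by (rule bm.measurable_at) (simp add: t_def)
    show ?thesis unfolding Gt[abs_def] by measurable
  qed
  define s where "s j = sqrt ((t (Suc j) - t j) / a)" for j
  have tlt: "t j < t (Suc j)" for j using t(2) by (simp add: strict_mono_def)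
  have s: "0 < s j" for j unfolding s_def using tlt[of j] a by simp
  have s2: "(s j)\<^sup>2 = t (Suc j) / a - t j / a" for j
    unfolding s_def using tlt[of j] a by (simp add: diff_divide_distrib less_imp_le divide_right_mono)
  have box: "(\<lambda>L. \<P>(\<omega> in M. \<forall>j<m. lo j < grid_increment \<rho> L j \<omega> \<and> grid_increment \<rho> L j \<omega> \<le> hi j))
      \<longlonglongrightarrow> \<P>(\<omega> in N. \<forall>j<m. lo j < G j \<omega> \<and> G j \<omega> \<le> hi j)" if lh: "\<And>j. j < m \<Longrightarrow> lo j < hi j" for lo hi
  proof -
    have cs: "(\<lambda>L. (diffusive_scale \<beta> L)\<^sup>2 * clock \<beta> (diffusive_time (\<rho> j) L)) \<longlonglongrightarrow> t j / a" for j
      unfolding t_def a_def by (rule clock_scale_asymp[OF \<rho>0 beta_bounds(1) b])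
    have "(\<lambda>L. \<P>(\<omega> in M. \<forall>j<m. lo j < grid_increment \<rho> L j \<omega> \<and> grid_increment \<rho> L j \<omega> \<le> hi j))
      \<longlonglongrightarrow> (\<Prod>j<m. measure std_normal_distribution {lo j / s j<..hi j / s j})"
      unfolding grid_increment_def
    proof (rule increment_boxes[where T = "\<lambda>j. diffusive_time (\<rho> j)"])
      show "\<beta> \<le> 1 / 2" using b by simp
      show "2 \<le> diffusive_time (\<rho> j) L" for j L by (rule diffusive_time_ge_2)
      show "diffusive_time (\<rho> j) L \<le> diffusive_time (\<rho> (Suc j)) L" for j L
        by (rule diffusive_time_mono) (simp add: less_imp_le strict_monoD[OF \<rho>(2)])
      show "filterlim (diffusive_time (\<rho> (Suc j))) at_top sequentially" for j by (rule diffusive_time_at_top[OF \<rho>pos])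
      show "(\<lambda>L. (diffusive_scale \<beta> L)\<^sup>2 * (clock \<beta> (diffusive_time (\<rho> (Suc j)) L) - clock \<beta> (diffusive_time (\<rho> j) L))) \<longlonglongrightarrow> (s j)\<^sup>2" for j
        using tendsto_diff[OF cs[of "Suc j"] cs[of j]] unfolding s2 right_diff_distrib .
      show "\<exists>\<gamma>. \<forall>L. (diffusive_scale \<beta> L)\<^sup>2 * clock \<beta> (diffusive_time (\<rho> (Suc j)) L) \<le> \<gamma>" for j
      proof -
        have "Bseq (\<lambda>L. (diffusive_scale \<beta> L)\<^sup>2 * clock \<beta> (diffusive_time (\<rho> (Suc j)) L))"
          by (rule convergent_imp_Bseq[OF convergentI[OF cs]])
        then obtain \<gamma> where "\<And>L. norm ((diffusive_scale \<beta> L)\<^sup>2 * clock \<beta> (diffusive_time (\<rho> (Suc j)) L)) \<le> \<gamma>"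
          unfolding Bseq_def by blast
        then show ?thesis by (metis abs_ge_self order_trans real_norm_def)
      qed
      show "0 < s j" for j by (rule s)
      show "lo j < hi j" if "j < m" for j by (rule lh[OF that])
    qed
    also have "(\<Prod>j<m. measure std_normal_distribution {lo j / s j<..hi j / s j}) = \<P>(\<omega> in N. \<forall>j<m. lo j < G j \<omega> \<and> G j \<omega> \<le> hi j)"
      unfolding Gt s_def by (rule bm.brownian_boxes[OF t a, symmetric])
    finally show ?thesis .
  qed
  define d where "d = (c - c') / 4"
  have d: "0 < d" using c by (simp add: d_def)
  define F where "F x = \<sigma> * grid_functional \<beta> \<rho> m x" for x
  define Kc where "Kc = 2 * (\<Sum>j\<le>m. \<rho> j powr \<beta>) * real m"
  have FK: "\<bar>F x - F y\<bar> \<le> Kc * h" if "\<And>j. j < m \<Longrightarrow> \<bar>x j - y j\<bar> \<le> h" for x y h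
  proof -
    have "\<bar>F x - F y\<bar> = \<bar>grid_functional \<beta> \<rho> m x - grid_functional \<beta> \<rho> m y\<bar>"
      unfolding F_def right_diff_distrib[symmetric] abs_mult sgn by simp
    then show ?thesis using grid_functional_Lipschitz[OF that, where \<beta> = "\<beta>" and r = \<rho>] by (simp add: Kc_def)
  qed
  have FVm: "(\<lambda>\<omega>. grid_functional \<beta> \<rho> m (\<lambda>j. grid_increment \<rho> L j \<omega>)) \<in> borel_measurable M" for L
    by (rule grid_functional_measurable) measurable
  have FGm: "(\<lambda>\<omega>. grid_functional \<beta> \<rho> m (\<lambda>j. G j \<omega>)) \<in> borel_measurable N"
    by (rule grid_functional_measurable) (rule Gm)
  have 1: "\<forall>\<^sub>F L in sequentially. \<P>(\<omega> in N. c < F (\<lambda>j. G j \<omega>)) - \<eta> / 2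
    \<le> \<P>(\<omega> in M. c' + 2 * d < F (\<lambda>j. grid_increment \<rho> L j \<omega>))"
  proof (rule box_portmanteau[where K = Kc and m = m and V = "grid_increment \<rho>" and G = G and F = F])
    show "prob_space M" "prob_space N" by (rule prob_space_axioms, rule bm.prob_space_axioms)
    show "grid_increment \<rho> L j \<in> borel_measurable M" for L j by measurable
    show "G j \<in> borel_measurable N" for j by (rule Gm)
    show "0 \<le> Kc" unfolding Kc_def by (intro mult_nonneg_nonneg sum_nonneg) auto
    show "{\<omega> \<in> space M. c' + 2 * d < F (\<lambda>j. grid_increment \<rho> L j \<omega>)} \<in> events" for L
      unfolding F_def using FVm by measurable
    show "{\<omega> \<in> space N. c < F (\<lambda>j. G j \<omega>)} \<in> bm.events"
      unfolding F_def using FGm by measurable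
    show "c' + 2 * d < c" using c by (simp add: d_def field_simps)
  qed (use \<eta> in \<open>auto intro: box FK\<close>)
  have 2: "\<forall>\<^sub>F L in sequentially. \<P>(\<omega> in M. 2 * d < \<bar>grid_spread \<rho> m L \<omega> - grid_functional \<beta> \<rho> m (\<lambda>j. grid_increment \<rho> L j \<omega>)\<bar>) < \<eta> / 2"
    by (rule order_tendstoD(2)[OF grid_error_vanishes[OF b \<rho> d]]) (use \<eta> in simp)
  from 1 2 show ?thesis
  proof eventually_elim
    case (elim L)
    define A where "A = {\<omega> \<in> space M. c' < \<sigma> * grid_spread \<rho> m L \<omega>}"
    define E where "E = {\<omega> \<in> space M. 2 * d < \<bar>grid_spread \<rho> m L \<omega> - grid_functional \<beta> \<rho> m (\<lambda>j. grid_increment \<rho> L j \<omega>)\<bar>}"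
    have AE: "A \<in> events" "E \<in> events" unfolding A_def E_def using FVm by measurable
    have "\<P>(\<omega> in M. c' + 2 * d < F (\<lambda>j. grid_increment \<rho> L j \<omega>)) \<le> prob (A \<union> E)"
    proof (rule finite_measure_mono)
      show "{\<omega> \<in> space M. c' + 2 * d < F (\<lambda>j. grid_increment \<rho> L j \<omega>)} \<subseteq> A \<union> E"
      proof
        fix \<omega> assume \<omega>: "\<omega> \<in> {\<omega> \<in> space M. c' + 2 * d < F (\<lambda>j. grid_increment \<rho> L j \<omega>)}"
        have "\<bar>\<sigma> * grid_spread \<rho> m L \<omega> - F (\<lambda>j. grid_increment \<rho> L j \<omega>)\<bar> = \<bar>grid_spread \<rho> m L \<omega> - grid_functional \<beta> \<rho> m (\<lambda>j. grid_increment \<rho> L j \<omega>)\<bar>"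
          unfolding F_def right_diff_distrib[symmetric] abs_mult sgn by simp
        then show "\<omega> \<in> A \<union> E" using \<omega> by (auto simp: A_def E_def)
      qed
    qed (use AE in auto)
    also have "\<dots> \<le> prob A + prob E" using AE by (intro measure_Un_le) auto
    finally show ?case using elim by (simp add: A_def E_def F_def)
  qed
qed

end

section \<open>Fluctuations between grid points\<close>

text \<open>
  Consecutive blocks \<open>{T j..T (Suc j)}\<close> leave no gap.
\<close>

lemma block_containing:
  fixes T :: "nat \<Rightarrow> nat"
  assumes "T 1 \<le> k" "k \<le> T (Suc m)" "1 \<le> m"
  shows "\<exists>j\<in>{1..m}. T j \<le> k \<and> k \<le> T (Suc j)"
  using assms(3,1,2)
proof (induction m rule: nat_induct_at_least)
  case base
  then show ?case by auto
next
  case (Suc m)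
  show ?case
  proof (cases "k \<le> T (Suc m)")
    case True
    then obtain j where "j \<in> {1..m}" "T j \<le> k \<and> k \<le> T (Suc j)" using Suc by auto
    then show ?thesis by (intro bexI[of _ j]) auto
  next
    case False
    then show ?thesis using Suc.prems by (intro bexI[of _ "Suc m"]) auto
  qed
qed

text \<open>
  Constant ratios of neighbouring grid times make the relative change of \<open>b\<close> the same on all blocks. The point 0 is added.
\<close>

definition geometric_grid :: "real \<Rightarrow> real \<Rightarrow> nat \<Rightarrow> real" where
  "geometric_grid \<delta> q j = (if j = 0 then 0 else \<delta> * q ^ (j - 1))"

lemma geometric_grid_simps [simp]:
  "geometric_grid \<delta> q 0 = 0" "geometric_grid \<delta> q (Suc i) = \<delta> * q ^ i"
  by (simp_all add: geometric_grid_def)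

lemma strict_mono_geometric_grid: "0 < \<delta> \<Longrightarrow> 1 < q \<Longrightarrow> strict_mono (geometric_grid \<delta> q)"
  by (rule strict_monoI_Suc) (auto simp: geometric_grid_def gr0_conv_Suc)

context elephant_random_walk
begin

text \<open>
  Within a block, \<open>S\<^sub>k - S\<^sub>t\<close> splits into the martingale part \<open>b\<^sub>k (M\<^sub>k - M\<^sub>t)\<close> and the
  change \<open>(b\<^sub>k / b\<^sub>t - 1) S\<^sub>t\<close> of the norming factor; since \<open>b\<close> is monotone, the latter is
  largest at the end of the block.
\<close>

lemma spread_le_grid_spread:
  assumes h: "3 \<le> h"
    and m: "1 \<le> m" and T: "\<And>j. 2 \<le> T j" "T 0 = 2" "mono T"
    and X: "\<forall>k\<ge>1. X k \<omega> = 1 \<or> X k \<omega> = -1"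
    and early: "\<And>k. k \<in> {2..T 1} \<Longrightarrow> \<bar>walk k \<omega>\<bar> \<le> h"
    and R: "\<And>k. k \<in> {2..T (Suc m)} \<Longrightarrow> \<bar>walk k \<omega>\<bar> \<le> R"
    and ratio: "\<And>j. j \<in> {1..m} \<Longrightarrow> \<bar>norming \<beta> (T (Suc j)) / norming \<beta> (T j) - 1\<bar> * R \<le> h / 2"
    and block: "\<And>j k. j \<in> {1..m} \<Longrightarrow> k \<in> {T j..T (Suc j)} \<Longrightarrow>
      \<bar>mart k \<omega> - mart (T j) \<omega>\<bar> \<le> h / (2 * max (norming \<beta> (T j)) (norming \<beta> (T (Suc j))))"
  shows "spread (T (Suc m)) \<omega> \<le> path_spread (Suc m) (\<lambda>j. walk (T j) \<omega>) + 4 * h"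
proof -
  have near: "\<exists>j\<le>Suc m. \<bar>walk k \<omega> - walk (T j) \<omega>\<bar> \<le> 2 * h" if k: "k \<le> T (Suc m)" for k
  proof (cases "T 1 \<le> k")
    case False
    have w2: "\<bar>walk 2 \<omega>\<bar> \<le> 2" using abs_walk_le[OF X, of 2] by simp
    have "\<bar>walk k \<omega>\<bar> \<le> max 1 h"
    proof (cases "k < 2")
      case True
      then have "real k \<le> 1" by linarith
      then show ?thesis using abs_walk_le[OF X, of k] by linarith
    next
      case False': False
      then show ?thesis using early[of k] False by auto
    qed
    then have "\<bar>walk k \<omega> - walk (T 0) \<omega>\<bar> \<le> 2 * h" using w2 h T(2) by (simp add: max_def split: if_splits)
    then show ?thesis by blast
  next
    case True
    obtain j where j: "j \<in> {1..m}" "T j \<le> k" "k \<le> T (Suc j)" using block_containing[OF True k m] by auto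
    define c where "c = norming \<beta> k / norming \<beta> (T j)"
    have b1: "-1 \<le> \<beta>" by (rule beta_bounds(1))
    have Tj: "T j \<in> {2..T (Suc m)}" using T(1) monoD[OF T(3), of j "Suc m"] j by auto
    define bm where "bm = max (norming \<beta> (T j)) (norming \<beta> (T (Suc j)))"
    have bm: "0 < bm" using norming_beta_pos[of "T j"] by (simp add: bm_def less_max_iff_disj)
    have "\<bar>c - 1\<bar> * \<bar>walk (T j) \<omega>\<bar> \<le> \<bar>norming \<beta> (T (Suc j)) / norming \<beta> (T j) - 1\<bar> * R"
      unfolding c_def by (intro mult_mono norming_between(2)[OF b1 j(2,3)] R[OF Tj]) auto
    then have 1: "\<bar>(c - 1) * walk (T j) \<omega>\<bar> \<le> h / 2" using ratio[OF j(1)] by (simp add: abs_mult)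
    have "norming \<beta> k * \<bar>mart k \<omega> - mart (T j) \<omega>\<bar> \<le> bm * (h / (2 * bm))"
      unfolding bm_def using h block[OF j(1), of k] j by (intro mult_mono norming_between(1)[OF b1 j(2,3)]) (auto simp: le_max_iff_disj less_imp_le)
    then have 2: "\<bar>norming \<beta> k * (mart k \<omega> - mart (T j) \<omega>)\<bar> \<le> h / 2" using bm by (simp add: abs_mult abs_of_pos)
    have "walk k \<omega> - walk (T j) \<omega> = (c - 1) * walk (T j) \<omega> + norming \<beta> k * (mart k \<omega> - mart (T j) \<omega>)"
    proof -
      have "wk - wt = (nk / nt - 1) * wt + nk * (wk / nk - wt / nt)" if "nk \<noteq> 0" "nt \<noteq> 0" for wk wt nk nt :: real
        using that by (simp add: field_simps)
      from this[OF norming_beta_nonzero norming_beta_nonzero] show ?thesis unfolding c_def mart_def .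
    qed
    then have "\<bar>walk k \<omega> - walk (T j) \<omega>\<bar> \<le> 2 * h" using 1 2 h by linarith
    then show ?thesis using j by (intro exI[of _ j]) auto
  qed
  obtain i k where ik: "i \<le> T (Suc m)" "k \<le> T (Suc m)" "spread (T (Suc m)) \<omega> = walk i \<omega> - walk k \<omega>"
    unfolding spread_def by (rule path_spread_attained)
  obtain i' where i': "i' \<le> Suc m" "\<bar>walk i \<omega> - walk (T i') \<omega>\<bar> \<le> 2 * h" using near[OF ik(1)] by auto
  obtain k' where k': "k' \<le> Suc m" "\<bar>walk k \<omega> - walk (T k') \<omega>\<bar> \<le> 2 * h" using near[OF ik(2)] by auto
  have "walk (T i') \<omega> - walk (T k') \<omega> \<le> path_spread (Suc m) (\<lambda>j. walk (T j) \<omega>)"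
    by (rule path_spread_ge[OF i'(1) k'(1)])
  then show ?thesis using i' k' ik(3) by linarith
qed

text \<open>
  The squared clock increment on the right is what makes the sum over many short blocks small.
\<close>

lemma block_maximal_probability:
  assumes L: "0 < L" and \<epsilon>: "0 < \<epsilon>" and xy: "x \<le> y"
  shows "\<P>(\<omega> in M. \<exists>k\<in>{diffusive_time x L..diffusive_time y L}.
      \<epsilon> * real L / (2 * max (norming \<beta> (diffusive_time x L)) (norming \<beta> (diffusive_time y L))) \<le> \<bar>mart k \<omega> - mart (diffusive_time x L) \<omega>\<bar>)
    \<le> 128 * ((max (norming_ratio \<beta> x L) (norming_ratio \<beta> y L))\<^sup>2 *
        ((diffusive_scale \<beta> L)\<^sup>2 * clock \<beta> (diffusive_time y L) - (diffusive_scale \<beta> L)\<^sup>2 * clock \<beta> (diffusive_time x L)))\<^sup>2 / \<epsilon> ^ 4"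
proof -
  define \<kappa> where "\<kappa> = rGamma (2 + \<beta>) * real L powr (2 * \<beta>)"
  have \<kappa>: "0 < \<kappa>" using rGamma_norming_pos[OF beta_bounds(1)] L by (simp add: \<kappa>_def)
  have nr: "norming \<beta> (diffusive_time z L) = \<kappa> * norming_ratio \<beta> z L" for z
    unfolding norming_ratio_def \<kappa>_def[symmetric] using \<kappa> by simp
  have sc: "diffusive_scale \<beta> L = \<kappa> / real L"
    using L unfolding diffusive_scale_def \<kappa>_def by (subst powr_diff) simp_all
  define \<mu> where "\<mu> = max (norming_ratio \<beta> x L) (norming_ratio \<beta> y L)"
  have mx: "max (norming \<beta> (diffusive_time x L)) (norming \<beta> (diffusive_time y L)) = \<kappa> * \<mu>"
    unfolding nr \<mu>_def using \<kappa> by (simp add: max_mult_distrib_left)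
  have \<mu>: "0 < \<mu>"
  proof -
    have "0 < \<kappa> * \<mu>" unfolding mx[symmetric] using norming_beta_pos by (simp add: less_max_iff_disj)
    then show ?thesis using \<kappa> by (simp add: zero_less_mult_iff)
  qed
  have "\<P>(\<omega> in M. \<exists>k\<in>{diffusive_time x L..diffusive_time y L}. \<epsilon> * real L / (2 * (\<kappa> * \<mu>)) \<le> \<bar>mart k \<omega> - mart (diffusive_time x L) \<omega>\<bar>)
    \<le> 8 * (clock \<beta> (diffusive_time y L) - clock \<beta> (diffusive_time x L))\<^sup>2 / (\<epsilon> * real L / (2 * (\<kappa> * \<mu>))) ^ 4"
    using L \<epsilon> \<kappa> \<mu> by (intro mart_increment_maximal diffusive_time_ge_2 diffusive_time_mono xy) auto
  also have "\<dots> = 128 * (\<mu>\<^sup>2 * ((\<kappa> / real L)\<^sup>2 * clock \<beta> (diffusive_time y L) - (\<kappa> / real L)\<^sup>2 * clock \<beta> (diffusive_time x L)))\<^sup>2 / \<epsilon> ^ 4"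
  proof -
    have "8 * (v - v')\<^sup>2 / (\<epsilon> * l / (2 * (k * m))) ^ 4 = 128 * (m\<^sup>2 * ((k / l)\<^sup>2 * v - (k / l)\<^sup>2 * v'))\<^sup>2 / \<epsilon> ^ 4" for v v' l k m :: real
      unfolding right_diff_distrib[symmetric] by (simp add: power_divide power_mult_distrib mult_ac flip: power_mult)
    then show ?thesis .
  qed
  finally show ?thesis unfolding mx sc \<mu>_def .
qed

text \<open>
  Three constants are chosen in turn. First \<open>\<delta>\<close> makes the path up to time \<open>\<delta>L\<^sup>2\<close> negligible; then \<open>R\<close>
  bounds the whole path by \<open>RL\<close>; finally, \<open>m\<close> geometric blocks from \<open>\<delta>\<close> to \<open>x\<close> make the norming factor nearly
  constant on each block, while the \<open>m\<close> block probabilities are of order \<open>1/m\<^sup>2\<close> each.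
\<close>

lemma fluctuations_between_grid_points:
  assumes b: "\<beta> < 1 / 2" and x: "0 < x" and \<epsilon>: "0 < \<epsilon>" and \<eta>: "0 < \<eta>"
  obtains \<rho> m where "\<rho> 0 = 0" "strict_mono \<rho>" "\<rho> m = x"
    "\<forall>\<^sub>F L in sequentially. \<P>(\<omega> in M. real L * (grid_spread \<rho> m L \<omega> + 4 * \<epsilon>) < spread (nat \<lfloor>x * real L ^ 2\<rfloor>) \<omega>) < \<eta>"
proof -
  obtain C where C: "0 < C" and Cmax: "\<And>n c. 2 \<le> n \<Longrightarrow> 0 < c \<Longrightarrow>
    \<P>(\<omega> in M. \<exists>k\<in>{2..n}. c \<le> \<bar>walk k \<omega>\<bar>) \<le> C * real n / c\<^sup>2"
    by (rule walk_maximal_diffusive[OF b]) blast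
  define a where "a = 1 - 2 * \<beta>"
  have a: "0 < a" using b by (simp add: a_def)
  define \<delta> where "\<delta> = min (x / 2) (\<eta> * \<epsilon>\<^sup>2 / (8 * C))"
  have \<delta>: "0 < \<delta>" "\<delta> < x" "C * \<delta> / \<epsilon>\<^sup>2 < \<eta> / 4"
  proof -
    show "0 < \<delta>" "\<delta> < x" using x \<eta> \<epsilon> C by (auto simp: \<delta>_def)
    have "C * \<delta> \<le> C * (\<eta> * \<epsilon>\<^sup>2 / (8 * C))" using C by (intro mult_left_mono) (auto simp: \<delta>_def)
    also have "\<dots> = \<eta> / 8 * \<epsilon>\<^sup>2" using C by simp
    also have "\<dots> < \<eta> / 4 * \<epsilon>\<^sup>2" using \<eta> \<epsilon> by (intro mult_strict_right_mono) auto
    finally show "C * \<delta> / \<epsilon>\<^sup>2 < \<eta> / 4" using \<epsilon> by (simp only: pos_divide_less_eq zero_less_power)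
  qed
  define R where "R = sqrt (8 * C * x / \<eta>)"
  have R: "0 < R" "C * x / R\<^sup>2 < \<eta> / 4"
    using C x \<eta> by (auto simp: R_def)
  define y where "y = x / \<delta>"
  have y: "1 < y" using \<delta> by (simp add: y_def)
  define q where "q m = y powr (1 / real m)" for m :: nat
  (* An upper bound for the limit of the scaled variance of a block; it is of order 1/m. *)
  define w where "w m = x * (max 1 (q m powr \<beta>))\<^sup>2 * (q m powr a - 1) / a" for m
  have q1: "q \<longlonglongrightarrow> 1"
  proof -
    have "(\<lambda>m::nat. 1 / real m) \<longlonglongrightarrow> 0" by real_asymp
    then have "(\<lambda>m. y powr (1 / real m)) \<longlonglongrightarrow> y powr 0" using y by (intro tendsto_intros) auto
    then show ?thesis using y by (simp add: q_def[abs_def])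
  qed
  have qb: "(\<lambda>m. q m powr \<beta>) \<longlonglongrightarrow> 1"
    using tendsto_powr[OF q1 tendsto_const[of \<beta>]] by simp
  have "(\<lambda>m. \<bar>q m powr \<beta> - 1\<bar> * R) \<longlonglongrightarrow> \<bar>1 - 1\<bar> * R" by (intro tendsto_intros qb)
  then have evR: "\<forall>\<^sub>F m in sequentially. \<bar>q m powr \<beta> - 1\<bar> * R < \<epsilon> / 2" by (rule order_tendstoD(2)) (use \<epsilon> in simp)
  have mw: "(\<lambda>m. real m * (128 * (w m)\<^sup>2 / \<epsilon> ^ 4)) \<longlonglongrightarrow> 0"
  proof -
    define D where "D = a * ln y"
    have D: "0 < D" using a y by (simp add: D_def)
    have "(\<lambda>m::nat. real m * (exp (D / real m) - 1)\<^sup>2) \<longlonglongrightarrow> 0" using D by real_asymp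
    then have lm: "(\<lambda>m. 128 * (x * (max 1 (q m powr \<beta>))\<^sup>2 / a)\<^sup>2 / \<epsilon> ^ 4 * (real m * (exp (D / real m) - 1)\<^sup>2)) \<longlonglongrightarrow>
      128 * (x * (max 1 1)\<^sup>2 / a)\<^sup>2 / \<epsilon> ^ 4 * 0"
      using a \<epsilon> by (intro tendsto_intros qb) auto
    have eqm: "128 * (x * (max 1 (q m powr \<beta>))\<^sup>2 / a)\<^sup>2 / \<epsilon> ^ 4 * (real m * (exp (D / real m) - 1)\<^sup>2) = real m * (128 * (w m)\<^sup>2 / \<epsilon> ^ 4)" for m
    proof -
      have e: "exp (D / real m) = q m powr a" unfolding q_def powr_powr using y by (simp add: powr_def D_def)
      have g: "128 * (x * u / a)\<^sup>2 / \<epsilon> ^ 4 * (k * e\<^sup>2) = k * (128 * (x * u * e / a)\<^sup>2 / \<epsilon> ^ 4)" for u k e :: real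
        by (simp add: power_mult_distrib power_divide mult_ac)
      show ?thesis unfolding w_def e by (rule g)
    qed
    show ?thesis using lm unfolding eqm mult_zero_right .
  qed
  have "\<forall>\<^sub>F m in sequentially. real m * (128 * (w m)\<^sup>2 / \<epsilon> ^ 4) < \<eta> / 4" by (rule order_tendstoD(2)[OF mw]) (use \<eta> in simp)
  with evR eventually_ge_at_top[of 1]
  have "\<forall>\<^sub>F m in sequentially. 1 \<le> m \<and> \<bar>q m powr \<beta> - 1\<bar> * R < \<epsilon> / 2 \<and> real m * (128 * (w m)\<^sup>2 / \<epsilon> ^ 4) < \<eta> / 4"
    by eventually_elim auto
  then obtain m where m: "1 \<le> m" "\<bar>q m powr \<beta> - 1\<bar> * R < \<epsilon> / 2" "real m * (128 * (w m)\<^sup>2 / \<epsilon> ^ 4) < \<eta> / 4"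
    by (auto simp: eventually_sequentially)
  define Q where "Q = q m"
  have Q: "1 < Q" "Q ^ m = y"
  proof -
    have "y powr 0 < y powr (1 / real m)" using y m(1) by (intro powr_less_mono) auto
    then show "1 < Q" using y by (simp add: Q_def q_def)
    show "Q ^ m = y" using y m(1) by (simp add: Q_def q_def powr_power)
  qed
  define \<rho> where "\<rho> = geometric_grid \<delta> Q"
  have \<rho>: "\<rho> 0 = 0" "strict_mono \<rho>" "\<rho> (Suc m) = x"
    using strict_mono_geometric_grid[OF \<delta>(1) Q(1)] Q(2) \<delta>(1) by (auto simp: \<rho>_def y_def)
  have \<rho>1: "\<rho> 1 = \<delta>" by (simp add: \<rho>_def One_nat_def del: One_nat_def[symmetric])
  have step: "\<rho> (Suc j) = Q * \<rho> j" if "1 \<le> j" for j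
    using that by (cases j) (auto simp: \<rho>_def)
  have \<rho>pos: "0 < \<rho> j" if "1 \<le> j" for j using strict_monoD[OF \<rho>(2), of 0 j] that \<rho>(1) by simp
  have \<rho>le: "\<rho> j \<le> x" if "j \<le> Suc m" for j using monoD[OF strict_mono_mono[OF \<rho>(2)] that] \<rho>(3) by simp
  define T where "T L j = diffusive_time (\<rho> j) L" for L j
  have monoT: "mono (T L)" for L
    unfolding T_def by (intro monoI diffusive_time_mono monoD[OF strict_mono_mono[OF \<rho>(2)]])
  have T2: "2 \<le> T L j" for L j by (simp add: T_def diffusive_time_ge_2)
  define W where "W j L = (max (norming_ratio \<beta> (\<rho> j) L) (norming_ratio \<beta> (\<rho> (Suc j)) L))\<^sup>2 *
    ((diffusive_scale \<beta> L)\<^sup>2 * clock \<beta> (T L (Suc j)) - (diffusive_scale \<beta> L)\<^sup>2 * clock \<beta> (T L j))" for j L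
  have Wlim: "W j \<longlonglongrightarrow> \<rho> j * (max 1 (Q powr \<beta>))\<^sup>2 * (Q powr a - 1) / a" if j: "j \<in> {1..m}" for j
  proof -
    have j1: "1 \<le> j" using j by simp
    have p: "0 < \<rho> j" "0 < \<rho> (Suc j)" using \<rho>pos[of j] \<rho>pos[of "Suc j"] j by auto
    have cs: "(\<lambda>L. (diffusive_scale \<beta> L)\<^sup>2 * clock \<beta> (T L i)) \<longlonglongrightarrow> \<rho> i powr a / a" if "0 < \<rho> i" for i
      unfolding T_def a_def by (rule clock_scale_asymp[OF less_imp_le[OF that] beta_bounds(1) b])
    have "W j \<longlonglongrightarrow> (max (\<rho> j powr \<beta>) (\<rho> (Suc j) powr \<beta>))\<^sup>2 * (\<rho> (Suc j) powr a / a - \<rho> j powr a / a)"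
      unfolding W_def by (intro tendsto_intros norming_ratio_asymp p beta_bounds cs)
    also have "(max (\<rho> j powr \<beta>) (\<rho> (Suc j) powr \<beta>))\<^sup>2 * (\<rho> (Suc j) powr a / a - \<rho> j powr a / a)
      = \<rho> j * (max 1 (Q powr \<beta>))\<^sup>2 * (Q powr a - 1) / a"
    proof -
      have 1: "\<rho> (Suc j) powr z = \<rho> j powr z * Q powr z" for z
        unfolding step[OF j1] using p Q by (simp add: powr_mult)
      have 2: "max (\<rho> j powr \<beta>) (\<rho> j powr \<beta> * Q powr \<beta>) = \<rho> j powr \<beta> * max 1 (Q powr \<beta>)"
        by (simp add: max_mult_distrib_left)
      have 3: "(\<rho> j powr \<beta>)\<^sup>2 * \<rho> j powr a = \<rho> j"
        using p by (simp add: power2_eq_square a_def flip: powr_add)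
      have "(s * u)\<^sup>2 * (t * v / a - t / a) = (s\<^sup>2 * t) * u\<^sup>2 * (v - 1) / a" for s t u v :: real
        by (simp add: power_mult_distrib diff_divide_distrib algebra_simps)
      then show ?thesis unfolding 1 2 by (simp add: 3)
    qed
    finally show ?thesis .
  qed
  have wQ: "w m = x * (max 1 (Q powr \<beta>))\<^sup>2 * (Q powr a - 1) / a" by (simp add: w_def Q_def)
  have Qa: "1 \<le> Q powr a" using Q(1) a by (simp add: ge_one_powr_ge_zero)
  have "(\<lambda>L. \<Sum>j\<in>{1..m}. 128 * (W j L)\<^sup>2 / \<epsilon> ^ 4) \<longlonglongrightarrow> (\<Sum>j\<in>{1..m}. 128 * (\<rho> j * (max 1 (Q powr \<beta>))\<^sup>2 * (Q powr a - 1) / a)\<^sup>2 / \<epsilon> ^ 4)"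
    using \<epsilon> by (intro tendsto_intros Wlim) auto
  moreover have "(\<Sum>j\<in>{1..m}. 128 * (\<rho> j * (max 1 (Q powr \<beta>))\<^sup>2 * (Q powr a - 1) / a)\<^sup>2 / \<epsilon> ^ 4) < \<eta> / 4"
  proof -
    have "(\<Sum>j\<in>{1..m}. 128 * (\<rho> j * (max 1 (Q powr \<beta>))\<^sup>2 * (Q powr a - 1) / a)\<^sup>2 / \<epsilon> ^ 4) \<le> (\<Sum>j\<in>{1..m}. 128 * (w m)\<^sup>2 / \<epsilon> ^ 4)"
    proof (rule sum_mono)
      fix j assume j: "j \<in> {1..m}"
      have "\<rho> j * (max 1 (Q powr \<beta>))\<^sup>2 * (Q powr a - 1) / a \<le> w m"
        unfolding wQ using \<rho>le[of j] j Qa a by (intro divide_right_mono mult_right_mono) auto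
      moreover have "0 \<le> \<rho> j * (max 1 (Q powr \<beta>))\<^sup>2 * (Q powr a - 1) / a"
        using \<rho>pos[of j] j Qa a by (intro divide_nonneg_nonneg mult_nonneg_nonneg) auto
      ultimately show "128 * (\<rho> j * (max 1 (Q powr \<beta>))\<^sup>2 * (Q powr a - 1) / a)\<^sup>2 / \<epsilon> ^ 4 \<le> 128 * (w m)\<^sup>2 / \<epsilon> ^ 4"
        using \<epsilon> by (intro divide_right_mono mult_left_mono power_mono) auto
    qed
    also have "\<dots> = real m * (128 * (w m)\<^sup>2 / \<epsilon> ^ 4)" by simp
    finally show ?thesis using m(3) by linarith
  qed
  ultimately have ev1: "\<forall>\<^sub>F L in sequentially. (\<Sum>j\<in>{1..m}. 128 * (W j L)\<^sup>2 / \<epsilon> ^ 4) < \<eta> / 4" by (rule order_tendstoD(2))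
  have ev2: "\<forall>\<^sub>F L in sequentially. C * (real (T L 1) / real L ^ 2) / \<epsilon>\<^sup>2 < \<eta> / 4"
  proof (rule order_tendstoD(2))
    show "(\<lambda>L. C * (real (T L 1) / real L ^ 2) / \<epsilon>\<^sup>2) \<longlonglongrightarrow> C * \<delta> / \<epsilon>\<^sup>2"
      unfolding T_def \<rho>1 using \<epsilon> by (intro tendsto_intros diffusive_time_asymp \<delta>) auto
  qed (rule \<delta>(3))
  have ev3: "\<forall>\<^sub>F L in sequentially. C * (real (T L (Suc m)) / real L ^ 2) / R\<^sup>2 < \<eta> / 4"
  proof (rule order_tendstoD(2))
    show "(\<lambda>L. C * (real (T L (Suc m)) / real L ^ 2) / R\<^sup>2) \<longlonglongrightarrow> C * x / R\<^sup>2"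
      unfolding T_def \<rho>(3) using R by (intro tendsto_intros diffusive_time_asymp x) auto
  qed (rule R(2))
  have ev4: "\<forall>\<^sub>F L in sequentially. \<forall>j\<in>{1..m}. \<bar>norming_ratio \<beta> (\<rho> (Suc j)) L / norming_ratio \<beta> (\<rho> j) L - 1\<bar> * R < \<epsilon> / 2"
  proof (intro eventually_ball_finite ballI)
    fix j assume j: "j \<in> {1..m}"
    have p: "0 < \<rho> j" "0 < \<rho> (Suc j)" using \<rho>pos[of j] \<rho>pos[of "Suc j"] j by auto
    have "(\<lambda>L. \<bar>norming_ratio \<beta> (\<rho> (Suc j)) L / norming_ratio \<beta> (\<rho> j) L - 1\<bar> * R) \<longlonglongrightarrow> \<bar>\<rho> (Suc j) powr \<beta> / \<rho> j powr \<beta> - 1\<bar> * R"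
      using p by (intro tendsto_intros norming_ratio_asymp beta_bounds) auto
    moreover have "\<rho> (Suc j) powr \<beta> / \<rho> j powr \<beta> = Q powr \<beta>"
      using p Q j by (simp add: step powr_mult)
    ultimately show "\<forall>\<^sub>F L in sequentially. \<bar>norming_ratio \<beta> (\<rho> (Suc j)) L / norming_ratio \<beta> (\<rho> j) L - 1\<bar> * R < \<epsilon> / 2"
      using m(2) by (intro order_tendstoD(2)) (auto simp: Q_def)
  qed simp
  have ev5: "\<forall>\<^sub>F L in sequentially. 3 / \<epsilon> \<le> real L" by real_asymp
  have ev6: "\<forall>\<^sub>F L in sequentially. nat \<lfloor>x * real L ^ 2\<rfloor> = T L (Suc m)"
    using diffusive_time_eventually[OF x] by eventually_elim (simp add: T_def \<rho>(3))
  have "\<forall>\<^sub>F L in sequentially. \<P>(\<omega> in M. real L * (grid_spread \<rho> (Suc m) L \<omega> + 4 * \<epsilon>) < spread (nat \<lfloor>x * real L ^ 2\<rfloor>) \<omega>) < \<eta>"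
    using ev1 ev2 ev3 ev4 ev5 ev6 eventually_gt_at_top[of 0]
  proof eventually_elim
    case (elim L)
    have L: "0 < real L" using elim by simp
    define h where "h = \<epsilon> * real L"
    have h: "3 \<le> h" "0 < h" using elim(5) \<epsilon> L by (auto simp: h_def field_simps)
    define E0 where "E0 = {\<omega> \<in> space M. \<exists>k\<in>{2..T L 1}. h \<le> \<bar>walk k \<omega>\<bar>}"
    define ER where "ER = {\<omega> \<in> space M. \<exists>k\<in>{2..T L (Suc m)}. R * real L \<le> \<bar>walk k \<omega>\<bar>}"
    define E where "E j = {\<omega> \<in> space M. \<exists>k\<in>{T L j..T L (Suc j)}.
      h / (2 * max (norming \<beta> (T L j)) (norming \<beta> (T L (Suc j)))) \<le> \<bar>mart k \<omega> - mart (T L j) \<omega>\<bar>}" for j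
    have ev: "E0 \<in> events" "ER \<in> events"
    proof -
      show "E0 \<in> events" unfolding E0_def
        by (rule adapted_event[of "T L 1"], rule adapted_Bex, rule adapted_comp, rule adapted_walk) auto
      show "ER \<in> events" unfolding ER_def
        by (rule adapted_event[of "T L (Suc m)"], rule adapted_Bex, rule adapted_comp, rule adapted_walk) auto
    qed
    have evE: "E j \<in> events" for j unfolding E_def
      by (rule adapted_event[of "T L (Suc j)"], rule adapted_Bex, rule adapted_comp2[OF adapted_mart adapted_mart]) (auto intro: monoD[OF monoT])
    have P0: "prob E0 < \<eta> / 4"
    proof -
      have "prob E0 \<le> C * real (T L 1) / h\<^sup>2" unfolding E0_def by (rule Cmax[OF T2 h(2)])
      also have "\<dots> = C * (real (T L 1) / real L ^ 2) / \<epsilon>\<^sup>2" by (simp add: h_def power_mult_distrib)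
      finally show ?thesis using elim(2) by linarith
    qed
    have PR: "prob ER < \<eta> / 4"
    proof -
      have "prob ER \<le> C * real (T L (Suc m)) / (R * real L)\<^sup>2" unfolding ER_def by (rule Cmax[OF T2]) (use R L in simp)
      also have "\<dots> = C * (real (T L (Suc m)) / real L ^ 2) / R\<^sup>2" by (simp add: power_mult_distrib)
      finally show ?thesis using elim(3) by linarith
    qed
    have PE: "prob (\<Union>j\<in>{1..m}. E j) < \<eta> / 4"
    proof -
      have "prob (\<Union>j\<in>{1..m}. E j) \<le> (\<Sum>j\<in>{1..m}. prob (E j))" using evE by (intro measure_UNION_le) auto
      also have "\<dots> \<le> (\<Sum>j\<in>{1..m}. 128 * (W j L)\<^sup>2 / \<epsilon> ^ 4)"
      proof (rule sum_mono)
        fix j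
        have "\<rho> j \<le> \<rho> (Suc j)" by (rule monoD[OF strict_mono_mono[OF \<rho>(2)]]) simp
        from block_maximal_probability[OF elim(7) \<epsilon> this]
        show "prob (E j) \<le> 128 * (W j L)\<^sup>2 / \<epsilon> ^ 4" unfolding E_def W_def h_def T_def .
      qed
      finally show ?thesis using elim(1) by linarith
    qed
    have "\<P>(\<omega> in M. real L * (grid_spread \<rho> (Suc m) L \<omega> + 4 * \<epsilon>) < spread (nat \<lfloor>x * real L ^ 2\<rfloor>) \<omega>) \<le> prob (E0 \<union> ER \<union> (\<Union>j\<in>{1..m}. E j))"
    proof (rule finite_measure_mono_AE)
      show "E0 \<union> ER \<union> (\<Union>j\<in>{1..m}. E j) \<in> events" using ev evE by auto
      show "AE \<omega> in M. \<omega> \<in> {\<omega> \<in> space M. real L * (grid_spread \<rho> (Suc m) L \<omega> + 4 * \<epsilon>) < spread (nat \<lfloor>x * real L ^ 2\<rfloor>) \<omega>} \<longrightarrow> \<omega> \<in> E0 \<union> ER \<union> (\<Union>j\<in>{1..m}. E j)"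
        using AE_steps AE_space
      proof eventually_elim
        case X: (elim \<omega>)
        have "spread (T L (Suc m)) \<omega> \<le> real L * (grid_spread \<rho> (Suc m) L \<omega> + 4 * \<epsilon>)"
          if no: "\<omega> \<notin> E0" "\<omega> \<notin> ER" "\<omega> \<notin> (\<Union>j\<in>{1..m}. E j)"
        proof -
          have "spread (T L (Suc m)) \<omega> \<le> path_spread (Suc m) (\<lambda>j. walk (T L j) \<omega>) + 4 * h"
          proof (rule spread_le_grid_spread[OF h(1) m(1) T2 _ monoT X(1)])
            show "T L 0 = 2" by (simp add: T_def \<rho>(1))
            show "\<bar>walk k \<omega>\<bar> \<le> h" if "k \<in> {2..T L 1}" for k
              using no(1) that X(2) unfolding E0_def by (auto simp: not_le less_imp_le)
            show "\<bar>walk k \<omega>\<bar> \<le> R * real L" if "k \<in> {2..T L (Suc m)}" for k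
              using no(2) that X(2) unfolding ER_def by (auto simp: not_le less_imp_le)
            show "\<bar>mart k \<omega> - mart (T L j) \<omega>\<bar> \<le> h / (2 * max (norming \<beta> (T L j)) (norming \<beta> (T L (Suc j))))"
              if "j \<in> {1..m}" "k \<in> {T L j..T L (Suc j)}" for j k
            proof -
              have "\<omega> \<notin> E j" using no(3) that by blast
              then have "\<not> h / (2 * max (norming \<beta> (T L j)) (norming \<beta> (T L (Suc j)))) \<le> \<bar>mart k \<omega> - mart (T L j) \<omega>\<bar>"
                using that(2) X(2) unfolding E_def by blast
              then show ?thesis by (rule less_imp_le[OF iffD1[OF not_le]])
            qed
            show "\<bar>norming \<beta> (T L (Suc j)) / norming \<beta> (T L j) - 1\<bar> * (R * real L) \<le> h / 2" if "j \<in> {1..m}" for j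
            proof -
              define \<kappa> where "\<kappa> = rGamma (2 + \<beta>) * real L powr (2 * \<beta>)"
              have \<kappa>: "0 < \<kappa>" using rGamma_norming_pos[OF beta_bounds(1)] L by (simp add: \<kappa>_def)
              have "norming_ratio \<beta> (\<rho> (Suc j)) L / norming_ratio \<beta> (\<rho> j) L = norming \<beta> (T L (Suc j)) / norming \<beta> (T L j)"
                unfolding norming_ratio_def \<kappa>_def[symmetric] T_def using \<kappa> by simp
              then have "\<bar>norming \<beta> (T L (Suc j)) / norming \<beta> (T L j) - 1\<bar> * R \<le> \<epsilon> / 2"
                using elim(4) that by (metis less_imp_le)
              from mult_right_mono[OF this, of "real L"] show ?thesis by (simp add: h_def mult_ac)
            qed
          qed
          also have "path_spread (Suc m) (\<lambda>j. walk (T L j) \<omega>) = real L * grid_spread \<rho> (Suc m) L \<omega>"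
            unfolding grid_spread_def T_def using L by (subst path_spread_scale[symmetric]) auto
          finally show ?thesis by (simp add: h_def algebra_simps)
        qed
        then show ?case using elim(6) by force
      qed
    qed
    also have "\<dots> \<le> prob (E0 \<union> ER) + prob (\<Union>j\<in>{1..m}. E j)" using ev evE by (intro measure_Un_le) auto
    also have "\<dots> \<le> prob E0 + prob ER + prob (\<Union>j\<in>{1..m}. E j)" using ev by (intro add_right_mono measure_Un_le) auto
    finally show ?case using P0 PR PE \<eta> by linarith
  qed
  from that[OF \<rho>(1,2,3) this] show ?thesis .
qed

end

section \<open>Oscillation of the limit process and the cover time\<close>

text \<open>
  Dyadic grids are nested and their union is dense in \<open>[0, x]\<close> and contains \<open>x\<close>, so that right-continuity suffices to
  recover the oscillation (\<open>less_Osc_iff_dyadic\<close>).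
\<close>

definition dyadic_spread :: "real \<Rightarrow> nat \<Rightarrow> (real \<Rightarrow> real) \<Rightarrow> real" where
  "dyadic_spread x i f = path_spread (2 ^ i) (\<lambda>j. f (x * real j / 2 ^ i))"

text \<open>
  Also correct for unbounded \<open>f\<close>: the supremum is never \<open>- \<infinity>\<close> and the infimum never \<open>\<infinity>\<close>, so the difference
  of extended reals is the expected one.
\<close>

lemma less_Osc_iff:
  assumes x: "0 \<le> x"
  shows "ereal c < Osc x f \<longleftrightarrow> (\<exists>s\<in>{0..x}. \<exists>t\<in>{0..x}. c < f s - f t)"
proof
  assume *: "ereal c < Osc x f"
  show "\<exists>s\<in>{0..x}. \<exists>t\<in>{0..x}. c < f s - f t"
  proof (rule ccontr)
    assume "\<not> ?thesis"
    then have le: "\<And>s t. s \<in> {0..x} \<Longrightarrow> t \<in> {0..x} \<Longrightarrow> f s - f t \<le> c" by (meson not_le)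
    have 0: "0 \<in> {0..x}" using x by simp
    define S where "S = (SUP s\<in>{0..x}. ereal (f s))"
    have "S \<le> ereal (c + f 0)" unfolding S_def using le[OF _ 0] by (intro SUP_least) (simp add: algebra_simps)
    moreover have "ereal (f 0) \<le> S" unfolding S_def by (rule SUP_upper[OF 0])
    ultimately obtain z where z: "S = ereal z" by (cases S) auto
    have "ereal (z - c) \<le> (INF s\<in>{0..x}. ereal (f s))"
    proof (rule INF_greatest)
      fix t assume t: "t \<in> {0..x}"
      have "S \<le> ereal (c + f t)" unfolding S_def using le[OF _ t] by (intro SUP_least) (simp add: algebra_simps)
      then show "ereal (z - c) \<le> ereal (f t)" by (simp add: z)
    qed
    then have "Osc x f \<le> ereal z - ereal (z - c)" unfolding Osc_def S_def[symmetric] z by (intro ereal_minus_mono) auto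
    then show False using * by simp
  qed
next
  assume "\<exists>s\<in>{0..x}. \<exists>t\<in>{0..x}. c < f s - f t"
  then obtain s t where st: "s \<in> {0..x}" "t \<in> {0..x}" "c < f s - f t" by auto
  have "ereal c < ereal (f s) - ereal (f t)" using st by simp
  also have "\<dots> \<le> Osc x f" unfolding Osc_def using st by (intro ereal_minus_mono SUP_upper INF_lower)
  finally show "ereal c < Osc x f" .
qed

lemma Osc_mono: "0 \<le> x \<Longrightarrow> x \<le> y \<Longrightarrow> Osc x f \<le> Osc y f"
  unfolding Osc_def by (intro ereal_minus_mono SUP_subset_mono INF_superset_mono) auto

lemma le_Osc_iff: "ereal c \<le> Osc x f \<longleftrightarrow> (\<forall>k. ereal (c - inverse (real (Suc k))) < Osc x f)"
proof
  assume "ereal c \<le> Osc x f"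
  moreover have "ereal (c - inverse (real (Suc k))) < ereal c" for k by simp
  ultimately show "\<forall>k. ereal (c - inverse (real (Suc k))) < Osc x f" by (meson less_le_trans)
next
  assume *: "\<forall>k. ereal (c - inverse (real (Suc k))) < Osc x f"
  have "(\<lambda>k. ereal (c - inverse (real (Suc k)))) \<longlonglongrightarrow> ereal (c - 0)"
    by (intro tendsto_intros LIMSEQ_inverse_real_of_nat)
  then have "ereal (c - 0) \<le> Osc x f"
    by (rule LIMSEQ_le_const2) (use * in \<open>blast intro: less_imp_le\<close>)
  then show "ereal c \<le> Osc x f" by simp
qed

text \<open>
  The grid point is chosen to the right of \<open>s\<close>; for \<open>s = x\<close> it is \<open>x\<close> itself.
\<close>

lemma dyadic_approximation:
  fixes f :: "real \<Rightarrow> real"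
  assumes f: "f \<in> skorokhod_paths" and x: "0 < x" and s: "s \<in> {0..x}" and e: "0 < e"
  shows "\<forall>\<^sub>F i in sequentially. \<exists>j\<le>2 ^ i. \<bar>f (x * real j / 2 ^ i) - f s\<bar> < e"
proof -
  have "(f \<longlongrightarrow> f s) (at_right s)" using f s by (auto simp: skorokhod_paths_def)
  then have "\<forall>\<^sub>F t in at_right s. dist (f t) (f s) < e" using e by (rule tendstoD)
  then obtain d where d: "s < d" "\<And>t. s < t \<Longrightarrow> t < d \<Longrightarrow> dist (f t) (f s) < e"
    by (auto simp: eventually_at_right_field)
  have d': "\<bar>f t - f s\<bar> < e" if "s \<le> t" "t < d" for t
    using that d(2)[of t] e by (cases "t = s") (auto simp: dist_real_def)
  have "(\<lambda>i. x / 2 ^ i) \<longlonglongrightarrow> 0" by real_asymp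
  then have "\<forall>\<^sub>F i in sequentially. x / 2 ^ i < d - s" by (rule order_tendstoD(2)) (use d in simp)
  then show ?thesis
  proof eventually_elim
    case (elim i)
    define j where "j = nat \<lceil>s * 2 ^ i / x\<rceil>"
    have nn: "0 \<le> s * 2 ^ i / x" using s x by simp
    have j: "s * 2 ^ i / x \<le> real j" "real j < s * 2 ^ i / x + 1" unfolding j_def using nn by linarith+
    have "s * 2 ^ i / x \<le> 2 ^ i" using s x by (simp add: pos_divide_le_eq mult.commute)
    then have "\<lceil>s * 2 ^ i / x\<rceil> \<le> 2 ^ i" by (simp add: ceiling_le_iff)
    then have "j \<le> 2 ^ i" unfolding j_def by (simp add: nat_le_iff)
    moreover have "s \<le> x * real j / 2 ^ i" using j(1) x by (simp add: field_simps)
    moreover have "x * real j / 2 ^ i < d"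
    proof -
      have "x * real j / 2 ^ i < x * (s * 2 ^ i / x + 1) / 2 ^ i" using j(2) x by (intro divide_strict_right_mono mult_strict_left_mono) auto
      also have "\<dots> = s + x / 2 ^ i" using x by (simp add: field_simps)
      finally show ?thesis using elim by linarith
    qed
    ultimately show ?case using d' by blast
  qed
qed

lemma less_Osc_iff_dyadic:
  assumes f: "f \<in> skorokhod_paths" and x: "0 < x"
  shows "ereal c < Osc x f \<longleftrightarrow> (\<exists>i. c < dyadic_spread x i f)"
proof
  assume "ereal c < Osc x f"
  then obtain s t where st: "s \<in> {0..x}" "t \<in> {0..x}" "c < f s - f t"
    using less_Osc_iff[of x c f] x by auto
  define e where "e = (f s - f t - c) / 2"
  have e: "0 < e" using st by (simp add: e_def)
  have e2: "2 * e = f s - f t - c" by (simp add: e_def)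
  have "\<forall>\<^sub>F i in sequentially. (\<exists>j\<le>2 ^ i. \<bar>f (x * real j / 2 ^ i) - f s\<bar> < e) \<and> (\<exists>k\<le>2 ^ i. \<bar>f (x * real k / 2 ^ i) - f t\<bar> < e)"
    by (intro eventually_conj dyadic_approximation f x st e)
  then obtain i j k where ijk: "j \<le> 2 ^ i" "\<bar>f (x * real j / 2 ^ i) - f s\<bar> < e" "k \<le> 2 ^ i" "\<bar>f (x * real k / 2 ^ i) - f t\<bar> < e"
    by (auto simp: eventually_sequentially)
  have "c < f (x * real j / 2 ^ i) - f (x * real k / 2 ^ i)" using ijk(2,4) e2 by linarith
  then show "\<exists>i. c < dyadic_spread x i f" unfolding dyadic_spread_def less_path_spread_iff using ijk by blast
next
  assume "\<exists>i. c < dyadic_spread x i f"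
  then obtain i j k where ijk: "j \<le> 2 ^ i" "k \<le> 2 ^ i" "c < f (x * real j / 2 ^ i) - f (x * real k / 2 ^ i)"
    unfolding dyadic_spread_def less_path_spread_iff by blast
  have "x * real j / 2 ^ i \<in> {0..x}" if "j \<le> 2 ^ i" for j
  proof -
    have "real j \<le> 2 ^ i" using that by (metis of_nat_le_iff of_nat_numeral of_nat_power)
    then show ?thesis using x by (simp add: pos_divide_le_eq)
  qed
  then show "ereal c < Osc x f" using less_Osc_iff[of x c f] x ijk by auto
qed

lemma dyadic_spread_mono: "dyadic_spread x i f \<le> dyadic_spread x (Suc i) f"
proof -
  obtain j k where jk: "j \<le> 2 ^ i" "k \<le> 2 ^ i" "dyadic_spread x i f = f (x * real j / 2 ^ i) - f (x * real k / 2 ^ i)"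
    unfolding dyadic_spread_def by (rule path_spread_attained)
  have "f (x * real (2 * j) / 2 ^ Suc i) - f (x * real (2 * k) / 2 ^ Suc i) \<le> dyadic_spread x (Suc i) f"
    unfolding dyadic_spread_def using jk by (intro path_spread_ge) auto
  then show ?thesis using jk(3) by simp
qed

lemma Phi_le: "0 \<le> y \<Longrightarrow> ereal l \<le> Osc y f \<Longrightarrow> Phi l f \<le> ereal y"
  unfolding Phi_def by (intro Inf_lower) auto

text \<open>
  Monotonicity of the oscillation in time reduces the infimum to rational times.
\<close>

lemma Phi_less_iff: "Phi l f < ereal x \<longleftrightarrow> (\<exists>q\<in>\<rat>. 0 \<le> q \<and> q < x \<and> ereal l \<le> Osc q f)"
proof
  assume "Phi l f < ereal x"
  then obtain t where t: "0 \<le> t" "ereal l \<le> Osc t f" "t < x" unfolding Phi_def Inf_less_iff by auto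
  obtain q where q: "q \<in> \<rat>" "t < q" "q < x" using Rats_dense_in_real[OF t(3)] by auto
  have "ereal l \<le> Osc q f" using Osc_mono[OF t(1) less_imp_le[OF q(2)], of f] t(2) by (rule order_trans[rotated])
  then show "\<exists>q\<in>\<rat>. 0 \<le> q \<and> q < x \<and> ereal l \<le> Osc q f" using q t by force
next
  assume "\<exists>q\<in>\<rat>. 0 \<le> q \<and> q < x \<and> ereal l \<le> Osc q f"
  then obtain q where q: "0 \<le> q" "q < x" "ereal l \<le> Osc q f" by auto
  have "Phi l f \<le> ereal q" by (rule Phi_le[OF q(1,3)])
  then show "Phi l f < ereal x" using q(2) by (simp add: le_less_trans)
qed

lemma Phi_nonneg: "0 \<le> Phi l f"
  unfolding Phi_def by (intro Inf_greatest) auto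

lemma Osc_0: "Osc 0 f = 0"
  by (simp add: Osc_def)

lemma converges_in_distribution_cong:
  assumes "\<And>n \<omega>. n0 \<le> n \<Longrightarrow> Z n \<omega> = Z' n \<omega>" and "converges_in_distribution M Z N V"
  shows "converges_in_distribution M Z' N V"
proof -
  have eq: "Z' n = Z n" if "n0 \<le> n" for n using assms(1)[OF that] by auto
  have ev: "\<forall>\<^sub>F n in sequentially. Z' n = Z n" using eventually_ge_at_top[of n0] by eventually_elim (rule eq)
  have "\<forall>\<^sub>F n in sequentially. Z' n \<in> borel_measurable (M n) \<and> (AE \<omega> in M n. \<bar>Z' n \<omega>\<bar> \<noteq> \<infinity>)"
    using ev assms(2)[unfolded converges_in_distribution_def, THEN conjunct1] by eventually_elim simp
  moreover have "weak_conv_m (\<lambda>n. distr (M n) borel (\<lambda>\<omega>. real_of_ereal (Z' n \<omega>))) (distr N borel (\<lambda>\<omega>. real_of_ereal (V \<omega>)))"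
    unfolding weak_conv_m_def weak_conv_def
  proof (intro allI impI)
    fix x assume "isCont (cdf (distr N borel (\<lambda>\<omega>. real_of_ereal (V \<omega>)))) x"
    then have l: "(\<lambda>n. cdf (distr (M n) borel (\<lambda>\<omega>. real_of_ereal (Z n \<omega>))) x) \<longlonglongrightarrow> cdf (distr N borel (\<lambda>\<omega>. real_of_ereal (V \<omega>))) x"
      using assms(2) by (simp add: converges_in_distribution_def weak_conv_m_def weak_conv_def)
    have "\<forall>\<^sub>F n in sequentially. cdf (distr (M n) borel (\<lambda>\<omega>. real_of_ereal (Z n \<omega>))) x = cdf (distr (M n) borel (\<lambda>\<omega>. real_of_ereal (Z' n \<omega>))) x"
      using ev by eventually_elim simp
    with l show "(\<lambda>n. cdf (distr (M n) borel (\<lambda>\<omega>. real_of_ereal (Z' n \<omega>))) x) \<longlonglongrightarrow> cdf (distr N borel (\<lambda>\<omega>. real_of_ereal (V \<omega>))) x"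
      by (rule Lim_transform_eventually)
  qed
  ultimately show ?thesis using assms(2) by (simp add: converges_in_distribution_def)
qed

text \<open>
  The noise-reinforced process together with the Brownian motion that describes its law, in the
  diffusive regime.
\<close>

locale reinforced_pair = noise_reinforced_brownian_motion K W p N B + bm: standard_brownian_motion N B
  for K :: "'c measure" and W p and N :: "'b measure" and B +
  assumes p_less: "p < 3 / 4"
begin

abbreviation a :: real where "a \<equiv> 1 - 2 * (2 * p - 1)"

lemma a_pos: "0 < a" using p_less by simp

definition bm_increment :: "(nat \<Rightarrow> real) \<Rightarrow> nat \<Rightarrow> 'b \<Rightarrow> real" where
  "bm_increment \<rho> j \<omega> = (B (\<rho> (Suc j) powr a) \<omega> - B (\<rho> j powr a) \<omega>) / sqrt a"

lemma W_measurable [measurable]: "0 \<le> t \<Longrightarrow> W t \<in> borel_measurable K"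
  by (rule measurable_at)

text \<open>
  The spread along a grid is a measurable function of the coordinates, so its law depends only on the
  law of the process, which is that of the transformed Brownian motion.
\<close>

lemma grid_law:
  assumes \<rho>: "\<rho> 0 = 0" "strict_mono \<rho>"
  shows "\<P>(\<omega> in K. c < \<sigma> * path_spread m (\<lambda>j. W (\<rho> j) \<omega>))
    = \<P>(\<omega> in N. c < \<sigma> * grid_functional (2 * p - 1) \<rho> m (\<lambda>j. bm_increment \<rho> j \<omega>))"
proof -
  have \<rho>0: "0 \<le> \<rho> j" for j using strict_mono_mono[OF \<rho>(2)] monoD[of \<rho> 0 j] \<rho>(1) by simp
  define P where "P = Pi\<^sub>M {0..} (\<lambda>_::real. borel :: real measure)"
  define Ev where "Ev = {f \<in> space P. c < \<sigma> * path_spread m (\<lambda>j. f (\<rho> j))}"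
  have "(\<lambda>f. path_spread m (\<lambda>j. f (\<rho> j))) \<in> borel_measurable P"
    unfolding P_def using \<rho>0 by (intro path_spread_measurable measurable_component_singleton) auto
  then have Ev: "Ev \<in> sets P" unfolding Ev_def by measurable
  have mW: "(\<lambda>\<omega>. \<lambda>t\<in>{0..}. W t \<omega>) \<in> measurable K P" unfolding P_def by (rule measurable_restrict) simp
  have T: "reinforced_transform p B t \<in> borel_measurable N" if "0 \<le> t" for t
  proof (cases "t = 0")
    case True
    then show ?thesis by (simp add: reinforced_transform_def[abs_def])
  next
    case False
    have [measurable]: "B (t powr (3 - 4 * p)) \<in> borel_measurable N" by (rule bm.measurable_at) simp
    show ?thesis using False by (simp add: reinforced_transform_def[abs_def])
  qed
  have mT: "(\<lambda>\<omega>. \<lambda>t\<in>{0..}. reinforced_transform p B t \<omega>) \<in> measurable N P"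
    unfolding P_def by (rule measurable_restrict) (simp add: T)
  have "\<P>(\<omega> in K. c < \<sigma> * path_spread m (\<lambda>j. W (\<rho> j) \<omega>)) = measure (process_law K W) Ev"
  proof -
    have "(\<lambda>\<omega>. \<lambda>t\<in>{0..}. W t \<omega>) -` Ev \<inter> space K = {\<omega> \<in> space K. c < \<sigma> * path_spread m (\<lambda>j. W (\<rho> j) \<omega>)}"
      using measurable_space[OF mW] \<rho>0 by (auto simp: Ev_def)
    then show ?thesis unfolding process_law_def P_def[symmetric] using measure_distr[OF mW Ev] by simp
  qed
  also have "\<dots> = measure (process_law N (reinforced_transform p B)) Ev" by (simp add: law)
  also have "\<dots> = \<P>(\<omega> in N. c < \<sigma> * path_spread m (\<lambda>j. reinforced_transform p B (\<rho> j) \<omega>))"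
  proof -
    have "(\<lambda>\<omega>. \<lambda>t\<in>{0..}. reinforced_transform p B t \<omega>) -` Ev \<inter> space N = {\<omega> \<in> space N. c < \<sigma> * path_spread m (\<lambda>j. reinforced_transform p B (\<rho> j) \<omega>)}"
      using measurable_space[OF mT] \<rho>0 by (auto simp: Ev_def)
    then show ?thesis unfolding process_law_def P_def[symmetric] using measure_distr[OF mT Ev] by simp
  qed
  also have "\<dots> = \<P>(\<omega> in N. c < \<sigma> * grid_functional (2 * p - 1) \<rho> m (\<lambda>j. bm_increment \<rho> j \<omega>))"
  proof (rule measure_eq_AE)
    have sums: "(\<Sum>i<j. bm_increment \<rho> i \<omega>) = (B (\<rho> j powr a) \<omega> - B 0 \<omega>) / sqrt a" for j \<omega>
    proof -
      have "(\<Sum>i<j. bm_increment \<rho> i \<omega>) = (\<Sum>i<j. B (\<rho> (Suc i) powr a) \<omega> - B (\<rho> i powr a) \<omega>) / sqrt a"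
        by (simp add: bm_increment_def sum_divide_distrib)
      also have "(\<Sum>i<j. B (\<rho> (Suc i) powr a) \<omega> - B (\<rho> i powr a) \<omega>) = B (\<rho> j powr a) \<omega> - B (\<rho> 0 powr a) \<omega>"
        by (rule sum_lessThan_telescope)
      finally show ?thesis using \<rho>(1) by simp
    qed
    show "AE \<omega> in N. (\<omega> \<in> {\<omega> \<in> space N. c < \<sigma> * path_spread m (\<lambda>j. reinforced_transform p B (\<rho> j) \<omega>)})
      = (\<omega> \<in> {\<omega> \<in> space N. c < \<sigma> * grid_functional (2 * p - 1) \<rho> m (\<lambda>j. bm_increment \<rho> j \<omega>)})"
      using bm.start
    proof eventually_elim
      case (elim \<omega>)
      have "reinforced_transform p B (\<rho> j) \<omega> = \<rho> j powr (2 * p - 1) * (\<Sum>i<j. bm_increment \<rho> i \<omega>)" for j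
      proof -
        have "3 - 4 * p = a" by simp
        then show ?thesis unfolding sums reinforced_transform_def using elim by simp
      qed
      then show ?case by (simp add: grid_functional_def)
    qed
    have "(\<lambda>\<omega>. path_spread m (\<lambda>j. reinforced_transform p B (\<rho> j) \<omega>)) \<in> borel_measurable N"
      by (intro path_spread_measurable T \<rho>0)
    then show "{\<omega> \<in> space N. c < \<sigma> * path_spread m (\<lambda>j. reinforced_transform p B (\<rho> j) \<omega>)} \<in> sets N" by measurable
    have "bm_increment \<rho> j \<in> borel_measurable N" for j
    proof -
      have [measurable]: "B (z powr a) \<in> borel_measurable N" for z by (rule bm.measurable_at) simp
      show ?thesis unfolding bm_increment_def[abs_def] by measurable
    qed
    then have "(\<lambda>\<omega>. grid_functional (2 * p - 1) \<rho> m (\<lambda>j. bm_increment \<rho> j \<omega>)) \<in> borel_measurable N"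
      by (intro grid_functional_measurable)
    then show "{\<omega> \<in> space N. c < \<sigma> * grid_functional (2 * p - 1) \<rho> m (\<lambda>j. bm_increment \<rho> j \<omega>)} \<in> sets N" by measurable
  qed
  finally show ?thesis .
qed

definition path :: "'c \<Rightarrow> real \<Rightarrow> real" where "path \<omega> = (\<lambda>t. W t \<omega>)"

lemma path_skorokhod: "\<omega> \<in> space K \<Longrightarrow> path \<omega> \<in> skorokhod_paths"
  unfolding path_def by (rule paths)

lemma dyadic_measurable: "0 \<le> x \<Longrightarrow> (\<lambda>\<omega>. dyadic_spread x i (path \<omega>)) \<in> borel_measurable K"
  unfolding dyadic_spread_def path_def by (intro path_spread_measurable W_measurable) simp

lemma less_Osc_event:
  assumes "0 < x" shows "{\<omega> \<in> space K. ereal c < Osc x (path \<omega>)} \<in> events"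
proof -
  have "{\<omega> \<in> space K. ereal c < Osc x (path \<omega>)} = (\<Union>i. {\<omega> \<in> space K. c < dyadic_spread x i (path \<omega>)})"
    using less_Osc_iff_dyadic[OF path_skorokhod assms] by auto
  also have "\<dots> \<in> events"
  proof (rule sets.countable_UN, safe)
    fix i
    have [measurable]: "(\<lambda>\<omega>. dyadic_spread x i (path \<omega>)) \<in> borel_measurable K" using dyadic_measurable assms by simp
    show "{\<omega> \<in> space K. c < dyadic_spread x i (path \<omega>)} \<in> events" by measurable
  qed
  finally show ?thesis .
qed

lemma le_Osc_event:
  assumes "0 < x" shows "{\<omega> \<in> space K. ereal c \<le> Osc x (path \<omega>)} \<in> events"
proof -
  have "{\<omega> \<in> space K. ereal c \<le> Osc x (path \<omega>)} = (\<Inter>k. {\<omega> \<in> space K. ereal (c - inverse (real (Suc k))) < Osc x (path \<omega>)})"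
    unfolding le_Osc_iff[of c] by auto
  also have "\<dots> \<in> events" using less_Osc_event[OF assms] by (intro sets.countable_INT) auto
  finally show ?thesis .
qed

lemma Phi_less_set:
  "{\<omega> \<in> space K. Phi 1 (path \<omega>) < ereal x} = (\<Union>q\<in>{q \<in> \<rat>. 0 < q \<and> q < x}. {\<omega> \<in> space K. ereal 1 \<le> Osc q (path \<omega>)})"
proof -
  have "Phi 1 f < ereal x \<longleftrightarrow> (\<exists>q\<in>{q \<in> \<rat>. 0 < q \<and> q < x}. ereal 1 \<le> Osc q f)" for f
  proof -
    have "ereal 1 \<le> Osc q f \<Longrightarrow> q \<noteq> 0" for q using Osc_0[of f] by auto
    then show ?thesis
      unfolding Phi_less_iff by (auto simp: less_le)
  qed
  then show ?thesis by auto
qed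

lemma Phi_less_event: "{\<omega> \<in> space K. Phi 1 (path \<omega>) < ereal x} \<in> events"
  unfolding Phi_less_set
proof (rule sets.countable_UN'')
  show "countable {q \<in> \<rat>. 0 < q \<and> q < x}" by (rule countable_subset[OF _ countable_rat]) auto
qed (rule le_Osc_event, simp)

lemma Phi_measurable: "(\<lambda>\<omega>. Phi 1 (path \<omega>)) \<in> borel_measurable K"
proof (rule borel_measurableI_less)
  fix y :: ereal
  show "{\<omega> \<in> space K. Phi 1 (path \<omega>) < y} \<in> events"
  proof (cases y)
    case (real z)
    then show ?thesis using Phi_less_event by simp
  next
    case PInf
    have "z < \<infinity> \<longleftrightarrow> (\<exists>n. z < ereal (real n))" for z
      by (cases z) (auto intro: reals_Archimedean2)
    then have "{\<omega> \<in> space K. Phi 1 (path \<omega>) < y} = (\<Union>n. {\<omega> \<in> space K. Phi 1 (path \<omega>) < ereal (real n)})"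
      unfolding PInf by auto
    then show ?thesis using Phi_less_event by auto
  qed simp
qed

text \<open>
  The oscillation dominates the displacement at time \<open>x\<close>, which is normal with variance proportional to \<open>x\<close>.
\<close>

lemma Osc_tends_to_exceed_1: "(\<lambda>n. \<P>(\<omega> in K. ereal 1 \<le> Osc (real (Suc n)) (path \<omega>))) \<longlonglongrightarrow> 1"
proof -
  have lower: "1 - 4 * sqrt a / sqrt x \<le> \<P>(\<omega> in K. ereal 1 \<le> Osc x (path \<omega>))" if x: "0 < x" for x
  proof -
    define \<rho> where "\<rho> j = x * real j" for j
    have \<rho>: "\<rho> 0 = 0" "strict_mono \<rho>" using x by (auto simp: \<rho>_def strict_mono_def)
    define h where "h = 2 * x powr - (2 * p - 1)"
    have h: "0 < h" using x by (simp add: h_def)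
    define s where "s = sqrt ((x powr a - 0) / a)"
    have t: "0 \<le> \<rho> 0 powr a" "strict_mono (\<lambda>j. \<rho> j powr a)"
    proof -
      show "strict_mono (\<lambda>j. \<rho> j powr a)"
        using x strict_monoD[OF \<rho>(2)] a_pos by (intro strict_monoI powr_less_mono2) (auto simp: \<rho>_def)
    qed simp
    define A where "A = {\<omega> \<in> space N. - h < bm_increment \<rho> 0 \<omega> \<and> bm_increment \<rho> 0 \<omega> \<le> h}"
    have mG: "bm_increment \<rho> 0 \<in> borel_measurable N"
    proof -
      have [measurable]: "B (z powr a) \<in> borel_measurable N" for z by (rule bm.measurable_at) simp
      show ?thesis unfolding bm_increment_def[abs_def] by measurable
    qed
    have A: "A \<in> sets N" unfolding A_def using sets_Collect_slab[OF mG] .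
    have "measure N A = measure std_normal_distribution {- h / s<..h / s}"
      using bm.brownian_boxes[OF t a_pos, of 1 "\<lambda>_. - h" "\<lambda>_. h"]
      by (simp add: A_def bm_increment_def s_def \<rho>_def)
    also have "\<dots> \<le> h / s - - h / s"
    proof (rule std_normal_interval_le)
      have "0 \<le> s" unfolding s_def using a_pos by (intro real_sqrt_ge_zero divide_nonneg_pos) auto
      then show "- h / s \<le> h / s" using h by (intro divide_right_mono) auto
    qed
    also have "\<dots> = 4 * sqrt a / sqrt x"
    proof -
      have "s = x powr (a / 2) / sqrt a" using x by (simp add: s_def real_sqrt_divide powr_half_sqrt_powr)
      then have "h / s = 2 * sqrt a * (x powr - (2 * p - 1) / x powr (a / 2))" by (simp add: h_def)
      also have "x powr - (2 * p - 1) / x powr (a / 2) = x powr (- (1 / 2))"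
        unfolding powr_diff[symmetric] by (rule arg_cong[of _ _ "\<lambda>z. x powr z"]) (simp add: field_simps)
      also have "\<dots> = 1 / sqrt x" using x by (simp add: powr_minus_divide powr_half_sqrt)
      finally show ?thesis by simp
    qed
    finally have PA: "measure N A \<le> 4 * sqrt a / sqrt x" .
    have "1 - measure N A = measure N (space N - A)" using bm.prob_compl[OF A] by simp
    also have "\<dots> \<le> \<P>(\<omega> in N. 1 < 1 * grid_functional (2 * p - 1) \<rho> 1 (\<lambda>j. bm_increment \<rho> j \<omega>))"
    proof (rule bm.finite_measure_mono)
      have "bm_increment \<rho> j \<in> borel_measurable N" for j
      proof -
        have [measurable]: "B (z powr a) \<in> borel_measurable N" for z by (rule bm.measurable_at) simp
        show ?thesis unfolding bm_increment_def[abs_def] by measurable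
      qed
      then have "(\<lambda>\<omega>. grid_functional (2 * p - 1) \<rho> 1 (\<lambda>j. bm_increment \<rho> j \<omega>)) \<in> borel_measurable N"
        by (intro grid_functional_measurable)
      then show "{\<omega> \<in> space N. 1 < 1 * grid_functional (2 * p - 1) \<rho> 1 (\<lambda>j. bm_increment \<rho> j \<omega>)} \<in> sets N" by measurable
      show "space N - A \<subseteq> {\<omega> \<in> space N. 1 < 1 * grid_functional (2 * p - 1) \<rho> 1 (\<lambda>j. bm_increment \<rho> j \<omega>)}"
      proof
        fix \<omega> assume \<omega>: "\<omega> \<in> space N - A"
        then have "h \<le> \<bar>bm_increment \<rho> 0 \<omega>\<bar>" by (auto simp: A_def)
        then have "x powr (2 * p - 1) * h \<le> x powr (2 * p - 1) * \<bar>bm_increment \<rho> 0 \<omega>\<bar>" by (rule mult_left_mono) simp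
        moreover have "x powr (2 * p - 1) * h = 2"
        proof -
          have "x powr (2 * p - 1) * x powr - (2 * p - 1) = 1"
            unfolding powr_add[symmetric] add.right_inverse using x by simp
          then show ?thesis unfolding h_def by (metis mult.left_commute mult.right_neutral)
        qed
        ultimately have "2 \<le> \<bar>x powr (2 * p - 1) * bm_increment \<rho> 0 \<omega>\<bar>" by (simp add: abs_mult)
        moreover have "\<bar>x powr (2 * p - 1) * bm_increment \<rho> 0 \<omega>\<bar> \<le> grid_functional (2 * p - 1) \<rho> 1 (\<lambda>j. bm_increment \<rho> j \<omega>)"
          using path_spread_ge[of 0 1 1 "\<lambda>j. \<rho> j powr (2 * p - 1) * (\<Sum>i<j. bm_increment \<rho> i \<omega>)"]
            path_spread_ge[of 1 1 0 "\<lambda>j. \<rho> j powr (2 * p - 1) * (\<Sum>i<j. bm_increment \<rho> i \<omega>)"]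
          by (simp add: grid_functional_def \<rho>_def abs_le_iff)
        ultimately show "\<omega> \<in> {\<omega> \<in> space N. 1 < 1 * grid_functional (2 * p - 1) \<rho> 1 (\<lambda>j. bm_increment \<rho> j \<omega>)}" using \<omega> by simp
      qed
    qed
    also have "\<dots> = \<P>(\<omega> in K. 1 < 1 * path_spread 1 (\<lambda>j. W (\<rho> j) \<omega>))"
      by (rule grid_law[OF \<rho>, symmetric])
    also have "\<dots> \<le> \<P>(\<omega> in K. ereal 1 \<le> Osc x (path \<omega>))"
    proof (rule finite_measure_mono[OF _ le_Osc_event[OF x]])
      show "{\<omega> \<in> space K. 1 < 1 * path_spread 1 (\<lambda>j. W (\<rho> j) \<omega>)} \<subseteq> {\<omega> \<in> space K. ereal 1 \<le> Osc x (path \<omega>)}"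
      proof safe
        fix \<omega> assume "\<omega> \<in> space K" "1 < 1 * path_spread 1 (\<lambda>j. W (\<rho> j) \<omega>)"
        then obtain i j where "i \<le> 1" "j \<le> 1" "1 < W (\<rho> i) \<omega> - W (\<rho> j) \<omega>" by (auto simp: less_path_spread_iff)
        moreover have "\<rho> i \<in> {0..x}" if "i \<le> 1" for i
        proof -
          have "real i \<le> 1" using that by simp
          then show ?thesis using x mult_left_mono[of "real i" 1 x] by (simp add: \<rho>_def)
        qed
        ultimately show "ereal 1 \<le> Osc x (path \<omega>)"
          using less_Osc_iff[of x 1 "path \<omega>"] x by (intro less_imp_le) (auto simp: path_def)
      qed
    qed
    finally show ?thesis using PA by linarith
  qed
  have lim: "(\<lambda>n. 1 - 4 * sqrt a / sqrt (real (Suc n))) \<longlonglongrightarrow> 1" by real_asymp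
  show ?thesis
    by (rule tendsto_sandwich[OF _ _ lim tendsto_const]; intro always_eventually allI lower prob_le_1) simp
qed

lemma Phi_finite: "AE \<omega> in K. \<bar>Phi 1 (path \<omega>)\<bar> \<noteq> \<infinity>"
proof -
  define A where "A = {\<omega> \<in> space K. Phi 1 (path \<omega>) < \<infinity>}"
  have A: "A \<in> events" unfolding A_def using Phi_measurable by measurable
  have "\<P>(\<omega> in K. ereal 1 \<le> Osc (real (Suc n)) (path \<omega>)) \<le> prob A" for n
  proof (rule finite_measure_mono[OF _ A], safe)
    fix \<omega> assume "\<omega> \<in> space K" "ereal 1 \<le> Osc (real (Suc n)) (path \<omega>)"
    moreover from this(2) have "Phi 1 (path \<omega>) \<le> ereal (real (Suc n))" by (intro Phi_le) auto
    ultimately show "\<omega> \<in> A" by (auto simp: A_def intro: le_less_trans)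
  qed
  then have "1 \<le> prob A" by (intro LIMSEQ_le_const2[OF Osc_tends_to_exceed_1]) auto
  then have "prob A = 1" using prob_le_1[of A] by linarith
  then have "AE \<omega> in K. \<omega> \<in> A" using A by (simp add: prob_eq_1)
  then show ?thesis
  proof eventually_elim
    case (elim \<omega>)
    then show ?case using Phi_nonneg[of 1 "path \<omega>"] by (cases "Phi 1 (path \<omega>)") (auto simp: A_def)
  qed
qed

lemma cdf_Phi: "cdf (distr K borel (\<lambda>\<omega>. real_of_ereal (Phi 1 (path \<omega>)))) x = \<P>(\<omega> in K. Phi 1 (path \<omega>) \<le> ereal x)"
proof -
  have m: "(\<lambda>\<omega>. real_of_ereal (Phi 1 (path \<omega>))) \<in> borel_measurable K" using Phi_measurable by measurable
  have "cdf (distr K borel (\<lambda>\<omega>. real_of_ereal (Phi 1 (path \<omega>)))) x = \<P>(\<omega> in K. real_of_ereal (Phi 1 (path \<omega>)) \<le> x)"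
    unfolding cdf_def using m by (subst measure_distr) (auto simp: vimage_def Int_def conj_commute)
  also have "\<dots> = \<P>(\<omega> in K. Phi 1 (path \<omega>) \<le> ereal x)"
  proof (rule measure_eq_AE)
    show "AE \<omega> in K. (\<omega> \<in> {\<omega> \<in> space K. real_of_ereal (Phi 1 (path \<omega>)) \<le> x}) = (\<omega> \<in> {\<omega> \<in> space K. Phi 1 (path \<omega>) \<le> ereal x})"
      using Phi_finite
    proof eventually_elim
      case (elim \<omega>)
      then show ?case by (cases "Phi 1 (path \<omega>)") auto
    qed
  qed (use m Phi_measurable in measurable)
  finally show ?thesis .
qed

end

context elephant_random_walk
begin

text \<open>
  Restricting the walk to a grid only decreases the spread, so no control between the grid points is
  needed.
\<close>

lemma diffusive_spread_lower:
  assumes RP: "reinforced_pair K W p N B" and y: "0 < y" and c: "c' < c" and \<eta>: "0 < \<eta>"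
  shows "\<forall>\<^sub>F L in sequentially. \<P>(\<omega> in K. ereal c < Osc y (\<lambda>t. W t \<omega>)) - \<eta>
    \<le> \<P>(\<omega> in M. c' * real L < spread (nat \<lfloor>y * real L ^ 2\<rfloor>) \<omega>)"
proof -
  interpret R: reinforced_pair K W p N B by fact
  have b: "\<beta> < 1 / 2" using R.p_less by simp
  define D where "D i = {\<omega> \<in> space K. c < dyadic_spread y i (R.path \<omega>)}" for i
  have D: "D i \<in> R.events" for i
  proof -
    have [measurable]: "(\<lambda>\<omega>. dyadic_spread y i (R.path \<omega>)) \<in> borel_measurable K" using R.dyadic_measurable y by simp
    show ?thesis unfolding D_def by measurable
  qed
  have un: "{\<omega> \<in> space K. ereal c < Osc y (R.path \<omega>)} = (\<Union>i. D i)"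
    unfolding D_def using less_Osc_iff_dyadic[OF R.path_skorokhod y] by auto
  have "incseq D"
    by (rule incseq_SucI) (auto simp: D_def intro: less_le_trans[OF _ dyadic_spread_mono])
  then have "(\<lambda>i. R.prob (D i)) \<longlonglongrightarrow> R.prob (\<Union>i. D i)"
    using D by (intro R.finite_Lim_measure_incseq) auto
  then have "\<forall>\<^sub>F i in sequentially. R.prob (\<Union>i. D i) - \<eta> / 2 < R.prob (D i)"
    by (rule order_tendstoD(1)) (use \<eta> in simp)
  then obtain i where i: "R.prob (\<Union>i. D i) - \<eta> / 2 < R.prob (D i)" by (auto simp: eventually_sequentially)
  define \<rho> where "\<rho> j = y * real j / 2 ^ i" for j
  have \<rho>: "\<rho> 0 = 0" "strict_mono \<rho>" "\<rho> (2 ^ i) = y"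
    using y by (auto simp: \<rho>_def strict_mono_def divide_strict_right_mono)
  have "R.prob (D i) = \<P>(\<omega> in K. c < 1 * path_spread (2 ^ i) (\<lambda>j. W (\<rho> j) \<omega>))"
    by (simp add: D_def dyadic_spread_def \<rho>_def R.path_def)
  also have "\<dots> = \<P>(\<omega> in N. c < 1 * grid_functional \<beta> \<rho> (2 ^ i) (\<lambda>j. R.bm_increment \<rho> j \<omega>))"
    by (rule R.grid_law[OF \<rho>(1,2)])
  finally have Di: "R.prob (D i) = \<P>(\<omega> in N. c < 1 * grid_functional \<beta> \<rho> (2 ^ i) (\<lambda>j. R.bm_increment \<rho> j \<omega>))" .
  have "\<forall>\<^sub>F L in sequentially. \<P>(\<omega> in N. c < 1 * grid_functional \<beta> \<rho> (2 ^ i) (\<lambda>j. R.bm_increment \<rho> j \<omega>)) - \<eta> / 2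
    \<le> \<P>(\<omega> in M. c' < 1 * grid_spread \<rho> (2 ^ i) L \<omega>)"
    by (rule grid_spread_limit[OF R.bm.standard_brownian_motion_axioms b \<rho>(1,2) R.bm_increment_def _ c]) (use \<eta> in auto)
  then show ?thesis using diffusive_time_eventually[OF y] eventually_gt_at_top[of 0]
  proof eventually_elim
    case (elim L)
    have "\<P>(\<omega> in M. c' < 1 * grid_spread \<rho> (2 ^ i) L \<omega>) \<le> \<P>(\<omega> in M. c' * real L < spread (nat \<lfloor>y * real L ^ 2\<rfloor>) \<omega>)"
    proof (rule finite_measure_mono)
      show "{\<omega> \<in> space M. c' * real L < spread (nat \<lfloor>y * real L ^ 2\<rfloor>) \<omega>} \<in> events"
        by (rule adapted_event[OF adapted_comp[OF adapted_spread[OF order_refl]]])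
      show "{\<omega> \<in> space M. c' < 1 * grid_spread \<rho> (2 ^ i) L \<omega>} \<subseteq> {\<omega> \<in> space M. c' * real L < spread (nat \<lfloor>y * real L ^ 2\<rfloor>) \<omega>}"
      proof safe
        fix \<omega> assume "c' < 1 * grid_spread \<rho> (2 ^ i) L \<omega>"
        then obtain j k where jk: "j \<le> 2 ^ i" "k \<le> 2 ^ i"
          "c' < walk (diffusive_time (\<rho> j) L) \<omega> / real L - walk (diffusive_time (\<rho> k) L) \<omega> / real L"
          by (auto simp: grid_spread_def less_path_spread_iff)
        have "diffusive_time (\<rho> j) L \<le> nat \<lfloor>y * real L ^ 2\<rfloor>" if "j \<le> 2 ^ i" for j
          using diffusive_time_mono[of "\<rho> j" y L] monoD[OF strict_mono_mono[OF \<rho>(2)] that] \<rho>(3) elim(2) by simp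
        then have "walk (diffusive_time (\<rho> j) L) \<omega> - walk (diffusive_time (\<rho> k) L) \<omega> \<le> spread (nat \<lfloor>y * real L ^ 2\<rfloor>) \<omega>"
          unfolding spread_def using jk by (intro path_spread_ge)
        moreover have "c' * real L < walk (diffusive_time (\<rho> j) L) \<omega> - walk (diffusive_time (\<rho> k) L) \<omega>"
          using jk(3) elim(3) by (simp add: diff_divide_distrib[symmetric] pos_less_divide_eq)
        ultimately show "c' * real L < spread (nat \<lfloor>y * real L ^ 2\<rfloor>) \<omega>" by linarith
      qed
    qed
    moreover have "\<P>(\<omega> in K. ereal c < Osc y (\<lambda>t. W t \<omega>)) = R.prob (\<Union>i. D i)"
      using un unfolding R.path_def by simp
    ultimately show ?case using elim(1) i Di \<eta> by linarith
  qed
qed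

text \<open>
  The spread exceeds the grid spread by at most a small multiple of \<open>L\<close>, and the grid spread has a limit law bounded by that of the
  oscillation.
\<close>

lemma diffusive_spread_upper:
  assumes RP: "reinforced_pair K W p N B" and x: "0 < x" and \<eta>: "0 < \<eta>"
  shows "\<forall>\<^sub>F L in sequentially. \<P>(\<omega> in M. real L - 1 \<le> spread (nat \<lfloor>x * real L ^ 2\<rfloor>) \<omega>)
    \<le> \<P>(\<omega> in K. ereal 1 \<le> Osc x (\<lambda>t. W t \<omega>)) + \<eta>"
proof -
  interpret R: reinforced_pair K W p N B by fact
  have b: "\<beta> < 1 / 2" using R.p_less by simp
  define A where "A k = {\<omega> \<in> space K. ereal (1 - inverse (real (Suc k))) < Osc x (R.path \<omega>)}" for k
  have A: "A k \<in> R.events" for k unfolding A_def by (rule R.less_Osc_event[OF x])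
  have "decseq A"
  proof (rule decseq_SucI)
    fix k
    have "inverse (real (Suc (Suc k))) \<le> inverse (real (Suc k))" by (rule le_imp_inverse_le) auto
    then have "ereal (1 - inverse (real (Suc k))) \<le> ereal (1 - inverse (real (Suc (Suc k))))"
      unfolding ereal_less_eq(3) by linarith
    then show "A (Suc k) \<subseteq> A k" unfolding A_def by (blast intro: le_less_trans)
  qed
  then have "(\<lambda>k. R.prob (A k)) \<longlonglongrightarrow> R.prob (\<Inter>k. A k)"
    using A by (intro R.finite_Lim_measure_decseq) auto
  moreover have "(\<Inter>k. A k) = {\<omega> \<in> space K. ereal 1 \<le> Osc x (R.path \<omega>)}"
    unfolding A_def le_Osc_iff[of 1] by auto
  ultimately have "\<forall>\<^sub>F k in sequentially. R.prob (A k) < \<P>(\<omega> in K. ereal 1 \<le> Osc x (R.path \<omega>)) + \<eta> / 4"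
    using \<eta> by (intro order_tendstoD(2)) auto
  then obtain k where k: "R.prob (A k) < \<P>(\<omega> in K. ereal 1 \<le> Osc x (R.path \<omega>)) + \<eta> / 4"
    by (auto simp: eventually_sequentially)
  (* The four comparisons below lose 4, 1, 1 and 2 multiples of epsilon, in total 8. *)
  define \<epsilon> where "\<epsilon> = inverse (real (Suc k)) / 8"
  have \<epsilon>: "0 < \<epsilon>" by (simp add: \<epsilon>_def)
  have \<eta>4: "0 < \<eta> / 4" using \<eta> by simp
  obtain \<rho> m where \<rho>: "\<rho> 0 = 0" "strict_mono \<rho>" "\<rho> m = x"
    and fluct: "\<forall>\<^sub>F L in sequentially. \<P>(\<omega> in M. real L * (grid_spread \<rho> m L \<omega> + 4 * \<epsilon>) < spread (nat \<lfloor>x * real L ^ 2\<rfloor>) \<omega>) < \<eta> / 4"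
    by (rule fluctuations_between_grid_points[OF b x \<epsilon> \<eta>4]) blast
  have "\<forall>\<^sub>F L in sequentially. \<P>(\<omega> in N. - (1 - 6 * \<epsilon>) < - 1 * grid_functional \<beta> \<rho> m (\<lambda>j. R.bm_increment \<rho> j \<omega>)) - \<eta> / 4
    \<le> \<P>(\<omega> in M. - (1 - 5 * \<epsilon>) < - 1 * grid_spread \<rho> m L \<omega>)"
    by (rule grid_spread_limit[OF R.bm.standard_brownian_motion_axioms b \<rho>(1,2) R.bm_increment_def]) (use \<eta> \<epsilon> in auto)
  moreover have "\<forall>\<^sub>F L in sequentially. 1 < \<epsilon> * real L" using \<epsilon> by real_asymp
  ultimately show ?thesis using fluct eventually_gt_at_top[of 0]
  proof eventually_elim
    case (elim L)
    define G where "G = {\<omega> \<in> space M. - (1 - 5 * \<epsilon>) < - 1 * grid_spread \<rho> m L \<omega>}"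
    define E where "E = {\<omega> \<in> space M. real L * (grid_spread \<rho> m L \<omega> + 4 * \<epsilon>) < spread (nat \<lfloor>x * real L ^ 2\<rfloor>) \<omega>}"
    have [measurable]: "spread n \<in> borel_measurable M" for n by (rule adapted_borel[OF adapted_spread[OF order_refl]])
    have GE: "G \<in> events" "E \<in> events" unfolding G_def E_def by measurable
    have "\<P>(\<omega> in M. real L - 1 \<le> spread (nat \<lfloor>x * real L ^ 2\<rfloor>) \<omega>) \<le> prob ((space M - G) \<union> E)"
    proof (rule finite_measure_mono)
      show "{\<omega> \<in> space M. real L - 1 \<le> spread (nat \<lfloor>x * real L ^ 2\<rfloor>) \<omega>} \<subseteq> (space M - G) \<union> E"
      proof
        fix \<omega> assume \<omega>: "\<omega> \<in> {\<omega> \<in> space M. real L - 1 \<le> spread (nat \<lfloor>x * real L ^ 2\<rfloor>) \<omega>}"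
        have "\<omega> \<notin> G" if "\<omega> \<notin> E"
        proof
          assume "\<omega> \<in> G"
          then have "grid_spread \<rho> m L \<omega> + 4 * \<epsilon> < 1 - \<epsilon>" by (simp add: G_def)
          then have "real L * (grid_spread \<rho> m L \<omega> + 4 * \<epsilon>) < real L * (1 - \<epsilon>)" using elim(4) by (intro mult_strict_left_mono) auto
          also have "\<dots> < real L - 1" using elim(2) by (simp add: right_diff_distrib mult.commute)
          finally have "real L * (grid_spread \<rho> m L \<omega> + 4 * \<epsilon>) < real L - 1" .
          then show False using that \<omega> by (auto simp: E_def)
        qed
        then show "\<omega> \<in> (space M - G) \<union> E" using \<omega> by auto
      qed
    qed (use GE in auto)
    also have "\<dots> \<le> prob (space M - G) + prob E" using GE by (intro measure_Un_le) auto
    also have "prob (space M - G) = 1 - prob G" by (rule prob_compl[OF GE(1)])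
    also have "1 - prob G \<le> 1 - (\<P>(\<omega> in N. - (1 - 6 * \<epsilon>) < - 1 * grid_functional \<beta> \<rho> m (\<lambda>j. R.bm_increment \<rho> j \<omega>)) - \<eta> / 4)"
      using elim(1) by (simp add: G_def)
    also have "\<P>(\<omega> in N. - (1 - 6 * \<epsilon>) < - 1 * grid_functional \<beta> \<rho> m (\<lambda>j. R.bm_increment \<rho> j \<omega>))
      = \<P>(\<omega> in K. - (1 - 6 * \<epsilon>) < - 1 * path_spread m (\<lambda>j. W (\<rho> j) \<omega>))"
      by (rule R.grid_law[OF \<rho>(1,2), symmetric])
    finally have 1: "\<P>(\<omega> in M. real L - 1 \<le> spread (nat \<lfloor>x * real L ^ 2\<rfloor>) \<omega>)
      \<le> 1 - \<P>(\<omega> in K. - (1 - 6 * \<epsilon>) < - 1 * path_spread m (\<lambda>j. W (\<rho> j) \<omega>)) + \<eta> / 2"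
      using elim(3) by (simp add: E_def)
    have \<rho>x: "\<rho> j \<in> {0..x}" if "j \<le> m" for j
      using monoD[OF strict_mono_mono[OF \<rho>(2)], of 0 j] monoD[OF strict_mono_mono[OF \<rho>(2)] that] \<rho> by simp
    have "1 - R.prob (A k) = R.prob (space K - A k)" by (rule R.prob_compl[OF A, symmetric])
    also have "\<dots> \<le> \<P>(\<omega> in K. - (1 - 6 * \<epsilon>) < - 1 * path_spread m (\<lambda>j. W (\<rho> j) \<omega>))"
    proof (rule R.finite_measure_mono)
      have "0 \<le> \<rho> j" for j using monoD[OF strict_mono_mono[OF \<rho>(2)], of 0 j] \<rho>(1) by simp
      then have "(\<lambda>\<omega>. path_spread m (\<lambda>j. W (\<rho> j) \<omega>)) \<in> borel_measurable K"
        by (intro path_spread_measurable R.W_measurable)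
      then show "{\<omega> \<in> space K. - (1 - 6 * \<epsilon>) < - 1 * path_spread m (\<lambda>j. W (\<rho> j) \<omega>)} \<in> R.events" by measurable
      show "space K - A k \<subseteq> {\<omega> \<in> space K. - (1 - 6 * \<epsilon>) < - 1 * path_spread m (\<lambda>j. W (\<rho> j) \<omega>)}"
      proof
        fix \<omega> assume \<omega>: "\<omega> \<in> space K - A k"
        then have no: "\<not> ereal (1 - 8 * \<epsilon>) < Osc x (R.path \<omega>)" by (simp add: A_def \<epsilon>_def)
        have "path_spread m (\<lambda>j. W (\<rho> j) \<omega>) \<le> 1 - 8 * \<epsilon>"
        proof (rule ccontr)
          assume "\<not> ?thesis"
          then have "1 - 8 * \<epsilon> < path_spread m (\<lambda>j. W (\<rho> j) \<omega>)" by simp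
          then obtain i j where "i \<le> m" "j \<le> m" "1 - 8 * \<epsilon> < W (\<rho> i) \<omega> - W (\<rho> j) \<omega>" unfolding less_path_spread_iff by auto
          then have "ereal (1 - 8 * \<epsilon>) < Osc x (R.path \<omega>)"
            using \<rho>x less_Osc_iff[of x "1 - 8 * \<epsilon>" "R.path \<omega>"] x unfolding R.path_def by auto
          then show False using no by simp
        qed
        then show "\<omega> \<in> {\<omega> \<in> space K. - (1 - 6 * \<epsilon>) < - 1 * path_spread m (\<lambda>j. W (\<rho> j) \<omega>)}" using \<omega> \<epsilon> by simp
      qed
    qed
    finally show ?case using 1 k \<eta> unfolding R.path_def by linarith
  qed
qed

text \<open>
  With \<open>g x = P(Osc\<^sub>x \<ge> 1)\<close> and \<open>F\<close> the distribution function of the hitting time of level one, \<open>F z \<le> g y \<le> F y\<close> for \<open>z < y\<close>.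
  The upper bound by \<open>g x\<close> is direct. For the lower bound by \<open>g y\<close> with \<open>y < x\<close>, the same event is
  viewed with \<open>n = L / s\<close>, \<open>s\<^sup>2 = y/x\<close>, in the place of \<open>L\<close>: up to time \<open>y n\<^sup>2 = x L\<^sup>2\<close> a spread of only \<open>s n\<close> is required,
  which is strictly less than \<open>n\<close>. So it does not matter whether the oscillation of the limit could equal one on an interval of times.
\<close>

lemma diffusive_cover_probability:
  assumes RP: "reinforced_pair K W p N B" and x: "0 < x"
    and cont: "isCont (cdf (distr K borel (\<lambda>\<omega>. real_of_ereal (Phi 1 (\<lambda>t. W t \<omega>))))) x"
  shows "(\<lambda>L. \<P>(\<omega> in M. real L - 1 \<le> spread (nat \<lfloor>x * real L ^ 2\<rfloor>) \<omega>))
    \<longlonglongrightarrow> cdf (distr K borel (\<lambda>\<omega>. real_of_ereal (Phi 1 (\<lambda>t. W t \<omega>)))) x"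
proof (rule LIMSEQ_I)
  fix e :: real assume e: "0 < e"
  interpret R: reinforced_pair K W p N B by fact
  define F where "F = cdf (distr K borel (\<lambda>\<omega>. real_of_ereal (Phi 1 (R.path \<omega>))))"
  have F: "F z = \<P>(\<omega> in K. Phi 1 (R.path \<omega>) \<le> ereal z)" for z unfolding F_def by (rule R.cdf_Phi)
  define g where "g z = \<P>(\<omega> in K. ereal 1 \<le> Osc z (R.path \<omega>))" for z
  have Phi_event: "{\<omega> \<in> space K. Phi 1 (R.path \<omega>) \<le> ereal z} \<in> R.events" for z using R.Phi_measurable by measurable
  have gF: "g z \<le> F z" if "0 < z" for z
    unfolding g_def F using that by (intro R.finite_measure_mono Phi_event) (auto intro: Phi_le)
  have Fg: "F z \<le> g z'" if "z < z'" "0 < z'" for z z'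
    unfolding g_def F
  proof (rule R.finite_measure_mono[OF _ R.le_Osc_event[OF that(2)]])
    show "{\<omega> \<in> space K. Phi 1 (R.path \<omega>) \<le> ereal z} \<subseteq> {\<omega> \<in> space K. ereal 1 \<le> Osc z' (R.path \<omega>)}"
    proof safe
      fix \<omega> assume "Phi 1 (R.path \<omega>) \<le> ereal z"
      also have "\<dots> < ereal z'" using that by simp
      finally obtain t where t: "0 \<le> t" "ereal 1 \<le> Osc t (R.path \<omega>)" "t < z'" unfolding Phi_def Inf_less_iff by auto
      show "ereal 1 \<le> Osc z' (R.path \<omega>)" using Osc_mono[OF t(1) less_imp_le[OF t(3)], of "R.path \<omega>"] t(2) by (rule order_trans[rotated])
    qed
  qed
  have e4: "0 < e / 4" using e by simp
  have "isCont F x" using cont by (simp add: F_def R.path_def)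
  then have "(F \<longlongrightarrow> F x) (at_left x)" unfolding isCont_def by (rule filterlim_mono) (auto simp: at_within_le_at)
  then have "\<forall>\<^sub>F z in at_left x. F x - e / 4 < F z" by (rule order_tendstoD(1)) (use e in simp)
  then obtain z0 where z0: "z0 < x" "\<And>z. z0 < z \<Longrightarrow> z < x \<Longrightarrow> F x - e / 4 < F z" by (auto simp: eventually_at_left_field)
  (* Continuity of F at x provides z < y < x with F z close to F x. *)
  define z where "z = (max z0 0 + x) / 2"
  define y where "y = (z + x) / 2"
  have zy: "0 < z" "z < y" "y < x" "z0 < z" using z0 x by (auto simp: z_def y_def)
  have lowF: "F x - e / 4 < g y"
  proof -
    have "F x - e / 4 < F z" using z0(2)[of z] zy by simp
    also have "\<dots> \<le> g y" using zy by (intro Fg) auto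
    finally show ?thesis .
  qed
  (* Passage from L to n = L/s leaves x L^2 = y n^2 and turns the level L into s n. *)
  define s where "s = sqrt (y / x)"
  have s: "0 < s" "s < 1" using zy by (auto simp: s_def)
  define c' where "c' = (1 + s) / 2"
  have c': "s < c'" "c' < 1" using s by (auto simp: c'_def)
  define c where "c = (c' + 1) / 2"
  have c: "c' < c" "c < 1" using c' by (auto simp: c_def)
  define n where "n L = nat \<lfloor>real L / s\<rfloor>" for L
  have n: "filterlim n at_top sequentially" unfolding n_def using s by real_asymp
  have "\<forall>\<^sub>F k in sequentially. \<P>(\<omega> in K. ereal c < Osc y (R.path \<omega>)) - e / 4
    \<le> \<P>(\<omega> in M. c' * real k < spread (nat \<lfloor>y * real k ^ 2\<rfloor>) \<omega>)"
    unfolding R.path_def using zy by (intro diffusive_spread_lower[OF RP _ c(1) e4]) auto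
  then have lower: "\<forall>\<^sub>F L in sequentially. \<P>(\<omega> in K. ereal c < Osc y (R.path \<omega>)) - e / 4
    \<le> \<P>(\<omega> in M. c' * real (n L) < spread (nat \<lfloor>y * real (n L) ^ 2\<rfloor>) \<omega>)"
    by (rule eventually_compose_filterlim[OF _ n])
  have upper: "\<forall>\<^sub>F L in sequentially. \<P>(\<omega> in M. real L - 1 \<le> spread (nat \<lfloor>x * real L ^ 2\<rfloor>) \<omega>) \<le> g x + e / 4"
    unfolding g_def R.path_def by (rule diffusive_spread_upper[OF RP x e4])
  have size: "\<forall>\<^sub>F L in sequentially. real L - 1 \<le> c' * real (n L)"
  proof -
    have "1 < c' / s" using c' s by simp
    have "\<forall>\<^sub>F L in sequentially. c' \<le> (c' / s - 1) * real L + 1" using c'(2) \<open>1 < c' / s\<close> by (intro always_eventually allI) (simp add: add_increasing)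
    then show ?thesis
    proof eventually_elim
      case (elim L)
      have "real L / s - 1 \<le> real (n L)" unfolding n_def by linarith
      then have "c' * (real L / s - 1) \<le> c' * real (n L)" using c' s by (intro mult_left_mono) auto
      then show ?case using elim by (simp add: algebra_simps)
    qed
  qed
  have "\<forall>\<^sub>F L in sequentially. norm (\<P>(\<omega> in M. real L - 1 \<le> spread (nat \<lfloor>x * real L ^ 2\<rfloor>) \<omega>) - F x) < e"
    using lower upper size
  proof eventually_elim
    case (elim L)
    have evs: "{\<omega> \<in> space M. real L - 1 \<le> spread k \<omega>} \<in> events" for k
      by (rule adapted_event[OF adapted_comp[OF adapted_spread[OF order_refl]]])
    have "real (n L) \<le> real L / s" unfolding n_def using s by (intro of_nat_floor) simp
    then have "y * real (n L) ^ 2 \<le> y * (real L / s) ^ 2" using zy by (intro mult_left_mono power_mono) auto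
    also have "\<dots> = x * real L ^ 2" using zy by (simp add: s_def power_divide)
    finally have le: "nat \<lfloor>y * real (n L) ^ 2\<rfloor> \<le> nat \<lfloor>x * real L ^ 2\<rfloor>" by (intro nat_mono floor_mono)
    have "g y \<le> \<P>(\<omega> in K. ereal c < Osc y (R.path \<omega>))"
      unfolding g_def
    proof (rule R.finite_measure_mono)
      have "ereal c < ereal 1" using c(2) by simp
      then show "{\<omega> \<in> space K. ereal 1 \<le> Osc y (R.path \<omega>)} \<subseteq> {\<omega> \<in> space K. ereal c < Osc y (R.path \<omega>)}"
        by (blast intro: less_le_trans)
    qed (rule R.less_Osc_event, use zy in simp)
    moreover have "\<P>(\<omega> in M. c' * real (n L) < spread (nat \<lfloor>y * real (n L) ^ 2\<rfloor>) \<omega>)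
      \<le> \<P>(\<omega> in M. real L - 1 \<le> spread (nat \<lfloor>x * real L ^ 2\<rfloor>) \<omega>)"
    proof (rule finite_measure_mono[OF _ evs])
      have "real L - 1 \<le> spread (nat \<lfloor>x * real L ^ 2\<rfloor>) \<omega>"
        if "c' * real (n L) < spread (nat \<lfloor>y * real (n L) ^ 2\<rfloor>) \<omega>" for \<omega>
      proof -
        have "spread (nat \<lfloor>y * real (n L) ^ 2\<rfloor>) \<omega> \<le> spread (nat \<lfloor>x * real L ^ 2\<rfloor>) \<omega>"
          unfolding spread_def by (rule path_spread_mono[OF le])
        then show ?thesis using that elim(3) by linarith
      qed
      then show "{\<omega> \<in> space M. c' * real (n L) < spread (nat \<lfloor>y * real (n L) ^ 2\<rfloor>) \<omega>}
        \<subseteq> {\<omega> \<in> space M. real L - 1 \<le> spread (nat \<lfloor>x * real L ^ 2\<rfloor>) \<omega>}"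
        by blast
    qed
    ultimately have "F x - e / 2 < \<P>(\<omega> in M. real L - 1 \<le> spread (nat \<lfloor>x * real L ^ 2\<rfloor>) \<omega>)"
      using elim(1) lowF by linarith
    then have "\<bar>\<P>(\<omega> in M. real L - 1 \<le> spread (nat \<lfloor>x * real L ^ 2\<rfloor>) \<omega>) - F x\<bar> < e"
      using elim(2) gF[OF x] e unfolding abs_less_iff by linarith
    then show ?case by simp
  qed
  then show "\<exists>no. \<forall>L\<ge>no. norm (\<P>(\<omega> in M. real L - 1 \<le> spread (nat \<lfloor>x * real L ^ 2\<rfloor>) \<omega>)
    - cdf (distr K borel (\<lambda>\<omega>. real_of_ereal (Phi 1 (\<lambda>t. W t \<omega>)))) x) < e"
    by (simp add: eventually_sequentially F_def R.path_def)
qed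

end

theorem proposition1p2:
  fixes p :: real
    and M :: "nat \<Rightarrow> 'a measure" and X :: "nat \<Rightarrow> nat \<Rightarrow> 'a \<Rightarrow> int"
    and u :: "nat \<Rightarrow> nat \<Rightarrow> 'a \<Rightarrow> nat" and r :: "nat \<Rightarrow> nat \<Rightarrow> 'a \<Rightarrow> bool"
    and M' :: "'d measure" and X' :: "nat \<Rightarrow> 'd \<Rightarrow> int"
    and u' :: "nat \<Rightarrow> 'd \<Rightarrow> nat" and r' :: "nat \<Rightarrow> 'd \<Rightarrow> bool"
    and N :: "'b measure" and B :: "real \<Rightarrow> 'b \<Rightarrow> real"
    and K :: "'c measure" and W :: "real \<Rightarrow> 'c \<Rightarrow> real"
  assumes p: "0 \<le> p" "p < 1"
    and erw: "\<And>L. 2 \<le> L \<Longrightarrow> elephant_random_walk (M L) p (X L) (u L) (r L)"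
    and common_erw: "elephant_random_walk M' p X' u' r'"
    and bm: "standard_brownian_motion N B"
    and nrbm: "p < 3 / 4 \<Longrightarrow> noise_reinforced_brownian_motion K W p N B"
  shows "(p < 3 / 4 \<longrightarrow>
            converges_in_distribution M
              (\<lambda>L \<omega>. ereal_of_enat (cover_time L (X L) \<omega>) / ereal (real L ^ 2))
              K (\<lambda>\<omega>. Phi 1 (\<lambda>t. W t \<omega>)))
       \<and> (p = 3 / 4 \<longrightarrow>
            converges_in_distribution M
              (\<lambda>L \<omega>. ereal_of_enat (cover_time L (X L) \<omega>) * ereal (ln (real L)) / ereal (real L ^ 2))
              N (\<lambda>\<omega>. ereal (1 / (2 * (B 1 \<omega>) ^ 2))))
       \<and> (3 / 4 < p \<longrightarrow>
            (let Y = (\<lambda>\<omega>. lim (\<lambda>n. real_of_int (lifted_walk X' n \<omega>) / real n powr (2 * p - 1)))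
             in (AE \<omega> in M'.
                   convergent (\<lambda>n. real_of_int (lifted_walk X' n \<omega>) / real n powr (2 * p - 1))
                   \<and> Y \<omega> \<noteq> 0)
              \<and> (AE \<omega> in M'.
                   (\<lambda>L. ereal_of_enat (cover_time L X' \<omega>) / ereal (real L powr (1 / (2 * p - 1))))
                     \<longlonglongrightarrow> ereal (1 / \<bar>Y \<omega>\<bar> powr (1 / (2 * p - 1))))))"
proof -
  interpret E: elephant_random_walk M' p X' u' r' by (rule common_erw)
  interpret bm: standard_brownian_motion N B by (rule bm)
  have "converges_in_distribution M (\<lambda>L \<omega>. ereal_of_enat (cover_time L (X L) \<omega>) / ereal (real L ^ 2))
      K (\<lambda>\<omega>. Phi 1 (\<lambda>t. W t \<omega>))" if less: "p < 3 / 4"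
  proof -
    interpret R: reinforced_pair K W p N B
      by (rule reinforced_pair.intro[OF nrbm[OF less] bm]) (unfold_locales, rule less)
    have "converges_in_distribution M (\<lambda>L \<omega>. ereal_of_enat (cover_time L (X L) \<omega>) * ereal (1 / real L ^ 2))
      K (\<lambda>\<omega>. Phi 1 (R.path \<omega>))"
    proof (rule cover_time_converges_in_distribution[OF erw common_erw])
      show "p \<le> 3 / 4" using less by simp
      show "prob_space K" by (rule R.prob_space_axioms)
      show "0 < 1 / real L ^ 2" if "2 \<le> L" for L using that by simp
      show "(\<lambda>L. E.prob {\<omega> \<in> space M'. real L - 1 \<le> E.spread (nat \<lfloor>x / (1 / real L ^ 2)\<rfloor>) \<omega>})
        \<longlonglongrightarrow> cdf (distr K borel (\<lambda>\<omega>. real_of_ereal (Phi 1 (R.path \<omega>)))) x"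
        if "0 < x" "isCont (cdf (distr K borel (\<lambda>\<omega>. real_of_ereal (Phi 1 (R.path \<omega>))))) x" for x
        using E.diffusive_cover_probability[OF R.reinforced_pair_axioms that[unfolded R.path_def]] by (simp add: R.path_def)
    qed (rule R.Phi_measurable R.Phi_finite Phi_nonneg | assumption)+
    then show ?thesis
      unfolding R.path_def
      by (rule converges_in_distribution_cong[where ?n0.0 = 2, rotated]) (simp add: divide_ereal_def inverse_eq_divide)
  qed
  moreover have "converges_in_distribution M (\<lambda>L \<omega>. ereal_of_enat (cover_time L (X L) \<omega>) * ereal (ln (real L)) / ereal (real L ^ 2))
      N (\<lambda>\<omega>. ereal (1 / (2 * (B 1 \<omega>) ^ 2)))" if crit: "p = 3 / 4"
  proof -
    have half: "E.\<beta> = 1 / 2" using crit by simp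
    have [measurable]: "B 1 \<in> borel_measurable N" by (rule bm.measurable_at) simp
    have "converges_in_distribution M (\<lambda>L \<omega>. ereal_of_enat (cover_time L (X L) \<omega>) * ereal (ln (real L) / real L ^ 2))
      N (\<lambda>\<omega>. ereal (1 / (2 * (B 1 \<omega>) ^ 2)))"
    proof (rule cover_time_converges_in_distribution[OF erw common_erw])
      show "p \<le> 3 / 4" using crit by simp
      show "prob_space N" by (rule bm.prob_space_axioms)
      show "0 < ln (real L) / real L ^ 2" if "2 \<le> L" for L using that by simp
      show "(\<lambda>\<omega>. ereal (1 / (2 * (B 1 \<omega>) ^ 2))) \<in> borel_measurable N" by measurable
      fix x :: real assume x: "0 < x"
      have "cdf (distr N borel (\<lambda>\<omega>. real_of_ereal (ereal (1 / (2 * (B 1 \<omega>) ^ 2))))) x = bm.prob {\<omega> \<in> space N. 1 / (2 * (B 1 \<omega>)\<^sup>2) \<le> x}"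
        unfolding cdf_def by (subst measure_distr) (auto simp: vimage_def Int_def conj_commute)
      then show "(\<lambda>L. E.prob {\<omega> \<in> space M'. real L - 1 \<le> E.spread (nat \<lfloor>x / (ln (real L) / real L ^ 2)\<rfloor>) \<omega>})
        \<longlonglongrightarrow> cdf (distr N borel (\<lambda>\<omega>. real_of_ereal (ereal (1 / (2 * (B 1 \<omega>) ^ 2))))) x"
        using E.critical_cover_probability[OF half x] bm.critical_limit_cdf[OF x] by simp
    qed auto
    then show ?thesis
    proof (rule converges_in_distribution_cong[where ?n0.0 = 2, rotated])
      fix L :: nat and \<omega> assume "2 \<le> L"
      then have "ereal (ln (real L)) / ereal (real L ^ 2) = ereal (ln (real L) / real L ^ 2)" by simp
      then show "ereal_of_enat (cover_time L (X L) \<omega>) * ereal (ln (real L) / real L ^ 2)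
        = ereal_of_enat (cover_time L (X L) \<omega>) * ereal (ln (real L)) / ereal (real L ^ 2)"
        by (simp only: divide_ereal_def mult.assoc)
    qed
  qed
  moreover have "(AE \<omega> in M'. convergent (\<lambda>n. real_of_int (lifted_walk X' n \<omega>) / real n powr (2 * p - 1))
      \<and> lim (\<lambda>n. real_of_int (lifted_walk X' n \<omega>) / real n powr (2 * p - 1)) \<noteq> 0)
    \<and> (AE \<omega> in M'. (\<lambda>L. ereal_of_enat (cover_time L X' \<omega>) / ereal (real L powr (1 / (2 * p - 1))))
      \<longlonglongrightarrow> ereal (1 / \<bar>lim (\<lambda>n. real_of_int (lifted_walk X' n \<omega>) / real n powr (2 * p - 1))\<bar> powr (1 / (2 * p - 1))))"
    if "3 / 4 < p"
  proof -
    have "1 / 2 < E.\<beta>" using that by simp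
    from E.superdiffusive_limit[OF this] E.superdiffusive_cover_time[OF this] show ?thesis
      unfolding E.walk_def by (rule conjI)
  qed
  ultimately show ?thesis by (simp add: Let_def)
qed

end
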